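(* Assume Assumption A holds. Let $N\ge 1$ be fixed and let $0<x_1<x_2<\cdots<x_N<\infty$ be fixed points. Then, as $n\to\infty$, \[ \sqrt{nh}\,h^{\alpha}L(1/h)\Big(\widehat{k}_{\sharp}(x_1)-k_{\sharp}(x_1),\dots,\widehat{k}_{\sharp}(x_N)-k_{\sharp}(x_N)\Big)^{\top}\xrightarrow{d} N(0,\Sigma), \] where $\Sigma=\mathrm{diag}(d_1,\dots,d_N)$ with \[ d_\ell=\frac{x_\ell^{2}\pi(x_\ell)}{2\pi B^{2}}\int_{\mathbb{R}}|t|^{2\alpha}|\varphi_W(t)|^{2}\,dt,\qquad \ell=1,\dots,N, \] and $\pi(x)$ denotes the Lebesgue density of the stationary distribution.
   Context: Model: Let $\lambda>0$. Let $J_t=\sum_{j=1}^{N_t}U_j$ be a compound Poisson process, where $(N_t)$ is a Poisson process with intensity $\alpha>0$ and $(U_j)$ are i.i.d. positive random variables with distribution $F$, independent of $N$; its Lévy measure is $\nu=\alpha F$. Let $X=(X_t)_{t\ge0}$ be the stationary solution of $dX_t=-\lambda X_t\,dt+dJ_{\lambda t}$. Put $k(x)=\nu((x,\infty))$ for $x\ge0$ (and $k(x)=0$ for $x<0$), and $k_\sharp(x)=k(|x|)$ for $x\in\mathbb{R}$. The stationary distribution $\pi$ has characteristic function $\varphi(t)=\exp\big(\int_0^\infty(e^{itx}-1)\frac{k(x)}{x}dx\big)$; $\varphi_k(u)=\int_0^\infty e^{iux}k(x)dx$ $(=\varphi'/\varphi)$. One observes $X_\Delta,X_{2\Delta},\dots,X_{n\Delta}$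 with $\Delta=\Delta_n$. Estimator: Let $\theta_n$ be constants with $\theta_n\sim n^{1/2}(\log n)^{-3}$. Let $\widehat\varphi(u)=\frac1n\sum_{j=1}^n e^{iuX_{j\Delta}}$, $\widehat\varphi'_{\theta_n}(u)=\frac in\sum_{j=1}^n X_{j\Delta}e^{iuX_{j\Delta}}1\{|X_{j\Delta}|\le\theta_n\}$, $\widehat\varphi_\sharp(t)=\widehat\varphi(t)/\widehat\varphi(-t)$, $\widehat\varphi'_\sharp(t)=\widehat\varphi'_{\theta_n}(t)/\widehat\varphi(-t)+\widehat\varphi'_{\theta_n}(-t)\widehat\varphi(t)/\widehat\varphi^2(-t)$. For a kernel $W:\mathbb{R}\to\mathbb{R}$ with Fourier transform $\varphi_W(u)=\int e^{iux}W(x)dx$ and bandwidth $h=h_n\to0$, define for $x>0$ $\widehat k_\sharp(x)=\frac{-i}{2\pi}\int_{\mathbb{R}}e^{-itx}\frac{\widehat\varphi'_\sharp(t)}{\widehat\varphi_\sharp(t)}\varphi_W(th)\,dt$. Assumption A: (i) $\int_0^\infty(1\vee|x|^{2+\epsilon})k(x)dx<\infty$ for some $\epsilon>0$. (ii) $k(0)=\nu((0,\infty))=\alpha$ with $2<\alpha<\infty$. (iii) For some $r>1/2$, with $p$ the integer satisfying $p<r\le p+1$, $k_\sharp$ is $p$ times differentiable and $\sup_{x\ne y}|k_\sharp^{(p)}(x)-k_\sharp^{(p)}(y)|/|x-y|^{r-p}<\infty$. (iv) $|\varphi_k(u)|\lesssim(1+|u|)^{-1}$ and $|\varphi_k'(u)|\vee|\varphi_k''(u)|\lesssim(1+|u|)^{-2}$.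 (v) $W$ is integrable, $\int W=1$, $\int|x|^{p+1}|W(x)|dx<\infty$, $\int x^\ell W(x)dx=0$ for $\ell=1,\dots,p$, $\varphi_W(u)=0$ for $|u|>1$, and $\varphi_W$ is three times continuously differentiable. (vi) $\Delta_n\gtrsim\log n$, $n/\Delta_n\to\infty$, and for some $\delta\in(0,1/12)$, $((\log n)^5/n)^{1/(2+2\alpha-\delta)}\ll h\ll (1/(n\log n))^{1/(1+2r+2\alpha-\delta)}$. Slowly varying factor: under (ii) there exist a function $L:(1,\infty)\to[0,\infty)$ slowly varying at $\infty$ (i.e. $L(tx)/L(t)\to1$ as $t\to\infty$ for each $x>0$) and a constant $B>0$ with $\lim_{|t|\to\infty}|t|^\alpha|\varphi(t)|/L(|t|)=B$; $L$ and $B$ denote such a fixed pair. Notation: $a_n\lesssim b_n$ means $a_n\le Cb_n$ for a constant $C$ independent of $n$; $a_n\ll b_n$ means $a_n/b_n\to0$. *)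

theory Defs
  imports "HOL-Probability.Probability"
begin

text \<open>Jump times of the Poisson process N with interarrival times E 0, E 1, ...:
  the (k+1)-th jump happens at time E 0 + ... + E k.\<close>
definition jump_time :: "(nat \<Rightarrow> 's \<Rightarrow> real) \<Rightarrow> nat \<Rightarrow> 's \<Rightarrow> real" where
  "jump_time E k \<omega> = (\<Sum>i\<le>k. E i \<omega>)"

text \<open>Pathwise solution of dX_t = -lam X_t dt + dJ_(lam t) started at X0, where
  J_s = sum of U k over all k with jump_time E k \<le> s.\<close>
definition ou_X :: "real \<Rightarrow> ('s \<Rightarrow> real) \<Rightarrow> (nat \<Rightarrow> 's \<Rightarrow> real) \<Rightarrow> (nat \<Rightarrow> 's \<Rightarrow> real)
                    \<Rightarrow> real \<Rightarrow> 's \<Rightarrow> real" where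
  "ou_X lam X0 E U t \<omega> = exp (- lam * t) * X0 \<omega> +
     (\<Sum>k. if jump_time E k \<omega> \<le> lam * t
           then exp (- (lam * t - jump_time E k \<omega>)) * U k \<omega> else 0)"

definition kfun :: "real \<Rightarrow> real measure \<Rightarrow> real \<Rightarrow> real" where
  "kfun \<alpha> F x = (if 0 \<le> x then \<alpha> * measure F {x<..} else 0)"

definition ksharp :: "(real \<Rightarrow> real) \<Rightarrow> real \<Rightarrow> real" where
  "ksharp k x = k \<bar>x\<bar>"

text \<open>Characteristic function of the stationary distribution.\<close>
definition phi_stat :: "(real \<Rightarrow> real) \<Rightarrow> real \<Rightarrow> complex" where
  "phi_stat k t = exp (CLINT x:{0<..}|lborel. (iexp (t * x) - 1) * complex_of_real (k x / x))"

definition phi_k :: "(real \<Rightarrow> real) \<Rightarrow> real \<Rightarrow> complex" where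
  "phi_k k u = (CLINT x:{0..}|lborel. iexp (u * x) * complex_of_real (k x))"

definition ft :: "(real \<Rightarrow> real) \<Rightarrow> real \<Rightarrow> complex" where
  "ft W u = (CLINT x|lborel. iexp (u * x) * complex_of_real (W x))"

definition slowly_varying :: "(real \<Rightarrow> real) \<Rightarrow> bool" where
  "slowly_varying L \<longleftrightarrow> (\<forall>c>0. ((\<lambda>t. L (c * t) / L t) \<longlongrightarrow> 1) at_top)"

section \<open>Estimator (obs j = X_(j Delta), j = 1..n)\<close>

definition phi_hat :: "(nat \<Rightarrow> real) \<Rightarrow> nat \<Rightarrow> real \<Rightarrow> complex" where
  "phi_hat obs n u = (1 / of_nat n) * (\<Sum>j=1..n. iexp (u * obs j))"

definition dphi_hat :: "(nat \<Rightarrow> real) \<Rightarrow> nat \<Rightarrow> real \<Rightarrow> real \<Rightarrow> complex" where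
  "dphi_hat obs n \<theta> u = (\<i> / of_nat n) *
     (\<Sum>j=1..n. complex_of_real (obs j) * iexp (u * obs j) * (if \<bar>obs j\<bar> \<le> \<theta> then 1 else 0))"

definition phi_sharp_hat :: "(nat \<Rightarrow> real) \<Rightarrow> nat \<Rightarrow> real \<Rightarrow> complex" where
  "phi_sharp_hat obs n t = phi_hat obs n t / phi_hat obs n (- t)"

definition dphi_sharp_hat :: "(nat \<Rightarrow> real) \<Rightarrow> nat \<Rightarrow> real \<Rightarrow> real \<Rightarrow> complex" where
  "dphi_sharp_hat obs n \<theta> t =
     dphi_hat obs n \<theta> t / phi_hat obs n (- t)
     + dphi_hat obs n \<theta> (- t) * phi_hat obs n t / (phi_hat obs n (- t))\<^sup>2"

text \<open>The estimator; the complex integral is real-valued (its integrand is Hermitian),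
  we take the real part to obtain a real-valued quantity.\<close>
definition khat :: "(real \<Rightarrow> real) \<Rightarrow> real \<Rightarrow> real \<Rightarrow> (nat \<Rightarrow> real) \<Rightarrow> nat \<Rightarrow> real \<Rightarrow> real" where
  "khat W h \<theta> obs n x = Re ((- \<i> / (2 * complex_of_real pi)) *
     (CLINT t|lborel. iexp (- t * x) * (dphi_sharp_hat obs n \<theta> t / phi_sharp_hat obs n t)
                        * ft W (t * h)))"

definition conv_distr :: "'s measure \<Rightarrow> (nat \<Rightarrow> 's \<Rightarrow> 'a::euclidean_space) \<Rightarrow> 'a measure \<Rightarrow> bool" where
  "conv_distr M Y Q \<longleftrightarrow> (\<forall>n. Y n \<in> borel_measurable M) \<and>
     (\<forall>f :: 'a \<Rightarrow> real. continuous_on UNIV f \<longrightarrow> bounded (range f) \<longrightarrow>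
        (\<lambda>n. integral\<^sup>L (distr M borel (Y n)) f) \<longlonglongrightarrow> integral\<^sup>L Q f)"

text \<open>Centered Gaussian N(0, diag(d)) on real^'n: image of the standard Gaussian under
  z \<mapsto> (sqrt(d l) * z_l)_l (so degenerate components with d l = 0 are allowed).\<close>
definition gauss_diag :: "('n::finite \<Rightarrow> real) \<Rightarrow> (real ^ 'n) measure" where
  "gauss_diag d = distr (density lborel (\<lambda>z. ennreal (\<Prod>l\<in>UNIV. std_normal_density (z $ l))))
                        borel (\<lambda>z. \<chi> l. sqrt (d l) * z $ l)"

end

theory Submission
	imports Defs "HOL-Real_Asymp.Real_Asymp"
begin

text \<open>On the event that the empirical characteristic function stays within half of the true one on
	\<open>[-1/h, 1/h]\<close> (which has probability tending to one by second moments and a Sobolev-type sup bound) the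
	estimation error splits into the kernel bias, a linear statistic of the sampled chain and a quadratic
	remainder. The sampled chain is an autoregression whose innovations have an explicit law, so that it is
	approximated by \<open>q\<close>-dependent blocks, for a fixed \<open>q\<close>, with an error \<open>exp (- \<Delta>) ^ q\<close>
	that beats every power of \<open>n\<close> in use. A Stein-type differential inequality for the
	characteristic function then gives the central limit theorem for the linear statistic; its limiting
	covariance is computed by Fourier inversion, the lagged covariances vanish because
	\<open>\<phi>(t) / \<phi>(\<rho> t)\<close> is small, and Cramer-Wold passes to the vector.\<close>

text \<open>The estimator divides by \<open>phi\<close>, whose size is known only up to a slowly
  varying factor. Self-decomposability supplies the missing control:
  \<open>phi t / phi (\<rho> t)\<close> is the characteristic function of an innovation, so
  \<open>|phi|\<close> is decreasing, and regular variation then yields Potter bounds, used with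
  exponent 2 < \<alpha>. The intrinsic normalisation is G = sqrt (n h) |phi (1/h)|: after scaling,
  the quadratic remainder is of order 1/G and the bias of order G h^r. The prescribed normalisation
  differs from G by a factor tending to 1/B. The influence function is of size h^(-1/2) and has a
  Lipschitz constant of order h^(-2). Both are powers of n, and since \<open>\<Delta>\<close> grows
  at least like log n, so does the contraction over one sampling step; hence a fixed block length
  suffices. Only the part of the influence function concentrating at y = x survives. It carries a
  factor x, which explains the x^2 and the density at x in the variance and the independence at
  distinct points. The truncation is inactive with probability tending to one: the bounded third
  derivative of \<open>phi\<close> gives P(|X0| > y) = O(y^(-3)).\<close>

abbreviation cplx :: "real \<Rightarrow> complex" where "cplx \<equiv> complex_of_real"

section \<open>Elementary bounds and differentiation under the integral sign\<close>

lemma cmod_iexp_minus_one_le: "cmod (iexp x - 1) <= \<bar>x\<bar>"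
	using iexp_approx1[of x 0] by simp

lemma cmod_iexp_diff_le: "cmod (iexp x - iexp y) <= \<bar>x - y\<bar>"
proof -
	have "iexp x - iexp y = iexp y * (iexp (x - y) - 1)"
		by (simp add: algebra_simps flip: exp_add)
	then show ?thesis
		using cmod_iexp_minus_one_le[of "x - y"] by (simp add: norm_mult)
qed

text \<open>A non-integrable \<open>f\<close> has Bochner integral 0, so only the dominating
  function has to be integrable; this spares an integrability proof at each estimate.\<close>

lemma norm_integral_le:
	fixes f :: "'a => 'b::{banach, second_countable_topology}"
	assumes g: "integrable M g" and le: "!!x. x \<in> space M ==> norm (f x) <= g x"
	shows "norm (integral\<^sup>L M f) <= integral\<^sup>L M g"
proof (cases "integrable M f")
	case True
	then show ?thesis
		by (intro order_trans[OF integral_norm_bound] integral_mono g le) auto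
next
	case False
	then show ?thesis
		by (simp add: not_integrable_integral_eq integral_nonneg_AE order_trans[OF norm_ge_zero le] AE_I2)
qed

lemma abs_integral_le:
	fixes f :: "'a => real"
	assumes "integrable M g" "!!x. x \<in> space M ==> \<bar>f x\<bar> <= g x"
	shows "\<bar>integral\<^sup>L M f\<bar> <= integral\<^sup>L M g"
	using norm_integral_le[of M g f] assms by simp

text \<open>The factor \<open>iexp (t * a x) - 1\<close> compensates a weight \<open>g\<close> that
  need not be integrable, as long as \<open>a * g\<close> is. This is the situation of the weight
  \<open>k x / x\<close> in the exponent of the stationary law, which is singular at 0. The
  derivative comes from dominated convergence of the difference quotient.\<close>

lemma has_vector_derivative_integral_iexp:
	fixes a :: "'a => real" and g :: "'a => complex"
	assumes a[measurable]: "a \<in> borel_measurable N" and g[measurable]: "g \<in> borel_measurable N"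
		and int: "integrable N (%x. cplx (a x) * g x)"
	shows "((%t. \<integral>x. (iexp (t * a x) - 1) * g x \<partial>N) has_vector_derivative
					 (\<integral>x. \<i> * cplx (a x) * iexp (t * a x) * g x \<partial>N)) (at t)"
proof -
	let ?F = "%t. \<integral>x. (iexp (t * a x) - 1) * g x \<partial>N"
	let ?D = "\<integral>x. \<i> * cplx (a x) * iexp (t * a x) * g x \<partial>N"
	let ?R = "%d x. cmod (iexp (d * a x) - 1 - \<i> * (d * a x)) / \<bar>d\<bar> * cmod (g x)"
	have intn: "integrable N (%x. \<bar>a x\<bar> * cmod (g x))"
		using integrable_norm[OF int] by (simp add: norm_mult)
	have i1: "integrable N (%x. (iexp (u * a x) - 1) * g x)" for u
	proof (rule Bochner_Integration.integrable_bound[OF integrable_mult_right[OF intn, of "\<bar>u\<bar>"]])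
		show "AE x in N. norm ((iexp (u * a x) - 1) * g x) <= norm (\<bar>u\<bar> * (\<bar>a x\<bar> * cmod (g x)))"
			using cmod_iexp_minus_one_le[of "u * a _"]
			by (intro AE_I2) (simp add: norm_mult abs_mult mult_right_mono flip: mult.assoc)
	qed measurable
	have i2: "integrable N (%x. \<i> * cplx (a x) * iexp (t * a x) * g x)"
		by (rule Bochner_Integration.integrable_bound[OF intn])
			 (auto simp: norm_mult)
	\<comment> \<open>Two bounds for the remainder quotient: this one is integrable and dominates,
	  while \<open>Rle2\<close> tends to 0 pointwise but contains \<open>(a x)^2\<close>, which need
	  not be integrable against \<open>g\<close>.\<close>
	have Rle: "?R d x <= 2 * (\<bar>a x\<bar> * cmod (g x))" if "d ~= 0" for d x
	proof -
		have "cmod (iexp (d * a x) - 1 - \<i> * (d * a x)) <= 2 * \<bar>d * a x\<bar>"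
			using iexp_approx2[of "d * a x" 1] by (simp add: algebra_simps)
		then have "cmod (iexp (d * a x) - 1 - \<i> * (d * a x)) / \<bar>d\<bar> <= 2 * \<bar>a x\<bar>"
			using that by (simp add: abs_mult field_simps)
		then show ?thesis
			by (metis mult.assoc mult_right_mono norm_ge_zero)
	qed
	have Rle2: "?R d x <= \<bar>d\<bar> * (a x)\<^sup>2 * cmod (g x)" if "d ~= 0" for d x
	proof -
		have "cmod (iexp (d * a x) - 1 - \<i> * (d * a x)) <= \<bar>d * a x\<bar>\<^sup>2 / 2"
			using iexp_approx1[of "d * a x" 1] by (simp add: algebra_simps numeral_2_eq_2)
		also have "... <= \<bar>d\<bar>\<^sup>2 * (a x)\<^sup>2" by (simp add: power_mult_distrib)
		finally have "cmod (iexp (d * a x) - 1 - \<i> * (d * a x)) / \<bar>d\<bar> <= \<bar>d\<bar> * (a x)\<^sup>2"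
			using that by (simp add: field_simps power2_eq_square)
		then show ?thesis by (meson mult_right_mono norm_ge_zero)
	qed
	have Rint: "integrable N (?R d)" if "d ~= 0" for d
		by (rule Bochner_Integration.integrable_bound[OF integrable_mult_right[OF intn, of 2]])
			 (use Rle[OF that] in auto)
	have key: "norm (?F (t + d) - ?F t - d *\<^sub>R ?D) / \<bar>d\<bar> <= (\<integral>x. ?R d x \<partial>N)" if d: "d ~= 0" for d
	proof -
		have "?F (t + d) - ?F t - d *\<^sub>R ?D =
			(\<integral>x. (iexp ((t + d) * a x) - 1) * g x - (iexp (t * a x) - 1) * g x
				 - d *\<^sub>R (\<i> * cplx (a x) * iexp (t * a x) * g x) \<partial>N)"
			by (simp only: Bochner_Integration.integral_diff[OF Bochner_Integration.integrable_diff[OF i1 i1]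
						integrable_scaleR_right[OF i2]] Bochner_Integration.integral_diff[OF i1 i1] integral_scaleR_right)
		also have "... = (\<integral>x. iexp (t * a x) * (iexp (d * a x) - 1 - \<i> * (d * a x)) * g x \<partial>N)"
			by (intro Bochner_Integration.integral_cong refl)
				 (simp add: algebra_simps scaleR_conv_of_real flip: exp_add)
		also have "norm ... <= (\<integral>x. \<bar>d\<bar> * ?R d x \<partial>N)"
		proof (rule norm_integral_le)
			show "integrable N (%x. \<bar>d\<bar> * ?R d x)" using Rint[OF d] by (intro integrable_mult_right)
		qed (use d in \<open>auto simp: norm_mult\<close>)
		finally show ?thesis using d by (simp add: field_simps)
	qed
	have "((%d. (\<integral>x. ?R d x \<partial>N)) \<longlongrightarrow> 0) (at 0)"
		unfolding tendsto_at_iff_sequentially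
	proof safe
		fix X :: "nat => real" assume X: "\<forall>i. X i \<in> UNIV - {0}" "X \<longlonglongrightarrow> 0"
		have "(%i. (\<integral>x. ?R (X i) x \<partial>N)) \<longlonglongrightarrow> (\<integral>x. 0 \<partial>N)"
		proof (rule integral_dominated_convergence[where w="%x. 2 * (\<bar>a x\<bar> * cmod (g x))"])
			show "AE x in N. (%i. ?R (X i) x) \<longlonglongrightarrow> 0"
			proof (rule AE_I2)
				fix x
				have "(%i. \<bar>X i\<bar> * (a x)\<^sup>2 * cmod (g x)) \<longlonglongrightarrow> \<bar>0\<bar> * (a x)\<^sup>2 * cmod (g x)"
					by (intro tendsto_intros X)
				then have lim0: "(%i. \<bar>X i\<bar> * (a x)\<^sup>2 * cmod (g x)) \<longlonglongrightarrow> 0" by simp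
				have "norm (?R (X i) x) <= \<bar>X i\<bar> * (a x)\<^sup>2 * cmod (g x)" for i
					using Rle2[of "X i" x] X(1) by (simp add: abs_mult)
				then show "(%i. ?R (X i) x) \<longlonglongrightarrow> 0"
					by (intro Lim_null_comparison[OF _ lim0] always_eventually allI)
			qed
			show "AE x in N. norm (?R (X i) x) <= 2 * (\<bar>a x\<bar> * cmod (g x))" for i
				using X(1) Rle[of "X i"] by auto
		qed (use intn in auto)
		then show "((%d. (\<integral>x. ?R d x \<partial>N)) \<circ> X) \<longlonglongrightarrow> 0" by (simp add: comp_def)
	qed
	moreover have "eventually (%d. norm (norm (?F (t + d) - ?F t - d *\<^sub>R ?D) / norm d) <= (\<integral>x. ?R d x \<partial>N)) (at 0)"
		unfolding eventually_at_filter
	proof (intro always_eventually allI impI)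
		fix d :: real assume "d ~= 0"
		from key[OF this] show "norm (norm (?F (t + d) - ?F t - d *\<^sub>R ?D) / norm d) <= (\<integral>x. ?R d x \<partial>N)"
			unfolding real_norm_def abs_divide abs_norm_cancel abs_abs .
	qed
	ultimately have "((%d. norm (?F (t + d) - ?F t - d *\<^sub>R ?D) / norm d) \<longlongrightarrow> 0) (at 0)"
		by (rule Lim_null_comparison[rotated])
	then show ?thesis
		unfolding has_vector_derivative_def has_derivative_at
		by (intro conjI bounded_linear_scaleR_left)
qed

section \<open>Potter bounds for a decreasing function\<close>

lemma potter_upper:
	fixes m :: "real => real"
	assumes pos: "!!t. m t > 0" and dec: "!!s t. 0 <= s ==> s <= t ==> m t <= m s"
		and lim: "((%t. m (2 * t) / m t) \<longlongrightarrow> 2 powr (- \<alpha>)) at_top" and a: "0 <= a" "a < \<alpha>"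
	shows "\<exists>C\<ge>1. \<forall>s t. 0 <= s \<longrightarrow> s <= t \<longrightarrow> m t <= C * ((1 + s) / (1 + t)) powr a * m s"
proof -
	\<comment> \<open>With \<open>a < \<alpha>\<close> the limit makes \<open>P\<close> decrease under
	  doubling beyond \<open>t0\<close>. Monotonicity of \<open>m\<close> fills the gap between a point
	  and its double at the cost of \<open>2 powr a\<close>, and the range below \<open>t0\<close>
	  costs \<open>(1 + t0) powr a\<close>; the constant \<open>C\<close> is the product of the
	  two.\<close>
	define P where "P t = (1 + t) powr a * m t" for t
	have "2 powr (-\<alpha>) < 2 powr (-a)" using a by simp
	from order_tendstoD(2)[OF lim this] obtain t1 where t1: "!!t. t >= t1 ==> m (2 * t) / m t < 2 powr (-a)"
		by (auto simp: eventually_at_top_linorder)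
	define t0 where "t0 = max t1 1"
	have P2: "P (2 * t) <= P t" if "t >= t0" for t
	proof -
		have "m (2 * t) <= 2 powr (-a) * m t"
			using t1[of t] pos[of t] that by (simp add: t0_def divide_simps)
		moreover have "(1 + 2 * t) powr a <= (2 * (1 + t)) powr a"
			using that a by (intro powr_mono2) (auto simp: t0_def)
		ultimately have "P (2 * t) <= (2 * (1 + t)) powr a * (2 powr (-a) * m t)"
			unfolding P_def by (intro mult_mono) (use pos[of "2 * t"] in auto)
		also have "... = P t"
			unfolding P_def using that by (subst powr_mult) (auto simp: powr_minus field_simps t0_def)
		finally show ?thesis .
	qed
	have P1: "P t <= 2 powr a * P s" if "t0 <= s" "s <= t" "t < 2 ^ N * s" for N s t
		using that
	proof (induction N arbitrary: s)
		case (Suc N)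
		show ?case
		proof (cases "t < 2 * s")
			case True
			have "(1 + t) powr a <= (2 * (1 + s)) powr a"
				using True Suc.prems a by (intro powr_mono2) (auto simp: t0_def)
			then have "P t <= (2 * (1 + s)) powr a * m s"
				unfolding P_def using Suc.prems by (intro mult_mono dec) (auto simp: t0_def less_imp_le[OF pos])
			then show ?thesis using Suc.prems powr_mult[of 2 "1 + s" a] by (simp add: P_def mult.assoc t0_def)
		next
			case False
			have "P t <= 2 powr a * P (2 * s)"
				using False Suc.prems by (intro Suc.IH) (auto simp: t0_def algebra_simps)
			also have "... <= 2 powr a * P s"
				using P2[of s] Suc.prems by (intro mult_left_mono) auto
			finally show ?thesis .
		qed
	qed auto
	have P1': "P t <= 2 powr a * P s" if "t0 <= s" "s <= t" for s t
	proof -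
		obtain N where "t / s < 2 ^ N" using real_arch_pow[of 2 "t / s"] by auto
		then show ?thesis using that by (intro P1[of s t N]) (auto simp: field_simps t0_def)
	qed
	define C where "C = 2 powr a * (1 + t0) powr a"
	have one: "1 <= (2::real) powr a" "1 <= (1 + t0) powr a"
		using a by (auto simp: t0_def intro!: ge_one_powr_ge_zero)
	have Ple: "P t <= C * P s" if st: "0 <= s" "s <= t" for s t
	proof -
		have P0: "P u >= 0" for u by (simp add: P_def less_imp_le[OF pos])
		have low: "P u <= (1 + t0) powr a * P s" if "s <= u" "u <= t0" for u
		proof -
			have "P u <= (1 + t0) powr a * m s"
				unfolding P_def using that st a
				by (intro mult_mono powr_mono2 dec) (auto simp: less_imp_le[OF pos])
			also have "m s <= P s"
				unfolding P_def using st a pos[of s]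
					mult_right_mono[of 1 "(1 + s) powr a" "m s"] ge_one_powr_ge_zero[of "1 + s" a] by auto
			finally show ?thesis by (simp add: mult_left_mono)
		qed
		consider "t0 <= s" | "s < t0" "t <= t0" | "s < t0" "t0 < t" by linarith
		then show ?thesis
		proof cases
			case 1
			have "2 powr a * P s <= C * P s"
				unfolding C_def using one P0[of s] mult_left_mono[of 1 "(1 + t0) powr a" "2 powr a"]
				by (intro mult_right_mono) auto
			then show ?thesis using P1'[OF 1 st(2)] by linarith
		next
			case 2
			have "(1 + t0) powr a * P s <= C * P s"
				unfolding C_def using one P0[of s] mult_right_mono[of 1 "2 powr a" "(1 + t0) powr a"]
				by (intro mult_right_mono) auto
			then show ?thesis using low[OF st(2) 2(2)] by linarith
		next
			case 3
			have "P t <= 2 powr a * P t0" using 3 by (intro P1') auto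
			also have "... <= 2 powr a * ((1 + t0) powr a * P s)"
				using 3 by (intro mult_left_mono low) auto
			finally show ?thesis by (simp add: C_def)
		qed
	qed
	have "C >= 1" unfolding C_def using mult_mono[of 1 "2 powr a" 1 "(1 + t0) powr a"] one by auto
	moreover have "m t <= C * ((1 + s) / (1 + t)) powr a * m s" if "0 <= s" "s <= t" for s t
		using Ple[OF that] that unfolding P_def
		by (subst powr_divide) (auto simp: field_simps)
	ultimately show ?thesis by blast
qed

text \<open>The mirror image: for \<open>b > \<alpha>\<close> the product
  \<open>t powr b * m t\<close> grows under doubling beyond \<open>t0\<close>, so it stays above a
  positive multiple of its value at \<open>t0\<close>.\<close>

lemma potter_lower:
	fixes m :: "real => real"
	assumes pos: "!!t. m t > 0" and dec: "!!s t. 0 <= s ==> s <= t ==> m t <= m s"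
		and lim: "((%t. m (2 * t) / m t) \<longlongrightarrow> 2 powr (- \<alpha>)) at_top" and b: "0 <= b" "\<alpha> < b"
	shows "\<exists>c>0. eventually (%t. c * t powr (-b) <= m t) at_top"
proof -
	define P where "P t = t powr b * m t" for t
	have "2 powr (-b) < 2 powr (-\<alpha>)" using b by simp
	from order_tendstoD(1)[OF lim this] obtain t1 where t1: "!!t. t >= t1 ==> m (2 * t) / m t > 2 powr (-b)"
		by (auto simp: eventually_at_top_linorder)
	define t0 where "t0 = max t1 1"
	have P2: "P (2 * t) >= P t" if "t >= t0" for t
	proof -
		have "m (2 * t) >= 2 powr (-b) * m t"
			using t1[of t] pos[of t] that by (simp add: t0_def divide_simps)
		then have "P (2 * t) >= (2 * t) powr b * (2 powr (-b) * m t)"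
			unfolding P_def by (intro mult_left_mono) auto
		also have "(2 * t) powr b * (2 powr (-b) * m t) = P t"
			unfolding P_def using that by (simp add: powr_mult powr_minus field_simps t0_def)
		finally show ?thesis .
	qed
	have P1: "P t >= 2 powr (-b) * P s" if "t0 <= s" "s <= t" "t < 2 ^ N * s" for N s t
		using that
	proof (induction N arbitrary: s)
		case (Suc N)
		show ?case
		proof (cases "t < 2 * s")
			case True
			have "2 powr (-b) * P s <= 2 powr (-b) * P (2 * s)"
				using P2[of s] Suc.prems by (intro mult_left_mono) auto
			also have "... = s powr b * m (2 * s)"
				using Suc.prems by (simp add: P_def powr_mult powr_minus field_simps t0_def)
			also have "... <= P t"
				unfolding P_def using Suc.prems True b
				by (intro mult_mono dec powr_mono2) (auto simp: t0_def less_imp_le[OF pos])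
			finally show ?thesis .
		next
			case False
			have "P t >= 2 powr (-b) * P (2 * s)"
				using False Suc.prems by (intro Suc.IH) (auto simp: t0_def algebra_simps)
			moreover have "2 powr (-b) * P (2 * s) >= 2 powr (-b) * P s"
				using P2[of s] Suc.prems by (intro mult_left_mono) auto
			ultimately show ?thesis by linarith
		qed
	qed auto
	have P1': "P t >= 2 powr (-b) * P t0" if "t0 <= t" for t
	proof -
		obtain N where "t / t0 < 2 ^ N" using real_arch_pow[of 2 "t / t0"] by auto
		then show ?thesis using that by (intro P1[of t0 t N]) (auto simp: field_simps t0_def)
	qed
	define c where "c = 2 powr (-b) * P t0"
	have "c > 0" unfolding c_def P_def by (simp add: t0_def pos)
	moreover have "c * t powr (-b) <= m t" if "t0 <= t" for t
	proof -
		have "c * t powr (-b) <= P t * t powr (-b)"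
			using P1'[OF that] by (intro mult_right_mono) (auto simp: c_def)
		also have "... = m t" using that by (simp add: P_def powr_minus field_simps t0_def)
		finally show ?thesis .
	qed
	ultimately show ?thesis by (auto simp: eventually_at_top_linorder)
qed

section \<open>Inverse Fourier transforms of functions supported in [-1, 1]\<close>

definition kap :: "(real => complex) => real => complex" where
	"kap g z = (1 / (2 * cplx pi)) * (CLINT s|lborel. iexp (- (s * z)) * g s)"

lemma integrable_bounded_support:
	fixes g :: "real => 'b::{banach, second_countable_topology}"
	assumes [measurable]: "g \<in> borel_measurable borel"
		and bd: "!!s. \<bar>s\<bar> <= R ==> norm (g s) <= C" and supp: "!!s. \<bar>s\<bar> > R ==> g s = 0"
	shows "integrable lborel g" and "0 <= R ==> norm (integral\<^sup>L lborel g) <= 2 * R * C"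
proof -
	have i: "integrable lborel (%s. C * indicator {-R..R} s :: real)"
		by (intro integrable_mult_right integrable_real_indicator) (auto simp: emeasure_lborel_Icc_eq)
	have le: "norm (g s) <= C * indicator {-R..R} s" for s
		using bd[of s] supp[of s] by (cases "\<bar>s\<bar> <= R") (auto simp: indicator_def)
	show 1: "integrable lborel g"
		by (rule Bochner_Integration.integrable_bound[OF i]) (use le in \<open>auto intro!: AE_I2 order_trans[OF _ abs_ge_self]\<close>)
	assume "0 <= R"
	then have "(\<integral>s. C * indicator {-R..R} s \<partial>lborel) = 2 * R * C" by simp
	moreover have "norm (integral\<^sup>L lborel g) <= (\<integral>s. C * indicator {-R..R} s \<partial>lborel)"
		by (rule norm_integral_le[OF i]) (use le in auto)
	ultimately show "norm (integral\<^sup>L lborel g) <= 2 * R * C" by (simp only:)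
qed

text \<open>One constant \<open>C\<close> bounds both the function and its derivative. It is kept as
  a parameter because the instances used later depend on the bandwidth while \<open>C\<close> does
  not, so that the bounds \<open>C\<close> and \<open>C / |z|\<close> for the inverse transform hold
  uniformly in the bandwidth.\<close>

locale C1_unit_support =
	fixes g g' :: "real => complex" and C :: real
	assumes deriv: "!!s. (g has_vector_derivative g' s) (at s)"
		and cont': "continuous_on UNIV g'"
		and bound: "!!s. cmod (g s) <= C" and bound': "!!s. cmod (g' s) <= C"
		and supp: "!!s. \<bar>s\<bar> > 1 ==> g s = 0"
begin

lemma cont: "continuous_on UNIV g"
	by (intro continuous_at_imp_continuous_on ballI)
		 (use deriv has_vector_derivative_continuous in blast)

lemma meas [measurable]: "g \<in> borel_measurable borel" "g' \<in> borel_measurable borel"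
	using cont cont' by (auto intro: borel_measurable_continuous_onI)

lemma C_nonneg: "0 <= C"
	using norm_ge_zero bound order_trans by blast

lemma supp': "g' s = 0" if "\<bar>s\<bar> > 1"
proof -
	have op: "open {s::real. \<bar>s\<bar> > 1}"
		by (intro open_Collect_less continuous_intros)
	have "(g has_vector_derivative 0) (at s)"
		by (rule has_vector_derivative_transform_within_open[OF _ op, of "%_. 0"])
			 (use that supp in auto)
	then show ?thesis using deriv vector_derivative_unique_at by blast
qed

lemma integrable: "integrable lborel g"
	by (rule integrable_bounded_support[where R=1 and C=C]) (use bound supp in auto)

lemma integrable_kap: "integrable lborel (%s. iexp (- (s * z)) * g s)"
	by (rule integrable_bounded_support[where R=1 and C=C]) (use bound supp in \<open>auto simp: norm_mult\<close>)

lemma lipschitz: "cmod (g s - g t) <= C * \<bar>s - t\<bar>"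
proof -
	have "norm (g s - g t) <= C * norm (s - t)"
		by (rule differentiable_bound[of UNIV g "%s v. v *\<^sub>R g' s"])
			 (use deriv bound' in \<open>auto simp: has_vector_derivative_def onorm_scaleR_left
					bounded_linear_ident onorm_id\<close>)
	then show ?thesis by simp
qed

lemma norm_kap: "cmod (kap g z) <= C"
proof -
	have "cmod (CLINT s|lborel. iexp (- (s * z)) * g s) <= 2 * 1 * C"
		by (rule integrable_bounded_support) (use bound supp in \<open>auto simp: norm_mult\<close>)
	also have "... <= 2 * pi * C" using pi_gt3 C_nonneg by (intro mult_right_mono) auto
	finally show ?thesis by (simp add: kap_def norm_mult norm_divide field_simps)
qed

text \<open>Integration by parts: one derivative of \<open>g\<close> is traded for one factor of
  \<open>z\<close>.\<close>

lemma norm_mult_kap: "\<bar>z\<bar> * cmod (kap g z) <= C"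
proof -
	let ?f = "%s. (- \<i> * cplx z) * (iexp (- (s * z)) * g s) + iexp (- (s * z)) * g' s"
	have "((%s. iexp (- (s * z)) * g s) has_vector_derivative ?f s) (at s within {-2..2})" for s
	proof -
		have "((%s. iexp (- (s * z)) * g s) has_vector_derivative
				(iexp (- (s * z)) * g' s + ((- z) *\<^sub>R (\<i> * iexp (- (s * z)))) * g s)) (at s)"
			by (rule has_vector_derivative_mult[OF _ deriv])
				 (rule vector_diff_chain_at[of "%s. - (s * z)" "-z" s iexp, unfolded comp_def];
					auto intro!: derivative_eq_intros has_vector_derivative_iexp[THEN has_vector_derivative_at_within]
						 simp flip: has_real_derivative_iff_has_vector_derivative)
		also have "(iexp (- (s * z)) * g' s + ((- z) *\<^sub>R (\<i> * iexp (- (s * z)))) * g s) = ?f s"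
			by (simp add: scaleR_conv_of_real algebra_simps)
		finally show ?thesis by (rule has_vector_derivative_at_within)
	qed
	moreover have "continuous_on {-2..2} ?f"
		using continuous_on_subset[OF cont] continuous_on_subset[OF cont']
		by (intro continuous_intros) auto
	\<comment> \<open>The endpoints -2 and 2 lie outside the support, so the boundary terms
	  vanish.\<close>
	ultimately have "has_bochner_integral lborel (%x. indicator {-2..2} x *\<^sub>R ?f x)
			(iexp (- (2 * z)) * g 2 - iexp (- (-2 * z)) * g (-2))"
		by (intro has_bochner_integral_FTC_Icc) auto
	moreover have "indicator {-2..2} x *\<^sub>R ?f x = ?f x" for x
		using supp[of x] supp'[of x] by (auto simp: indicator_def)
	ultimately have "(CLINT s|lborel. ?f s) = 0"
		using supp[of 2] supp[of "-2"] by (simp add: has_bochner_integral_integral_eq)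
	moreover have i': "integrable lborel (%s. iexp (- (s * z)) * g' s)"
		by (rule integrable_bounded_support[where R=1 and C=C]) (use bound' supp' in \<open>auto simp: norm_mult\<close>)
	ultimately have "(- \<i> * cplx z) * (CLINT s|lborel. iexp (- (s * z)) * g s)
			= - (CLINT s|lborel. iexp (- (s * z)) * g' s)"
		using integrable_kap[of z] by (simp add: add_eq_0_iff)
	then have "cmod ((- \<i> * cplx z) * (CLINT s|lborel. iexp (- (s * z)) * g s)) <= 2 * 1 * C"
		using integrable_bounded_support(2)[of "%s. iexp (- (s * z)) * g' s" 1 C] bound' supp'
		by (simp add: norm_mult)
	also have "... <= 2 * pi * C" using pi_gt3 C_nonneg by (intro mult_right_mono) auto
	finally show ?thesis by (simp add: kap_def norm_mult norm_divide field_simps)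
qed

lemma kap_measurable [measurable]: "kap g \<in> borel_measurable borel"
	unfolding kap_def by measurable

text \<open>The substitution of \<open>- s\<close> for \<open>s\<close> turns the transform into its
  conjugate. Real parts can thus be dropped in products, which later allows a product of two such
  functions to be written with a conjugate.\<close>

lemma kap_real: assumes "!!s. g (- s) = cnj (g s)" shows "cplx (Re (kap g z)) = kap g z"
proof -
	have "cnj (CLINT s|lborel. iexp (- (s * z)) * g s) = (CLINT s|lborel. iexp (s * z) * g (- s))"
	proof -
		have "cnj (CLINT s|lborel. iexp (- (s * z)) * g s) = (CLINT s|lborel. cnj (iexp (- (s * z)) * g s))"
			by (rule Bochner_Integration.integral_cnj[symmetric])
		also have "... = (CLINT s|lborel. iexp (s * z) * g (- s))"
			using assms by (intro Bochner_Integration.integral_cong refl) (simp add: exp_cnj)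
		finally show ?thesis .
	qed
	also have "... = (CLINT s|lborel. iexp (- (s * z)) * g s)"
		using lborel_integral_real_affine[of "-1" "%s. iexp (s * z) * g (- s)" 0] by simp
	finally have "cnj (kap g z) = kap g z" by (simp add: kap_def)
	then show ?thesis by (simp add: complex_eq_iff)
qed

end

section \<open>Fourier inversion by Gaussian damping\<close>

lemma gaussian_fourier:
	assumes s: "\<sigma> > 0"
	shows "integrable lborel (%t::real. exp (- (\<sigma> * t)\<^sup>2 / 2))"
		and "(CLINT t|lborel. iexp (t * u) * cplx (exp (- (\<sigma> * t)\<^sup>2 / 2)))
			 = cplx (2 * pi * normal_density 0 \<sigma> u)"
proof -
	have eq: "exp (- (\<sigma> * t)\<^sup>2 / 2) = sqrt (2 * pi) * std_normal_density (0 + \<sigma> * t)" for t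
		by (simp add: std_normal_density_def)
	show "integrable lborel (%t::real. exp (- (\<sigma> * t)\<^sup>2 / 2))"
		unfolding eq using s lborel_integrable_real_affine[of std_normal_density \<sigma> 0]
			integrable_normal_density[of 1 0]
		by (intro integrable_mult_right) auto
	have "cplx (exp (- (u / \<sigma>)\<^sup>2 / 2)) = char std_normal_distribution (u / \<sigma>)"
		by (simp add: char_std_normal_distribution)
	also have "... = (CLINT z|lborel. std_normal_density z *\<^sub>R iexp (u / \<sigma> * z))"
		unfolding char_def by (subst integral_density) (auto simp: normal_density_nonneg)
	also have "... = \<sigma> *\<^sub>R (CLINT t|lborel. std_normal_density (0 + \<sigma> * t) *\<^sub>R iexp (u / \<sigma> * (0 + \<sigma> * t)))"
		using s by (subst lborel_integral_real_affine[of \<sigma> _ 0]) auto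
	also have "... = \<sigma> *\<^sub>R (CLINT t|lborel. (1 / sqrt (2 * pi)) *\<^sub>R (iexp (t * u) * cplx (exp (- (\<sigma> * t)\<^sup>2 / 2))))"
		using s by (intro arg_cong[where f="%x. \<sigma> *\<^sub>R x"] Bochner_Integration.integral_cong refl)
			(simp add: std_normal_density_def scaleR_conv_of_real mult_ac)
	finally have "cplx (exp (- (u / \<sigma>)\<^sup>2 / 2)) = cplx (\<sigma> / sqrt (2 * pi)) *
			(CLINT t|lborel. iexp (t * u) * cplx (exp (- (\<sigma> * t)\<^sup>2 / 2)))"
		by (simp add: scaleR_conv_of_real)
	moreover have "sqrt (2 * pi) / \<sigma> * exp (- (u / \<sigma>)\<^sup>2 / 2) = 2 * pi * normal_density 0 \<sigma> u"
		using s by (simp add: normal_density_def real_sqrt_mult power_divide field_simps)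
	moreover have "cplx (sqrt (2 * pi) / \<sigma>) * cplx (\<sigma> / sqrt (2 * pi)) = 1"
		using s by (simp flip: of_real_mult)
	ultimately show "(CLINT t|lborel. iexp (t * u) * cplx (exp (- (\<sigma> * t)\<^sup>2 / 2)))
			 = cplx (2 * pi * normal_density 0 \<sigma> u)"
		by (metis (no_types, lifting) mult.assoc mult.left_neutral of_real_mult)
qed

text \<open>Near \<open>x\<close> the continuity of \<open>f\<close> is used. Away from
  \<open>x\<close> the two terms need different arguments: \<open>f y\<close> is only integrable, so
  the density is bounded pointwise by a multiple of its standard deviation; the constant
  \<open>f x\<close> is handled by the second moment, as in Chebyshev's inequality.\<close>

lemma normal_density_concentrate:
	fixes f :: "real => real"
	assumes f: "integrable lborel f" and c: "isCont f x"
	shows "((%n. \<integral>y. f y * normal_density 0 (1 / real (Suc n)) (y - x) \<partial>lborel) \<longlonglongrightarrow> f x)"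
proof (rule LIMSEQ_I)
	fix e :: real assume "e > 0"
	obtain d where d: "d > 0" "!!y. \<bar>y - x\<bar> < d ==> \<bar>f y - f x\<bar> < e / 2"
		using c \<open>e > 0\<close> unfolding isCont_def LIM_def
		by (metis abs_zero diff_self dist_real_def half_gt_zero)
	let ?nd = "%s y. normal_density 0 s (y - x)"
	define K where "K = 2 / d\<^sup>2 * (\<integral>y. \<bar>f y\<bar> \<partial>lborel) + \<bar>f x\<bar> / d\<^sup>2"
	have main: "\<bar>(\<integral>y. f y * ?nd s y \<partial>lborel) - f x\<bar> <= e / 2 + s * K" if s: "0 < s" "s <= 1" for s
	proof -
		have nd': "normal_density 0 s (y - x) = normal_density x s y" for y by (simp add: normal_density_def)
		have nd: "?nd s = normal_density x s" by (rule ext) (rule nd')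
		have ndle: "?nd s y <= 2 * s / d\<^sup>2" if "\<bar>y - x\<bar> >= d" for y
		proof -
			let ?u = "(y - x)\<^sup>2 / (2 * s\<^sup>2)"
			have y: "(y - x)\<^sup>2 >= d\<^sup>2" using that d(1) by (metis abs_le_square_iff abs_of_pos)
			then have u0: "?u > 0" using d(1) s by (intro divide_pos_pos) (auto intro: less_le_trans[of 0 "d\<^sup>2"])
			have "?u <= exp ?u" using exp_ge_add_one_self[of ?u] by linarith
			then have "exp (- ?u) <= 1 / ?u" using u0 le_imp_inverse_le[of ?u "exp ?u"] by (simp only: exp_minus inverse_eq_divide)
			also have "... <= 2 * s\<^sup>2 / d\<^sup>2" using y d(1) s by (simp add: frac_le)
			finally have 1: "exp (- ?u) <= 2 * s\<^sup>2 / d\<^sup>2" .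
			have "1 <= sqrt (2 * pi)" using pi_gt3 by simp
			then have 2: "1 / sqrt (2 * pi * s\<^sup>2) <= 1 / s" using s by (simp add: real_sqrt_mult field_simps)
			have "?nd s y = 1 / sqrt (2 * pi * s\<^sup>2) * exp (- ?u)" by (simp add: normal_density_def)
			also have "... <= 1 / s * (2 * s\<^sup>2 / d\<^sup>2)" by (intro mult_mono 1 2) (use s in auto)
			finally show ?thesis using s by (simp add: power2_eq_square)
		qed
		have i1: "integrable lborel (?nd s)" and e1: "(\<integral>y. ?nd s y \<partial>lborel) = 1"
			unfolding nd using s by (auto intro: integrable_normal_density integral_normal_density)
		have hm: "has_bochner_integral lborel (%y. normal_density x s y * (y - x)^(2*1)) (fact (2*1) / ((2 / s\<^sup>2)^1 * fact 1))"
			by (rule normal_moment_even) (use s in auto)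
		then have i2: "integrable lborel (%y. ?nd s y * (y - x)\<^sup>2)" and e2: "(\<integral>y. ?nd s y * (y - x)\<^sup>2 \<partial>lborel) = s\<^sup>2"
			using s by (auto simp: has_bochner_integral_iff nd')
		have bd: "\<bar>f y * ?nd s y - f x * ?nd s y\<bar>
				<= e / 2 * ?nd s y + 2 * s / d\<^sup>2 * \<bar>f y\<bar> + \<bar>f x\<bar> / d\<^sup>2 * (?nd s y * (y - x)\<^sup>2)" for y
		proof (cases "\<bar>y - x\<bar> < d")
			case True
			have "\<bar>f y * ?nd s y - f x * ?nd s y\<bar> = \<bar>f y - f x\<bar> * ?nd s y"
				by (simp add: abs_mult flip: left_diff_distrib)
			also have "... <= e / 2 * ?nd s y" using d(2)[OF True] by (intro mult_right_mono) auto
			finally show ?thesis using s by (simp add: add_nonneg_nonneg add_increasing2)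
		next
			case False
			have "\<bar>f y * ?nd s y\<bar> <= 2 * s / d\<^sup>2 * \<bar>f y\<bar>"
				using mult_right_mono[OF ndle[of y], of "\<bar>f y\<bar>"] False by (simp add: abs_mult mult.commute)
			moreover have "\<bar>f x * ?nd s y\<bar> <= \<bar>f x\<bar> / d\<^sup>2 * (?nd s y * (y - x)\<^sup>2)"
			proof -
				have "d\<^sup>2 <= (y - x)\<^sup>2" using False d(1) by (metis abs_le_square_iff abs_of_pos not_less)
				then have "1 <= (y - x)\<^sup>2 / d\<^sup>2" using d(1) by simp
				then have "\<bar>f x\<bar> * ?nd s y * 1 <= \<bar>f x\<bar> * ?nd s y * ((y - x)\<^sup>2 / d\<^sup>2)"
					by (intro mult_left_mono) auto
				then show ?thesis by (simp add: abs_mult field_simps)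
			qed
			moreover have "0 <= e / 2 * ?nd s y" using \<open>e > 0\<close> by simp
			ultimately show ?thesis by linarith
		qed
		have i0: "integrable lborel (%y. f y * ?nd s y)"
		proof (rule Bochner_Integration.integrable_bound[OF integrable_mult_right[OF f, of "1 / sqrt (2 * pi * s\<^sup>2)"]])
			show "(%y. f y * ?nd s y) \<in> borel_measurable lborel" using f by measurable
			have "?nd s y <= 1 / sqrt (2 * pi * s\<^sup>2)" for y
				using s by (simp add: normal_density_def mult_left_le divide_simps)
			then have "\<bar>?nd s y\<bar> <= \<bar>1 / sqrt (2 * pi * s\<^sup>2)\<bar>" for y
				by (simp add: abs_of_nonneg[OF normal_density_nonneg])
			then show "AE y in lborel. norm (f y * ?nd s y) <= norm (1 / sqrt (2 * pi * s\<^sup>2) * f y)"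
				unfolding mult.commute[of "f _"] real_norm_def abs_mult
				by (intro AE_I2 mult_right_mono abs_ge_zero)
		qed
		have e0: "(\<integral>y. f y * ?nd s y \<partial>lborel) - f x = (\<integral>y. f y * ?nd s y - f x * ?nd s y \<partial>lborel)"
			using i0 i1 e1 by (subst Bochner_Integration.integral_diff) auto
		have "\<bar>(\<integral>y. f y * ?nd s y \<partial>lborel) - f x\<bar> <= (\<integral>y. e / 2 * ?nd s y + 2 * s / d\<^sup>2 * \<bar>f y\<bar> + \<bar>f x\<bar> / d\<^sup>2 * (?nd s y * (y - x)\<^sup>2) \<partial>lborel)"
			unfolding e0 by (rule abs_integral_le) (use bd i1 i2 f in \<open>auto intro!: Bochner_Integration.integrable_add integrable_mult_right\<close>)
		also have "... = e / 2 + 2 * s / d\<^sup>2 * (\<integral>y. \<bar>f y\<bar> \<partial>lborel) + \<bar>f x\<bar> / d\<^sup>2 * s\<^sup>2"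
			using i1 i2 f e1 e2 by (simp add: Bochner_Integration.integral_add)
		also have "... <= e / 2 + s * K"
		proof -
			have "\<bar>f x\<bar> / d\<^sup>2 * s\<^sup>2 <= \<bar>f x\<bar> / d\<^sup>2 * s"
				using s by (intro mult_left_mono) (auto simp: power2_eq_square mult_left_le)
			then show ?thesis by (simp add: K_def algebra_simps)
		qed
		finally show ?thesis .
	qed
	have "K >= 0" unfolding K_def by (intro add_nonneg_nonneg mult_nonneg_nonneg integral_nonneg_AE) auto
	have lim0: "(%n. K * (1 / real (Suc n))) \<longlonglongrightarrow> 0"
		using tendsto_mult_right_zero[OF LIMSEQ_inverse_real_of_nat, of K] by (simp only: inverse_eq_divide)
	have "0 < e / 2" using \<open>e > 0\<close> by simp
	from order_tendstoD(2)[OF lim0 this] obtain N where N: "!!n. n >= N ==> K * (1 / real (Suc n)) < e / 2"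
		unfolding eventually_sequentially by blast
	show "\<exists>N. \<forall>n\<ge>N. norm ((\<integral>y. f y * ?nd (1 / real (Suc n)) y \<partial>lborel) - f x) < e"
	proof (intro exI allI impI)
		fix n assume "n >= N"
		have "\<bar>(\<integral>y. f y * ?nd (1 / real (Suc n)) y \<partial>lborel) - f x\<bar> <= e / 2 + 1 / real (Suc n) * K"
			by (rule main) auto
		also have "... < e" using N[OF \<open>n >= N\<close>] mult.commute[of K "1 / real (Suc n)"] by linarith
		finally show "norm ((\<integral>y. f y * ?nd (1 / real (Suc n)) y \<partial>lborel) - f x) < e" by simp
	qed
qed

text \<open>The factor \<open>exp (- (s n * t)^2 / 2)\<close> makes the double integral absolutely
  convergent, so that Fubini turns the damped inverse transform into the smoothing of
  \<open>f\<close> by a normal density with standard deviation \<open>s n\<close>. As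
  \<open>s n\<close> tends to 0, one side converges by domination and the other by concentration at
  \<open>x\<close>.\<close>

lemma fourier_inversion:
	fixes f :: "real => real"
	assumes f: "integrable lborel f" and c: "isCont f x" and F: "integrable lborel (ft f)"
	shows "cplx (f x) = 1 / (2 * cplx pi) * (CLINT t|lborel. iexp (- (t * x)) * ft f t)"
proof -
	have [measurable]: "f \<in> borel_measurable borel" using f by auto
	have [measurable]: "ft f \<in> borel_measurable borel" using F by auto
	define s where "s n = 1 / real (Suc n)" for n
	have s: "0 < s n" for n by (simp add: s_def)
	let ?G = "%n t. cplx (exp (- (s n * t)\<^sup>2 / 2))"
	have eq: "(CLINT t|lborel. iexp (- (t * x)) * ft f t * ?G n t)
			= cplx (2 * pi * (\<integral>y. f y * normal_density 0 (s n) (y - x) \<partial>lborel))" for n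
	proof -
		have int2: "integrable (lborel \<Otimes>\<^sub>M lborel) (%(t, y). iexp (- (t * x)) * (iexp (t * y) * cplx (f y)) * ?G n t)"
		proof (rule Bochner_Integration.integrable_bound)
			show "integrable (lborel \<Otimes>\<^sub>M lborel) (%(t, y). exp (- (s n * t)\<^sup>2 / 2) * f y)"
				using f gaussian_fourier(1)[OF s[of n]]
				by (intro lborel_pair.Fubini_integrable) (auto simp: abs_mult)
			show "AE p in lborel \<Otimes>\<^sub>M lborel. norm (case p of (t, y) => iexp (- (t * x)) * (iexp (t * y) * cplx (f y)) * ?G n t)
					<= norm (case p of (t, y) => exp (- (s n * t)\<^sup>2 / 2) * f y)"
				by (intro AE_I2) (simp add: split_beta norm_mult abs_mult)
		qed measurable
		have "(CLINT t|lborel. iexp (- (t * x)) * ft f t * ?G n t) =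
			 (CLINT t|lborel. (CLINT y|lborel. iexp (- (t * x)) * (iexp (t * y) * cplx (f y)) * ?G n t))"
			unfolding ft_def by simp
		also have "... = (CLINT y|lborel. (CLINT t|lborel. iexp (- (t * x)) * (iexp (t * y) * cplx (f y)) * ?G n t))"
			using lborel_pair.Fubini_integral[OF int2] by simp
		also have "... = (CLINT y|lborel. cplx (f y) * (CLINT t|lborel. iexp (t * (y - x)) * ?G n t))"
		proof -
			have "iexp (t * (y - x)) = iexp (- (t * x)) * iexp (t * y)" for t y
				by (simp add: algebra_simps flip: exp_add)
			then show ?thesis
				by (intro Bochner_Integration.integral_cong refl, subst integral_mult_right_zero[symmetric],
						intro Bochner_Integration.integral_cong refl) (simp add: mult_ac)
		qed
		also have "... = (CLINT y|lborel. cplx (f y * (2 * pi * normal_density 0 (s n) (y - x))))"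
			unfolding gaussian_fourier(2)[OF s] by simp
		also have "... = cplx (2 * pi * (\<integral>y. f y * normal_density 0 (s n) (y - x) \<partial>lborel))"
		proof -
			have "f y * (2 * pi * normal_density 0 (s n) (y - x)) = (2 * pi) * (f y * normal_density 0 (s n) (y - x))" for y
				by simp
			then show ?thesis unfolding integral_complex_of_real by (simp only: integral_mult_right_zero)
		qed
		finally show ?thesis .
	qed
	have s0: "s \<longlonglongrightarrow> 0"
		unfolding s_def using LIMSEQ_inverse_real_of_nat by (simp add: inverse_eq_divide)
	have "(%n. (CLINT t|lborel. iexp (- (t * x)) * ft f t * ?G n t)) \<longlonglongrightarrow> (CLINT t|lborel. iexp (- (t * x)) * ft f t * 1)"
	proof (rule integral_dominated_convergence[where w="%t. cmod (ft f t)"])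
		show "AE t in lborel. (%n. iexp (- (t * x)) * ft f t * ?G n t) \<longlonglongrightarrow> iexp (- (t * x)) * ft f t * 1"
		proof (intro AE_I2 tendsto_mult tendsto_const)
			fix t :: real
			have "(%n. cplx (exp (- (s n * t)\<^sup>2 / 2))) \<longlonglongrightarrow> cplx (exp (- (0 * t)\<^sup>2 / 2))"
				by (intro tendsto_intros s0) auto
			then show "(%n. ?G n t) \<longlonglongrightarrow> 1" by simp
		qed
		show "AE t in lborel. norm (iexp (- (t * x)) * ft f t * ?G n t) <= cmod (ft f t)" for n
			by (intro AE_I2) (simp add: norm_mult mult_left_le)
	qed (use F in auto)
	moreover have "(%n. cplx (2 * pi * (\<integral>y. f y * normal_density 0 (s n) (y - x) \<partial>lborel)))
			\<longlonglongrightarrow> cplx (2 * pi * f x)"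
		unfolding s_def by (intro tendsto_intros normal_density_concentrate f c)
	ultimately have "(CLINT t|lborel. iexp (- (t * x)) * ft f t) = cplx (2 * pi * f x)"
		unfolding eq mult_1_right by (rule LIMSEQ_unique)
	then show ?thesis by simp
qed

section \<open>Bias of a kernel with vanishing moments\<close>

lemma taylor_hoelder:
	fixes D :: "nat => real => real"
	assumes deriv: "!!j y. j < p ==> (D j has_real_derivative D (Suc j) y) (at y)"
		and hol: "!!y z. y ~= z ==> \<bar>D p y - D p z\<bar> <= C * \<bar>y - z\<bar> powr (r - real p)"
		and r: "real p < r"
	shows "\<bar>D 0 (x + u) - (\<Sum>j\<le>p. D j x / fact j * u ^ j)\<bar> <= \<bar>C\<bar> * \<bar>u\<bar> powr r"
proof (cases "u = 0")
	case True
	have "(\<Sum>j\<le>p. D j x / fact j * 0 ^ j) = (\<Sum>j\<in>{0}. D j x / fact j * 0 ^ j)"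
		by (rule sum.mono_neutral_right) auto
	then show ?thesis using True by simp
next
	case False
	have "\<exists>t. \<bar>t - x\<bar> <= \<bar>u\<bar> \<and> D 0 (x + u) = (\<Sum>j<p. D j x / fact j * u ^ j) + D p t / fact p * u ^ p"
	proof (cases "p = 0")
		case True then show ?thesis by (intro exI[of _ "x + u"]) auto
	next
		case p: False
		have "\<exists>t. (if x + u < x then x + u < t \<and> t < x else x < t \<and> t < x + u) \<and>
			 D 0 (x + u) = (\<Sum>j<p. D j x / fact j * (x + u - x) ^ j) + D p t / fact p * (x + u - x) ^ p"
			by (rule Taylor[of p D "D 0" "x - \<bar>u\<bar>" "x + \<bar>u\<bar>"]) (use p deriv False in auto)
		then obtain t where "if x + u < x then x + u < t \<and> t < x else x < t \<and> t < x + u"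
			 "D 0 (x + u) = (\<Sum>j<p. D j x / fact j * (x + u - x) ^ j) + D p t / fact p * (x + u - x) ^ p" by blast
		then show ?thesis by (intro exI[of _ t]) (auto split: if_splits)
	qed
	then obtain t where t: "\<bar>t - x\<bar> <= \<bar>u\<bar>"
		"D 0 (x + u) = (\<Sum>j<p. D j x / fact j * u ^ j) + D p t / fact p * u ^ p" by auto
	\<comment> \<open>The Lagrange remainder carries \<open>D p\<close> at an intermediate point
	  \<open>t\<close>. Moving it to \<open>x\<close> costs only the Hoelder modulus, since
	  \<open>t\<close> is within \<open>|u|\<close> of \<open>x\<close>.\<close>
	have Dp: "\<bar>D p t - D p x\<bar> <= \<bar>C\<bar> * \<bar>u\<bar> powr (r - real p)"
	proof (cases "t = x")
		case False
		have "\<bar>D p t - D p x\<bar> <= C * \<bar>t - x\<bar> powr (r - real p)" by (rule hol[OF False])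
		also have "... <= \<bar>C\<bar> * \<bar>u\<bar> powr (r - real p)"
			using t(1) r by (intro mult_mono powr_mono2) auto
		finally show ?thesis .
	qed auto
	have "{..p} = insert p {..<p}" by auto
	then have "D 0 (x + u) - (\<Sum>j\<le>p. D j x / fact j * u ^ j) = (D p t - D p x) * (u ^ p / fact p)"
		unfolding t(2) by (simp add: field_simps)
	also have "\<bar>...\<bar> <= \<bar>C\<bar> * \<bar>u\<bar> powr (r - real p) * \<bar>u\<bar> ^ p"
	proof -
		have "\<bar>u ^ p / fact p\<bar> <= \<bar>u\<bar> ^ p"
			using mult_left_mono[of 1 "fact p :: real" "\<bar>u\<bar> ^ p"] by (simp add: power_abs divide_le_eq)
		then show ?thesis unfolding abs_mult[of "D p t - D p x"] using Dp by (intro mult_mono) auto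
	qed
	also have "... = \<bar>C\<bar> * \<bar>u\<bar> powr r"
		using False by (simp add: powr_realpow[symmetric] powr_add[symmetric])
	finally show ?thesis .
qed

text \<open>The Taylor polynomial of degree \<open>p\<close> integrates to its constant term,
  because \<open>W\<close> has mass one and vanishing moments up to order \<open>p\<close>. The
  remainder is bounded by the absolute moment of order \<open>r\<close>, which is finite because
  \<open>r <= p + 1\<close>.\<close>

lemma kernel_bias:
	fixes D :: "nat => real => real" and W :: "real => real"
	assumes deriv: "!!j y. j < p ==> (D j has_real_derivative D (Suc j) y) (at y)"
		and hol: "!!y z. y ~= z ==> \<bar>D p y - D p z\<bar> <= C * \<bar>y - z\<bar> powr (r - real p)"
		and r: "real p < r" "r <= real p + 1"
		and W: "integrable lborel W" "(LINT y|lborel. W y) = 1"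
		and Wm: "integrable lborel (%y. \<bar>y\<bar> ^ (p + 1) * \<bar>W y\<bar>)"
		and Wv: "!!l. l \<in> {1..p} ==> (LINT y|lborel. y ^ l * W y) = 0"
		and bdd: "!!y. \<bar>D 0 y\<bar> <= A" and meas[measurable]: "D 0 \<in> borel_measurable borel"
	shows "\<exists>K. \<forall>h>0. \<bar>(\<integral>z. D 0 (x - h * z) * W z \<partial>lborel) - D 0 x\<bar> <= K * h powr r"
proof -
	have [measurable]: "W \<in> borel_measurable borel" using W by auto
	have pw: "\<bar>z\<bar> ^ j <= 1 + \<bar>z\<bar> ^ (p + 1)" if "j <= p + 1" for z :: real and j
	proof (cases "\<bar>z\<bar> <= 1")
		case True
		then show ?thesis using power_le_one[of "\<bar>z\<bar>" j] by (simp add: add_increasing2)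
	next
		case False
		then have "\<bar>z\<bar> ^ j <= \<bar>z\<bar> ^ (p + 1)" using that by (intro power_increasing) auto
		then show ?thesis by simp
	qed
	have pwr: "\<bar>z\<bar> powr r <= 1 + \<bar>z\<bar> ^ (p + 1)" for z :: real
	proof (cases "\<bar>z\<bar> <= 1")
		case True
		then have "\<bar>z\<bar> powr r <= 1" using powr_mono2[of r "\<bar>z\<bar>" 1] r by auto
		then show ?thesis by (simp add: add_increasing2)
	next
		case False
		then have "\<bar>z\<bar> powr r <= \<bar>z\<bar> powr (real (p + 1))" using r by (intro powr_mono) auto
		also have "... = \<bar>z\<bar> ^ (p + 1)" using False by (subst powr_realpow) auto
		finally show ?thesis by simp
	qed
	have iw: "integrable lborel (%z. (1 + \<bar>z\<bar> ^ (p + 1)) * \<bar>W z\<bar>)"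
		unfolding distrib_right mult_1 by (intro Bochner_Integration.integrable_add integrable_abs W Wm)
	have ij: "integrable lborel (%z. z ^ j * W z)" if "j <= p + 1" for j
		by (rule Bochner_Integration.integrable_bound[OF iw])
			 (use pw[OF that] in \<open>auto simp: abs_mult power_abs intro!: AE_I2 mult_right_mono\<close>)
	have ir: "integrable lborel (%z. \<bar>z\<bar> powr r * \<bar>W z\<bar>)"
		by (rule Bochner_Integration.integrable_bound[OF iw])
			 (use pwr in \<open>auto simp: abs_mult intro!: AE_I2 mult_right_mono\<close>)
	have iD: "integrable lborel (%z. D 0 (x - h * z) * W z)" for h
		by (rule Bochner_Integration.integrable_bound[OF integrable_mult_right[OF W(1), of A]])
			 (use bdd in \<open>auto simp: abs_mult intro!: AE_I2 mult_right_mono order_trans[OF _ abs_ge_self[of A]]\<close>)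
	define K where "K = \<bar>C\<bar> * (\<integral>z. \<bar>z\<bar> powr r * \<bar>W z\<bar> \<partial>lborel)"
	have "\<bar>(\<integral>z. D 0 (x - h * z) * W z \<partial>lborel) - D 0 x\<bar> <= K * h powr r" if h: "h > 0" for h
	proof -
		let ?P = "%z. (\<Sum>j\<le>p. D j x / fact j * (- h) ^ j * (z ^ j * W z))"
		have "(\<integral>z. ?P z \<partial>lborel) = (\<Sum>j\<le>p. D j x / fact j * (- h) ^ j * (\<integral>z. z ^ j * W z \<partial>lborel))"
			using ij by (subst Bochner_Integration.integral_sum) auto
		also have "... = (\<Sum>j\<in>{0}. D j x / fact j * (- h) ^ j * (\<integral>z. z ^ j * W z \<partial>lborel))"
			using Wv by (intro sum.mono_neutral_right) auto
		also have "... = D 0 x" using W by simp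
		finally have eP: "(\<integral>z. ?P z \<partial>lborel) = D 0 x" .
		have iP: "integrable lborel ?P"
			using ij by (intro Bochner_Integration.integrable_sum integrable_mult_right) auto
		have e0: "(\<integral>z. D 0 (x - h * z) * W z \<partial>lborel) - D 0 x = (\<integral>z. D 0 (x - h * z) * W z - ?P z \<partial>lborel)"
			using iD[of h] iP eP by (subst Bochner_Integration.integral_diff) auto
		have "\<bar>(\<integral>z. D 0 (x - h * z) * W z \<partial>lborel) - D 0 x\<bar> <= (\<integral>z. \<bar>C\<bar> * h powr r * (\<bar>z\<bar> powr r * \<bar>W z\<bar>) \<partial>lborel)"
			unfolding e0
		proof (rule abs_integral_le)
			show "integrable lborel (%z. \<bar>C\<bar> * h powr r * (\<bar>z\<bar> powr r * \<bar>W z\<bar>))"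
				using ir by (rule integrable_mult_right)
			fix z
			have "D 0 (x - h * z) * W z - ?P z = (D 0 (x + - h * z) - (\<Sum>j\<le>p. D j x / fact j * (- h * z) ^ j)) * W z"
			proof -
				have "x + - h * z = x - h * z" by simp
				then show ?thesis by (simp only: left_diff_distrib sum_distrib_right power_mult_distrib mult.assoc)
			qed
			also have "\<bar>...\<bar> <= \<bar>C\<bar> * \<bar>- h * z\<bar> powr r * \<bar>W z\<bar>"
				unfolding abs_mult[of _ "W z"]
				by (intro mult_right_mono taylor_hoelder deriv hol r) auto
			also have "... = \<bar>C\<bar> * h powr r * (\<bar>z\<bar> powr r * \<bar>W z\<bar>)"
				using h by (simp add: abs_mult powr_mult mult_ac)
			finally show "\<bar>D 0 (x - h * z) * W z - ?P z\<bar> <= \<bar>C\<bar> * h powr r * (\<bar>z\<bar> powr r * \<bar>W z\<bar>)" .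
		qed
		also have "... = K * h powr r" unfolding K_def integral_mult_right_zero by simp
		finally show ?thesis .
	qed
	then show ?thesis by blast
qed

text \<open>Fubini gives the smoothed function the transform \<open>ft f t * ft W (t * h)\<close>,
  and inversion recovers its values. Boundedness and continuity of \<open>f\<close> make the
  smoothed function continuous, which pointwise inversion requires.\<close>

lemma ft_convolution:
	fixes f W :: "real => real"
	assumes f: "integrable lborel f" and bdd: "!!y. \<bar>f y\<bar> <= A" and c: "continuous_on UNIV f"
		and W: "integrable lborel W" and F: "integrable lborel (%t. ft f t * ft W (t * h))"
	shows "cplx (\<integral>z. f (x - h * z) * W z \<partial>lborel)
		 = 1 / (2 * cplx pi) * (CLINT t|lborel. iexp (- (t * x)) * (ft f t * ft W (t * h)))"
proof -
	let ?c = "%x. \<integral>z. f (x - h * z) * W z \<partial>lborel"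
	have [measurable]: "f \<in> borel_measurable borel" "W \<in> borel_measurable borel" using f W by auto
	have int2: "integrable (lborel \<Otimes>\<^sub>M lborel) (%(z, y). f (y - h * z) * W z)"
	proof (rule lborel_pair.Fubini_integrable)
		have "(\<integral>y. norm (f (y - h * z) * W z) \<partial>lborel) = \<bar>W z\<bar> * (\<integral>y. \<bar>f y\<bar> \<partial>lborel)" for z
			using lborel_integral_real_affine[of 1 "%y. \<bar>f y\<bar>" "- (h * z)"] by (simp add: abs_mult mult.commute)
		then show "integrable lborel (%z. \<integral>y. norm (case (z, y) of (z, y) => f (y - h * z) * W z) \<partial>lborel)"
			using W by simp
		have "integrable lborel (%y. f (y - h * z))" for z
			using lborel_integrable_real_affine[OF f, of 1 "- (h * z)"] by simp
		then show "AE z in lborel. integrable lborel (%y. case (z, y) of (z, y) => f (y - h * z) * W z)"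
			by (intro AE_I2) (simp only: prod.case integrable_mult_left)
	qed measurable
	have ic: "integrable lborel ?c"
		using lborel_pair.integrable_snd[OF int2] by simp
	have cont: "isCont ?c x"
	proof (rule continuous_within_sequentially[THEN iffD2], safe)
		fix X :: "nat => real" assume X: "X \<longlonglongrightarrow> x"
		show "(?c \<circ> X) \<longlonglongrightarrow> ?c x"
			unfolding comp_def
		proof (rule integral_dominated_convergence[where w="%z. A * \<bar>W z\<bar>"])
			show "AE z in lborel. (%i. f (X i - h * z) * W z) \<longlonglongrightarrow> f (x - h * z) * W z"
				using c by (intro AE_I2 tendsto_intros isCont_tendsto_compose[of _ f] X)
					 (auto simp: continuous_on_eq_continuous_at)
		qed (use W bdd in \<open>auto simp: abs_mult intro!: AE_I2 mult_right_mono\<close>)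
	qed
	have ftc: "ft ?c t = ft f t * ft W (t * h)" for t
	proof -
		have int3: "integrable (lborel \<Otimes>\<^sub>M lborel) (%(z, y). iexp (t * y) * cplx (f (y - h * z) * W z))"
			by (rule Bochner_Integration.integrable_bound[OF int2]) (auto simp: norm_mult)
		have "ft ?c t = (CLINT y|lborel. (CLINT z|lborel. iexp (t * y) * cplx (f (y - h * z) * W z)))"
			unfolding ft_def by (simp only: integral_mult_right_zero integral_complex_of_real)
		also have "... = (CLINT z|lborel. (CLINT y|lborel. iexp (t * y) * cplx (f (y - h * z) * W z)))"
			using lborel_pair.Fubini_integral[OF int3] by simp
		also have "... = (CLINT z|lborel. ft f t * (iexp (t * h * z) * cplx (W z)))"
		proof (intro Bochner_Integration.integral_cong refl)
			fix z
			have "(CLINT y|lborel. iexp (t * y) * cplx (f (y - h * z) * W z)) =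
				(CLINT y|lborel. iexp (t * (h * z + 1 * y)) * cplx (f ((h * z + 1 * y) - h * z) * W z))"
				by (subst lborel_integral_real_affine[of 1 _ "h * z"]) auto
			also have "... = (CLINT y|lborel. (iexp (t * h * z) * cplx (W z)) * (iexp (t * y) * cplx (f y)))"
				by (intro Bochner_Integration.integral_cong refl) (simp add: distrib_left exp_add mult_ac)
			also have "... = ft f t * (iexp (t * h * z) * cplx (W z))"
				unfolding ft_def by simp
			finally show "(CLINT y|lborel. iexp (t * y) * cplx (f (y - h * z) * W z)) =
				 ft f t * (iexp (t * h * z) * cplx (W z))" .
		qed
		also have "... = ft f t * ft W (t * h)" unfolding ft_def by simp
		finally show ?thesis .
	qed
	have "integrable lborel (ft ?c)" unfolding ftc[abs_def] by (rule F)
	from fourier_inversion[OF ic cont this] show ?thesis unfolding ftc .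
qed

section \<open>Independence and normal approximation through characteristic functions\<close>

lemma (in prob_space) integrable_iexp_rv:
	"random_variable borel Y ==> integrable M (%w. iexp (v * Y w))"
	by (intro integrable_const_bound[of _ 1]) auto

text \<open>Uniqueness of characteristic functions for a signed weight. The positive and negative
  parts of \<open>Z\<close> have the same mass \<open>m\<close> (take \<open>v = 0\<close>); divided
  by \<open>m\<close>, they weight the law of \<open>Y\<close> into two probability measures with
  the same characteristic function.\<close>

lemma (in prob_space) real_char_zero_imp:
	fixes Z Y :: "'a => real"
	assumes Z: "integrable M Z" and Y[measurable]: "random_variable borel Y"
		and zero: "!!v. (CLINT w|M. cplx (Z w) * iexp (v * Y w)) = 0"
		and A[measurable]: "A \<in> sets borel"
	shows "(LINT w|M. Z w * indicator A (Y w)) = 0"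
proof -
	define P Q where "P w = max 0 (Z w)" and "Q w = max 0 (- Z w)" for w
	have Zm[measurable]: "Z \<in> borel_measurable M" using Z by simp
	have Pm[measurable]: "P \<in> borel_measurable M" "Q \<in> borel_measurable M" unfolding P_def Q_def by measurable
	have PQ: "Z w = P w - Q w" "0 <= P w" "0 <= Q w" for w by (auto simp: P_def Q_def)
	have iP: "integrable M P" and iQ: "integrable M Q"
		unfolding P_def Q_def using Z by auto
	define m where "m = (LINT w|M. P w)"
	have ieP: "integrable M (%w. cplx (P w) * iexp (v * Y w))" for v
		by (rule Bochner_Integration.integrable_bound[OF iP]) (auto simp: norm_mult)
	have ieQ: "integrable M (%w. cplx (Q w) * iexp (v * Y w))" for v
		by (rule Bochner_Integration.integrable_bound[OF iQ]) (auto simp: norm_mult)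
	have chPQ: "(CLINT w|M. cplx (P w) * iexp (v * Y w)) = (CLINT w|M. cplx (Q w) * iexp (v * Y w))" for v
		using zero[of v] ieP[of v] ieQ[of v] by (simp add: PQ(1) left_diff_distrib)
	have mQ: "m = (LINT w|M. Q w)"
		using chPQ[of 0] unfolding m_def by (simp del: of_real_eq_iff flip: of_real_eq_iff[where 'a=complex])
	have m0: "m >= 0" unfolding m_def using PQ(2) by (simp add: integral_nonneg_AE)
	show ?thesis
	proof (cases "m = 0")
		case True
		have "AE w in M. P w = 0" using integral_nonneg_eq_0_iff_AE[OF iP] PQ(2) True m_def by simp
		moreover have "AE w in M. Q w = 0" using integral_nonneg_eq_0_iff_AE[OF iQ] PQ(3) True mQ by simp
		ultimately have "AE w in M. Z w * indicator A (Y w) = 0" by eventually_elim (simp add: PQ(1))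
		then show ?thesis by (subst integral_cong_AE[where g="%_. 0"]) auto
	next
		case False
		then have m: "m > 0" using m0 by simp
		define \<mu> where "\<mu> R = distr (density M (%w. ennreal (R w / m))) borel Y" for R :: "'a => real"
		have int\<mu>: "integral\<^sup>L (\<mu> R) f = (LINT w|M. (R w / m) *\<^sub>R f (Y w))"
			if [measurable]: "R \<in> borel_measurable M" "f \<in> borel_measurable borel" and R: "!!w. 0 <= R w"
			for R and f :: "real => 'b::{banach, second_countable_topology}"
			unfolding \<mu>_def using m R by (subst integral_distr) (auto simp: integral_density)
		have rd: "real_distribution (\<mu> R)" if [measurable]: "R \<in> borel_measurable M" and R: "!!w. 0 <= R w"
			and i: "integrable M R" and e: "(LINT w|M. R w) = m" for R
		proof -
			have "(\<integral>\<^sup>+w. ennreal (R w / m) \<partial>M) = ennreal (LINT w|M. R w / m)"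
				using i R m by (intro nn_integral_eq_integral) auto
			also have "... = 1" using e m by simp
			finally have "prob_space (density M (%w. ennreal (R w / m)))"
				by (intro prob_spaceI) (simp add: emeasure_density cong: nn_integral_cong)
			then have "prob_space (\<mu> R)" unfolding \<mu>_def by (rule prob_space.prob_space_distr) simp
			then show ?thesis by (simp add: real_distribution_def real_distribution_axioms_def \<mu>_def)
		qed
		have ch: "char (\<mu> R) v = (1 / cplx m) * (CLINT w|M. cplx (R w) * iexp (v * Y w))"
			if "R \<in> borel_measurable M" "!!w. 0 <= R w" for R v
			unfolding char_def using that
			by (subst int\<mu>) (auto simp: scaleR_conv_of_real simp flip: integral_mult_right_zero)
		have "char (\<mu> P) = char (\<mu> Q)"
			using chPQ PQ Pm by (auto simp: ch fun_eq_iff)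
		then have "\<mu> P = \<mu> Q"
			using iP iQ PQ m_def mQ by (intro Levy_uniqueness rd) auto
		then have "integral\<^sup>L (\<mu> P) (indicator A :: real => real) = integral\<^sup>L (\<mu> Q) (indicator A)" by simp
		then have "(LINT w|M. (P w / m) * indicator A (Y w)) = (LINT w|M. (Q w / m) * indicator A (Y w))"
			using int\<mu>[of P "indicator A :: real => real"] int\<mu>[of Q "indicator A :: real => real"] PQ(2,3)
			by (simp only: real_scaleR_def Pm borel_measurable_indicator A)
		then have "(LINT w|M. P w * indicator A (Y w)) = (LINT w|M. Q w * indicator A (Y w))"
			using m by simp
		moreover have "integrable M (%w. P w * indicator A (Y w))" "integrable M (%w. Q w * indicator A (Y w))"
			by (rule Bochner_Integration.integrable_bound[OF iP] Bochner_Integration.integrable_bound[OF iQ];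
					auto simp: abs_mult indicator_def)+
		ultimately show ?thesis by (simp add: PQ(1) left_diff_distrib)
	qed
qed

text \<open>The conjugate of \<open>Z\<close> satisfies the same identity, by conjugating the one at
  \<open>- v\<close>. Hence so do the real and imaginary parts, to which the real case
  applies.\<close>

lemma (in prob_space) char_zero_imp:
	fixes Z :: "'a => complex" and Y :: "'a => real"
	assumes Z: "integrable M Z" and Y[measurable]: "random_variable borel Y"
		and zero: "!!v. (CLINT w|M. Z w * iexp (v * Y w)) = 0"
		and A[measurable]: "A \<in> sets borel"
	shows "(CLINT w|M. Z w * indicator A (Y w)) = 0"
proof -
	have [measurable]: "Z \<in> borel_measurable M" using Z by simp
	have [measurable]: "cnj \<in> borel_measurable borel" by (intro borel_measurable_continuous_onI continuous_intros)
	have int: "integrable M (%w. Z w * iexp (v * Y w))" for v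
		by (rule Bochner_Integration.integrable_bound[OF Z]) (auto simp: norm_mult)
	have cnj0: "(CLINT w|M. cnj (Z w) * iexp (v * Y w)) = 0" for v
	proof -
		have "cnj (CLINT w|M. Z w * iexp ((- v) * Y w)) = (CLINT w|M. cnj (Z w * iexp ((- v) * Y w)))"
			by (rule Bochner_Integration.integral_cnj[symmetric])
		also have "... = (CLINT w|M. cnj (Z w) * iexp (v * Y w))"
			by (intro Bochner_Integration.integral_cong refl) (simp add: exp_cnj)
		finally show ?thesis using zero[of "- v"] by simp
	qed
	have intc: "integrable M (%w. cnj (Z w) * iexp (v * Y w))" for v
		by (rule Bochner_Integration.integrable_bound[OF Z]) (auto simp: norm_mult)
	have R: "(CLINT w|M. cplx (Re (Z w)) * iexp (v * Y w)) = 0" for v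
	proof -
		have e: "cplx (Re z) * wv = (1 / 2) * (z * wv + cnj z * wv)" for z wv :: complex
			by (simp add: complex_eq_iff field_simps)
		show ?thesis unfolding e using zero[of v] cnj0[of v] int[of v] intc[of v] by simp
	qed
	have I: "(CLINT w|M. cplx (Im (Z w)) * iexp (v * Y w)) = 0" for v
	proof -
		have e: "cplx (Im z) * wv = (- \<i> / 2) * (z * wv - cnj z * wv)" for z wv :: complex
			by (simp add: complex_eq_iff field_simps)
		show ?thesis unfolding e using zero[of v] cnj0[of v] int[of v] intc[of v] by simp
	qed
	have intA: "integrable M (%w. Z w * indicator A (Y w))"
		by (rule Bochner_Integration.integrable_bound[OF Z]) (auto simp: norm_mult indicator_def)
	have "Re (CLINT w|M. Z w * indicator A (Y w)) = (LINT w|M. Re (Z w) * indicator A (Y w))"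
		by (subst integral_Re[OF intA, symmetric]) (auto intro!: Bochner_Integration.integral_cong simp: indicator_def)
	also have "... = 0" using Z by (intro real_char_zero_imp R) auto
	finally have 1: "Re (CLINT w|M. Z w * indicator A (Y w)) = 0" .
	have "Im (CLINT w|M. Z w * indicator A (Y w)) = (LINT w|M. Im (Z w) * indicator A (Y w))"
		by (subst integral_Im[OF intA, symmetric]) (auto intro!: Bochner_Integration.integral_cong simp: indicator_def)
	also have "... = 0" using Z by (intro real_char_zero_imp I) auto
	finally show ?thesis using 1 by (simp add: complex_eq_iff)
qed

text \<open>Exponentials are exchanged for indicators one index at a time, \<open>K\<close> being
  the set of indices already treated. When all are exchanged, the product formula for events
  remains.\<close>

lemma (in prob_space) indep_vars_if_char_factorizes:
	fixes Y :: "'i => 'a => real"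
	assumes J: "finite J" "J ~= {}" and Y: "!!j. j \<in> J ==> random_variable borel (Y j)"
		and fac: "!!v. (CLINT w|M. (\<Prod>j\<in>J. iexp (v j * Y j w))) = (\<Prod>j\<in>J. (CLINT w|M. iexp (v j * Y j w)))"
	shows "indep_vars (%_. borel) Y J"
proof -
	let ?ch = "%j v. (CLINT w|M. iexp (v * Y j w))"
	have claim: "(CLINT w|M. (\<Prod>j\<in>K. indicator (A j) (Y j w)) * (\<Prod>j\<in>J - K. iexp (v j * Y j w)))
		 = (\<Prod>j\<in>K. cplx (prob (Y j -` A j \<inter> space M))) * (\<Prod>j\<in>J - K. ?ch j (v j))"
		if "finite K" "K \<subseteq> J" "!!j. j \<in> J ==> A j \<in> sets borel" for K A v
		using that(1,2)
	proof (induction K arbitrary: v rule: finite_induct)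
		case empty
		show ?case using fac by simp
	next
		case (insert i K)
		have Ym: "!!j. j \<in> J ==> Y j \<in> borel_measurable M" by (rule Y)
		have iJ: "i \<in> J" "i \<notin> K" "K \<subseteq> J" using insert by auto
		have fK: "finite K" "finite (J - K)" "finite (J - insert i K)" using insert J by auto
		have sp: "J - K = insert i (J - insert i K)" using iJ by auto
		have ni: "i \<notin> J - insert i K" by auto
		let ?U = "%w. (\<Prod>j\<in>K. indicator (A j) (Y j w)) * (\<Prod>j\<in>J - insert i K. iexp (v j * Y j w)) :: complex"
		let ?c = "(\<Prod>j\<in>K. cplx (prob (Y j -` A j \<inter> space M))) * (\<Prod>j\<in>J - insert i K. ?ch j (v j))"
		have Um[measurable]: "?U \<in> borel_measurable M"
		proof (intro borel_measurable_times borel_measurable_prod)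
			fix j assume "j \<in> K"
			then have "j \<in> J" using iJ by auto
			with Ym that(3) show "(%w. indicator (A j) (Y j w) :: complex) \<in> borel_measurable M" by measurable
		next
			fix j assume "j \<in> J - insert i K"
			then have [measurable]: "Y j \<in> borel_measurable M" using Ym by auto
			show "(%w. iexp (v j * Y j w)) \<in> borel_measurable M" by measurable
		qed
		have Yi[measurable]: "Y i \<in> borel_measurable M" "A i \<in> sets borel" using Ym iJ that(3) by auto
		have U1: "cmod (?U w) <= 1" for w
			unfolding norm_mult prod_norm[symmetric]
			by (intro mult_le_one prod_le_1 prod_nonneg conjI ballI) (auto simp: indicator_def)
		have iU: "integrable M (%w. ?U w * g w)" if [measurable]: "g \<in> borel_measurable M" and "!!w. cmod (g w) <= 1" for g
			using mult_le_one[OF U1 norm_ge_zero that(2)] by (intro integrable_const_bound[of _ 1] borel_measurable_times Um that(1)) (auto simp: norm_mult)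
		\<comment> \<open>\<open>?U\<close> collects the factors of all indices other than
		  \<open>i\<close>. By the induction hypothesis \<open>?U - ?c\<close> integrates to 0 against
		  every exponential of \<open>Y i\<close>, hence against every indicator of
		  \<open>Y i\<close>.\<close>
		have "(CLINT w|M. (?U w - ?c) * indicator (A i) (Y i w)) = 0"
		proof (rule char_zero_imp)
			show "integrable M (%w. ?U w - ?c)" using iU[of "%_. 1"] by auto
			fix u
			have "(CLINT w|M. ?U w * iexp (u * Y i w)) =
				 (CLINT w|M. (\<Prod>j\<in>K. indicator (A j) (Y j w)) * (\<Prod>j\<in>J - K. iexp ((v(i := u)) j * Y j w)))"
				unfolding sp prod.insert[OF fK(3) ni] using ni
				by (intro Bochner_Integration.integral_cong refl) (auto simp: mult_ac intro!: prod.cong)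
			also have "... = (\<Prod>j\<in>K. cplx (prob (Y j -` A j \<inter> space M))) * (\<Prod>j\<in>J - K. ?ch j ((v(i := u)) j))"
				by (rule insert.IH) (rule iJ)
			also have "... = ?c * ?ch i u"
			proof -
				have "(\<Prod>j\<in>J - insert i K. ?ch j ((v(i := u)) j)) = (\<Prod>j\<in>J - insert i K. ?ch j (v j))"
					by (intro prod.cong refl) auto
				then show ?thesis unfolding sp prod.insert[OF fK(3) ni] by (simp add: mult_ac)
			qed
			finally show "(CLINT w|M. (?U w - ?c) * iexp (u * Y i w)) = 0"
				using iU[of "%w. iexp (u * Y i w)"] integrable_iexp_rv[OF Yi(1), of u] by (simp add: left_diff_distrib)
		qed auto
		moreover have "integrable M (%w. indicator (A i) (Y i w) :: complex)"
			by (intro integrable_const_bound[of _ 1]) (auto simp: indicator_def)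
		moreover have "integrable M (%w. ?U w * indicator (A i) (Y i w))"
			by (rule iU) (auto simp: indicator_def)
		moreover have "(CLINT w|M. indicator (A i) (Y i w)) = cplx (prob (Y i -` A i \<inter> space M))"
		proof -
			have "(CLINT w|M. indicator (A i) (Y i w)) = (CLINT w|M. cplx (indicator (Y i -` A i \<inter> space M) w))"
				by (intro Bochner_Integration.integral_cong refl) (auto simp: indicator_def)
			then show ?thesis unfolding integral_complex_of_real by simp
		qed
		ultimately have "(CLINT w|M. ?U w * indicator (A i) (Y i w)) = ?c * cplx (prob (Y i -` A i \<inter> space M))"
			by (simp add: left_diff_distrib)
		then show ?case using fK iJ by (simp add: mult_ac)
	qed
	show ?thesis
	proof (subst indep_vars_finite[where E="%_. sets borel"])
		show "\<forall>A\<in>J \<rightarrow> (sets borel :: real set set). prob (\<Inter>j\<in>J. Y j -` A j \<inter> space M) = (\<Prod>j\<in>J. prob (Y j -` A j \<inter> space M))"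
		proof
			fix A :: "'i => real set" assume A: "A \<in> J \<rightarrow> sets borel"
			have "cplx (prob (\<Inter>j\<in>J. Y j -` A j \<inter> space M)) =
					(CLINT w|M. cplx (indicator (\<Inter>j\<in>J. Y j -` A j \<inter> space M) w))"
				unfolding integral_complex_of_real using J by auto
			also have "... = (CLINT w|M. (\<Prod>j\<in>J. indicator (A j) (Y j w)) * (\<Prod>j\<in>J - J. iexp (0 * Y j w)))"
			proof (intro Bochner_Integration.integral_cong refl)
				fix w assume wv: "w \<in> space M"
				have "indicator (\<Inter>j\<in>J. Y j -` A j \<inter> space M) w = (\<Prod>j\<in>J. indicator (Y j -` A j \<inter> space M) w :: real)"
					using J by (simp add: indicator_inter_arith indicator_def prod_eq_1_iff) (auto intro!: prod_zero)
				also have "cplx ... = (\<Prod>j\<in>J. indicator (A j) (Y j w))"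
					unfolding of_real_prod using wv by (intro prod.cong refl) (auto simp: indicator_def)
				finally show "cplx (indicator (\<Inter>j\<in>J. Y j -` A j \<inter> space M) w) =
					 (\<Prod>j\<in>J. indicator (A j) (Y j w)) * (\<Prod>j\<in>J - J. iexp (0 * Y j w))" by simp
			qed
			also have "... = (\<Prod>j\<in>J. cplx (prob (Y j -` A j \<inter> space M)))"
				using A J by (subst claim) auto
			finally show "prob (\<Inter>j\<in>J. Y j -` A j \<inter> space M) = (\<Prod>j\<in>J. prob (Y j -` A j \<inter> space M))"
				by (simp only: of_real_prod[symmetric] of_real_eq_iff)
		qed
	qed (use J Y in \<open>auto simp: Int_stable_def sets.sigma_sets_eq[of borel, simplified space_borel]\<close>)
qed

text \<open>The expectation \<open>ch s\<close> of \<open>iexp (s * S)\<close> nearly solves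
  \<open>ch' = - s * V * ch\<close>. The set \<open>nb j\<close> holds the indices on which
  \<open>\<xi> j\<close> may depend, and \<open>nb2 j\<close> those on which a product
  \<open>\<xi> j * \<xi> i\<close> with \<open>i\<close> in \<open>nb j\<close> may depend;
  independence enters only through the factorisations \<open>ind1\<close> and \<open>ind2\<close>.
  Since \<open>V\<close> is not assumed nonnegative, the bound carries the factor
  \<open>exp |V|\<close>.\<close>

lemma (in prob_space) stein_char:
	fixes \<xi> :: "nat => 'a => real" and nb nb2 :: "nat => nat set"
	assumes I: "finite I" and nb: "!!j. j \<in> I ==> nb j \<subseteq> nb2 j" "!!j. j \<in> I ==> nb2 j \<subseteq> I"
		and rv[measurable]: "!!j. random_variable borel (\<xi> j)"
		and b: "!!j w. \<bar>\<xi> j w\<bar> <= b" and q: "!!j. j \<in> I ==> real (card (nb2 j)) <= q"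
		and v: "!!j. j \<in> I ==> expectation (%w. (\<xi> j w)\<^sup>2) <= v"
		and ind1: "!!j s. j \<in> I ==> (CLINT w|M. cplx (\<xi> j w) * iexp (s * (\<Sum>i\<in>I - nb j. \<xi> i w)))
				= cplx (expectation (\<xi> j)) * (CLINT w|M. iexp (s * (\<Sum>i\<in>I - nb j. \<xi> i w)))"
		and ind2: "!!j i s. j \<in> I ==> i \<in> nb j ==>
				(CLINT w|M. cplx (\<xi> j w * \<xi> i w) * iexp (s * (\<Sum>i\<in>I - nb2 j. \<xi> i w)))
				= cplx (expectation (%w. \<xi> j w * \<xi> i w)) * (CLINT w|M. iexp (s * (\<Sum>i\<in>I - nb2 j. \<xi> i w)))"
	defines "V \<equiv> (\<Sum>j\<in>I. \<Sum>i\<in>nb j. expectation (%w. \<xi> j w * \<xi> i w))"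
	shows "cmod ((CLINT w|M. iexp (\<Sum>i\<in>I. \<xi> i w)) - cplx (exp (- V / 2)))
		 <= exp \<bar>V\<bar> * ((\<Sum>j\<in>I. \<bar>expectation (\<xi> j)\<bar>) + 3 * real (card I) * q\<^sup>2 * b * v)"
proof -
	define S where "S w = (\<Sum>i\<in>I. \<xi> i w)" for w
	define Sc where "Sc j w = (\<Sum>i\<in>I - nb j. \<xi> i w)" for j w
	define Sd where "Sd j w = (\<Sum>i\<in>I - nb2 j. \<xi> i w)" for j w
	define Y where "Y j w = (\<Sum>i\<in>nb j. \<xi> i w)" for j w
	define ch where "ch s = (CLINT w|M. iexp (s * S w))" for s
	have b0: "0 <= b" using b[of 0] abs_ge_zero order_trans by blast
	have meas[measurable]: "S \<in> borel_measurable M" "Sc j \<in> borel_measurable M" "Sd j \<in> borel_measurable M" "Y j \<in> borel_measurable M" for j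
		unfolding S_def Sc_def Sd_def Y_def by measurable
	have bsum: "\<bar>\<Sum>i\<in>A. \<xi> i w\<bar> <= real (card A) * b" for A w
		using sum_bounded_above[of A "%i. \<bar>\<xi> i w\<bar>" b] b order_trans[OF sum_abs] by auto
	have fin: "finite (nb j)" "finite (nb2 j)" if "j \<in> I" for j
		using nb[OF that] I by (auto intro: finite_subset)
	have cnb: "real (card (nb j)) <= q" "0 <= q" if "j \<in> I" for j
		using q[OF that] card_mono[OF fin(2) nb(1)] that by (auto intro: order_trans[of _ "real (card (nb2 j))"])
	have Yb: "\<bar>Y j w\<bar> <= q * b" if "j \<in> I" for j w
		using bsum[of _ "nb j"] mult_right_mono[OF cnb(1)[OF that] b0] unfolding Y_def by (auto intro: order_trans)
	have SSd: "\<bar>S w - Sd j w\<bar> <= q * b" if "j \<in> I" for j w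
	proof -
		have "S w - Sd j w = (\<Sum>i\<in>nb2 j. \<xi> i w)"
			unfolding S_def Sd_def using sum.subset_diff[OF nb(2)[OF that] I, of "%i. \<xi> i w"] by simp
		then show ?thesis using bsum[of _ "nb2 j"] mult_right_mono[OF q[OF that] b0] by (auto intro: order_trans)
	qed
	have SSc: "S w = Sc j w + Y j w" if "j \<in> I" for j w
		unfolding S_def Sc_def Y_def using sum.subset_diff[of "nb j" I "%i. \<xi> i w"] nb[OF that] I by auto
	have ScSd: "\<bar>Sc j w - Sd j w\<bar> <= q * b" if "j \<in> I" for j w
	proof -
		have "Sc j w - Sd j w = (\<Sum>i\<in>nb2 j - nb j. \<xi> i w)"
			using SSc[OF that, of w] sum.subset_diff[OF nb(2)[OF that] I, of "%i. \<xi> i w"]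
				sum.subset_diff[OF nb(1)[OF that] fin(2)[OF that], of "%i. \<xi> i w"]
			unfolding S_def Sd_def Y_def by simp
		moreover have "real (card (nb2 j - nb j)) <= q"
			using q[OF that] card_mono[OF fin(2)[OF that], of "nb2 j - nb j"] by auto
		ultimately show ?thesis using bsum[of _ "nb2 j - nb j"] mult_right_mono[OF _ b0] by (auto intro: order_trans)
	qed
	have ib: "integrable M f" if "f \<in> borel_measurable M" "!!w. norm (f w) <= B" for f :: "'a => 'c::{banach, second_countable_topology}" and B
		using that by (intro integrable_const_bound[of _ B]) auto
	have bb: "\<bar>\<xi> j w * \<xi> i w\<bar> <= b * b" for i j w unfolding abs_mult by (intro mult_mono b b0) auto
	have ixx: "integrable M (%w. \<xi> j w * \<xi> i w)" for i j by (rule ib[of _ "b * b"]) (use bb in auto)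
	have isq: "integrable M (%w. (\<xi> j w)\<^sup>2)" for j using ixx[of j j] by (simp add: power2_eq_square)
	have v0: "0 <= v" if "j \<in> I" for j
		by (rule order_trans[OF Bochner_Integration.integral_nonneg v[OF that]]) simp
	have xx: "expectation (%w. \<bar>\<xi> j w * \<xi> i w\<bar>) <= v" if "j \<in> I" "i \<in> I" for i j
	proof -
		have "\<bar>\<xi> j w * \<xi> i w\<bar> <= ((\<xi> j w)\<^sup>2 + (\<xi> i w)\<^sup>2) / 2" for w
			using sum_squares_bound[of "\<bar>\<xi> j w\<bar>" "\<bar>\<xi> i w\<bar>"] by (simp add: abs_mult)
		then have "expectation (%w. \<bar>\<xi> j w * \<xi> i w\<bar>) <= expectation (%w. ((\<xi> j w)\<^sup>2 + (\<xi> i w)\<^sup>2) / 2)"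
			using ixx isq by (intro integral_mono) auto
		also have "... <= v" using v[OF that(1)] v[OF that(2)] isq by simp
		finally show ?thesis .
	qed
	have xY: "expectation (%w. \<bar>\<xi> j w\<bar> * \<bar>Y j w\<bar>) <= q * v" and ixY: "integrable M (%w. \<bar>\<xi> j w\<bar> * \<bar>Y j w\<bar>)" if j: "j \<in> I" for j
	proof -
		show i: "integrable M (%w. \<bar>\<xi> j w\<bar> * \<bar>Y j w\<bar>)"
			by (rule ib[of _ "b * (q * b)"]) (use b Yb[OF j] b0 in \<open>auto intro!: mult_mono simp: abs_mult\<close>)
		have "expectation (%w. \<bar>\<xi> j w\<bar> * \<bar>Y j w\<bar>) <= expectation (%w. \<Sum>i\<in>nb j. \<bar>\<xi> j w * \<xi> i w\<bar>)"
		proof (rule integral_mono[OF i])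
			show "integrable M (%w. \<Sum>i\<in>nb j. \<bar>\<xi> j w * \<xi> i w\<bar>)"
				using ixx by (intro Bochner_Integration.integrable_sum integrable_abs)
			show "\<bar>\<xi> j w\<bar> * \<bar>Y j w\<bar> <= (\<Sum>i\<in>nb j. \<bar>\<xi> j w * \<xi> i w\<bar>)" for w
				unfolding Y_def abs_mult sum_distrib_left[symmetric] by (intro mult_left_mono sum_abs) auto
		qed
		also have "... = (\<Sum>i\<in>nb j. expectation (%w. \<bar>\<xi> j w * \<xi> i w\<bar>))"
			using ixx by (intro Bochner_Integration.integral_sum) auto
		also have "... <= (\<Sum>i\<in>nb j. v)" using nb[OF j] j by (intro sum_mono xx) auto
		also have "... <= q * v" using cnb[OF j] v0[OF j] by (simp add: mult_right_mono)
		finally show "expectation (%w. \<bar>\<xi> j w\<bar> * \<bar>Y j w\<bar>) <= q * v" .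
	qed
	define E where "E = (\<Sum>j\<in>I. \<bar>expectation (\<xi> j)\<bar>) + 3 * real (card I) * q\<^sup>2 * b * v"
	have dch: "(ch has_vector_derivative (CLINT w|M. \<i> * cplx (S w) * iexp (s * S w) * 1)) (at s)" for s
	proof -
		have iS: "integrable M (%w. cplx (S w) * 1)"
			by (rule ib[of _ "real (card I) * b"]) (use bsum[of _ I] in \<open>auto simp: S_def simp del: of_real_sum\<close>)
		have "((%t. (CLINT w|M. (iexp (t * S w) - 1) * 1) + 1) has_vector_derivative
				(CLINT w|M. \<i> * cplx (S w) * iexp (s * S w) * 1) + 0) (at s)"
			by (intro has_vector_derivative_add has_vector_derivative_const has_vector_derivative_integral_iexp iS) auto
		moreover have "(CLINT w|M. (iexp (t * S w) - 1) * 1) + 1 = ch t" for t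
			unfolding ch_def using integrable_iexp_rv[OF meas(1), of t] by (simp add: prob_space)
		ultimately show ?thesis by simp
	qed
	\<comment> \<open>The neighbours are split off and their exponential is expanded to first order
	  (1). The constant term factorises into the mean (2). In the linear term the exponent is cut down
	  to the complement of \<open>nb2 j\<close> (3), where the product moment factorises, and is
	  restored afterwards (4). The steps 1, 3 and 4 cost \<open>q^2 * b * v\<close> each, hence the
	  factor 3.\<close>
	have main: "cmod ((CLINT w|M. cplx (\<xi> j w) * iexp (s * S w))
			 - \<i> * cplx (s * expectation (%w. \<xi> j w * Y j w)) * ch s)
			<= \<bar>expectation (\<xi> j)\<bar> + 3 * q\<^sup>2 * b * v" if j: "j \<in> I" and s: "0 <= s" "s <= 1" for j s
	proof -
		let ?x = "%w. cplx (\<xi> j w)" and ?y = "%w. cplx (Y j w)"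
		let ?A = "CLINT w|M. ?x w * iexp (s * S w)"
		let ?B = "CLINT w|M. ?x w * iexp (s * Sc j w)"
		let ?C = "CLINT w|M. ?x w * ?y w * iexp (s * Sc j w)"
		let ?D = "CLINT w|M. ?x w * ?y w * iexp (s * Sd j w)"
		let ?e = "cplx (expectation (%w. \<xi> j w * Y j w))"
		have qb: "0 <= q * b" using cnb(2)[OF j] b0 by simp
		have ix: "integrable M (%w. ?x w * iexp (R w))" if [measurable]: "R \<in> borel_measurable M" for R
			by (rule ib[of _ b]) (use b in \<open>auto simp: norm_mult\<close>)
		have bxy: "\<bar>\<xi> j w\<bar> * \<bar>Y j w\<bar> <= b * (q * b)" for w using b Yb[OF j] b0 by (intro mult_mono) auto
		have ixy: "integrable M (%w. ?x w * ?y w * iexp (R w))" if [measurable]: "R \<in> borel_measurable M" for R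
			by (rule ib[of _ "b * (q * b)"]) (use bxy in \<open>auto simp: norm_mult\<close>)
		have nsc: "cmod (CLINT w|M. iexp (R w)) <= 1" if "R \<in> borel_measurable M" for R
			using norm_integral_le[of M "%_. 1" "%w. iexp (R w)"] by (simp add: prob_space)
		have s2: "s\<^sup>2 <= 1" using s by (simp add: power_le_one)
		have 1: "cmod (?A - ?B - \<i> * s * ?C) <= q\<^sup>2 * b * v"
		proof -
			have "?A - ?B - \<i> * s * ?C = (CLINT w|M. ?x w * iexp (s * S w) - ?x w * iexp (s * Sc j w)
					- \<i> * s * (?x w * ?y w * iexp (s * Sc j w)))"
				using ix[of "%w. s * S w"] ix[of "%w. s * Sc j w"] ixy[of "%w. s * Sc j w"] by simp
			also have "... = (CLINT w|M. ?x w * iexp (s * Sc j w) * (iexp (s * Y j w) - 1 - \<i> * (s * Y j w)))"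
				by (intro Bochner_Integration.integral_cong refl)
					 (simp add: SSc[OF j] algebra_simps exp_add)
			finally have e: "?A - ?B - \<i> * s * ?C = ..." .
			have "cmod (?A - ?B - \<i> * s * ?C) <= (LINT w|M. (q * b) * (\<bar>\<xi> j w\<bar> * \<bar>Y j w\<bar>))"
				unfolding e
			proof (rule norm_integral_le)
				show "integrable M (%w. (q * b) * (\<bar>\<xi> j w\<bar> * \<bar>Y j w\<bar>))" using ixY[OF j] by simp
				fix w
				have "cmod (iexp (s * Y j w) - 1 - \<i> * (s * Y j w)) <= \<bar>s * Y j w\<bar>\<^sup>2 / 2"
					using iexp_approx1[of "s * Y j w" 1] by (simp add: algebra_simps numeral_2_eq_2)
				also have "... <= (Y j w)\<^sup>2"
					unfolding power2_abs power_mult_distrib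
					using mult_right_mono[OF s2, of "(Y j w)\<^sup>2"] zero_le_power2[of "Y j w"] by linarith
				also have "... <= (q * b) * \<bar>Y j w\<bar>"
					using mult_right_mono[OF Yb[OF j, of w], of "\<bar>Y j w\<bar>"] by (simp add: power2_eq_square flip: abs_mult)
				finally have "\<bar>\<xi> j w\<bar> * cmod (iexp (s * Y j w) - 1 - \<i> * (s * Y j w)) <= \<bar>\<xi> j w\<bar> * ((q * b) * \<bar>Y j w\<bar>)"
					by (intro mult_left_mono) auto
				then show "cmod (?x w * iexp (s * Sc j w) * (iexp (s * Y j w) - 1 - \<i> * (s * Y j w))) <= (q * b) * (\<bar>\<xi> j w\<bar> * \<bar>Y j w\<bar>)"
					unfolding norm_mult norm_exp_i_times norm_of_real mult_1_right by (simp only: mult_ac)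
			qed
			also have "... <= (q * b) * (q * v)" using xY[OF j] qb by (simp add: mult_left_mono)
			finally show ?thesis by (simp add: power2_eq_square mult_ac)
		qed
		have 2: "cmod ?B <= \<bar>expectation (\<xi> j)\<bar>"
			using ind1[OF j, of s] nsc[of "%w. s * Sc j w"] unfolding Sc_def
			by (simp add: norm_mult mult_left_le Sc_def[symmetric])
		have 3: "cmod (\<i> * s * ?C - \<i> * s * ?D) <= q\<^sup>2 * b * v"
		proof -
			have e: "?C - ?D = (CLINT w|M. ?x w * ?y w * (iexp (s * Sc j w) - iexp (s * Sd j w)))"
				using ixy[of "%w. s * Sc j w"] ixy[of "%w. s * Sd j w"] by (simp add: right_diff_distrib)
			have "cmod (?C - ?D) <= (LINT w|M. (q * b) * (\<bar>\<xi> j w\<bar> * \<bar>Y j w\<bar>))"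
				unfolding e
			proof (rule norm_integral_le)
				show "integrable M (%w. (q * b) * (\<bar>\<xi> j w\<bar> * \<bar>Y j w\<bar>))" using ixY[OF j] by simp
				fix w
				have "cmod (iexp (s * Sc j w) - iexp (s * Sd j w)) <= \<bar>s\<bar> * \<bar>Sc j w - Sd j w\<bar>"
					using cmod_iexp_diff_le[of "s * Sc j w" "s * Sd j w"] by (simp flip: abs_mult right_diff_distrib)
				also have "... <= 1 * (q * b)" using s ScSd[OF j, of w] by (intro mult_mono) auto
				finally have "\<bar>\<xi> j w\<bar> * \<bar>Y j w\<bar> * cmod (iexp (s * Sc j w) - iexp (s * Sd j w)) <= \<bar>\<xi> j w\<bar> * \<bar>Y j w\<bar> * (1 * (q * b))"
					by (intro mult_left_mono) auto
				then show "cmod (?x w * ?y w * (iexp (s * Sc j w) - iexp (s * Sd j w))) <= (q * b) * (\<bar>\<xi> j w\<bar> * \<bar>Y j w\<bar>)"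
					unfolding norm_mult norm_of_real by (simp only: mult_ac mult_1)
			qed
			also have "... <= (q * b) * (q * v)" using xY[OF j] qb by (simp add: mult_left_mono)
			finally have c: "cmod (?C - ?D) <= q\<^sup>2 * b * v" by (simp add: power2_eq_square mult_ac)
			have "cmod (\<i> * s * ?C - \<i> * s * ?D) = s * cmod (?C - ?D)"
				using s by (simp add: norm_mult flip: right_diff_distrib)
			also have "... <= 1 * cmod (?C - ?D)" using s by (intro mult_right_mono) auto
			finally show ?thesis using c by simp
		qed
		have D: "?D = ?e * (CLINT w|M. iexp (s * Sd j w))"
		proof -
			have "?D = (CLINT w|M. (\<Sum>i\<in>nb j. cplx (\<xi> j w * \<xi> i w) * iexp (s * Sd j w)))"
				by (intro Bochner_Integration.integral_cong refl)
					 (simp add: Y_def sum_distrib_left sum_distrib_right)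
			also have "... = (\<Sum>i\<in>nb j. (CLINT w|M. cplx (\<xi> j w * \<xi> i w) * iexp (s * Sd j w)))"
				by (intro Bochner_Integration.integral_sum ib[of _ "b * b"]) (use bb in \<open>auto simp: norm_mult abs_mult\<close>)
			also have "... = (\<Sum>i\<in>nb j. cplx (expectation (%w. \<xi> j w * \<xi> i w)) * (CLINT w|M. iexp (s * Sd j w)))"
				unfolding Sd_def by (intro sum.cong refl ind2[OF j])
			also have "... = ?e * (CLINT w|M. iexp (s * Sd j w))"
				unfolding Y_def sum_distrib_left using ixx by (simp add: sum_distrib_right)
			finally show ?thesis .
		qed
		have ee: "cmod ?e <= q * v"
		proof -
			have "cmod ?e <= expectation (%w. \<bar>\<xi> j w\<bar> * \<bar>Y j w\<bar>)"
				using abs_integral_le[OF ixY[OF j], of "%w. \<xi> j w * Y j w"] by (simp add: abs_mult)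
			then show ?thesis using xY[OF j] by simp
		qed
		have 4: "cmod (\<i> * s * ?D - \<i> * cplx (s * expectation (%w. \<xi> j w * Y j w)) * ch s) <= q\<^sup>2 * b * v"
		proof -
			have e: "(CLINT w|M. iexp (s * Sd j w)) - ch s = (CLINT w|M. iexp (s * Sd j w) - iexp (s * S w))"
				unfolding ch_def using integrable_iexp_rv[OF meas(1), of s] integrable_iexp_rv[OF meas(3), of s] by simp
			have "cmod ((CLINT w|M. iexp (s * Sd j w)) - ch s) <= (LINT w|M. q * b)"
				unfolding e
			proof (rule norm_integral_le)
				fix w
				have "cmod (iexp (s * Sd j w) - iexp (s * S w)) <= \<bar>s\<bar> * \<bar>S w - Sd j w\<bar>"
					using cmod_iexp_diff_le[of "s * Sd j w" "s * S w"] by (simp add: abs_mult abs_minus_commute[of "S w"] flip: right_diff_distrib)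
				also have "... <= 1 * (q * b)" using s SSd[OF j, of w] by (intro mult_mono) auto
				finally show "cmod (iexp (s * Sd j w) - iexp (s * S w)) <= q * b" by simp
			qed simp
			then have c: "cmod ((CLINT w|M. iexp (s * Sd j w)) - ch s) <= q * b" by (simp add: prob_space)
			have "\<i> * s * ?D - \<i> * cplx (s * expectation (%w. \<xi> j w * Y j w)) * ch s
				 = \<i> * s * (?e * ((CLINT w|M. iexp (s * Sd j w)) - ch s))"
				unfolding D by (simp add: algebra_simps)
			then have "cmod (\<i> * s * ?D - \<i> * cplx (s * expectation (%w. \<xi> j w * Y j w)) * ch s)
				 = s * (cmod ?e * cmod ((CLINT w|M. iexp (s * Sd j w)) - ch s))"
				using s by (simp add: norm_mult)
			also have "... <= 1 * (cmod ?e * cmod ((CLINT w|M. iexp (s * Sd j w)) - ch s))"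
				using s by (intro mult_right_mono) auto
			also have "... <= 1 * ((q * v) * (q * b))"
				using cnb(2)[OF j] v0[OF j] by (intro mult_left_mono mult_mono ee c) auto
			finally show ?thesis by (simp add: power2_eq_square mult_ac)
		qed
		have tri: "cmod (a - f) <= cmod (a - b - c) + cmod b + cmod (c - d) + cmod (d - f)" for a b c d f :: complex
			using norm_triangle_ineq[of "a - b - c" "b + (c - d) + (d - f)"]
				norm_triangle_ineq[of "b + (c - d)" "d - f"] norm_triangle_ineq[of b "c - d"] by simp
		show ?thesis
			using tri[of ?A "\<i> * cplx (s * expectation (%w. \<xi> j w * Y j w)) * ch s" ?B "\<i> * s * ?C" "\<i> * s * ?D"]
				1 2 3 4 by linarith
	qed
	have der: "cmod ((CLINT w|M. \<i> * cplx (S w) * iexp (s * S w) * 1) + cplx (s * V) * ch s) <= E"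
		if s: "0 <= s" "s <= 1" for s
	proof -
		let ?a = "%j. (CLINT w|M. cplx (\<xi> j w) * iexp (s * S w))"
		let ?e = "%j. expectation (%w. \<xi> j w * Y j w)"
		have "(CLINT w|M. \<i> * cplx (S w) * iexp (s * S w) * 1)
				= (CLINT w|M. (\<Sum>j\<in>I. \<i> * (cplx (\<xi> j w) * iexp (s * S w))))"
			by (intro Bochner_Integration.integral_cong refl)
				 (simp add: S_def[of "_"] sum_distrib_left sum_distrib_right mult_ac)
		also have "... = (\<Sum>j\<in>I. \<i> * ?a j)"
			by (subst Bochner_Integration.integral_sum) (auto intro!: ib[of _ b] simp: norm_mult b)
		finally have 1: "(CLINT w|M. \<i> * cplx (S w) * iexp (s * S w) * 1) = (\<Sum>j\<in>I. \<i> * ?a j)" .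
		have V: "V = (\<Sum>j\<in>I. ?e j)"
			unfolding V_def Y_def using ixx by (simp add: sum_distrib_left)
		have eq: "(\<Sum>j\<in>I. \<i> * ?a j) + cplx (s * V) * ch s
			 = (\<Sum>j\<in>I. \<i> * (?a j - \<i> * cplx (s * ?e j) * ch s))"
			unfolding V by (simp add: sum_distrib_left sum_distrib_right algebra_simps sum.distrib[symmetric])
		have "cmod (\<Sum>j\<in>I. \<i> * (?a j - \<i> * cplx (s * ?e j) * ch s)) <= (\<Sum>j\<in>I. \<bar>expectation (\<xi> j)\<bar> + 3 * q\<^sup>2 * b * v)"
			by (rule sum_norm_le) (use main s in \<open>auto simp: norm_mult\<close>)
		also have "... = E" unfolding E_def sum.distrib by simp
		finally show ?thesis unfolding 1 eq .
	qed
	\<comment> \<open>Integrating factor: the derivative of \<open>\<Phi>\<close> is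
	  \<open>exp (s^2 * V / 2)\<close> times the defect of the differential equation.\<close>
	define \<Phi> where "\<Phi> s = cplx (exp (s\<^sup>2 * V / 2)) * ch s" for s
	have d\<Phi>: "(\<Phi> has_vector_derivative cplx (exp (s\<^sup>2 * V / 2)) *
		 ((CLINT w|M. \<i> * cplx (S w) * iexp (s * S w) * 1) + cplx (s * V) * ch s)) (at s)" for s
	proof -
		have "((%s. exp (s\<^sup>2 * V / 2)) has_real_derivative exp (s\<^sup>2 * V / 2) * (s * V)) (at s)"
			by (auto intro!: derivative_eq_intros)
		from has_vector_derivative_mult[OF has_vector_derivative_of_real[OF this] dch[of s]]
		show ?thesis unfolding \<Phi>_def by (simp add: algebra_simps)
	qed
	have "norm (\<Phi> 1 - \<Phi> 0) <= exp (\<bar>V\<bar> / 2) * E * norm (1 - 0 :: real)"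
	proof (rule differentiable_bound[of "{0..1}" \<Phi>])
		fix s :: real assume s: "s \<in> {0..1}"
		show "(\<Phi> has_derivative (%h. h *\<^sub>R (cplx (exp (s\<^sup>2 * V / 2)) *
		 ((CLINT w|M. \<i> * cplx (S w) * iexp (s * S w) * 1) + cplx (s * V) * ch s)))) (at s within {0..1})"
			using d\<Phi>[of s] unfolding has_vector_derivative_def by (rule has_derivative_at_withinI)
		have "s\<^sup>2 * V / 2 <= \<bar>V\<bar> / 2"
		proof -
			have "s\<^sup>2 * V <= s\<^sup>2 * \<bar>V\<bar>" by (intro mult_left_mono) auto
			moreover have "s\<^sup>2 * \<bar>V\<bar> <= 1 * \<bar>V\<bar>" using s by (intro mult_right_mono) (auto simp: power_le_one)
			ultimately show ?thesis by linarith
		qed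
		then have "exp (s\<^sup>2 * V / 2) * cmod ((CLINT w|M. \<i> * cplx (S w) * iexp (s * S w) * 1) + cplx (s * V) * ch s)
			 <= exp (\<bar>V\<bar> / 2) * E"
			using der[of s] s by (intro mult_mono) auto
		then show "onorm (%h. h *\<^sub>R (cplx (exp (s\<^sup>2 * V / 2)) *
		 ((CLINT w|M. \<i> * cplx (S w) * iexp (s * S w) * 1) + cplx (s * V) * ch s))) <= exp (\<bar>V\<bar> / 2) * E"
			by (subst onorm_scaleR_left) (auto simp: bounded_linear_ident onorm_id norm_mult)
	qed auto
	moreover have "\<Phi> 0 = 1" unfolding \<Phi>_def ch_def by (simp add: prob_space)
	ultimately have P1: "cmod (cplx (exp (V / 2)) * ch 1 - 1) <= exp (\<bar>V\<bar> / 2) * E"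
		unfolding \<Phi>_def by simp
	have "ch 1 - cplx (exp (- V / 2)) = cplx (exp (- V / 2)) * (cplx (exp (V / 2)) * ch 1 - 1)"
		by (simp add: right_diff_distrib flip: mult.assoc of_real_mult exp_add)
	then have "cmod (ch 1 - cplx (exp (- V / 2))) = exp (- V / 2) * cmod (cplx (exp (V / 2)) * ch 1 - 1)"
		by (simp add: norm_mult)
	also have "... <= exp (\<bar>V\<bar> / 2) * (exp (\<bar>V\<bar> / 2) * E)"
		using P1 by (intro mult_mono) auto
	also have "... = exp \<bar>V\<bar> * E" by (simp flip: mult.assoc exp_add)
	finally show ?thesis unfolding E_def ch_def S_def by simp
qed

section \<open>The continuity theorem in several dimensions\<close>

inductive trig_poly :: "('a::euclidean_space => complex) => bool" where
	trig_exp: "trig_poly (%y. c * iexp (a \<bullet> y))"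
| trig_add: "trig_poly f ==> trig_poly g ==> trig_poly (%y. f y + g y)"

lemma trig_const: "trig_poly (%y. c)"
	using trig_exp[of c 0] by simp

lemma trig_sum: "finite A ==> (!!i. i \<in> A ==> trig_poly (f i)) ==> trig_poly (%y. \<Sum>i\<in>A. f i y)"
	by (induction A rule: finite_induct) (auto intro: trig_const trig_add)

lemma trig_mult: assumes "trig_poly f" "trig_poly g" shows "trig_poly (%y. f y * g y)"
proof -
	have e: "trig_poly (%y. c * iexp (a \<bullet> y) * g y)" for c a
		using assms(2)
	proof induction
		case (trig_exp d b)
		have "(%y. c * iexp (a \<bullet> y) * (d * iexp (b \<bullet> y))) = (%y. (c * d) * iexp ((a + b) \<bullet> y))"
			by (auto simp: fun_eq_iff inner_add_left distrib_left exp_add)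
		then show ?case by (simp add: trig_poly.trig_exp)
	next
		case (trig_add f g)
		then show ?case by (simp add: distrib_left trig_poly.trig_add)
	qed
	show ?thesis using assms(1) by induction (auto simp: distrib_right e trig_add)
qed

lemma trig_poly_sin: "trig_poly (%y::real^'n. cplx (sin (y $ l / R)))"
proof -
	have e: "(axis l (c / R)) \<bullet> y = c * (y $ l / R)" for c and y :: "real^'n" by (simp add: inner_axis' mult.commute)
	have "(%y::real^'n. cplx (sin (y $ l / R))) =
		 (%y. (1 / (2 * \<i>)) * iexp (axis l (1 / R) \<bullet> y) + (- 1 / (2 * \<i>)) * iexp (axis l ((-1) / R) \<bullet> y))"
		unfolding e by (auto simp: fun_eq_iff sin_of_real[symmetric] sin_exp_eq field_simps)
	then show ?thesis by (simp only: trig_poly.intros)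
qed

text \<open>For finite sums of exponentials, convergence of expectations is immediate from that of
  the characteristic functions. Composition with the sine turns a polynomial that approximates on a
  cube into such a sum, which is moreover bounded on the whole space.\<close>

lemma trig_poly_real_polynomial:
	fixes p :: "real^'n => real"
	assumes "real_polynomial_function p"
	shows "trig_poly (%y::real^'n. cplx (p (\<chi> l. sin (y $ l / R))))"
	using assms
proof induction
	case (linear f)
	interpret bounded_linear f by fact
	have fv: "f v = (\<Sum>l\<in>UNIV. v $ l * f (axis l 1))" for v :: "real^'n"
	proof -
		have "v = (\<Sum>l\<in>UNIV. v $ l *\<^sub>R axis l 1)"
			using basis_expansion[of v] by (simp add: scalar_mult_eq_scaleR)
		then have "f v = f (\<Sum>l\<in>UNIV. v $ l *\<^sub>R axis l 1)" by simp
		then show ?thesis by (simp add: sum scaleR)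
	qed
	have "(%y::real^'n. cplx (f (\<chi> l. sin (y $ l / R)))) =
		 (%y. \<Sum>l\<in>UNIV. cplx (sin (y $ l / R)) * cplx (f (axis l 1)))"
		by (rule ext, subst fv) simp
	moreover have "trig_poly (%y::real^'n. \<Sum>l\<in>UNIV. cplx (sin (y $ l / R)) * cplx (f (axis l 1)))"
		by (intro trig_sum trig_mult trig_const trig_poly_sin finite)
	ultimately show ?case by (simp only:)
next
	case (const c)
	then show ?case by (rule trig_const)
next
	case (add f g)
	then show ?case by (simp add: trig_add)
next
	case (mult f g)
	then show ?case by (simp add: trig_mult)
qed

text \<open>Tightness, one coordinate at a time: the characteristic functions converge along each
  axis, so the one-dimensional continuity theorem applies to the coordinates.\<close>

lemma coordinate_tail:
	fixes Y :: "nat => 's => real^'n" and Q :: "(real^'n) measure"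
	assumes M: "prob_space M" and Y[measurable]: "!!n. Y n \<in> borel_measurable M"
		and Q: "prob_space Q" "sets Q = sets borel"
		and ch: "!!s. (%n. (CLINT w|M. iexp (s \<bullet> Y n w))) \<longlonglongrightarrow> (CLINT y|Q. iexp (s \<bullet> y))"
		and e: "e > 0"
	shows "\<exists>R0. \<forall>R\<ge>R0. eventually (%n. measure M {w\<in>space M. \<bar>Y n w $ l\<bar> > R} < e) sequentially
		 \<and> measure Q {y\<in>space Q. \<bar>y $ l\<bar> > R} < e"
proof -
	interpret M: prob_space M by fact
	interpret Q: prob_space Q by fact
	have [measurable]: "(%y::real^'n. y $ l) \<in> borel_measurable Q"
		unfolding measurable_cong_sets[OF Q(2) refl] by (rule borel_measurable_continuous_onI) (intro continuous_intros)
	have [measurable]: "(%w. Y n w $ l) \<in> borel_measurable M" for n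
		by (rule measurable_compose[OF Y]) (rule borel_measurable_continuous_onI, intro continuous_intros)
	let ?\<mu> = "%n. distr M borel (%w. Y n w $ l)" and ?\<nu> = "distr Q borel (%y. y $ l)"
	have rd: "real_distribution (?\<mu> n)" "real_distribution ?\<nu>" for n
		by (auto simp: real_distribution_def real_distribution_axioms_def intro!: M.prob_space_distr Q.prob_space_distr)
	interpret N: real_distribution ?\<nu> by (rule rd)
	have "weak_conv_m ?\<mu> ?\<nu>"
	proof (rule levy_continuity[OF rd])
		fix t
		have a: "axis l t \<bullet> y = t * y $ l" for y :: "real^'n" by (simp add: inner_axis')
		show "(%n. char (?\<mu> n) t) \<longlonglongrightarrow> char ?\<nu> t"
			using ch[of "axis l t"] unfolding char_def by (simp add: integral_distr a)
	qed
	note wc = weak_conv_imp_integral_bdd_continuous_conv[OF rd this]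
	have "(%i. measure ?\<nu> {x. \<bar>x\<bar> > real i}) \<longlonglongrightarrow> measure ?\<nu> (\<Inter>i. {x. \<bar>x\<bar> > real i})"
		by (rule N.finite_Lim_measure_decseq) (auto simp: decseq_def)
	moreover have "(\<Inter>i. {x::real. \<bar>x\<bar> > real i}) = {}"
	proof safe
		fix x :: real assume "x \<in> (\<Inter>i. {x. \<bar>x\<bar> > real i})"
		then have "\<bar>x\<bar> > real i" for i by auto
		then show "x \<in> {}" using reals_Archimedean2[of "\<bar>x\<bar>"] by (meson less_asym)
	qed
	ultimately have "(%i. measure ?\<nu> {x. \<bar>x\<bar> > real i}) \<longlonglongrightarrow> 0" by simp
	from order_tendstoD(2)[OF this e] obtain i where i: "measure ?\<nu> {x. \<bar>x\<bar> > real i} < e"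
		by (auto simp: eventually_sequentially)
	\<comment> \<open>A continuous function that vanishes for \<open>|x| <= i\<close> and is 1 for
	  \<open>|x| >= i + 1\<close>. Its limiting expectation is below \<open>e\<close>, and it dominates
	  all tails beyond \<open>i + 1\<close>.\<close>
	define \<psi> where "\<psi> x = min 1 (max 0 (\<bar>x\<bar> - real i))" for x :: real
	have c: "isCont \<psi> x" for x unfolding \<psi>_def by (intro continuous_intros)
	have b: "norm (\<psi> x) <= 1" for x by (simp add: \<psi>_def)
	have [measurable]: "\<psi> \<in> borel_measurable borel"
		by (intro borel_measurable_continuous_onI continuous_at_imp_continuous_on ballI c)
	have lim: "(%n. integral\<^sup>L (?\<mu> n) \<psi>) \<longlonglongrightarrow> integral\<^sup>L ?\<nu> \<psi>" by (rule wc[OF c b])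
	have "integral\<^sup>L ?\<nu> \<psi> <= integral\<^sup>L ?\<nu> (indicator {x. \<bar>x\<bar> > real i})"
		by (intro integral_mono N.integrable_const_bound[of _ 1]) (auto simp: \<psi>_def indicator_def)
	also have "... < e" using i by simp
	finally have ev: "eventually (%n. integral\<^sup>L (?\<mu> n) \<psi> < e) sequentially" using order_tendstoD(2)[OF lim] by auto
	show ?thesis
	proof (intro exI allI impI conjI)
		fix R assume R: "R >= real i + 1"
		show "eventually (%n. measure M {w\<in>space M. \<bar>Y n w $ l\<bar> > R} < e) sequentially"
			using ev
		proof eventually_elim
			case (elim n)
			have "measure M {w\<in>space M. \<bar>Y n w $ l\<bar> > R} = (LINT w|M. indicator {w\<in>space M. \<bar>Y n w $ l\<bar> > R} w)" by simp
			also have "... <= (LINT w|M. \<psi> (Y n w $ l))"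
				using R by (intro integral_mono M.integrable_const_bound[of _ 1]) (auto simp: \<psi>_def indicator_def)
			also have "... = integral\<^sup>L (?\<mu> n) \<psi>" by (simp add: integral_distr)
			finally show ?case using elim by simp
		qed
		have "measure Q {y\<in>space Q. \<bar>y $ l\<bar> > R} <= measure Q ((%y. y $ l) -` {x. \<bar>x\<bar> > real i} \<inter> space Q)"
			using R by (intro Q.finite_measure_mono) auto
		also have "... = measure ?\<nu> {x. \<bar>x\<bar> > real i}" by (simp add: measure_distr)
		finally show "measure Q {y\<in>space Q. \<bar>y $ l\<bar> > R} < e" using i by simp
	qed
qed

text \<open>On a large cube \<open>f\<close> is approximated by a trigonometric polynomial
  \<open>q\<close>. Off the cube \<open>q\<close> is still bounded by \<open>B + \<epsilon>\<close>,
  and the tails are small uniformly for large \<open>n\<close>. Expectations of \<open>q\<close>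
  converge by hypothesis.\<close>

lemma conv_distr_if_char:
	fixes Y :: "nat => 's => real^'n" and Q :: "(real^'n) measure"
	assumes M: "prob_space M" and Y[measurable]: "!!n. Y n \<in> borel_measurable M"
		and Q: "prob_space Q" "sets Q = sets borel"
		and ch: "!!s. (%n. (CLINT w|M. iexp (s \<bullet> Y n w))) \<longlonglongrightarrow> (CLINT y|Q. iexp (s \<bullet> y))"
	shows "conv_distr M Y Q"
	unfolding conv_distr_def
proof (intro conjI allI impI)
	show "Y n \<in> borel_measurable M" for n by (rule Y)
	interpret M: prob_space M by fact
	interpret Q: prob_space Q by fact
	note [measurable_cong] = Q(2)
	fix f :: "real^'n => real" assume f: "continuous_on UNIV f" "bounded (range f)"
	have [measurable]: "f \<in> borel_measurable borel" using f(1) by (rule borel_measurable_continuous_onI)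
	obtain B where B: "B > 0" "!!y. \<bar>f y\<bar> <= B" using f(2) unfolding bounded_pos by auto
	have trig: "continuous_on UNIV g \<and> integrable Q g \<and> (\<forall>n. integrable M (%w. g (Y n w))) \<and> (%n. CLINT w|M. g (Y n w)) \<longlonglongrightarrow> integral\<^sup>L Q g"
		if "trig_poly g" for g :: "real^'n => complex"
		using that
	proof induction
		case (trig_exp c a)
		have [measurable]: "(%y. iexp (a \<bullet> y)) \<in> borel_measurable borel"
			by (intro borel_measurable_continuous_onI continuous_intros)
		have iM: "integrable M (%w. iexp (a \<bullet> Y n w))" for n by (rule M.integrable_const_bound[of _ 1]) auto
		have "integrable Q (%y. iexp (a \<bullet> y))" by (rule Q.integrable_const_bound[of _ 1]) auto
		then show ?case using iM ch[of a] by (auto intro!: continuous_intros tendsto_mult_left)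
	next
		case (trig_add f g)
		then show ?case by (auto intro!: continuous_intros tendsto_add)
	qed
	show "(%n. integral\<^sup>L (distr M borel (Y n)) f) \<longlonglongrightarrow> integral\<^sup>L Q f"
	proof (rule LIMSEQ_I)
		fix r :: real assume r: "r > 0"
		define \<epsilon> where "\<epsilon> = min 1 (r / 8)"
		have eps: "\<epsilon> > 0" "\<epsilon> <= 1" "\<epsilon> <= r / 8" using r by (auto simp: \<epsilon>_def)
		define N where "N = real CARD('n)"
		have N: "N > 0" unfolding N_def by simp
		\<comment> \<open>Off the cube \<open>f\<close> and \<open>q\<close> differ by at most
		  \<open>2 * B + 1\<close>, so tails below \<open>\<eta>\<close> in each of the \<open>N\<close>
		  coordinates contribute at most \<open>r / 8\<close> in total.\<close>
		define \<eta> where "\<eta> = r / (8 * N * (2 * B + 1))"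
		have eta: "\<eta> > 0" using r N B by (simp add: \<eta>_def)
		have "\<forall>l. \<exists>R0. \<forall>R\<ge>R0. eventually (%n. measure M {w\<in>space M. \<bar>Y n w $ l\<bar> > R} < \<eta>) sequentially
		 \<and> measure Q {y\<in>space Q. \<bar>y $ l\<bar> > R} < \<eta>"
			using coordinate_tail[OF M Y Q ch eta] by (intro allI)
		from choice[OF this] obtain R0 where RR: "\<forall>l. \<forall>R\<ge>R0 l. eventually (%n. measure M {w\<in>space M. \<bar>Y n w $ l\<bar> > R} < \<eta>) sequentially
		 \<and> measure Q {y\<in>space Q. \<bar>y $ l\<bar> > R} < \<eta>" by (elim exE)
		have R0: "R >= R0 l ==> eventually (%n. measure M {w\<in>space M. \<bar>Y n w $ l\<bar> > R} < \<eta>) sequentially"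
			"R >= R0 l ==> measure Q {y\<in>space Q. \<bar>y $ l\<bar> > R} < \<eta>" for l R
			using RR by simp_all
		define R where "R = Max (insert 1 (range R0))"
		have R: "R >= 1" "R >= R0 l" for l unfolding R_def by (rule Max_ge; simp)+
		let ?K = "cbox (\<chi> l. -1) (\<chi> l. 1) :: (real^'n) set"
		\<comment> \<open>The substitution \<open>y $ l = R * arcsin (v $ l)\<close> moves the problem to
		  the cube of side [-1, 1], where the Weierstrass theorem applies. It is inverted by
		  \<open>sin (y $ l / R)\<close> as long as \<open>|y $ l| <= R\<close>, because then
		  \<open>|y $ l / R| <= 1 < pi / 2\<close>.\<close>
		let ?F = "%v::real^'n. f (\<chi> l. R * arcsin (v $ l))"
		have "continuous_on ?K ?F"
			by (rule continuous_on_compose2[OF f(1)])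
				 (auto intro!: continuous_intros simp: mem_box_cart)
		then obtain p where p: "real_polynomial_function p" "!!v. v \<in> ?K ==> \<bar>?F v - p v\<bar> < \<epsilon>"
			using Stone_Weierstrass_real_polynomial_function[of ?K ?F \<epsilon>] eps by auto
		define q where "q y = p (\<chi> l. sin (y $ l / R))" for y :: "real^'n"
		note tq = trig[OF trig_poly_real_polynomial[OF p(1), of R], folded q_def]
		have qc: "continuous_on UNIV q"
		proof -
			have "continuous_on UNIV (%y. Re (cplx (q y)))" using tq by (intro continuous_intros) auto
			then show ?thesis by simp
		qed
		have [measurable]: "q \<in> borel_measurable borel" using qc by (rule borel_measurable_continuous_onI)
		have qb: "\<bar>q y\<bar> <= B + \<epsilon>" for y
		proof -
			have "(\<chi> l. sin (y $ l / R)) \<in> ?K" by (auto simp: mem_box_cart)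
			from p(2)[OF this] B(2)[of "\<chi> l. R * arcsin ((\<chi> l. sin (y $ l / R)) $ l)"] show ?thesis
				unfolding q_def by linarith
		qed
		have close: "\<bar>f y - q y\<bar> <= \<epsilon>" if "!!l. \<bar>y $ l\<bar> <= R" for y
		proof -
			have "R * arcsin (sin (y $ l / R)) = y $ l" for l
			proof -
				have "\<bar>y $ l / R\<bar> <= 1" using that[of l] R(1) by simp
				then have "-1 <= y $ l / R" "y $ l / R <= 1" by (simp_all only: abs_le_iff) linarith+
				then have "arcsin (sin (y $ l / R)) = y $ l / R" using pi_gt3 by (intro arcsin_sin) linarith+
				then show ?thesis using R(1) by simp
			qed
			then have "?F (\<chi> l. sin (y $ l / R)) = f y" by (simp add: vec_eq_iff)
			moreover have "(\<chi> l. sin (y $ l / R)) \<in> ?K" by (auto simp: mem_box_cart)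
			ultimately show ?thesis using p(2)[of "\<chi> l. sin (y $ l / R)"] unfolding q_def by simp
		qed
		have pt: "\<bar>f y - q y\<bar> <= \<epsilon> + (\<Sum>l\<in>UNIV. (2 * B + 1) * indicator {y. \<bar>y $ l\<bar> > R} y)" for y
		proof (cases "\<forall>l. \<bar>y $ l\<bar> <= R")
			case True
			have "0 <= (\<Sum>l\<in>UNIV. (2 * B + 1) * indicator {y. \<bar>y $ l\<bar> > R} y)" using B(1) by (intro sum_nonneg) simp
			moreover have "\<bar>f y - q y\<bar> <= \<epsilon>" using True by (intro close) blast
			ultimately show ?thesis by linarith
		next
			case False
			then obtain l0 where l0: "\<bar>y $ l0\<bar> > R" by (auto simp: not_le)
			have "\<bar>f y - q y\<bar> <= 2 * B + 1" using B(2)[of y] qb[of y] eps by linarith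
			also have "... = (2 * B + 1) * indicator {y. \<bar>y $ l0\<bar> > R} y" using l0 by simp
			also have "... <= (\<Sum>l\<in>UNIV. (2 * B + 1) * indicator {y. \<bar>y $ l\<bar> > R} y)"
				using B by (intro member_le_sum) auto
			finally show ?thesis using eps by linarith
		qed
		have comp: "\<bar>(LINT w|P. f (Z w)) - (LINT w|P. q (Z w))\<bar> <= \<epsilon> + r / 8"
			if P: "prob_space P" and Z[measurable]: "Z \<in> borel_measurable P"
				and tail: "!!l. measure P {w\<in>space P. \<bar>Z w $ l\<bar> > R} < \<eta>" for P :: "'z measure" and Z
		proof -
			interpret P: prob_space P by fact
			have [measurable]: "(%w. Z w $ l) \<in> borel_measurable P" for l
				by (rule measurable_compose[OF Z]) (rule borel_measurable_continuous_onI, intro continuous_intros)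
			have if': "integrable P (%w. f (Z w))" by (rule P.integrable_const_bound[of _ B]) (use B in auto)
			have iq: "integrable P (%w. q (Z w))" by (rule P.integrable_const_bound[of _ "B + \<epsilon>"]) (use qb in auto)
			have ii: "integrable P (%w. indicator {w\<in>space P. \<bar>Z w $ l\<bar> > R} w :: real)" for l
				by (rule P.integrable_const_bound[of _ 1]) (auto simp: indicator_def)
			have e: "(LINT w|P. f (Z w)) - (LINT w|P. q (Z w)) = (LINT w|P. f (Z w) - q (Z w))"
				using if' iq by simp
			have "\<bar>(LINT w|P. f (Z w)) - (LINT w|P. q (Z w))\<bar>
					<= (LINT w|P. \<epsilon> + (\<Sum>l\<in>UNIV. (2 * B + 1) * indicator {w\<in>space P. \<bar>Z w $ l\<bar> > R} w))"
				unfolding e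
			proof (rule abs_integral_le)
				show "integrable P (%w. \<epsilon> + (\<Sum>l\<in>UNIV. (2 * B + 1) * indicator {w\<in>space P. \<bar>Z w $ l\<bar> > R} w))"
					using ii by (intro Bochner_Integration.integrable_add Bochner_Integration.integrable_sum integrable_mult_right) auto
				fix w assume "w \<in> space P"
				then have "indicator {w\<in>space P. \<bar>Z w $ l\<bar> > R} w = (indicator {y. \<bar>y $ l\<bar> > R} (Z w) :: real)" for l
					by (auto simp: indicator_def)
				then show "\<bar>f (Z w) - q (Z w)\<bar> <= \<epsilon> + (\<Sum>l\<in>UNIV. (2 * B + 1) * indicator {w\<in>space P. \<bar>Z w $ l\<bar> > R} w)"
					using pt[of "Z w"] by simp
			qed
			also have "... = \<epsilon> + (\<Sum>l\<in>UNIV. (2 * B + 1) * measure P {w\<in>space P. \<bar>Z w $ l\<bar> > R})"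
			proof -
				have i2: "integrable P (%w. (2 * B + 1) * indicator {w\<in>space P. \<bar>Z w $ l\<bar> > R} w)" for l
					using ii by (rule integrable_mult_right)
				have i3: "(LINT w|P. (2 * B + 1) * indicator {w\<in>space P. \<bar>Z w $ l\<bar> > R} w)
						= (2 * B + 1) * measure P {w\<in>space P. \<bar>Z w $ l\<bar> > R}" for l by simp
				show ?thesis
					by (subst Bochner_Integration.integral_add[OF _ Bochner_Integration.integrable_sum[OF i2]], simp)
						 (simp only: Bochner_Integration.integral_sum[OF i2] i3 lebesgue_integral_const P.prob_space scaleR_one)
			qed
			also have "(\<Sum>l\<in>UNIV. (2 * B + 1) * measure P {w\<in>space P. \<bar>Z w $ l\<bar> > R}) <= (\<Sum>l\<in>(UNIV::'n set). (2 * B + 1) * \<eta>)"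
				using tail B by (intro sum_mono mult_left_mono) (auto intro: less_imp_le)
			also have "... = r / 8"
			proof -
				have "N * (c * (r / (8 * N * c))) = r / 8" if "c > 0" for c using N that by (simp add: field_simps)
				from this[of "2 * B + 1"] B(1) show ?thesis by (simp add: \<eta>_def N_def del: times_divide_eq_right)
			qed
			finally show ?thesis by simp
		qed
		have rq: "(LINT w|P. q (Z w)) = Re (CLINT w|P. cplx (q (Z w)))" for P :: "'z measure" and Z
			by (simp add: integral_complex_of_real)
		have "(%n. LINT w|M. q (Y n w)) \<longlonglongrightarrow> integral\<^sup>L Q q"
		proof -
			have "(%n. CLINT w|M. cplx (q (Y n w))) \<longlonglongrightarrow> (CLINT y|Q. cplx (q y))" using tq by simp
			then show ?thesis unfolding integral_complex_of_real by (simp only: tendsto_of_real_iff)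
		qed
		from LIMSEQ_D[OF this, of "r / 8"] r obtain n0 where
			n0: "!!n. n >= n0 ==> \<bar>(LINT w|M. q (Y n w)) - integral\<^sup>L Q q\<bar> < r / 8" by auto
		have "eventually (%n. \<forall>l\<in>UNIV. measure M {w\<in>space M. \<bar>Y n w $ l\<bar> > R} < \<eta>) sequentially"
			by (intro eventually_ball_finite ballI R0(1) R(2)) auto
		then obtain n1 where n1: "!!n l. n >= n1 ==> measure M {w\<in>space M. \<bar>Y n w $ l\<bar> > R} < \<eta>"
			unfolding eventually_sequentially by auto
		have cQ: "\<bar>integral\<^sup>L Q f - integral\<^sup>L Q q\<bar> <= \<epsilon> + r / 8"
			using comp[OF Q(1), of "%y. y"] R0(2)[OF R(2)] by (simp add: measurable_ident_sets[OF Q(2)])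
		show "\<exists>no. \<forall>n\<ge>no. norm (integral\<^sup>L (distr M borel (Y n)) f - integral\<^sup>L Q f) < r"
		proof (intro exI allI impI)
			fix n assume n: "n >= max n0 n1"
			have "\<bar>(LINT w|M. f (Y n w)) - (LINT w|M. q (Y n w))\<bar> <= \<epsilon> + r / 8"
				using n by (intro comp M Y n1) auto
			then have "\<bar>(LINT w|M. f (Y n w)) - integral\<^sup>L Q f\<bar> < r"
				using cQ n0[of n] n eps r by (simp add: abs_if split: if_splits)
			then show "norm (integral\<^sup>L (distr M borel (Y n)) f - integral\<^sup>L Q f) < r"
				by (simp add: integral_distr)
		qed
	qed
qed

section \<open>Characteristic function of the diagonal Gaussian law\<close>

lemma integral_lborel_vec_prod:
	fixes g :: "'n::finite => real => complex"
	assumes g: "!!l. integrable lborel (g l)"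
	shows "(CLINT z|(lborel :: (real^'n) measure). (\<Prod>l\<in>UNIV. g l (z $ l))) = (\<Prod>l\<in>UNIV. integral\<^sup>L lborel (g l))"
proof -
	interpret product_sigma_finite "%_::real^'n. lborel :: real measure" ..
	have [measurable]: "g l \<in> borel_measurable borel" for l using g by auto
	have B: "Basis = range (%l::'n. axis l (1::real))" by (auto simp: Basis_vec_def)
	have inj: "inj (%l::'n. axis l (1::real))" by (auto intro!: injI simp: axis_eq_axis)
	\<comment> \<open>The product measure behind \<open>lborel\<close> is indexed by basis vectors;
	  \<open>ix\<close> translates these back into coordinates.\<close>
	define ix where "ix b = (inv (%l::'n. axis l (1::real)) b)" for b
	have ix: "ix (axis l 1) = l" for l unfolding ix_def by (rule inv_f_f[OF inj])
	have co: "(\<Sum>b\<in>Basis. f b *\<^sub>R b) $ l = f (axis l 1)" for f :: "real^'n => real" and l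
	proof -
		have "(\<Sum>b\<in>Basis. f b *\<^sub>R b) $ l = (\<Sum>b\<in>Basis. f b *\<^sub>R b) \<bullet> axis l 1" by (simp add: inner_axis)
		also have "... = f (axis l 1)" by (rule inner_sum_left_Basis) (auto simp: B)
		finally show ?thesis .
	qed
	have "(CLINT z|(lborel :: (real^'n) measure). (\<Prod>l\<in>UNIV. g l (z $ l))) =
		 (CLINT f|(\<Pi>\<^sub>M b\<in>Basis. lborel). (\<Prod>l\<in>UNIV. g l ((\<Sum>b\<in>Basis. f b *\<^sub>R b) $ l)))"
		by (subst lborel_eq, rule integral_distr)
			 (auto intro!: borel_measurable_prod measurable_compose[OF _ borel_measurable_continuous_onI[of "%z. z $ _"]] continuous_intros)
	also have "... = (CLINT f|(\<Pi>\<^sub>M b\<in>(Basis::(real^'n) set). lborel). (\<Prod>b\<in>Basis. g (ix b) (f b)))"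
	proof (intro Bochner_Integration.integral_cong refl)
		fix f :: "real^'n => real"
		have "(\<Prod>b\<in>Basis. g (ix b) (f b)) = (\<Prod>l\<in>UNIV. g l (f (axis l 1)))"
			unfolding B by (subst prod.reindex[OF inj]) (simp add: ix)
		then show "(\<Prod>l\<in>UNIV. g l ((\<Sum>b\<in>Basis. f b *\<^sub>R b) $ l)) = (\<Prod>b\<in>Basis. g (ix b) (f b))"
			by (simp only: co)
	qed
	also have "... = (\<Prod>b\<in>(Basis::(real^'n) set). integral\<^sup>L lborel (g (ix b)))"
		by (rule product_integral_prod) (use g in auto)
	also have "... = (\<Prod>l\<in>UNIV. integral\<^sup>L lborel (g l))"
		unfolding B by (subst prod.reindex[OF inj]) (simp add: ix)
	finally show ?thesis .
qed

lemma gauss_diag_facts: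
	fixes d :: "'n::finite => real"
	assumes d: "!!l. d l >= 0"
	shows "prob_space (gauss_diag d)" "sets (gauss_diag d) = sets borel"
		"(CLINT y|gauss_diag d. iexp (s \<bullet> y)) = cplx (exp (- (\<Sum>l\<in>UNIV. (s $ l)\<^sup>2 * d l) / 2))"
proof -
	let ?\<rho> = "%z::real^'n. \<Prod>l\<in>UNIV. std_normal_density (z $ l)"
	let ?G = "density lborel (%z. ennreal (?\<rho> z))"
	have m1[measurable]: "(%z::real^'n. z $ l) \<in> borel_measurable borel" for l
		by (intro borel_measurable_continuous_onI continuous_intros)
	have rm[measurable]: "?\<rho> \<in> borel_measurable borel"
		by (intro borel_measurable_prod) measurable
	have r0: "0 <= ?\<rho> z" for z by (intro prod_nonneg) auto
	have T[measurable]: "(%z::real^'n. \<chi> l. sqrt (d l) * z $ l) \<in> borel_measurable borel"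
		by (intro borel_measurable_continuous_onI continuous_intros)
	have ind: "integral\<^sup>L lborel (%x. cplx (std_normal_density x) * iexp (t * x)) = cplx (exp (- t\<^sup>2 / 2))"
		and ii: "integrable lborel (%x. cplx (std_normal_density x) * iexp (t * x))" for t
	proof -
		have "cplx (exp (- t\<^sup>2 / 2)) = char std_normal_distribution t" by (simp add: char_std_normal_distribution)
		also have "... = (CLINT x|lborel. cplx (std_normal_density x) * iexp (t * x))"
			unfolding char_def by (subst integral_density) (auto simp: normal_density_nonneg scaleR_conv_of_real)
		finally show "integral\<^sup>L lborel (%x. cplx (std_normal_density x) * iexp (t * x)) = cplx (exp (- t\<^sup>2 / 2))" by simp
		show "integrable lborel (%x. cplx (std_normal_density x) * iexp (t * x))"
			by (rule Bochner_Integration.integrable_bound[OF integrable_normal_density[of 1 0]]) (auto simp: norm_mult)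
	qed
	have "(\<integral>\<^sup>+z. ennreal (?\<rho> z) \<partial>lborel) = (\<integral>\<^sup>+z. (\<Prod>b\<in>(Basis::(real^'n) set). ennreal (std_normal_density (z \<bullet> b))) \<partial>lborel)"
	proof (intro nn_integral_cong)
		fix z :: "real^'n"
		have inj: "inj (%l::'n. axis l (1::real))" by (auto intro!: injI simp: axis_eq_axis)
		have B: "Basis = range (%l::'n. axis l (1::real))" by (auto simp: Basis_vec_def)
		have "ennreal (?\<rho> z) = (\<Prod>l\<in>UNIV. ennreal (std_normal_density (z $ l)))" by (simp add: prod_ennreal)
		also have "... = (\<Prod>b\<in>(Basis::(real^'n) set). ennreal (std_normal_density (z \<bullet> b)))"
			unfolding B by (subst prod.reindex[OF inj]) (simp add: inner_axis)
		finally show "ennreal (?\<rho> z) = (\<Prod>b\<in>(Basis::(real^'n) set). ennreal (std_normal_density (z \<bullet> b)))" .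
	qed
	also have "... = (\<Prod>b\<in>(Basis::(real^'n) set). (\<integral>\<^sup>+x. ennreal (std_normal_density x) \<partial>lborel))"
		by (rule nn_integral_lborel_prod) auto
	also have "(\<integral>\<^sup>+x. ennreal (std_normal_density x) \<partial>lborel) = 1"
		by (subst nn_integral_eq_integral) (auto intro: integrable_normal_density simp: integral_normal_density)
	finally have "(\<integral>\<^sup>+z. ennreal (?\<rho> z) \<partial>lborel) = 1" by simp
	then have "prob_space ?G" by (intro prob_spaceI) (simp add: emeasure_density cong: nn_integral_cong)
	then show "prob_space (gauss_diag d)" unfolding gauss_diag_def by (rule prob_space.prob_space_distr) simp
	show "sets (gauss_diag d) = sets borel" by (simp add: gauss_diag_def)
	have m2[measurable]: "(%y::real^'n. iexp (s \<bullet> y)) \<in> borel_measurable borel"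
		by (intro borel_measurable_continuous_onI continuous_intros)
	have "(CLINT y|gauss_diag d. iexp (s \<bullet> y)) = (CLINT z|?G. iexp (s \<bullet> (\<chi> l. sqrt (d l) * z $ l)))"
		unfolding gauss_diag_def by (rule integral_distr) auto
	also have "... = (CLINT z|lborel. ?\<rho> z *\<^sub>R iexp (s \<bullet> (\<chi> l. sqrt (d l) * z $ l)))"
		using r0 by (intro integral_density) auto
	also have "... = (CLINT z|lborel. (\<Prod>l\<in>UNIV. cplx (std_normal_density (z $ l)) * iexp (s $ l * sqrt (d l) * z $ l)))"
	proof (intro Bochner_Integration.integral_cong refl)
		fix z :: "real^'n"
		have "iexp (s \<bullet> (\<chi> l. sqrt (d l) * z $ l)) = (\<Prod>l\<in>UNIV. iexp (s $ l * sqrt (d l) * z $ l))"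
			by (simp add: inner_vec_def exp_sum[symmetric] sum_distrib_left mult_ac)
		then show "?\<rho> z *\<^sub>R iexp (s \<bullet> (\<chi> l. sqrt (d l) * z $ l)) =
				(\<Prod>l\<in>UNIV. cplx (std_normal_density (z $ l)) * iexp (s $ l * sqrt (d l) * z $ l))"
			by (simp only: scaleR_conv_of_real of_real_prod prod.distrib)
	qed
	also have "... = (\<Prod>l\<in>UNIV. cplx (exp (- (s $ l * sqrt (d l))\<^sup>2 / 2)))"
		by (subst integral_lborel_vec_prod) (auto simp only: ii ind)
	also have "... = cplx (exp (\<Sum>l\<in>UNIV. - ((s $ l)\<^sup>2 * d l) / 2))"
		using d by (simp add: exp_sum power_mult_distrib)
	also have "(\<Sum>l\<in>UNIV. - ((s $ l)\<^sup>2 * d l) / 2) = - (\<Sum>l\<in>UNIV. (s $ l)\<^sup>2 * d l) / 2"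
		by (simp add: sum_negf sum_divide_distrib)
	finally show "(CLINT y|gauss_diag d. iexp (s \<bullet> y)) = cplx (exp (- (\<Sum>l\<in>UNIV. (s $ l)\<^sup>2 * d l) / 2))" .
qed

text \<open>Fubini on the joint law, written back on the original space with a second copy
  \<open>w'\<close> of the sample point. It serves to integrate over the next jump while the past is
  held fixed.\<close>

lemma (in prob_space) indep_var_iterated_integral:
	fixes f :: "'b \<times> 'b => complex"
	assumes ind: "indep_var S X T Y" and f[measurable]: "f \<in> borel_measurable (S \<Otimes>\<^sub>M T)"
		and bd: "!!z. cmod (f z) <= B"
	shows "(CLINT w|M. f (X w, Y w)) = (CLINT w|M. (CLINT w'|M. f (X w, Y w')))"
proof -
	have [measurable]: "X \<in> measurable M S" "Y \<in> measurable M T"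
		using ind by (auto simp: indep_var_distribution_eq)
	interpret X: prob_space "distr M S X" by (rule prob_space_distr) simp
	interpret Y: prob_space "distr M T Y" by (rule prob_space_distr) simp
	interpret P: pair_prob_space "distr M S X" "distr M T Y" ..
	have int: "integrable (distr M S X \<Otimes>\<^sub>M distr M T Y) f"
		by (rule P.integrable_const_bound[of _ B]) (use bd in auto)
	have "(CLINT w|M. f (X w, Y w)) = integral\<^sup>L (distr M (S \<Otimes>\<^sub>M T) (%w. (X w, Y w))) f"
		by (subst integral_distr) auto
	also have "... = integral\<^sup>L (distr M S X \<Otimes>\<^sub>M distr M T Y) f"
		using ind by (simp add: indep_var_distribution_eq)
	also have "... = (CLINT x|distr M S X. (CLINT y|distr M T Y. f (x, y)))"
		using P.integral_fst'[OF int] by simp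
	also have "... = (CLINT w|M. (CLINT y|distr M T Y. f (X w, y)))"
		by (subst integral_distr) auto
	also have "... = (CLINT w|M. (CLINT w'|M. f (X w, Y w')))"
		by (intro Bochner_Integration.integral_cong refl) (subst integral_distr, auto)
	finally show ?thesis .
qed

section \<open>The jump process and the exponent of the stationary law\<close>

locale ou_process = prob_space M for M :: "'s measure" +
	fixes \<alpha> :: real and X0 :: "'s => real" and E U :: "nat => 's => real" and F :: "real measure" and k :: "real => real"
	assumes alpha_pos: "\<alpha> > 0"
		and indep: "indep_vars (%_. borel)
									(%i. case i of Inl _ => X0 | Inr (Inl j) => E j | Inr (Inr j) => U j)
									(UNIV :: (unit + (nat + nat)) set)"
		and E_exp: "!!i. distributed M lborel (E i) (%y. ennreal (exponential_density \<alpha> y))"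
		and U_iid: "!!i. distr M borel (U i) = F"
		and U_pos: "!!i. AE w in M. U i w > 0"
		and k_def: "k = kfun \<alpha> F"
		and k_int: "set_integrable lborel {0..} k"
		and X0_char: "!!t. char (distr M borel X0) t = phi_stat k t"
begin

abbreviation vars :: "unit + (nat + nat) => 's => real" where "vars \<equiv> (%i. case i of Inl _ => X0 | Inr (Inl j) => E j | Inr (Inr j) => U j)"

lemma rv [measurable]: "X0 \<in> borel_measurable M" "E i \<in> borel_measurable M" "U i \<in> borel_measurable M"
proof -
	have "\<forall>i\<in>UNIV. random_variable borel (vars i)" using indep unfolding indep_vars_def by (rule conjunct1)
	then have *: "random_variable borel (vars i)" for i by blast
	show "X0 \<in> borel_measurable M" using *[of "Inl ()"] by simp
	show "E i \<in> borel_measurable M" using *[of "Inr (Inl i)"] by simp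
	show "U i \<in> borel_measurable M" using *[of "Inr (Inr i)"] by simp
qed

lemma F_dist: "real_distribution F"
	using real_distribution_distr[OF rv(3)[of 0]] U_iid[of 0] by simp

sublocale F: real_distribution F by (rule F_dist)

lemma F_pos: "AE u in F. u > 0"
	using U_pos[of 0] unfolding U_iid[of 0, symmetric] by (subst AE_distr_iff) auto

definition tl :: "real => real" where "tl x = measure F {x<..}"

lemma tl_measurable [measurable]: "tl \<in> borel_measurable borel"
proof -
	have "mono (%x. - tl x)" unfolding tl_def by (intro monoI) (auto intro!: F.finite_measure_mono)
	then have "(%x. - tl x) \<in> borel_measurable borel" by (rule borel_measurable_mono)
	then have "(%x. - (- tl x)) \<in> borel_measurable borel" by measurable
	then show ?thesis by simp
qed

lemma k_eq: "k x = (if 0 <= x then \<alpha> * tl x else 0)" by (simp add: k_def kfun_def tl_def)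

lemma k_meas [measurable]: "k \<in> borel_measurable borel"
	unfolding k_eq[abs_def] by measurable

lemma k_nonneg: "0 <= k x" using alpha_pos by (simp add: k_eq tl_def)

lemma k_bound: "k x <= \<alpha>" using alpha_pos by (simp add: k_eq tl_def mult_left_le)

lemma k_integrable: "integrable lborel k"
proof -
	have "(%x. indicator {0..} x *\<^sub>R k x) = k" by (auto simp: indicator_def k_eq)
	then show ?thesis using k_int unfolding set_integrable_def by simp
qed

text \<open>A continuous logarithm of \<open>phi_stat k\<close>. Quotients of characteristic
  functions become differences of \<open>Psi\<close>, without any choice of a branch.\<close>

definition Psi :: "real => complex" where
	"Psi t = (CLINT x:{0<..}|lborel. (iexp (t * x) - 1) * cplx (k x / x))"

lemma phi_stat_eq: "phi_stat k t = exp (Psi t)" by (simp add: phi_stat_def Psi_def)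

lemma phi_k_eq: "phi_k k u = (CLINT x|lborel. iexp (u * x) * cplx (k x))"
	unfolding phi_k_def set_lebesgue_integral_def
	by (intro Bochner_Integration.integral_cong refl) (auto simp: indicator_def k_eq)

lemma Psi_deriv: "(Psi has_vector_derivative \<i> * phi_k k t) (at t)"
proof -
	let ?g = "%x. indicator {0<..} x *\<^sub>R cplx (k x / x)"
	have ae: "AE x in lborel. x ~= (0::real)" by (rule AE_lborel_singleton)
	have eq: "x ~= 0 ==> cplx x * ?g x = cplx (k x)" for x
		by (auto simp: indicator_def k_eq)
	have "integrable lborel (%x. cplx x * ?g x)"
	proof (rule integrable_cong_AE_imp)
		show "integrable lborel (%x. cplx (k x))" using k_integrable by simp
		show "AE x in lborel. cplx (k x) = cplx x * ?g x" using ae by eventually_elim (rule eq[symmetric])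
	qed measurable
	from has_vector_derivative_integral_iexp[OF _ _ this]
	have "((%t. CLINT x|lborel. (iexp (t * x) - 1) * ?g x) has_vector_derivative
		 (CLINT x|lborel. \<i> * cplx x * iexp (t * x) * ?g x)) (at t)" by simp
	moreover have "(CLINT x|lborel. (iexp (t * x) - 1) * ?g x) = Psi t" for t
		unfolding Psi_def set_lebesgue_integral_def by (intro Bochner_Integration.integral_cong refl) simp
	moreover have "(CLINT x|lborel. \<i> * cplx x * iexp (t * x) * ?g x) = \<i> * phi_k k t"
	proof -
		have "(CLINT x|lborel. \<i> * cplx x * iexp (t * x) * ?g x) = (CLINT x|lborel. \<i> * (iexp (t * x) * cplx (k x)))"
		proof (rule integral_cong_AE)
			show "AE x in lborel. \<i> * cplx x * iexp (t * x) * ?g x = \<i> * (iexp (t * x) * cplx (k x))"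
				using ae
			proof eventually_elim
				case (elim x)
				have "\<i> * cplx x * iexp (t * x) * ?g x = \<i> * (iexp (t * x) * (cplx x * ?g x))" by (simp only: mult_ac)
				then show ?case by (simp only: eq[OF elim])
			qed
		qed measurable
		then show ?thesis by (simp add: phi_k_eq)
	qed
	ultimately show ?thesis by simp
qed

text \<open>Integration by parts in disguise: \<open>k x\<close> is \<open>\<alpha>\<close> times
  the mass that \<open>F\<close> gives to \<open>u > x\<close>, and exchanging the integrals leaves
  the integral of \<open>\<i> * y * iexp (y * x)\<close> over [0, u], which is
  \<open>iexp (y * u) - 1\<close> because the jumps are positive.\<close>

lemma phi_k_char: "\<i> * cplx y * phi_k k y = cplx \<alpha> * (char F y - 1)"
proof -
	let ?f = "%(x, u). (if 0 <= x \<and> x < u then 1 else 0) :: real"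
	interpret P: pair_sigma_finite lborel F by (simp add: pair_sigma_finite_def lborel.sigma_finite_measure_axioms F.sigma_finite_measure_axioms)
	have tlx: "(\<integral>u. (if x < u then 1 else 0 :: real) \<partial>F) = tl x" for x
	proof -
		have "(%u. (if x < u then 1 else 0 :: real)) = indicator {x<..}" by (auto simp: indicator_def)
		then show ?thesis by (simp add: tl_def)
	qed
	have iy: "integrable F (%u. (if 0 <= x \<and> x < u then 1 else 0) :: real)" for x
		by (rule F.integrable_const_bound[of _ 1]) auto
	have int: "integrable (lborel \<Otimes>\<^sub>M F) ?f"
	proof (rule P.Fubini_integrable)
		have "(%x. \<integral>u. norm (?f (x, u)) \<partial>F) = (%x. k x / \<alpha>)"
			using alpha_pos tlx by (auto simp: k_eq fun_eq_iff)
		then show "integrable lborel (%x. \<integral>u. norm (?f (x, u)) \<partial>F)" using k_integrable by simp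
	qed (use iy in auto)
	let ?h = "%(x, u). cplx (?f (x, u)) * (\<i> * cplx y * iexp (y * x))"
	have inth: "integrable (lborel \<Otimes>\<^sub>M F) ?h"
	proof (rule Bochner_Integration.integrable_bound[OF integrable_mult_right[OF int, of y]])
		show "AE z in lborel \<Otimes>\<^sub>M F. norm (?h z) <= norm (y * ?f z)"
			by (intro AE_I2) (auto simp: norm_mult)
	qed measurable
	have "\<i> * cplx y * phi_k k y = (CLINT x|lborel. \<alpha> * (CLINT u|F. ?h (x, u)))"
		unfolding phi_k_eq integral_mult_right_zero[symmetric]
	proof (intro Bochner_Integration.integral_cong refl)
		fix x
		have "(CLINT u|F. ?h (x, u)) = (CLINT u|F. cplx (if 0 <= x \<and> x < u then 1 else 0)) * (\<i> * cplx y * iexp (y * x))"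
			by simp
		also have "(CLINT u|F. cplx (if 0 <= x \<and> x < u then 1 else 0)) = cplx (if 0 <= x then tl x else 0)"
			using tlx by (subst integral_complex_of_real) auto
		finally have A: "(CLINT u|F. ?h (x, u)) = cplx (if 0 <= x then tl x else 0) * (\<i> * cplx y * iexp (y * x))" .
		show "\<i> * cplx y * (iexp (y * x) * cplx (k x)) = (CLINT u|F. cplx \<alpha> * ?h (x, u))"
			unfolding integral_mult_right_zero A by (simp add: k_eq)
	qed
	also have "... = \<alpha> * (CLINT u|F. (CLINT x|lborel. ?h (x, u)))"
		using P.Fubini_integral[OF inth] by simp
	also have "(CLINT u|F. (CLINT x|lborel. ?h (x, u))) = (CLINT u|F. iexp (y * u) - 1)"
	proof (rule integral_cong_AE)
		show "AE u in F. (CLINT x|lborel. ?h (x, u)) = iexp (y * u) - 1"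
			using F_pos
		proof eventually_elim
			case (elim u)
			have dv: "((%x. iexp (y * x)) has_vector_derivative \<i> * cplx y * iexp (y * x)) (at x within {0..u})" for x
			proof -
				have "((%x. iexp (y * x)) has_vector_derivative y *\<^sub>R (\<i> * iexp (y * x))) (at x)"
					by (rule vector_diff_chain_at[of "%s. y * s" y x iexp, unfolded comp_def];
							auto intro!: derivative_eq_intros has_vector_derivative_iexp[THEN has_vector_derivative_at_within]
								simp flip: has_real_derivative_iff_has_vector_derivative)
				then show ?thesis by - (rule has_vector_derivative_at_within, simp add: scaleR_conv_of_real mult_ac)
			qed
			have "has_bochner_integral lborel (%x. indicator {0..u} x *\<^sub>R (\<i> * cplx y * iexp (y * x))) (iexp (y * u) - iexp (y * 0))"
				using elim dv by (intro has_bochner_integral_FTC_Icc) (auto intro!: continuous_intros)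
			moreover have "(CLINT x|lborel. ?h (x, u)) = (CLINT x|lborel. indicator {0..u} x *\<^sub>R (\<i> * cplx y * iexp (y * x)))"
				unfolding prod.case
			proof (rule integral_cong_AE)
				show "AE x in lborel. cplx (if 0 <= x \<and> x < u then 1 else 0) * (\<i> * cplx y * iexp (y * x))
						= indicator {0..u} x *\<^sub>R (\<i> * cplx y * iexp (y * x))"
					using AE_lborel_singleton[of u] by eventually_elim (auto simp: indicator_def)
			qed measurable
			ultimately show ?case by (simp add: has_bochner_integral_integral_eq)
		qed
	qed measurable
	also have "(CLINT u|F. iexp (y * u) - 1) = char F y - 1"
		unfolding char_def using F.integrable_iexp_rv[of "%u. u" y] F.prob_space by (simp add: measurable_ident_sets)
	finally show ?thesis by simp
qed

text \<open>By \<open>phi_k_char\<close>, the derivative of \<open>Psi (v * exp (s - b))\<close> in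
  \<open>s\<close> is \<open>\<alpha>\<close> times \<open>char F - 1\<close> at the same argument.
  So the exponent produced by the jumps in [a, b], discounted to time \<open>b\<close>, is a
  difference of two values of \<open>Psi\<close>; this is what makes the law of the innovations
  explicit.\<close>

lemma jump_integral:
	assumes "a <= b"
	shows "((%s. 1 - char F (v * exp (s - b))) has_integral - (Psi v - Psi (v * exp (a - b))) / cplx \<alpha>) {a..b}"
proof -
	have "((%s. (- 1 / cplx \<alpha>) * Psi (v * exp (s - b))) has_vector_derivative 1 - char F (v * exp (s - b))) (at s within {a..b})" for s
	proof -
		let ?y = "v * exp (s - b)"
		have "((%s. v * exp (s - b)) has_vector_derivative ?y) (at s)"
			by (auto intro!: derivative_eq_intros simp flip: has_real_derivative_iff_has_vector_derivative)
		then have "((%s. Psi (v * exp (s - b))) has_vector_derivative ?y *\<^sub>R (\<i> * phi_k k ?y)) (at s)"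
			using vector_diff_chain_at[of "%s. v * exp (s - b)" ?y s Psi] Psi_deriv[of ?y]
			by (simp add: comp_def)
		moreover have "?y *\<^sub>R (\<i> * phi_k k ?y) = cplx \<alpha> * (char F ?y - 1)"
			using phi_k_char[of ?y] by (simp only: scaleR_conv_of_real mult_ac)
		ultimately have "((%s. Psi (v * exp (s - b))) has_vector_derivative cplx \<alpha> * (char F ?y - 1)) (at s)" by simp
		then have "((%s. (- 1 / cplx \<alpha>) * Psi (v * exp (s - b))) has_vector_derivative (- 1 / cplx \<alpha>) * (cplx \<alpha> * (char F ?y - 1))) (at s)"
			by (rule has_vector_derivative_mult_right)
		moreover have "(- 1 / cplx \<alpha>) * (cplx \<alpha> * (char F ?y - 1)) = 1 - char F ?y"
			using alpha_pos by (simp flip: mult.assoc)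
		ultimately show ?thesis by - (rule has_vector_derivative_at_within, simp only:)
	qed
	note ftc = fundamental_theorem_of_calculus[OF assms this]
	have "(- 1 / cplx \<alpha>) * Psi (v * exp (b - b)) - (- 1 / cplx \<alpha>) * Psi (v * exp (a - b))
		 = - (Psi v - Psi (v * exp (a - b))) / cplx \<alpha>"
		by (simp add: diff_divide_distrib)
	with ftc show ?thesis by (simp only:)
qed

definition Tm :: "nat => 's => real" where "Tm N w = (\<Sum>i<N. E i w)"

lemma Tm_meas [measurable]: "Tm N \<in> borel_measurable M" unfolding Tm_def by measurable

lemma jump_time_eq: "jump_time E j w = Tm (Suc j) w"
	by (simp add: jump_time_def Tm_def lessThan_Suc_atMost)

lemma E_pos: "AE w in M. \<forall>i. 0 <= E i w"
proof -
	have "AE w in M. 0 <= E i w" for i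
	proof -
		have "AE x in distr M lborel (E i). 0 <= x"
			unfolding distributed_distr_eq_density[OF E_exp] by (subst AE_density) (auto simp: exponential_density_def)
		then show ?thesis by (subst (asm) AE_distr_iff) auto
	qed
	then show ?thesis by (subst AE_all_countable) auto
qed

lemma expectation_E: fixes g :: "real => 'b::{banach,second_countable_topology}"
	assumes [measurable]: "g \<in> borel_measurable borel"
	shows "(\<integral>w. g (E i w) \<partial>M) = (\<integral>x. exponential_density \<alpha> x *\<^sub>R g x \<partial>lborel)"
proof -
	have "(\<integral>w. g (E i w) \<partial>M) = integral\<^sup>L (distr M lborel (E i)) g" by (subst integral_distr) auto
	also have "... = (\<integral>x. exponential_density \<alpha> x *\<^sub>R g x \<partial>lborel)"
		unfolding distributed_distr_eq_density[OF E_exp]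
		by (subst integral_density) (auto simp: exponential_density_nonneg[OF alpha_pos])
	finally show ?thesis .
qed

text \<open>\<open>c\<close> is the Laplace transform of an interarrival time at 1, so
  \<open>exp (- Tm N)\<close> has mean \<open>c ^ N\<close>. If all jump times stayed below
  \<open>R\<close> with positive probability, this mean could not tend to 0.\<close>

lemma Tm_at_top: "AE w in M. filterlim (%N. Tm N w) at_top sequentially"
proof -
	define c where "c = \<alpha> / (\<alpha> + 1)"
	have c: "0 <= c" "c < 1" using alpha_pos by (auto simp: c_def)
	have cE: "expectation (%w. exp (- E i w)) = c" for i
	proof -
		have "exponential_density \<alpha> x * exp (- x) = c * exponential_density (\<alpha> + 1) x" for x
		proof -
			have "exp (- x * \<alpha>) * exp (- x) = exp (- x * (\<alpha> + 1))" by (simp add: algebra_simps flip: exp_add)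
			moreover have "c * (\<alpha> + 1) = \<alpha>" using alpha_pos by (simp add: c_def)
			ultimately show ?thesis by (simp add: exponential_density_def mult.assoc)
		qed
		moreover have "(\<integral>x. exponential_density (\<alpha> + 1) x \<partial>lborel) = 1"
		proof -
			interpret P: prob_space "density lborel (exponential_density (\<alpha> + 1))"
				using alpha_pos by (intro prob_space_exponential_density) auto
			have "(\<integral>\<^sup>+x. ennreal (exponential_density (\<alpha> + 1) x) \<partial>lborel) = 1"
				using P.emeasure_space_1 by (simp add: emeasure_density cong: nn_integral_cong)
			then show ?thesis using alpha_pos by (subst integral_eq_nn_integral) (auto simp: exponential_density_nonneg)
		qed
		ultimately show ?thesis by (subst expectation_E) auto
	qed
	have pos: "AE w in M. \<forall>i. 0 <= E i w" by (rule E_pos)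
	have iE: "integrable M (%w. exp (- E i w))" for i
		using pos by (intro integrable_const_bound[of _ 1]) auto
	have ET: "expectation (%w. exp (- Tm N w)) = c ^ N" for N
	proof -
		let ?J = "(%j. Inr (Inl j)) ` {..<N} :: (unit + (nat + nat)) set"
		have "expectation (%w. exp (- Tm N w)) = expectation (%w. \<Prod>i<N. exp (- E i w))"
			unfolding Tm_def by (simp add: exp_sum[symmetric] sum_negf)
		also have "... = expectation (%w. \<Prod>i\<in>?J. exp (- vars i w))"
			by (subst prod.reindex) (auto simp: inj_on_def)
		also have "... = (\<Prod>i\<in>?J. expectation (%w. exp (- vars i w)))"
		proof (rule indep_vars_lebesgue_integral)
			show "indep_vars (%_. borel) (%i w. exp (- vars i w)) ?J"
				by (rule indep_vars_compose2[OF indep_vars_subset[OF indep], where Y="%_ x. exp (- x)"]) auto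
			show "integrable M (%w. exp (- vars i w))" if "i \<in> ?J" for i
				using that iE by auto
		qed simp
		also have "... = (\<Prod>i<N. expectation (%w. exp (- E i w)))"
			by (subst prod.reindex) (auto simp: inj_on_def)
		also have "... = c ^ N" by (simp add: cE)
		finally show ?thesis .
	qed
	have iT: "integrable M (%w. exp (- Tm N w))" for N
		using pos by (intro integrable_const_bound[of _ 1]) (auto simp: Tm_def intro!: sum_nonneg)
	have "AE w in M. \<forall>R::nat. \<exists>N. Tm N w > real R"
		unfolding AE_all_countable
	proof
		fix R :: nat
		let ?A = "{w\<in>space M. \<forall>N. Tm N w <= real R}"
		have A: "?A \<in> sets M" by measurable
		have "prob ?A * exp (- real R) <= c ^ N" for N
		proof -
			have "prob ?A * exp (- real R) = expectation (%w. indicator ?A w * exp (- real R))" using A by simp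
			also have "... <= expectation (%w. exp (- Tm N w))"
				using A by (intro integral_mono[OF _ iT[of N]] integrable_const_bound[of _ 1]) (auto simp: indicator_def)
			finally show ?thesis by (simp add: ET)
		qed
		then have "prob ?A * exp (- real R) <= 0"
			using LIMSEQ_le_const[OF LIMSEQ_realpow_zero[OF c]] by auto
		then have "prob ?A = 0" using measure_nonneg[of M ?A] by (auto simp: mult_le_0_iff)
		then have "AE w in M. w \<notin> ?A" using A by (intro AE_not_in) (auto simp: null_sets_def emeasure_eq_measure)
		then show "AE w in M. \<exists>N. Tm N w > real R" by (auto simp: not_le)
	qed
	then show ?thesis using pos
	proof eventually_elim
		case (elim w)
		have mono: "N <= N' ==> Tm N w <= Tm N' w" for N N'
			unfolding Tm_def using elim(2) by (intro sum_mono2) auto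
		show ?case
			unfolding filterlim_at_top
		proof
			fix Z :: real
			obtain R :: nat where "Z <= real R" using real_arch_simple by blast
			moreover obtain N where "Tm N w > real R" using elim(1) by blast
			ultimately show "eventually (%N. Z <= Tm N w) sequentially"
				unfolding eventually_sequentially using mono by (intro exI[of _ N]) (meson less_imp_le order_trans)
		qed
	qed
qed

end

section \<open>Characteristic functionals of the marked jump times\<close>

context ou_process
begin

lemma char_U: "(CLINT w|M. iexp (a * U i w)) = char F a"
	unfolding U_iid[of i, symmetric] char_def by (subst integral_distr) auto

text \<open>The jump size is integrated first, which produces \<open>char F\<close>, and the waiting
  time afterwards, against its exponential density.\<close>

lemma expectation_EU:
	fixes G :: "real => complex"
	assumes [measurable]: "wv \<in> borel_measurable borel" "G \<in> borel_measurable borel" and G: "!!s. cmod (G s) <= B"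
	shows "(CLINT w|M. iexp (U N w * wv (t + E N w)) * G (t + E N w))
		 = (CLINT e|lborel. exponential_density \<alpha> e *\<^sub>R (char F (wv (t + e)) * G (t + e)))"
proof -
	have "indep_var (PiM {Inr (Inl N)} (%_. borel)) (%w. restrict (%i. vars i w) {Inr (Inl N)})
			(PiM {Inr (Inr N)} (%_. borel)) (%w. restrict (%i. vars i w) {Inr (Inr N)})"
		by (rule indep_var_restrict[OF indep]) auto
	then have "indep_var borel ((%p. p (Inr (Inl N))) \<circ> (%w. restrict (%i. vars i w) {Inr (Inl N)}))
			borel ((%p. p (Inr (Inr N))) \<circ> (%w. restrict (%i. vars i w) {Inr (Inr N)}))"
		by (rule indep_var_compose) (auto intro!: measurable_component_singleton)
	then have ind: "indep_var borel (E N) borel (U N)" by (simp add: comp_def)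
	have "(CLINT w|M. (%(e, u). iexp (u * wv (t + e)) * G (t + e)) (E N w, U N w))
		 = (CLINT w|M. CLINT w'|M. (%(e, u). iexp (u * wv (t + e)) * G (t + e)) (E N w, U N w'))"
		by (rule indep_var_iterated_integral[OF ind, where B=B]) (use G in \<open>auto simp: norm_mult\<close>)
	then have "(CLINT w|M. iexp (U N w * wv (t + E N w)) * G (t + E N w))
		 = (CLINT w|M. (CLINT w'|M. iexp (wv (t + E N w) * U N w')) * G (t + E N w))"
		by (simp add: mult.commute)
	also have "... = (CLINT w|M. char F (wv (t + E N w)) * G (t + E N w))"
		by (simp only: char_U)
	also have "... = (CLINT e|lborel. exponential_density \<alpha> e *\<^sub>R (char F (wv (t + e)) * G (t + e)))"
		by (rule expectation_E) measurable
	finally show ?thesis .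
qed

text \<open>The integral equation solved by
	\<open>G\<close> says that \<open>iexp (P N) * G (Tm N)\<close> is a martingale along the jump times.\<close>

lemma campbell:
	assumes wv[measurable]: "wv \<in> borel_measurable borel" and S: "S >= 0" and supp: "!!s. s > S ==> wv s = 0"
		and B: "finite B" and cont: "!!s. s \<notin> B ==> isCont wv s"
	shows "(CLINT w|M. iexp (v0 * X0 w + (\<Sum>j. U j w * wv (Tm (Suc j) w))))
		 = phi_stat k v0 * exp (- cplx \<alpha> * integral {0..S} (%s. 1 - char F (wv s)))"
proof -
	define \<psi> where "\<psi> s = 1 - char F (wv s)" for s
	have [measurable]: "\<psi> \<in> borel_measurable borel" unfolding \<psi>_def by measurable
	have \<psi>2: "cmod (\<psi> s) <= 2" for s
		unfolding \<psi>_def using norm_triangle_ineq4[of 1 "char F (wv s)"] F.cmod_char_le_1[of "wv s"] by simp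
	have \<psi>0: "\<psi> s = 0" if "s > S" for s using supp[OF that] by (simp add: \<psi>_def F.char_zero)
	have \<psi>c: "isCont \<psi> s" if "s \<notin> B" for s
		unfolding \<psi>_def using isCont_o2[OF cont[OF that] F.isCont_char] by (intro continuous_intros)
	have si: "set_integrable lborel {0..b} \<psi>" for b
		unfolding set_integrable_def
		by (rule integrable_bounded_support(1)[where R="\<bar>b\<bar>" and C=2]) (use \<psi>2 in \<open>auto simp: indicator_def\<close>)
	define A where "A s = (CLINT x|lborel. (if 0 <= x \<and> x <= s then 1 else 0) * \<psi> x)" for s :: real
	have Am[measurable]: "A \<in> borel_measurable borel" unfolding A_def by measurable
	have Aeq: "A s = integral {0..s} \<psi>" and ii: "\<psi> integrable_on {0..s}" for s
	proof -
		have "A s = (CLINT x:{0..s}|lborel. \<psi> x)"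
			unfolding A_def set_lebesgue_integral_def by (intro Bochner_Integration.integral_cong refl) (auto simp: indicator_def)
		then show "A s = integral {0..s} \<psi>" using set_borel_integral_eq_integral(2)[OF si] by simp
		show "\<psi> integrable_on {0..s}" using set_borel_integral_eq_integral(1)[OF si] .
	qed
	have AS: "A s = A S" if "s >= S" for s
	proof -
		have "(\<psi> has_integral integral {0..S} \<psi>) {0..S}" using ii by (rule integrable_integral)
		moreover have "(\<psi> has_integral 0) {S..s}"
			by (rule has_integral_spike_finite[of "{S}" _ _ "%_. 0"]) (use \<psi>0 in auto)
		ultimately have "(\<psi> has_integral integral {0..S} \<psi> + 0) {0..s}" using S that by (rule_tac has_integral_combine) auto
		then show ?thesis unfolding Aeq by (simp add: integral_unique)
	qed
	\<comment> \<open>\<open>G s\<close> is the mean factor contributed by the jumps after time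
	  \<open>s\<close>. It solves \<open>G' = \<alpha> * \<psi> * G\<close> at positive times off
	  \<open>B\<close>, and equals 1 from \<open>S\<close> on.\<close>
	define G where "G s = exp (- cplx \<alpha> * (A S - A s))" for s
	have Gm[measurable]: "G \<in> borel_measurable borel" unfolding G_def by measurable
	have Ab: "cmod (A s) <= 2 * S" if "s <= S" for s
	proof -
		have "cmod (A s) <= 2 * S * 2 / 2" unfolding A_def
		proof -
			have "norm (CLINT x|lborel. (if 0 <= x \<and> x <= s then 1 else 0) * \<psi> x) <= (LINT x|lborel. 2 * indicator {0..S} x)"
			proof (rule norm_integral_le)
				show "integrable lborel (%x. 2 * indicator {0..S} x :: real)"
					using S by (intro integrable_mult_right integrable_real_indicator) auto
			qed (use that \<psi>2 in \<open>auto simp: indicator_def\<close>)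
			then show "cmod (CLINT x|lborel. (if 0 <= x \<and> x <= s then 1 else 0) * \<psi> x) <= 2 * S * 2 / 2" using S by simp
		qed
		then show ?thesis by simp
	qed
	define Bd where "Bd = exp (\<alpha> * (4 * S))"
	have Gb: "cmod (G s) <= Bd" for s
	proof -
		have "cmod (A S - A s) <= 4 * S"
		proof (cases "s <= S")
			case True then show ?thesis using norm_triangle_ineq4[of "A S" "A s"] Ab[of S] Ab[of s] by simp
		next
			case False then show ?thesis using AS[of s] S by simp
		qed
		then have "Re (- cplx \<alpha> * (A S - A s)) <= \<alpha> * (4 * S)"
			using complex_Re_le_cmod[of "- cplx \<alpha> * (A S - A s)"] alpha_pos
			by (simp add: norm_mult) (smt (verit) mult_left_mono)
		then show ?thesis unfolding G_def Bd_def norm_exp_eq_Re by simp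
	qed
	have dA: "(A has_vector_derivative \<psi> s) (at s)" if "s > 0" "s \<notin> B" for s
	proof -
		have "((%u. integral {0..u} \<psi>) has_vector_derivative \<psi> s) (at s within {0..s + 1} - {})"
			by (rule integral_has_vector_derivative_continuous_at[OF ii _ _ continuous_at_imp_continuous_at_within[OF \<psi>c[OF that(2)]]])
				 (use that in auto)
		moreover have "at s within {0..s + 1} - {} = at s" using that at_within_Icc_at[of 0 s "s + 1"] by simp
		moreover have "A = (%u. integral {0..u} \<psi>)" by (rule ext) (rule Aeq)
		ultimately show ?thesis by (simp only:)
	qed
	have dG: "(G has_vector_derivative cplx \<alpha> * \<psi> s * G s) (at s)" if "s > 0" "s \<notin> B" for s
	proof -
		have "((%s. - cplx \<alpha> * (A S - A s)) has_vector_derivative - cplx \<alpha> * (0 - \<psi> s)) (at s)"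
			by (intro has_vector_derivative_mult_right has_vector_derivative_diff has_vector_derivative_const dA that)
		then have "((exp \<circ> (%s. - cplx \<alpha> * (A S - A s))) has_vector_derivative (- cplx \<alpha> * (0 - \<psi> s)) * exp (- cplx \<alpha> * (A S - A s))) (at s)"
			by (rule field_vector_diff_chain_at) (rule DERIV_exp)
		then show ?thesis unfolding G_def comp_def by simp
	qed
	have cG: "continuous_on {0..b} G" for b
	proof -
		have "A = (%u. integral {0..u} \<psi>)" by (rule ext) (rule Aeq)
		then have "continuous_on {0..b} A" using indefinite_integral_continuous_1[OF ii[of b]] by (simp only:)
		then show ?thesis unfolding G_def by (intro continuous_intros)
	qed
	\<comment> \<open>Averaging over the next jump time and its size reproduces \<open>G\<close>. By
	  the differential equation the integrand has the primitive
	  \<open>- exp (- (\<alpha> * e)) * G (s + e)\<close>, whose value at infinity vanishes because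
	  \<open>G\<close> is bounded.\<close>
	have ker: "(CLINT e|lborel. exponential_density \<alpha> e *\<^sub>R (char F (wv (s + e)) * G (s + e))) = G s" if s: "s >= 0" for s
	proof -
		let ?g = "%e. exponential_density \<alpha> e *\<^sub>R (char F (wv (s + e)) * G (s + e))"
		have id: "integrable lborel (exponential_density \<alpha>)"
		proof -
			interpret P: prob_space "density lborel (exponential_density \<alpha>)"
				using alpha_pos by (rule prob_space_exponential_density)
			have "(\<integral>\<^sup>+x. ennreal (exponential_density \<alpha> x) \<partial>lborel) = 1"
				using P.emeasure_space_1 by (simp add: emeasure_density cong: nn_integral_cong)
			then show ?thesis using alpha_pos by (intro integrableI_nonneg) (auto simp: exponential_density_nonneg)
		qed
		have ig: "integrable lborel ?g"
		proof (rule Bochner_Integration.integrable_bound[OF integrable_mult_right[OF id, of Bd]])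
			show "AE e in lborel. norm (?g e) <= norm (Bd * exponential_density \<alpha> e)"
			proof (rule AE_I2)
				fix e
				have "cmod (char F (wv (s + e))) * cmod (G (s + e)) <= 1 * Bd"
					using F.cmod_char_le_1 Gb by (intro mult_mono) auto
				then have "\<bar>exponential_density \<alpha> e\<bar> * (cmod (char F (wv (s + e))) * cmod (G (s + e))) <= \<bar>exponential_density \<alpha> e\<bar> * (1 * Bd)"
					by (intro mult_left_mono) auto
				then show "norm (?g e) <= norm (Bd * exponential_density \<alpha> e)"
					by (simp add: norm_mult abs_mult mult.commute Bd_def)
			qed
		qed measurable
		have "((%y. \<integral>e. indicator {..y} e *\<^sub>R ?g e \<partial>lborel) \<longlongrightarrow> integral\<^sup>L lborel ?g) at_top"
			by (rule tendsto_integral_at_top[OF _ ig]) simp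
		moreover have "((%y. \<integral>e. indicator {..y} e *\<^sub>R ?g e \<partial>lborel) \<longlongrightarrow> G s) at_top"
		proof -
			have eq: "(\<integral>e. indicator {..y} e *\<^sub>R ?g e \<partial>lborel) = G s - exp (- (\<alpha> * y)) *\<^sub>R G (s + y)" if y: "y >= 0" for y
			proof -
				let ?f = "%e. (\<alpha> * exp (- (\<alpha> * e))) *\<^sub>R ((1 - \<psi> (s + e)) * G (s + e))"
				have e1: "indicator {..y} e *\<^sub>R ?g e = indicator {0..y} e *\<^sub>R ?f e" for e
					by (auto simp: indicator_def exponential_density_def \<psi>_def mult.commute)
				have "integrable lborel (%e. indicator {..y} e *\<^sub>R ?g e)"
					using ig by (rule integrable_mult_indicator[rotated]) simp
				then have "set_integrable lborel {0..y} ?f" unfolding set_integrable_def e1 .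
				then have "(\<integral>e. indicator {..y} e *\<^sub>R ?g e \<partial>lborel) = integral {0..y} ?f"
					unfolding e1 by (rule set_borel_integral_eq_integral(2)[unfolded set_lebesgue_integral_def])
				also have "(?f has_integral (- (exp (- (\<alpha> * y)) *\<^sub>R G (s + y)) - - (exp (- (\<alpha> * 0)) *\<^sub>R G (s + 0)))) {0..y}"
				proof (rule fundamental_theorem_of_calculus_interior_strong[of "(%b. b - s) ` B"])
					show "continuous_on {0..y} (%e. - (exp (- (\<alpha> * e)) *\<^sub>R G (s + e)))"
						by (intro continuous_intros continuous_on_compose2[OF cG[of "s + y"]]) (use s in auto)
					fix e assume e: "e \<in> {0<..<y} - (%b. b - s) ` B"
					then have se: "s + e > 0" "s + e \<notin> B" using s by (auto simp: image_iff algebra_simps)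
					have "((G \<circ> (%e. s + e)) has_vector_derivative 1 *\<^sub>R (cplx \<alpha> * \<psi> (s + e) * G (s + e))) (at e)"
						by (rule vector_diff_chain_at) (auto intro!: derivative_eq_intros dG se simp flip: has_real_derivative_iff_has_vector_derivative)
					then have 1: "((%e. G (s + e)) has_vector_derivative cplx \<alpha> * \<psi> (s + e) * G (s + e)) (at e)"
						by (simp add: comp_def)
					have 2: "((%e. exp (- (\<alpha> * e))) has_real_derivative - \<alpha> * exp (- (\<alpha> * e))) (at e)"
						by (auto intro!: derivative_eq_intros)
					from has_vector_derivative_minus[OF has_vector_derivative_scaleR[OF 2 1]]
					show "((%e. - (exp (- (\<alpha> * e)) *\<^sub>R G (s + e))) has_vector_derivative ?f e) (at e)"
						by (rule has_vector_derivative_eq_rhs) (simp add: scaleR_conv_of_real algebra_simps)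
				qed (use y B in auto)
				then have "integral {0..y} ?f = G s - exp (- (\<alpha> * y)) *\<^sub>R G (s + y)" by (simp add: integral_unique)
				finally show ?thesis .
			qed
			have l0: "((%y. exp (- (\<alpha> * y)) * Bd) \<longlongrightarrow> 0) at_top"
			proof -
				have "filterlim (%y. \<alpha> * y) at_top at_top"
					using alpha_pos by (intro filterlim_tendsto_pos_mult_at_top[OF tendsto_const]) (auto simp: filterlim_ident)
				then have "((%y. exp (- (\<alpha> * y))) \<longlongrightarrow> 0) at_top"
					by (intro filterlim_compose[OF exp_at_bot] filterlim_uminus_at_top[THEN iffD1])
				then show ?thesis by (rule tendsto_mult_left_zero)
			qed
			have "((%y. exp (- (\<alpha> * y)) *\<^sub>R G (s + y)) \<longlongrightarrow> 0) at_top"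
				by (rule Lim_null_comparison[OF _ l0]) (auto intro!: always_eventually mult_left_mono Gb)
			from tendsto_diff[OF tendsto_const this, of "G s"]
			have lim: "((%y. G s - exp (- (\<alpha> * y)) *\<^sub>R G (s + y)) \<longlongrightarrow> G s) at_top" by simp
			have ev: "eventually (%y. G s - exp (- (\<alpha> * y)) *\<^sub>R G (s + y) = (\<integral>e. indicator {..y} e *\<^sub>R ?g e \<partial>lborel)) at_top"
				unfolding eventually_at_top_linorder
			proof (intro exI allI impI)
				fix y :: real assume "0 <= y" from eq[OF this]
				show "G s - exp (- (\<alpha> * y)) *\<^sub>R G (s + y) = (\<integral>e. indicator {..y} e *\<^sub>R ?g e \<partial>lborel)" by (rule sym)
			qed
			show ?thesis by (rule Lim_transform_eventually[OF lim ev])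
		qed
		ultimately show ?thesis by (rule tendsto_unique[OF trivial_limit_at_top_linorder])
	qed
	define P where "P N w = v0 * X0 w + (\<Sum>j<N. U j w * wv (Tm (Suc j) w))" for N w
	define Z where "Z N w = iexp (P N w) * G (Tm N w)" for N w
	have Pm[measurable]: "P N \<in> borel_measurable M" for N unfolding P_def by measurable
	have Zm[measurable]: "Z N \<in> borel_measurable M" for N unfolding Z_def by measurable
	\<comment> \<open>Only the waiting time and the jump size with index \<open>N\<close> are new. All
	  earlier variables form an independent block that is held fixed while \<open>ker\<close>
	  integrates out the new pair.\<close>
	have step: "(CLINT w|M. Z (Suc N) w) = (CLINT w|M. Z N w)" for N
	proof -
		let ?IA = "insert (Inl ()) ((%j. Inr (Inl j)) ` {..<N} \<union> (%j. Inr (Inr j)) ` {..<N}) :: (unit + (nat + nat)) set"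
		let ?IB = "{Inr (Inl N), Inr (Inr N)} :: (unit + (nat + nat)) set"
		let ?R = "%I w. restrict (%i. vars i w) I"
		have ind: "indep_var (PiM ?IA (%_. borel)) (?R ?IA) (PiM ?IB (%_. borel)) (?R ?IB)"
			by (rule indep_var_restrict[OF indep]) auto
		define pf where "pf p = v0 * p (Inl ()) + (\<Sum>j<N. p (Inr (Inr j)) * wv (\<Sum>i\<le>j. p (Inr (Inl i))))" for p :: "unit + (nat + nat) => real"
		define tf where "tf p = (\<Sum>i<N. p (Inr (Inl i)))" for p :: "unit + (nat + nat) => real"
		have comp: "(%p. p i) \<in> borel_measurable (PiM I (%_. borel))" if "i \<in> I" for i :: "unit + (nat + nat)" and I
			using that by (rule measurable_component_singleton)
		have pfm[measurable]: "pf \<in> borel_measurable (PiM ?IA (%_. borel))"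
			unfolding pf_def
			by (intro borel_measurable_add borel_measurable_times borel_measurable_sum measurable_compose[OF _ wv] comp borel_measurable_const) auto
		have tfm[measurable]: "tf \<in> borel_measurable (PiM ?IA (%_. borel))"
			unfolding tf_def by (intro borel_measurable_sum comp) auto
		have [measurable]: "(%q. q (Inr (Inl N))) \<in> borel_measurable (PiM ?IB (%_. borel))"
			"(%q. q (Inr (Inr N))) \<in> borel_measurable (PiM ?IB (%_. borel))" by (intro comp; simp)+
		let ?f = "%(p, q). iexp (pf p) * (iexp (q (Inr (Inr N)) * wv (tf p + q (Inr (Inl N)))) * G (tf p + q (Inr (Inl N))))"
		have pfR: "pf (?R ?IA w) = P N w" for w
			unfolding pf_def P_def Tm_def lessThan_Suc_atMost by (auto intro!: sum.cong arg_cong[where f=wv])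
		have tfR: "tf (?R ?IA w) = Tm N w" for w unfolding tf_def Tm_def by (auto intro!: sum.cong)
		have "(CLINT w|M. Z (Suc N) w) = (CLINT w|M. ?f (?R ?IA w, ?R ?IB w))"
		proof (intro Bochner_Integration.integral_cong refl)
			fix w
			have "Tm (Suc N) w = Tm N w + E N w" by (simp add: Tm_def)
			moreover have "P (Suc N) w = P N w + U N w * wv (Tm (Suc N) w)" by (simp add: P_def)
			ultimately show "Z (Suc N) w = ?f (?R ?IA w, ?R ?IB w)"
				unfolding prod.case pfR tfR Z_def by (simp add: exp_add distrib_left)
		qed
		also have "... = (CLINT w|M. CLINT w'|M. ?f (?R ?IA w, ?R ?IB w'))"
		proof (rule indep_var_iterated_integral[OF ind, where B=Bd])
			show "?f \<in> borel_measurable (PiM ?IA (%_. borel) \<Otimes>\<^sub>M PiM ?IB (%_. borel))" by measurable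
			show "cmod (?f z) <= Bd" for z using Gb by (auto simp: norm_mult split: prod.split)
		qed
		also have "... = (CLINT w|M. iexp (P N w) * (CLINT w'|M. iexp (U N w' * wv (Tm N w + E N w')) * G (Tm N w + E N w')))"
			unfolding prod.case pfR tfR by simp
		also have "... = (CLINT w|M. iexp (P N w) * (CLINT e|lborel. exponential_density \<alpha> e *\<^sub>R (char F (wv (Tm N w + e)) * G (Tm N w + e))))"
			by (simp only: expectation_EU[OF wv Gm Gb])
		also have "... = (CLINT w|M. Z N w)"
		proof (rule integral_cong_AE)
			show "AE w in M. iexp (P N w) * (CLINT e|lborel. exponential_density \<alpha> e *\<^sub>R (char F (wv (Tm N w + e)) * G (Tm N w + e))) = Z N w"
				using E_pos
			proof eventually_elim
				case (elim w)
				then have "Tm N w >= 0" unfolding Tm_def by (intro sum_nonneg) auto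
				then show ?case unfolding Z_def by (simp only: ker)
			qed
		qed measurable
		finally show ?thesis .
	qed
	have EZ: "(CLINT w|M. Z N w) = phi_stat k v0 * G 0" for N
	proof (induction N)
		case 0
		have "(CLINT w|M. Z 0 w) = (CLINT w|M. iexp (v0 * X0 w)) * G 0" by (simp add: Z_def P_def Tm_def)
		also have "(CLINT w|M. iexp (v0 * X0 w)) = char (distr M borel X0) v0"
			unfolding char_def by (subst integral_distr) auto
		finally show ?case by (simp add: X0_char)
	qed (simp add: step)
	have [measurable]: "(%w. \<Sum>j. U j w * wv (Tm (Suc j) w)) \<in> borel_measurable M"
		by (intro borel_measurable_suminf) measurable
	\<comment> \<open>Almost surely the jump times pass \<open>S\<close>. From then on no term is added
	  and \<open>G\<close> is 1, so \<open>Z N\<close> is eventually constant in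
	  \<open>N\<close>.\<close>
	have "(%N. (CLINT w|M. Z N w)) \<longlonglongrightarrow> (CLINT w|M. iexp (v0 * X0 w + (\<Sum>j. U j w * wv (Tm (Suc j) w))))"
	proof (rule integral_dominated_convergence[where w="%_. Bd"])
		show "AE w in M. (%N. Z N w) \<longlonglongrightarrow> iexp (v0 * X0 w + (\<Sum>j. U j w * wv (Tm (Suc j) w)))"
			using Tm_at_top
		proof eventually_elim
			case (elim w)
			then have "eventually (%N. S + 1 <= Tm N w) sequentially" by (simp add: filterlim_at_top)
			then obtain N0 where N0: "!!N. N >= N0 ==> Tm N w > S" by (auto simp: eventually_sequentially) (smt (verit))
			have "Z N w = iexp (v0 * X0 w + (\<Sum>j. U j w * wv (Tm (Suc j) w)))" if "N >= N0" for N
			proof -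
				have "(\<Sum>j. U j w * wv (Tm (Suc j) w)) = (\<Sum>j<N. U j w * wv (Tm (Suc j) w))"
					using N0 that supp by (intro suminf_finite) auto
				moreover have "G (Tm N w) = 1" using AS[of "Tm N w"] N0[OF that] by (simp add: G_def)
				ultimately show ?thesis by (simp add: Z_def P_def)
			qed
			then show ?case by (intro tendsto_eventually) (auto simp: eventually_sequentially)
		qed
		show "AE w in M. norm (Z N w) <= Bd" for N using Gb by (simp add: Z_def norm_mult)
	qed auto
	then have "(CLINT w|M. iexp (v0 * X0 w + (\<Sum>j. U j w * wv (Tm (Suc j) w)))) = phi_stat k v0 * G 0"
		unfolding EZ by (simp add: LIMSEQ_const_iff)
	moreover have "A 0 = 0" unfolding Aeq by simp
	ultimately show ?thesis unfolding G_def Aeq \<psi>_def by simp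
qed

end

section \<open>The sampled process as an autoregression\<close>

context ou_process
begin

text \<open>The jumps in the half-open window of step \<open>j\<close>, discounted to its right end.
  The initial value counts as innovation number 0, so that \<open>Xc\<close> is a weighted sum of
  innovations without a separate starting term.\<close>

definition eta :: "real => nat => 's => real" where
	"eta tau j w = (if j = 0 then X0 w else
		 (\<Sum>i. U i w * (if (real j - 1) * tau < Tm (Suc i) w \<and> Tm (Suc i) w <= real j * tau
											then exp (Tm (Suc i) w - real j * tau) else 0)))"

definition Xc :: "real => nat => 's => real" where
	"Xc tau j w = (\<Sum>i\<le>j. exp (- tau) ^ (j - i) * eta tau i w)"

lemma eta_meas [measurable]: "eta tau j \<in> borel_measurable M"
proof (cases "j = 0")
	case True then show ?thesis by (simp add: eta_def[abs_def])
next
	case False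
	have "(%w. \<Sum>i. U i w * (if (real j - 1) * tau < Tm (Suc i) w \<and> Tm (Suc i) w <= real j * tau
											then exp (Tm (Suc i) w - real j * tau) else 0)) \<in> borel_measurable M"
		by (intro borel_measurable_suminf) measurable
	then show ?thesis using False by (simp add: eta_def[abs_def])
qed

lemma Xc_meas [measurable]: "Xc tau j \<in> borel_measurable M"
	unfolding Xc_def by measurable

lemma Xc_Suc: "Xc tau (Suc j) w = exp (- tau) * Xc tau j w + eta tau (Suc j) w"
	unfolding Xc_def by (simp add: sum_distrib_left Suc_diff_le mult_ac)

text \<open>On this almost sure set every bounded time interval contains finitely many jumps, so
  that the series are finite sums. The condition \<open>0 < E 0 w\<close> excludes a jump at time 0,
  which would enter \<open>ou_X\<close> but lie in no window.\<close>

definition good :: "'s => bool" where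
	"good w \<longleftrightarrow> filterlim (%N. Tm N w) at_top sequentially \<and> (\<forall>i. 0 <= E i w) \<and> 0 < E 0 w \<and> (\<forall>i. 0 < U i w)"

lemma AE_good: "AE w in M. good w"
proof -
	have "AE x in distr M lborel (E 0). 0 < x"
		unfolding distributed_distr_eq_density[OF E_exp]
		by (subst AE_density) (use AE_lborel_singleton[of "0::real"] in \<open>auto simp: exponential_density_def elim: eventually_mono\<close>)
	then have "AE w in M. 0 < E 0 w" by (subst (asm) AE_distr_iff) auto
	moreover
	have "AE w in M. \<forall>i. 0 < U i w" using U_pos by (simp add: AE_all_countable)
	ultimately show ?thesis using Tm_at_top E_pos unfolding good_def by eventually_elim simp
qed

lemma good_beyond: assumes "good w" obtains N0 where "!!N. N >= N0 ==> Tm N w > S"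
proof -
	have "eventually (%N. S + 1 <= Tm N w) sequentially" using assms by (simp add: good_def filterlim_at_top)
	then obtain N0 where "!!N. N >= N0 ==> S + 1 <= Tm N w" by (auto simp: eventually_sequentially)
	then have "!!N. N >= N0 ==> Tm N w > S" by (meson less_add_one less_le_trans)
	then show ?thesis by (rule that)
qed

lemma eta_finite:
	assumes "!!N. N >= N0 ==> Tm N w > real j * tau" "j ~= 0"
	shows "eta tau j w = (\<Sum>i<N0. U i w * (if (real j - 1) * tau < Tm (Suc i) w \<and> Tm (Suc i) w <= real j * tau
											then exp (Tm (Suc i) w - real j * tau) else 0))"
proof -
	have "\<not> Tm (Suc i) w <= real j * tau" if "i \<notin> {..<N0}" for i using assms(1)[of "Suc i"] that by simp
	then have "U i w * (if (real j - 1) * tau < Tm (Suc i) w \<and> Tm (Suc i) w <= real j * tau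
											then exp (Tm (Suc i) w - real j * tau) else 0) = 0" if "i \<notin> {..<N0}" for i using that by simp
	from suminf_finite[OF finite_lessThan this] show ?thesis unfolding eta_def using assms(2) by simp
qed

lemma eta_nonneg: assumes "good w" "j ~= 0" shows "eta tau j w >= 0"
proof -
	obtain N0 where "!!N. N >= N0 ==> Tm N w > real j * tau" using good_beyond[OF assms(1)] by blast
	from eta_finite[OF this assms(2)] show ?thesis using assms(1)
		by (auto intro!: sum_nonneg simp: good_def less_imp_le)
qed

lemma ou_X_eq:
	assumes g: "good w" and tau: "tau >= 0" and lt: "tau = lam * \<Delta>"
	shows "ou_X lam X0 E U (real j * \<Delta>) w = Xc tau j w"
proof -
	have lj: "lam * (real j * \<Delta>) = real j * tau" for j by (simp add: lt)
	have ou: "ou_X lam X0 E U (real j * \<Delta>) w = exp (- tau) ^ j * X0 w +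
			(\<Sum>i<N0. U i w * (if Tm (Suc i) w <= real j * tau then exp (Tm (Suc i) w - real j * tau) else 0))"
		if "!!N. N >= N0 ==> Tm N w > real j * tau" for j N0
	proof -
		have "\<not> Tm (Suc i) w <= real j * tau" if "i \<notin> {..<N0}" for i using that \<open>!!N. N >= N0 ==> _\<close>[of "Suc i"] by simp
		then have "(\<Sum>i. if jump_time E i w <= lam * (real j * \<Delta>) then exp (- (lam * (real j * \<Delta>) - jump_time E i w)) * U i w else 0)
			= (\<Sum>i<N0. if jump_time E i w <= lam * (real j * \<Delta>) then exp (- (lam * (real j * \<Delta>) - jump_time E i w)) * U i w else 0)"
			unfolding lj jump_time_eq by (intro suminf_finite) auto
		moreover have "exp (- lam * (real j * \<Delta>)) = exp (- tau) ^ j"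
			by (simp add: lt exp_of_nat_mult[symmetric] mult_ac)
		ultimately show ?thesis unfolding ou_X_def lj jump_time_eq by (auto intro!: sum.cong)
	qed
	show ?thesis
	proof (induction j)
		case 0
		obtain N0 where N0: "!!N. N >= N0 ==> Tm N w > real 0 * tau" using good_beyond[OF g] by blast
		have "\<not> Tm (Suc i) w <= 0" for i
		proof -
			have "E 0 w <= Tm (Suc i) w" unfolding Tm_def using g by (intro member_le_sum) (auto simp: good_def)
			then show ?thesis using g by (simp add: good_def)
		qed
		moreover have "ou_X lam X0 E U (real 0 * \<Delta>) w = exp (- tau) ^ 0 * X0 w +
			(\<Sum>i<N0. U i w * (if Tm (Suc i) w <= real 0 * tau then exp (Tm (Suc i) w - real 0 * tau) else 0))"
			by (rule ou[OF N0])
		ultimately show ?case by (simp add: Xc_def eta_def)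
	next
		case (Suc j)
		obtain N0 where N0: "!!N. N >= N0 ==> Tm N w > real (Suc j) * tau" using good_beyond[OF g] by blast
		have N1: "!!N. N >= N0 ==> Tm N w > real j * tau" using N0 tau by (smt (verit) mult_right_mono of_nat_Suc)
		have ee: "exp (Tm (Suc i) w - real (Suc j) * tau) = exp (- tau) * exp (Tm (Suc i) w - real j * tau)" for i
			by (simp add: algebra_simps flip: exp_add)
		have o1: "ou_X lam X0 E U (real (Suc j) * \<Delta>) w = exp (- tau) ^ Suc j * X0 w +
			(\<Sum>i<N0. U i w * (if Tm (Suc i) w <= real (Suc j) * tau then exp (Tm (Suc i) w - real (Suc j) * tau) else 0))"
			by (rule ou[OF N0])
		have o2: "ou_X lam X0 E U (real j * \<Delta>) w = exp (- tau) ^ j * X0 w +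
			(\<Sum>i<N0. U i w * (if Tm (Suc i) w <= real j * tau then exp (Tm (Suc i) w - real j * tau) else 0))"
			by (rule ou[OF N1])
		have o3: "eta tau (Suc j) w = (\<Sum>i<N0. U i w * (if (real (Suc j) - 1) * tau < Tm (Suc i) w \<and> Tm (Suc i) w <= real (Suc j) * tau
											then exp (Tm (Suc i) w - real (Suc j) * tau) else 0))"
			by (rule eta_finite[OF N0 Suc_not_Zero])
		have "ou_X lam X0 E U (real (Suc j) * \<Delta>) w = exp (- tau) * ou_X lam X0 E U (real j * \<Delta>) w + eta tau (Suc j) w"
			unfolding o1 o2 o3 distrib_left sum_distrib_left add.assoc sum.distrib[symmetric]
		proof (intro arg_cong2[where f="(+)"] sum.cong refl)
			fix i
			have "real j * tau <= real (Suc j) * tau" using tau by (intro mult_right_mono) auto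
			then show "U i w * (if Tm (Suc i) w <= real (Suc j) * tau then exp (Tm (Suc i) w - real (Suc j) * tau) else 0) =
				 exp (- tau) * (U i w * (if Tm (Suc i) w <= real j * tau then exp (Tm (Suc i) w - real j * tau) else 0)) +
				 U i w * (if (real (Suc j) - 1) * tau < Tm (Suc i) w \<and> Tm (Suc i) w <= real (Suc j) * tau then exp (Tm (Suc i) w - real (Suc j) * tau) else 0)"
				unfolding ee by (auto simp del: of_nat_Suc) (auto simp: of_nat_Suc)
		qed simp
		then show ?case unfolding Suc.IH Xc_Suc .
	qed
qed

lemma isCont_window: "s ~= a ==> s ~= b ==> isCont (%s::real. if a < s \<and> s <= b then exp (s - c) else 0 :: real) s"
proof -
	assume ab: "s ~= a" "s ~= b"
	consider "s < a" | "a < s" "s < b" | "a < s" "b < s" using ab by linarith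
	then show ?thesis
	proof cases
		case 1
		have "eventually (%x. x \<in> {..<a}) (nhds s)" using 1 by (intro eventually_nhds_in_open) auto
		then have "eventually (%x. (if a < x \<and> x <= b then exp (x - c) else 0) = 0) (nhds s)" by eventually_elim auto
		from isCont_cong[OF this] show ?thesis by simp
	next
		case 2
		have "eventually (%x. x \<in> {a<..<b}) (nhds s)" using 2 by (intro eventually_nhds_in_open) auto
		then have "eventually (%x. (if a < x \<and> x <= b then exp (x - c) else 0) = exp (x - c)) (nhds s)" by eventually_elim auto
		from isCont_cong[OF this] show ?thesis by (simp add: continuous_intros)
	next
		case 3
		have "eventually (%x. x \<in> {b<..}) (nhds s)" using 3 by (intro eventually_nhds_in_open) auto
		then have "eventually (%x. (if a < x \<and> x <= b then exp (x - c) else 0) = 0) (nhds s)" by eventually_elim auto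
		from isCont_cong[OF this] show ?thesis by simp
	qed
qed

text \<open>This is \<open>campbell\<close> with a weight that is \<open>v j\<close> times the
  discount factor on the window of step \<open>j\<close>. The windows are disjoint, so the exponent
  is a sum of integrals of the type in \<open>jump_integral\<close>. The product form yields both
  the laws of the innovations and their independence.\<close>

lemma eta_joint:
	assumes tau: "tau > 0"
	shows "(CLINT w|M. (\<Prod>j\<le>n. iexp (v j * eta tau j w))) = phi_stat k (v 0) * (\<Prod>j=1..n. exp (Psi (v j) - Psi (exp (- tau) * v j)))"
proof -
	let ?I = "%j s. if (real j - 1) * tau < s \<and> s <= real j * tau then exp (s - real j * tau) else 0 :: real"
	define wv where "wv s = (\<Sum>j=1..n. v j * ?I j s)" for s
	have wm: "wv \<in> borel_measurable borel" unfolding wv_def by measurable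
	have supp: "wv s = 0" if "s > real n * tau" for s
	proof -
		have "\<not> s <= real j * tau" if "j \<in> {1..n}" for j
		proof -
			have "real j * tau <= real n * tau" using that tau by (intro mult_right_mono) auto
			then show ?thesis using \<open>s > real n * tau\<close> by simp
		qed
		then show ?thesis unfolding wv_def by (intro sum.neutral) auto
	qed
	\<comment> \<open>The endpoints of all windows, the only places where the weight can jump.\<close>
	define B where "B = (%j. (real j - 1) * tau) ` {..n} \<union> (%j. real j * tau) ` {..n}"
	have fB: "finite B" by (simp add: B_def)
	have cw: "isCont wv s" if "s \<notin> B" for s
		unfolding wv_def
		by (intro continuous_sum continuous_mult continuous_const isCont_window) (use that in \<open>auto simp: B_def\<close>)
	have win: "wv s = v m * exp (s - real m * tau)" if m: "m \<in> {1..n}" and s: "(real m - 1) * tau < s" "s <= real m * tau" for m s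
	proof -
		have "?I j s = (if j = m then exp (s - real m * tau) else 0)" for j
		proof (cases "j = m")
			case False
			have "\<not> ((real j - 1) * tau < s \<and> s <= real j * tau)"
			proof
				assume "(real j - 1) * tau < s \<and> s <= real j * tau"
				then have "(real j - 1) * tau < real m * tau" "(real m - 1) * tau < real j * tau" using s by linarith+
				then have "real j - 1 < real m" "real m - 1 < real j" using tau by (simp_all only: mult_less_cancel_right)
				then show False using False by linarith
			qed
			then show ?thesis using False by simp
		qed (use s in simp)
		then have "wv s = (\<Sum>j=1..n. if j = m then v j * exp (s - real m * tau) else 0)"
			unfolding wv_def by (intro sum.cong refl) simp
		then show ?thesis using m by simp
	qed
	have int: "((%s. 1 - char F (wv s)) has_integral (\<Sum>j=1..m. - (Psi (v j) - Psi (exp (- tau) * v j)) / cplx \<alpha>)) {0..real m * tau}"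
		if "m <= n" for m
		using that
	proof (induction m)
		case 0 then show ?case by (simp add: has_integral_refl)
	next
		case (Suc m)
		let ?b = "real (Suc m) * tau"
		have "((%s. 1 - char F (v (Suc m) * exp (s - ?b))) has_integral
				 - (Psi (v (Suc m)) - Psi (v (Suc m) * exp (real m * tau - ?b))) / cplx \<alpha>) {real m * tau..?b}"
			using tau by (intro jump_integral) simp
		moreover have "v (Suc m) * exp (real m * tau - ?b) = exp (- tau) * v (Suc m)" by (simp add: algebra_simps)
		ultimately have "((%s. 1 - char F (v (Suc m) * exp (s - ?b))) has_integral
				 - (Psi (v (Suc m)) - Psi (exp (- tau) * v (Suc m))) / cplx \<alpha>) {real m * tau..?b}" by (simp only:)
		\<comment> \<open>The left endpoint belongs to the preceding window; a single point does not
		  affect the integral.\<close>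
		then have "((%s. 1 - char F (wv s)) has_integral
				 - (Psi (v (Suc m)) - Psi (exp (- tau) * v (Suc m))) / cplx \<alpha>) {real m * tau..?b}"
			by (rule has_integral_spike_finite[of "{real m * tau}", rotated 2]) (use Suc.prems win[of "Suc m"] in auto)
		moreover have "((%s. 1 - char F (wv s)) has_integral (\<Sum>j=1..m. - (Psi (v j) - Psi (exp (- tau) * v j)) / cplx \<alpha>)) {0..real m * tau}"
			using Suc by simp
		ultimately show ?case
			using tau has_integral_combine[of 0 "real m * tau" ?b] by (simp del: of_nat_Suc add: mult_right_mono)
	qed
	have "(CLINT w|M. (\<Prod>j\<le>n. iexp (v j * eta tau j w))) = (CLINT w|M. iexp (v 0 * X0 w + (\<Sum>j. U j w * wv (Tm (Suc j) w))))"
	proof (rule integral_cong_AE)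
		show "AE w in M. (\<Prod>j\<le>n. iexp (v j * eta tau j w)) = iexp (v 0 * X0 w + (\<Sum>j. U j w * wv (Tm (Suc j) w)))"
			using AE_good
		proof eventually_elim
			case (elim w)
			obtain N0 where N0: "!!N. N >= N0 ==> Tm N w > real n * tau" using good_beyond[OF elim] by blast
			have Nj: "Tm N w > real j * tau" if "j <= n" "N >= N0" for j N
			proof -
				have "real j * tau <= real n * tau" using that tau by (intro mult_right_mono) auto
				then show ?thesis using N0[OF that(2)] by linarith
			qed
			have "(\<Sum>j. U j w * wv (Tm (Suc j) w)) = (\<Sum>i<N0. U i w * wv (Tm (Suc i) w))"
				using N0 supp by (intro suminf_finite) auto
			also have "... = (\<Sum>i<N0. \<Sum>j=1..n. v j * (U i w * ?I j (Tm (Suc i) w)))"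
				unfolding wv_def by (simp add: sum_distrib_left mult_ac)
			also have "... = (\<Sum>j=1..n. v j * (\<Sum>i<N0. U i w * ?I j (Tm (Suc i) w)))"
				by (subst sum.swap) (simp add: sum_distrib_left)
			also have "... = (\<Sum>j=1..n. v j * eta tau j w)"
				using Nj by (intro sum.cong refl) (subst eta_finite[of N0], auto)
			finally have e: "(\<Sum>j. U j w * wv (Tm (Suc j) w)) = (\<Sum>j=1..n. v j * eta tau j w)" .
			have "{..n} = insert 0 {1..n}" by auto
			then have "(\<Sum>j\<le>n. v j * eta tau j w) = v 0 * X0 w + (\<Sum>j=1..n. v j * eta tau j w)" by (simp add: eta_def)
			then show ?case unfolding e by (simp add: exp_sum[symmetric] sum_distrib_left[symmetric] flip: of_real_sum of_real_mult of_real_add)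
		qed
		show "(%w. \<Prod>j\<le>n. iexp (v j * eta tau j w)) \<in> borel_measurable M" by measurable
		have [measurable]: "wv \<in> borel_measurable borel" by (rule wm)
		have [measurable]: "(%w. \<Sum>j. U j w * wv (Tm (Suc j) w)) \<in> borel_measurable M"
			by (intro borel_measurable_suminf) measurable
		show "(%w. iexp (v 0 * X0 w + (\<Sum>j. U j w * wv (Tm (Suc j) w)))) \<in> borel_measurable M" by measurable
	qed
	also have "... = phi_stat k (v 0) * exp (- cplx \<alpha> * integral {0..real n * tau} (%s. 1 - char F (wv s)))"
		using tau by (intro campbell[OF wm _ supp fB cw]) auto
	also have "integral {0..real n * tau} (%s. 1 - char F (wv s)) = (\<Sum>j=1..n. - (Psi (v j) - Psi (exp (- tau) * v j)) / cplx \<alpha>)"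
		using int[of n] by (simp add: integral_unique)
	also have "- cplx \<alpha> * (\<Sum>j=1..n. - (Psi (v j) - Psi (exp (- tau) * v j)) / cplx \<alpha>)
		 = (\<Sum>j=1..n. Psi (v j) - Psi (exp (- tau) * v j))"
		unfolding sum_distrib_left using alpha_pos by (intro sum.cong refl) simp
	finally show ?thesis by (simp add: exp_sum)
qed

lemma Psi_0: "Psi 0 = 0" by (simp add: Psi_def)

lemma char_X0: "(CLINT w|M. iexp (t * X0 w)) = phi_stat k t"
	unfolding X0_char[symmetric] char_def by (subst integral_distr) auto

lemma char_eta:
	assumes tau: "tau > 0"
	shows "(CLINT w|M. iexp (t * eta tau j w)) = (if j = 0 then phi_stat k t else exp (Psi t - Psi (exp (- tau) * t)))"
proof (cases "j = 0")
	case True then show ?thesis using char_X0 by (simp add: eta_def)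
next
	case False
	let ?v = "%i. if i = j then t else 0"
	have "(\<Prod>i\<le>j. iexp (?v i * eta tau i w)) = iexp (t * eta tau j w)" for w
		by (subst prod.remove[of _ j]) (auto intro!: prod.neutral)
	then have "(CLINT w|M. iexp (t * eta tau j w)) = phi_stat k (?v 0) * (\<Prod>i=1..j. exp (Psi (?v i) - Psi (exp (- tau) * ?v i)))"
		using eta_joint[OF tau, of ?v j] by simp
	also have "... = exp (Psi t - Psi (exp (- tau) * t))"
		using False by (subst prod.remove[of _ j]) (auto intro!: prod.neutral simp: Psi_0 phi_stat_eq)
	finally show ?thesis using False by simp
qed

lemma indep_eta: assumes tau: "tau > 0" shows "indep_vars (%_. borel) (eta tau) {..n}"
proof (rule indep_vars_if_char_factorizes)
	fix v
	have st: "{..n} = insert 0 {1..n}" and n0: "0 \<notin> {1..n}" by auto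
	have e: "(\<Prod>j=1..n. if j = 0 then phi_stat k (v j) else exp (Psi (v j) - Psi (exp (- tau) * v j)))
		 = (\<Prod>j=1..n. exp (Psi (v j) - Psi (exp (- tau) * v j)))" by (intro prod.cong) auto
	show "(CLINT w|M. \<Prod>j\<in>{..n}. iexp (v j * eta tau j w)) = (\<Prod>j\<in>{..n}. CLINT w|M. iexp (v j * eta tau j w))"
		using eta_joint[OF tau, of v n] unfolding char_eta[OF tau] st prod.insert[OF finite_atLeastAtMost n0] e by simp
qed auto

text \<open>Stationarity by telescoping: the innovations after the start contribute
  \<open>Psi t - Psi (t * exp (- tau) ^ j)\<close> in total, and the initial value contributes the
  subtracted term.\<close>

lemma char_Xc: assumes tau: "tau > 0" shows "(CLINT w|M. iexp (t * Xc tau j w)) = phi_stat k t"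
proof -
	let ?r = "exp (- tau)"
	have "iexp (t * Xc tau j w) = (\<Prod>i\<le>j. iexp ((t * ?r ^ (j - i)) * eta tau i w))" for w
	proof -
		have "t * Xc tau j w = (\<Sum>i\<le>j. (t * ?r ^ (j - i)) * eta tau i w)"
			unfolding Xc_def by (simp add: sum_distrib_left mult_ac)
		then show ?thesis by (simp only: of_real_sum sum_distrib_left exp_sum finite_atMost)
	qed
	then have "(CLINT w|M. iexp (t * Xc tau j w)) = phi_stat k (t * ?r ^ j) * (\<Prod>i=1..j. exp (Psi (t * ?r ^ (j - i)) - Psi (?r * (t * ?r ^ (j - i)))))"
		using eta_joint[OF tau, of "%i. t * ?r ^ (j - i)" j] by simp
	also have "... = exp (Psi (t * ?r ^ j) + (\<Sum>i=1..j. Psi (t * ?r ^ (j - i)) - Psi (?r * (t * ?r ^ (j - i)))))"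
		by (simp add: phi_stat_eq exp_add exp_sum)
	also have "(\<Sum>i=1..j. Psi (t * ?r ^ (j - i)) - Psi (?r * (t * ?r ^ (j - i)))) = Psi t - Psi (t * ?r ^ j)"
	proof -
		have "(\<Sum>i=1..m. Psi (t * ?r ^ (j - i)) - Psi (?r * (t * ?r ^ (j - i)))) = Psi (t * ?r ^ (j - m)) - Psi (t * ?r ^ j)" if "m <= j" for m
			using that
		proof (induction m)
			case (Suc m)
			have "?r * (t * ?r ^ (j - Suc m)) = t * ?r ^ (j - m)" using Suc.prems
				by (simp add: Suc_diff_Suc mult.left_commute flip: power_Suc)
			moreover have "(\<Sum>i=1..Suc m. g i) = (\<Sum>i=1..m. g i) + g (Suc m)" for g :: "nat => complex" by simp
			moreover have "(\<Sum>i=1..m. Psi (t * ?r ^ (j - i)) - Psi (?r * (t * ?r ^ (j - i)))) = Psi (t * ?r ^ (j - m)) - Psi (t * ?r ^ j)"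
				using Suc by simp
			ultimately show ?case by (simp only:) simp
		qed simp
		from this[of j] show ?thesis by simp
	qed
	finally show ?thesis by (simp add: phi_stat_eq)
qed

lemma distr_Xc: assumes tau: "tau > 0" shows "distr M borel (Xc tau j) = distr M borel X0"
proof (rule Levy_uniqueness)
	show "char (distr M borel (Xc tau j)) = char (distr M borel X0)"
		unfolding fun_eq_iff X0_char using char_Xc[OF tau] by (simp add: char_def integral_distr)
qed (auto intro!: real_distribution_distr)

text \<open>\<open>Xc tau 1\<close> has the law of \<open>X0\<close> and is at least
  \<open>exp (- tau) * X0\<close>, the innovation being nonnegative. So the probability of a value
  below \<open>- a\<close> is at most that of a value below \<open>- (a * exp tau)\<close>, and
  \<open>tau\<close> is arbitrary.\<close>

lemma X0_nonneg: "AE w in M. X0 w >= 0"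
proof -
	have tail: "prob {w\<in>space M. X0 w < - a} <= prob {w\<in>space M. X0 w < - (a * exp tau)}" if "tau > 0" "a > 0" for a tau
	proof -
		have "prob {w\<in>space M. X0 w < - a} = measure (distr M borel X0) {..<- a}" by (subst measure_distr) (auto intro!: arg_cong[where f=prob])
		also have "... = prob {w\<in>space M. Xc tau 1 w < - a}"
			unfolding distr_Xc[OF that(1), of 1, symmetric] by (subst measure_distr) (auto intro!: arg_cong[where f=prob])
		also have "... <= prob {w\<in>space M. X0 w < - (a * exp tau)}"
		proof (rule finite_measure_mono_AE)
			show "AE w in M. w \<in> {w\<in>space M. Xc tau 1 w < - a} \<longrightarrow> w \<in> {w\<in>space M. X0 w < - (a * exp tau)}"
				using AE_good
			proof eventually_elim
				case (elim w)
				have "Xc tau 1 w = exp (- tau) * X0 w + eta tau 1 w" by (simp add: Xc_def eta_def)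
				moreover have "eta tau 1 w >= 0" using elim by (intro eta_nonneg) auto
				ultimately have "Xc tau 1 w < - a ==> exp (- tau) * X0 w < - a" by linarith
				then show ?case by (auto simp: exp_minus field_simps)
			qed
		qed measurable
		finally show ?thesis .
	qed
	have "prob {w\<in>space M. X0 w < - a} = 0" if a: "a > 0" for a
	proof -
		let ?A = "%n::nat. {w\<in>space M. X0 w < - (a * real (Suc n))}"
		have "(%n. prob (?A n)) \<longlonglongrightarrow> prob (\<Inter>n. ?A n)"
			using a by (intro finite_Lim_measure_decseq) (auto simp: decseq_def intro: less_le_trans)
		moreover have "(\<Inter>n. ?A n) = {}"
		proof safe
			fix w assume "w \<in> (\<Inter>n. ?A n)"
			then have *: "X0 w < - (a * real (Suc n))" for n by auto
			obtain n where "- X0 w / a < real n" using reals_Archimedean2 by blast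
			then have "- X0 w < a * real n" using a by (simp add: field_simps)
			also have "... <= a * real (Suc n)" using a by simp
			finally show "w \<in> {}" using *[of n] by simp
		qed
		ultimately have lim: "(%n. prob (?A n)) \<longlonglongrightarrow> 0" by simp
		have "prob {w\<in>space M. X0 w < - a} <= prob (?A (Suc n))" for n
			using tail[of "ln (real (Suc (Suc n)))" a] a by simp
		then have "prob {w\<in>space M. X0 w < - a} <= 0"
			using LIMSEQ_le_const[OF LIMSEQ_Suc[OF lim]] by blast
		then show ?thesis using measure_nonneg[of M] by (simp add: antisym)
	qed
	note null = this
	have "AE w in M. \<not> X0 w < - (1 / real (Suc n))" for n
	proof -
		have "{w\<in>space M. X0 w < - (1 / real (Suc n))} \<in> null_sets M"
			using null[of "1 / real (Suc n)"] by (simp add: null_sets_def emeasure_eq_measure)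
		from AE_not_in[OF this] AE_space show ?thesis by eventually_elim simp
	qed
	then have "AE w in M. \<forall>n. \<not> X0 w < - (1 / real (Suc n))" unfolding AE_all_countable by (rule allI)
	then show ?thesis
	proof eventually_elim
		case (elim w)
		show ?case
		proof (rule ccontr)
			assume "\<not> 0 <= X0 w"
			then obtain n where "inverse (real (Suc n)) < - X0 w" using reals_Archimedean[of "- X0 w"] by auto
			then show False using elim[rule_format, of n] by (simp add: inverse_eq_divide)
		qed
	qed
qed

end

section \<open>Modulus, derivatives and moments of the stationary law\<close>

locale ou_stat = ou_process +
	fixes d1 d2 :: "real => complex" and Ck :: real
	assumes phik_d1: "!!u. (phi_k k has_vector_derivative d1 u) (at u)"
		and phik_d2: "!!u. (d1 has_vector_derivative d2 u) (at u)"
		and phik_b: "!!u. cmod (phi_k k u) <= Ck / (1 + \<bar>u\<bar>)"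
		and phik_b1: "!!u. cmod (d1 u) <= Ck / (1 + \<bar>u\<bar>)\<^sup>2"
		and phik_b2: "!!u. cmod (d2 u) <= Ck / (1 + \<bar>u\<bar>)\<^sup>2"
		and alpha2: "2 < \<alpha>"
		and ratio: "!!c. c > 0 ==> ((%t. cmod (phi_stat k (c * t)) / cmod (phi_stat k t)) \<longlongrightarrow> c powr (- \<alpha>)) at_top"
begin

abbreviation "phi \<equiv> phi_stat k"
abbreviation "phik \<equiv> phi_k k"

definition md :: "real => real" where "md t = cmod (phi t)"

lemma phi_nz [simp]: "phi t ~= 0" by (simp add: phi_stat_eq)

lemma md_pos: "0 < md t" by (simp add: md_def)

lemma phi_0 [simp]: "phi 0 = 1" by (simp add: phi_stat_eq Psi_0)

lemma phi_minus: "phi (- t) = cnj (phi t)"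
proof -
	have "cnj (CLINT w|M. iexp (t * X0 w)) = (CLINT w|M. cnj (iexp (t * X0 w)))"
		by (rule Bochner_Integration.integral_cnj[symmetric])
	also have "... = (CLINT w|M. iexp ((- t) * X0 w))"
		by (intro Bochner_Integration.integral_cong refl) (simp add: exp_cnj)
	finally show ?thesis unfolding char_X0 by simp
qed

lemma md_minus [simp]: "md (- t) = md t" by (simp add: md_def phi_minus)

lemma md_abs: "md \<bar>t\<bar> = md t" by (simp add: abs_if)

lemma phi_deriv: "(phi has_vector_derivative \<i> * phik t * phi t) (at t)"
proof -
	have "((exp \<circ> Psi) has_vector_derivative (\<i> * phik t) * exp (Psi t)) (at t)"
		by (rule field_vector_diff_chain_at[OF Psi_deriv DERIV_exp])
	moreover have "exp \<circ> Psi = phi" by (auto simp: phi_stat_eq)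
	ultimately show ?thesis by (simp add: phi_stat_eq)
qed

lemma phi_cont: "continuous_on A phi"
	by (intro continuous_at_imp_continuous_on ballI) (use phi_deriv has_vector_derivative_continuous in blast)

lemma phik_cont: "continuous_on A phik"
	by (intro continuous_at_imp_continuous_on ballI) (use phik_d1 has_vector_derivative_continuous in blast)

lemma phi_meas [measurable]: "phi \<in> borel_measurable borel" "phik \<in> borel_measurable borel" "md \<in> borel_measurable borel"
	unfolding md_def using phi_cont phik_cont by (auto intro!: borel_measurable_continuous_onI continuous_intros)

lemma norm_char_le_1: "cmod (CLINT w|M. iexp (t * Y w)) <= 1"
	using norm_integral_le[of M "%_. 1" "%w. iexp (t * Y w)"] by (simp add: prob_space)

lemma md_le_1: "md t <= 1" unfolding md_def char_X0[symmetric] by (rule norm_char_le_1)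

text \<open>For \<open>0 < s < t\<close> the quotient \<open>phi t / phi s\<close> is the
  characteristic function of the innovation over a step of length \<open>ln (t / s)\<close>, so its
  modulus is at most 1.\<close>

lemma md_dec: assumes "0 <= s" "s <= t" shows "md t <= md s"
proof -
	consider "s = 0" | "s = t" | "0 < s" "s < t" using assms by linarith
	then show ?thesis
	proof cases
		case 1 then show ?thesis using md_le_1 by (simp add: md_def)
	next
		case 3
		define tau where "tau = ln (t / s)"
		have tau: "tau > 0" "exp (- tau) * t = s" using 3 by (auto simp: tau_def exp_minus)
		have "cmod (exp (Psi t - Psi s)) <= 1"
			using norm_char_le_1[of t "eta tau 1"] char_eta[OF tau(1), of t 1] tau(2) by simp
		then have "cmod (exp (Psi t)) <= cmod (exp (Psi s))" by (simp add: exp_diff norm_divide divide_le_eq)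
		then show ?thesis by (simp add: md_def phi_stat_eq)
	qed simp
qed

lemma md_dec_abs: "\<bar>s\<bar> <= \<bar>t\<bar> ==> md t <= md s"
	using md_dec[of "\<bar>s\<bar>" "\<bar>t\<bar>"] by (simp add: md_abs)

lemma md_ratio2: "((%t. md (2 * t) / md t) \<longlongrightarrow> 2 powr (- \<alpha>)) at_top"
	unfolding md_def using ratio[of 2] by simp

text \<open>The exponent 2 is admissible because \<open>2 < \<alpha>\<close>. It makes
  \<open>phi\<close> integrable and provides the decay needed for the lagged covariances.\<close>

lemma md_potter: "\<exists>C\<ge>1. \<forall>s t. \<bar>s\<bar> <= \<bar>t\<bar> \<longrightarrow> md t <= C * ((1 + \<bar>s\<bar>) / (1 + \<bar>t\<bar>))\<^sup>2 * md s"
proof -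
	obtain C where C: "C >= 1" "!!s t. 0 <= s ==> s <= t ==> md t <= C * ((1 + s) / (1 + t)) powr 2 * md s"
		using potter_upper[OF md_pos md_dec md_ratio2, of 2] alpha2 by auto
	have "md t <= C * ((1 + \<bar>s\<bar>) / (1 + \<bar>t\<bar>))\<^sup>2 * md s" if "\<bar>s\<bar> <= \<bar>t\<bar>" for s t
	proof -
		have "((1 + \<bar>s\<bar>) / (1 + \<bar>t\<bar>)) powr 2 = ((1 + \<bar>s\<bar>) / (1 + \<bar>t\<bar>))\<^sup>2"
			using powr_realpow[of "(1 + \<bar>s\<bar>) / (1 + \<bar>t\<bar>)" 2] by (simp add: add_pos_nonneg)
		then show ?thesis using C(2)[of "\<bar>s\<bar>" "\<bar>t\<bar>"] that by (simp add: md_abs)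
	qed
	then show ?thesis using C(1) by blast
qed

text \<open>A fixed witness of \<open>md_potter\<close>, named so that later constants can be
  defined from it.\<close>

definition CP :: real where
	"CP = (SOME C. C >= 1 \<and> (\<forall>s t. \<bar>s\<bar> <= \<bar>t\<bar> \<longrightarrow> md t <= C * ((1 + \<bar>s\<bar>) / (1 + \<bar>t\<bar>))\<^sup>2 * md s))"

lemma CP: "CP >= 1" "\<bar>s\<bar> <= \<bar>t\<bar> ==> md t <= CP * ((1 + \<bar>s\<bar>) / (1 + \<bar>t\<bar>))\<^sup>2 * md s"
proof -
	have "CP >= 1 \<and> (\<forall>s t. \<bar>s\<bar> <= \<bar>t\<bar> \<longrightarrow> md t <= CP * ((1 + \<bar>s\<bar>) / (1 + \<bar>t\<bar>))\<^sup>2 * md s)"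
		unfolding CP_def using md_potter by (rule someI_ex)
	then show "CP >= 1" "\<bar>s\<bar> <= \<bar>t\<bar> ==> md t <= CP * ((1 + \<bar>s\<bar>) / (1 + \<bar>t\<bar>))\<^sup>2 * md s" by blast+
qed

lemma md_le: "md t <= CP / (1 + \<bar>t\<bar>)\<^sup>2"
	using CP(2)[of 0 t] md_le_1[of 0] by (simp add: power_divide md_def)

lemma integrable_inverse_square: "integrable lborel (%t::real. 1 / (1 + \<bar>t\<bar>)\<^sup>2)"
proof -
	have "set_integrable lborel {0..} (%t::real. 1 / (1 + t)\<^sup>2)"
	proof -
		have "((%y::real. - (1 / (1 + y))) \<longlongrightarrow> 0) at_top"
			using tendsto_minus[OF tendsto_inverse_0_at_top[OF filterlim_tendsto_add_at_top[OF tendsto_const[of 1] filterlim_ident]]]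
			by (simp add: inverse_eq_divide)
		moreover have "((%t. - (1 / (1 + t))) has_real_derivative 1 / (1 + t)\<^sup>2) (at t)" if "t >= 0" for t :: real
			using that by (auto intro!: derivative_eq_intros simp: field_simps power2_eq_square)
		ultimately have "(\<integral>\<^sup>+t. ennreal (1 / (1 + t)\<^sup>2) * indicator {0..} t \<partial>lborel) = ennreal (0 - - (1 / (1 + 0)))"
			by (intro nn_integral_FTC_atLeast) auto
		moreover have "ennreal (1 / (1 + t)\<^sup>2) * indicator {0..} t = ennreal (indicator {0..} t *\<^sub>R (1 / (1 + t)\<^sup>2))" for t :: real
			by (auto simp: indicator_def)
		ultimately show ?thesis unfolding set_integrable_def by (intro integrableI_nonneg) auto
	qed
	then have i1: "integrable lborel (%t. indicator {0..} t *\<^sub>R (1 / (1 + t)\<^sup>2) :: real)" by (simp add: set_integrable_def)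
	have i2: "integrable lborel (%t. indicator {0..} (- t) *\<^sub>R (1 / (1 + (- t))\<^sup>2) :: real)"
		using lborel_integrable_real_affine[OF i1, of "-1" 0] by simp
	show ?thesis
		by (rule Bochner_Integration.integrable_bound[OF Bochner_Integration.integrable_add[OF i1 i2]])
			 (auto simp: indicator_def)
qed

lemma md_integrable: "integrable lborel md"
	by (rule Bochner_Integration.integrable_bound[OF integrable_mult_right[OF integrable_inverse_square, of CP]])
		 (use md_le CP(1) in \<open>auto simp: abs_of_pos[OF md_pos] intro!: AE_I2\<close>)

lemma Ck_nonneg: "0 <= Ck"
	using order_trans[OF norm_ge_zero phik_b[of 0]] by simp

lemma phik_le: "cmod (phik u) <= Ck"
proof -
	have "Ck / (1 + \<bar>u\<bar>) <= Ck / 1" using Ck_nonneg by (intro divide_left_mono) auto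
	then show ?thesis using phik_b[of u] by simp
qed

lemma d1_le: "cmod (d1 u) <= Ck" "cmod (d2 u) <= Ck"
proof -
	have "Ck / (1 + \<bar>u\<bar>)\<^sup>2 <= Ck / 1" using Ck_nonneg by (intro divide_left_mono) auto
	then show "cmod (d1 u) <= Ck" "cmod (d2 u) <= Ck" using phik_b1[of u] phik_b2[of u] by auto
qed

text \<open>The first three derivatives of \<open>phi\<close>, from
  \<open>phi' = \<i> * phik * phi\<close> and the derivatives \<open>d1\<close>, \<open>d2\<close>
  of \<open>phik\<close>.\<close>

definition f1 where "f1 t = \<i> * phik t * phi t"
definition f2 where "f2 t = (\<i> * d1 t - phik t * phik t) * phi t"
definition f3 where "f3 t = (\<i> * d2 t - 2 * phik t * d1 t) * phi t + (\<i> * d1 t - phik t * phik t) * f1 t"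

lemma f1_deriv: "(f1 has_vector_derivative f2 t) (at t)"
	unfolding f1_def f2_def
	by (rule has_vector_derivative_eq_rhs[OF has_vector_derivative_mult[OF has_vector_derivative_mult_right[OF phik_d1] phi_deriv]])
		 (simp add: algebra_simps)

lemma f2_deriv: "(f2 has_vector_derivative f3 t) (at t)"
	unfolding f2_def f3_def f1_def
	by (rule has_vector_derivative_eq_rhs[OF has_vector_derivative_mult[OF has_vector_derivative_diff[OF
				has_vector_derivative_mult_right[OF phik_d2] has_vector_derivative_mult[OF phik_d1 phik_d1]] phi_deriv]])
		 (simp add: algebra_simps)

lemma f3_bound: "cmod (f3 t) <= Ck + 3 * Ck\<^sup>2 + Ck ^ 3"
proof -
	have p1: "cmod (phi t) <= 1" using md_le_1 by (simp add: md_def)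
	have q: "cmod (phik t * phik t) <= Ck\<^sup>2" unfolding norm_mult power2_eq_square by (intro mult_mono phik_le) (auto simp: Ck_nonneg)
	have q2: "cmod (2 * phik t * d1 t) <= 2 * Ck\<^sup>2"
		unfolding norm_mult power2_eq_square using mult_mono[OF phik_le d1_le(1), of t t] Ck_nonneg by simp
	have a: "cmod (\<i> * d2 t - 2 * phik t * d1 t) <= Ck + 2 * Ck\<^sup>2"
		using norm_triangle_ineq4[of "\<i> * d2 t" "2 * phik t * d1 t"] q2 d1_le(2)[of t] by (simp add: norm_mult)
	have b: "cmod (\<i> * d1 t - phik t * phik t) <= Ck + Ck\<^sup>2"
		using norm_triangle_ineq4[of "\<i> * d1 t" "phik t * phik t"] q d1_le(1)[of t] by (simp add: norm_mult)
	have c: "cmod (f1 t) <= Ck" unfolding f1_def norm_mult using mult_mono[OF phik_le p1, of t] Ck_nonneg by simp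
	have "cmod (f3 t) <= (Ck + 2 * Ck\<^sup>2) * 1 + (Ck + Ck\<^sup>2) * Ck"
		unfolding f3_def
		by (intro order_trans[OF norm_triangle_ineq] add_mono; unfold norm_mult[of _ "phi t"] norm_mult[of _ "f1 t"];
				intro mult_mono a b c p1) (use Ck_nonneg in auto)
	then show ?thesis by (simp add: algebra_simps power2_eq_square power3_eq_cube)
qed

definition C3 :: real where "C3 = Ck + 3 * Ck\<^sup>2 + Ck ^ 3"

lemma Re_deriv: "(f has_vector_derivative D) (at t) ==> ((%t. Re (f t)) has_real_derivative Re D) (at t)"
	unfolding has_real_derivative_iff_has_vector_derivative
	by (rule bounded_linear.has_vector_derivative[OF bounded_linear_Re])

text \<open>There is no linear term because \<open>phik 0\<close> is real, so that
  \<open>phi'\<close> is imaginary at 0. Both the second moment and the tail of \<open>X0\<close>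
  are read off from this expansion.\<close>

lemma Re_phi_taylor: "\<bar>Re (phi t) - (1 + Re (f2 0) / 2 * t\<^sup>2)\<bar> <= C3 * \<bar>t\<bar> ^ 3 / 6"
proof (cases "t = 0")
	case False
	define D where "D m = (%t. Re ((if m = 0 then phi else if m = 1 then f1 else if m = 2 then f2 else f3) t))" for m :: nat
	have D: "(D m has_real_derivative D (Suc m) u) (at u)" if "m < 3" for m u
	proof -
		have "m = 0 \<or> m = 1 \<or> m = 2" using that by presburger
		then consider "m = 0" | "m = 1" | "m = 2" by blast
		then show ?thesis unfolding D_def
		proof cases
			case 1 then show "((%t. Re ((if m = 0 then phi else if m = 1 then f1 else if m = 2 then f2 else f3) t)) has_real_derivative Re ((if Suc m = 0 then phi else if Suc m = 1 then f1 else if Suc m = 2 then f2 else f3) u)) (at u)"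
				using Re_deriv[OF phi_deriv[of u, folded f1_def]] by simp
		next
			case 2 then show "((%t. Re ((if m = 0 then phi else if m = 1 then f1 else if m = 2 then f2 else f3) t)) has_real_derivative Re ((if Suc m = 0 then phi else if Suc m = 1 then f1 else if Suc m = 2 then f2 else f3) u)) (at u)"
				using Re_deriv[OF f1_deriv[of u]] by simp
		next
			case 3 then show "((%t. Re ((if m = 0 then phi else if m = 1 then f1 else if m = 2 then f2 else f3) t)) has_real_derivative Re ((if Suc m = 0 then phi else if Suc m = 1 then f1 else if Suc m = 2 then f2 else f3) u)) (at u)"
				using Re_deriv[OF f2_deriv[of u]] by simp
		qed
	qed
	have "\<exists>u. (if t < 0 then t < u \<and> u < 0 else 0 < u \<and> u < t) \<and>
		 D 0 t = (\<Sum>m<3. D m 0 / fact m * (t - 0) ^ m) + D 3 u / fact 3 * (t - 0) ^ 3"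
		by (rule Taylor[of 3 D "D 0" "- \<bar>t\<bar>" "\<bar>t\<bar>"]) (use D False in auto)
	then obtain u where u: "D 0 t = (\<Sum>m<3. D m 0 / fact m * t ^ m) + D 3 u / fact 3 * t ^ 3" by auto
	have k0: "Re (f1 0) = 0"
	proof -
		have "phik 0 = cplx (LINT x|lborel. k x)" unfolding phi_k_eq by simp
		then show ?thesis by (simp add: f1_def)
	qed
	have e: "Re (phi t) - (1 + Re (f2 0) / 2 * t\<^sup>2) = Re (f3 u) * (t ^ 3 / 6)"
		using u k0 by (simp add: D_def eval_nat_numeral)
	have "\<bar>Re (phi t) - (1 + Re (f2 0) / 2 * t\<^sup>2)\<bar> = \<bar>Re (f3 u)\<bar> * (\<bar>t\<bar> ^ 3 / 6)"
		unfolding e by (simp add: abs_mult power_abs)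
	also have "... <= C3 * (\<bar>t\<bar> ^ 3 / 6)"
		using f3_bound[of u] abs_Re_le_cmod[of "f3 u"] by (intro mult_right_mono) (auto simp: C3_def)
	finally show ?thesis by simp
qed simp

lemma integrable_bounded_rv: "f \<in> borel_measurable M ==> (!!w. norm (f w) <= B) ==> integrable M f"
	for f :: "'a => 'c::{banach, second_countable_topology}"
	by (intro integrable_const_bound[of _ B]) auto

lemma expectation_cos: "expectation (%w. cos (t * X0 w)) = Re (phi t)"
proof -
	have "Re (phi t) = (LINT w|M. Re (iexp (t * X0 w)))"
		unfolding char_X0[symmetric] by (rule integral_Re[symmetric]) (rule integrable_iexp_rv, simp)
	also have "... = expectation (%w. cos (t * X0 w))"
		by (intro Bochner_Integration.integral_cong refl) (simp add: Re_exp)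
	finally show ?thesis by simp
qed

text \<open>With \<open>N = Suc n\<close>, the function \<open>2 * N^2 * (1 - cos (X0 / N))\<close>
  tends to \<open>X0^2\<close> and has bounded mean by the Taylor bound, so Fatou's lemma
  applies.\<close>

lemma X0_square_integrable: "integrable M (%w. (X0 w)\<^sup>2)"
proof -
	define K where "K = \<bar>Re (f2 0)\<bar> + C3"
	have C3: "0 <= C3" using Ck_nonneg by (simp add: C3_def)
	let ?g = "%n w. 2 * (real (Suc n))\<^sup>2 * (1 - cos (1 / real (Suc n) * X0 w))"
	have bound: "expectation (?g n) <= K" for n
	proof -
		let ?t = "1 / real (Suc n)"
		have i: "integrable M (%w. cos (?t * X0 w))" by (rule integrable_bounded_rv[of _ 1]) auto
		have e: "expectation (?g n) = 2 * (real (Suc n))\<^sup>2 * (1 - Re (phi ?t))"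
			using i expectation_cos[of ?t] by (simp add: prob_space del: of_nat_Suc)
		have "1 - Re (phi ?t) <= \<bar>Re (f2 0)\<bar> / 2 * ?t\<^sup>2 + C3 * \<bar>?t\<bar> ^ 3 / 6"
		proof -
			have "- Re (f2 0) / 2 * ?t\<^sup>2 <= \<bar>Re (f2 0)\<bar> / 2 * ?t\<^sup>2" by (intro mult_right_mono) auto
			then show ?thesis using Re_phi_taylor[of ?t] by linarith
		qed
		moreover have "C3 * \<bar>?t\<bar> ^ 3 / 6 <= C3 / 2 * ?t\<^sup>2"
		proof -
			have "\<bar>?t\<bar> ^ 3 <= ?t\<^sup>2" using power_decreasing[of 2 3 "?t"] by simp
			then have "C3 * \<bar>?t\<bar> ^ 3 <= C3 * ?t\<^sup>2" using C3 by (rule mult_left_mono)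
			moreover have "0 <= C3 * ?t\<^sup>2" using C3 by simp
			ultimately show ?thesis by linarith
		qed
		ultimately have "1 - Re (phi ?t) <= (K / 2) * ?t\<^sup>2"
			unfolding K_def add_divide_distrib distrib_right by linarith
		then have "2 * (real (Suc n))\<^sup>2 * (1 - Re (phi ?t)) <= 2 * (real (Suc n))\<^sup>2 * ((K / 2) * ?t\<^sup>2)"
			by (intro mult_left_mono) auto
		also have "... = K" by (simp add: power_divide)
		finally show ?thesis using e by simp
	qed
	have lim: "(%n. ?g n w) \<longlonglongrightarrow> (X0 w)\<^sup>2" for w
	proof -
		have "(%n. 2 * (1 - cos (1 / real (Suc n) * X0 w)) / (1 / real (Suc n))\<^sup>2) \<longlonglongrightarrow> (X0 w)\<^sup>2"
		proof -
			have sl: "((%t::real. 2 * (1 - cos (t * x)) / t\<^sup>2) \<longlongrightarrow> x\<^sup>2) (at 0)" for x :: real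
			proof -
				\<comment> \<open>The half-angle formula reduces the limit to the derivative of the sine at
				  0.\<close>
				have sq: "2 * (1 - cos (t * x)) = (2 * sin (t * x / 2))\<^sup>2" for t
					using cos_double_sin[of "t * x / 2"] by (simp add: power_mult_distrib)
				have "((%t::real. sin (t * (x / 2))) has_real_derivative (x / 2)) (at 0)"
					by (auto intro!: derivative_eq_intros)
				then have "((%t. (sin (t * (x / 2)) - sin (0 * (x / 2))) / (t - 0)) \<longlongrightarrow> x / 2) (at 0)"
					unfolding has_field_derivative_iff .
				then have l: "((%t. sin (t * x / 2) / t) \<longlongrightarrow> x / 2) (at 0)" by simp
				have "((%t. (2 * (sin (t * x / 2) / t))\<^sup>2) \<longlongrightarrow> (2 * (x / 2))\<^sup>2) (at 0)"
					by (rule tendsto_power[OF tendsto_mult[OF tendsto_const l]])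
				then show ?thesis unfolding sq by (simp add: power_divide power_mult_distrib)
			qed
			have "filterlim (%n. 1 / real (Suc n)) (at 0) sequentially"
				unfolding filterlim_at using LIMSEQ_inverse_real_of_nat by (simp add: inverse_eq_divide)
			from filterlim_compose[OF sl this] show ?thesis .
		qed
		moreover have "2 * (1 - cos (1 / real (Suc n) * X0 w)) / (1 / real (Suc n))\<^sup>2 = ?g n w" for n
			by (simp add: power_divide del: of_nat_Suc)
		ultimately show ?thesis by (simp only:)
	qed
	have g0: "0 <= ?g n w" for n w by simp
	have ig: "integrable M (?g n)" for n
		by (intro integrable_mult_right Bochner_Integration.integrable_diff integrable_bounded_rv[of _ 1]) auto
	have "(\<integral>\<^sup>+w. ennreal ((X0 w)\<^sup>2) \<partial>M) = (\<integral>\<^sup>+w. liminf (%n. ennreal (?g n w)) \<partial>M)"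
		by (intro nn_integral_cong) (rule lim_imp_Liminf[symmetric], simp, intro tendsto_ennrealI lim)
	also have "... <= liminf (%n. \<integral>\<^sup>+w. ennreal (?g n w) \<partial>M)"
		by (rule nn_integral_liminf) measurable
	also have "(%n. \<integral>\<^sup>+w. ennreal (?g n w) \<partial>M) = (%n. ennreal (expectation (?g n)))"
		by (rule ext) (rule nn_integral_eq_integral[OF ig], use g0 in simp)
	also have "liminf (%n. ennreal (expectation (?g n))) <= ennreal K"
		by (rule Liminf_le) (use bound in \<open>auto intro!: always_eventually ennreal_leI\<close>)
	also have "... < \<infinity>" by simp
	finally show ?thesis by (intro integrableI_bounded) auto
qed

lemma abs_le_one_plus_square: "\<bar>x::real\<bar> <= 1 + x\<^sup>2"
	using zero_le_power2[of "\<bar>x\<bar> - 1"] abs_ge_zero[of x] unfolding power2_diff power2_abs one_power2 by linarith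

lemma X0_integrable: "integrable M X0"
	by (rule Bochner_Integration.integrable_bound[OF Bochner_Integration.integrable_add[OF integrable_const[of 1] X0_square_integrable]])
		 (use abs_le_one_plus_square in \<open>auto intro!: AE_I2 order_trans[OF _ abs_ge_self]\<close>)

lemma phi_k_phi: "(CLINT w|M. cplx (X0 w) * iexp (t * X0 w)) = phik t * phi t"
proof -
	have "((%t. (CLINT w|M. (iexp (t * X0 w) - 1) * 1) + 1) has_vector_derivative
			(CLINT w|M. \<i> * cplx (X0 w) * iexp (t * X0 w) * 1) + 0) (at t)"
		by (intro has_vector_derivative_add has_vector_derivative_const has_vector_derivative_integral_iexp) (use X0_integrable in auto)
	moreover have "(CLINT w|M. (iexp (t * X0 w) - 1) * 1) + 1 = phi t" for t
		using integrable_iexp_rv[of X0 t] char_X0[of t] by (simp add: prob_space)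
	ultimately have "(phi has_vector_derivative (CLINT w|M. \<i> * cplx (X0 w) * iexp (t * X0 w))) (at t)" by simp
	from vector_derivative_unique_at[OF this phi_deriv[of t]]
	have "\<i> * (CLINT w|M. cplx (X0 w) * iexp (t * X0 w)) = \<i> * (phik t * phi t)"
		by (simp only: mult.assoc integral_mult_right_zero)
	then show ?thesis by simp
qed

text \<open>\<open>(1 - cos)^2\<close> is a combination of cosines in which the constant and the
  quadratic Taylor terms cancel, so its mean is at most \<open>C3 * t ^ 3\<close>. Averaging over
  \<open>t\<close> in [0, T] turns this into a cubic tail bound.\<close>

lemma X0_tail: assumes T: "T > 0" shows "prob {w\<in>space M. 9 / (4 * T) <= \<bar>X0 w\<bar>} <= 2 * C3 * T ^ 3"
proof -
	let ?q = "%t x::real. (1 - cos (t * x))\<^sup>2"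
	have q4: "?q t x <= 4" for t x :: real
		using power_mono[of "1 - cos (t * x)" 2 2] by simp
	have qe: "?q t x = 3 / 2 - 2 * cos (t * x) + cos ((2 * t) * x) / 2" for t x :: real
		using cos_double_cos[of "t * x"] by (simp add: power2_eq_square algebra_simps)
	have Eq: "expectation (%w. ?q t (X0 w)) <= C3 * T ^ 3" if t: "0 <= t" "t <= T" for t
	proof -
		have i: "integrable M (%w. cos (t * X0 w))" for t by (rule integrable_bounded_rv[of _ 1]) auto
		have e: "expectation (%w. ?q t (X0 w)) = 3 / 2 - 2 * Re (phi t) + Re (phi (2 * t)) / 2"
			unfolding qe using i[of t] i[of "2 * t"] by (simp add: prob_space expectation_cos)
		have "3 / 2 - 2 * Re (phi t) + Re (phi (2 * t)) / 2 <= C3 * t ^ 3"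
		proof -
			have "Re (phi t) >= 1 + Re (f2 0) / 2 * t\<^sup>2 - C3 * t ^ 3 / 6"
				using Re_phi_taylor[of t] unfolding abs_of_nonneg[OF t(1)] by linarith
			moreover have "Re (phi (2 * t)) <= 1 + Re (f2 0) / 2 * (4 * t\<^sup>2) + C3 * (8 * t ^ 3) / 6"
			proof -
				have e: "\<bar>2 * t\<bar> = 2 * t" "(2 * t)\<^sup>2 = 4 * t\<^sup>2" "(2 * t) ^ 3 = 8 * t ^ 3" using t(1) by (auto simp: power_mult_distrib)
				show ?thesis using Re_phi_taylor[of "2 * t"] unfolding e by linarith
			qed
			ultimately show ?thesis by linarith
		qed
		also have "... <= C3 * T ^ 3" using t Ck_nonneg by (intro mult_left_mono power_mono) (auto simp: C3_def)
		finally show ?thesis using e by simp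
	qed
	interpret P: pair_sigma_finite lborel M by (simp add: pair_sigma_finite_def lborel.sigma_finite_measure_axioms sigma_finite_measure_axioms)
	have int: "integrable (lborel \<Otimes>\<^sub>M M) (%(t, w). indicator {0..T} t * ?q t (X0 w))"
	proof (rule P.Fubini_integrable)
		have "integrable lborel (%t. 4 * indicator {0..T} t :: real)"
			using T by (intro integrable_mult_right integrable_real_indicator) auto
		then show "integrable lborel (%t. \<integral>w. norm (case (t, w) of (t, w) => indicator {0..T} t * ?q t (X0 w)) \<partial>M)"
		proof (rule Bochner_Integration.integrable_bound)
			show "AE t in lborel. norm (\<integral>w. norm (case (t, w) of (t, w) => indicator {0..T} t * ?q t (X0 w)) \<partial>M) <= norm (4 * indicator {0..T} t :: real)"
			proof (rule AE_I2)
				fix t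
				have "norm (\<integral>w. norm (case (t, w) of (t, w) => indicator {0..T} t * ?q t (X0 w)) \<partial>M) <= (\<integral>w. 4 * indicator {0..T} t \<partial>M)"
					using q4 by (intro norm_integral_le) (auto simp: indicator_def)
				then show "norm (\<integral>w. norm (case (t, w) of (t, w) => indicator {0..T} t * ?q t (X0 w)) \<partial>M) <= norm (4 * indicator {0..T} t :: real)"
					by (simp add: prob_space)
			qed
		qed measurable
		show "AE t in lborel. integrable M (%w. case (t, w) of (t, w) => indicator {0..T} t * ?q t (X0 w))"
			using q4 by (intro AE_I2 integrable_bounded_rv[of _ 4]) (auto simp: indicator_def)
	qed measurable
	\<comment> \<open>The oscillating terms of the integral are at most \<open>(2 + 1/4) / |x|\<close>,
	  which is at most \<open>T\<close> once \<open>|x| >= 9 / (4 * T)\<close>; this leaves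
	  \<open>3/2 * T - T\<close>.\<close>
	have low: "(LINT t|lborel. indicator {0..T} t * ?q t x) >= T / 2" if x: "9 / (4 * T) <= \<bar>x\<bar>" for x
	proof -
		have x0: "x ~= 0" using x T by auto
		have "((%t. 3 / 2 * t - 2 * sin (t * x) / x + sin (2 * t * x) / (4 * x)) has_real_derivative ?q t x) (at t)" for t
			unfolding qe using x0 by (auto intro!: derivative_eq_intros simp: field_simps)
		then have "has_bochner_integral lborel (%t. ?q t x * indicator {0..T} t)
				((3 / 2 * T - 2 * sin (T * x) / x + sin (2 * T * x) / (4 * x)) - (3 / 2 * 0 - 2 * sin (0 * x) / x + sin (2 * 0 * x) / (4 * x)))"
			using T by (intro has_bochner_integral_FTC_Icc_real) (auto intro!: continuous_intros)
		then have e: "(LINT t|lborel. indicator {0..T} t * ?q t x) = 3 / 2 * T - 2 * sin (T * x) / x + sin (2 * T * x) / (4 * x)"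
			by (simp add: has_bochner_integral_integral_eq mult.commute)
		have ix: "1 / \<bar>x\<bar> <= 4 * T / 9" using x T x0 by (simp add: field_simps)
		have "\<bar>2 * sin (T * x) / x\<bar> <= 2 * (1 / \<bar>x\<bar>)" by (simp add: abs_mult divide_right_mono)
		moreover have "\<bar>sin (2 * T * x) / (4 * x)\<bar> <= 1 / 4 * (1 / \<bar>x\<bar>)" by (simp add: abs_mult divide_right_mono)
		ultimately show ?thesis unfolding e abs_le_iff using ix by linarith
	qed
	let ?A = "{w\<in>space M. 9 / (4 * T) <= \<bar>X0 w\<bar>}"
	have iw: "integrable M (%w. LINT t|lborel. indicator {0..T} t * ?q t (X0 w))"
		using P.integrable_snd[OF int] by simp
	have "T / 2 * prob ?A = (LINT w|M. T / 2 * indicator ?A w)" by simp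
	also have "... <= (LINT w|M. (LINT t|lborel. indicator {0..T} t * ?q t (X0 w)))"
	proof (rule integral_mono[OF _ iw])
		show "integrable M (%w. T / 2 * indicator ?A w)"
			by (intro integrable_mult_right integrable_real_indicator) (auto simp: emeasure_eq_measure)
		show "T / 2 * indicator ?A w <= (LINT t|lborel. indicator {0..T} t * ?q t (X0 w))" for w
			using low[of "X0 w"] by (auto simp: indicator_def intro!: integral_nonneg_AE AE_I2)
	qed
	also have "... = (LINT t|lborel. (LINT w|M. indicator {0..T} t * ?q t (X0 w)))"
		using P.Fubini_integral[OF int] by simp
	also have "... <= (LINT t|lborel. C3 * T ^ 3 * indicator {0..T} t)"
	proof (rule order_trans[OF abs_ge_self], rule abs_integral_le)
		show "integrable lborel (%t. C3 * T ^ 3 * indicator {0..T} t)"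
			using T by (intro integrable_mult_right integrable_real_indicator) auto
		show "\<bar>LINT w|M. indicator {0..T} t * ?q t (X0 w)\<bar> <= C3 * T ^ 3 * indicator {0..T} t" for t
			using Eq[of t] integral_nonneg_AE[of "%w. ?q t (X0 w)" M] by (auto simp: indicator_def)
	qed
	also have "... = T * (C3 * T ^ 3)" using T by simp
	finally show ?thesis using T by (simp add: field_simps)
qed

lemma density_inversion:
	assumes dens: "distributed M lborel X0 (%y. ennreal (\<pi>d y))" and nn: "!!y. \<pi>d y >= 0" and c: "continuous_on UNIV \<pi>d"
	shows "cplx (\<pi>d x) = 1 / (2 * cplx pi) * (CLINT t|lborel. iexp (- (t * x)) * phi t)"
proof -
	have [measurable]: "\<pi>d \<in> borel_measurable borel" using c by (rule borel_measurable_continuous_onI)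
	have ft: "ft \<pi>d t = phi t" for t
	proof -
		have "phi t = integral\<^sup>L (distr M lborel X0) (%x. iexp (t * x))"
			unfolding char_X0[symmetric] by (subst integral_distr) auto
		also have "... = (CLINT x|lborel. \<pi>d x *\<^sub>R iexp (t * x))"
			unfolding distributed_distr_eq_density[OF dens] using nn by (subst integral_density) auto
		also have "... = ft \<pi>d t" unfolding ft_def by (intro Bochner_Integration.integral_cong refl) (simp add: scaleR_conv_of_real mult.commute)
		finally show ?thesis by simp
	qed
	have "(\<integral>\<^sup>+x. ennreal (\<pi>d x) \<partial>lborel) = emeasure (distr M lborel X0) UNIV"
		unfolding distributed_distr_eq_density[OF dens] by (simp add: emeasure_density)
	also have "... = 1" by (simp add: emeasure_distr emeasure_space_1)
	finally have "integrable lborel \<pi>d" using nn by (intro integrableI_nonneg) auto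
	moreover have "integrable lborel (ft \<pi>d)"
		unfolding ft[abs_def] by (rule Bochner_Integration.integrable_bound[OF md_integrable]) (auto simp: md_def)
	ultimately show ?thesis
		using fourier_inversion[of \<pi>d x] c unfolding ft by (simp add: continuous_on_eq_continuous_at)
qed

end

section \<open>Decoupling of the sampled chain and variance bounds\<close>

context ou_stat
begin

definition zeta :: "real => nat => nat => 'a => real" where
	"zeta tau i j w = (\<Sum>l\<in>{i<..j}. exp (- tau) ^ (j - l) * eta tau l w)"

lemma zeta_meas [measurable]: "zeta tau i j \<in> borel_measurable M" unfolding zeta_def by measurable

lemma Xc_split: assumes "i <= j" shows "Xc tau j w = exp (- tau) ^ (j - i) * Xc tau i w + zeta tau i j w"
proof -
	have s: "{..j} = {..i} \<union> {i<..j}" using assms by auto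
	have "exp (- tau) ^ (j - l) * eta tau l w = exp (- tau) ^ (j - i) * (exp (- tau) ^ (i - l) * eta tau l w)" if "l <= i" for l
	proof -
		have "j - l = (j - i) + (i - l)" using that assms by simp
		then show ?thesis by (simp only: power_add mult.assoc)
	qed
	then have "(\<Sum>l\<le>i. exp (- tau) ^ (j - l) * eta tau l w) = exp (- tau) ^ (j - i) * Xc tau i w"
		unfolding Xc_def sum_distrib_left by (intro sum.cong refl) auto
	then show ?thesis unfolding Xc_def[of tau j] zeta_def s by (subst sum.union_disjoint) auto
qed

lemma indep_eta_functions:
	assumes tau: "tau > 0" and AB: "A \<inter> B = {}" "A \<subseteq> {..n}" "B \<subseteq> {..n}"
		and f: "f \<in> borel_measurable (PiM A (%_. borel))" and g: "g \<in> borel_measurable (PiM B (%_. borel))"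
	shows "indep_var borel (%w. f (restrict (%i. eta tau i w) A)) borel (%w. g (restrict (%i. eta tau i w) B))"
	using indep_var_compose[OF indep_var_restrict[OF indep_eta[OF tau, of n] AB] f g] by (simp add: comp_def)

lemma indep_Xc_zeta:
	assumes tau: "tau > 0" and "i <= j"
	shows "indep_var borel (Xc tau i) borel (zeta tau i j)"
proof -
	let ?f = "%p. \<Sum>l\<le>i. exp (- tau) ^ (i - l) * p l" and ?g = "%p. \<Sum>l\<in>{i<..j}. exp (- tau) ^ (j - l) * p l"
	have "indep_var borel (%w. ?f (restrict (%i. eta tau i w) {..i})) borel (%w. ?g (restrict (%i. eta tau i w) {i<..j}))"
		using assms by (intro indep_eta_functions[where n=j])
			(auto intro!: borel_measurable_sum borel_measurable_times measurable_component_singleton)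
	then show ?thesis by (simp add: Xc_def[abs_def] zeta_def[abs_def])
qed

lemma E_Xc:
	fixes f :: "real => 'c::{banach, second_countable_topology}"
	assumes tau: "tau > 0" and [measurable]: "f \<in> borel_measurable borel"
	shows "(\<integral>w. f (Xc tau j w) \<partial>M) = (\<integral>w. f (X0 w) \<partial>M)"
		and "integrable M (%w. f (Xc tau j w)) \<longleftrightarrow> integrable M (%w. f (X0 w))"
proof -
	have "(\<integral>w. f (Xc tau j w) \<partial>M) = integral\<^sup>L (distr M borel (Xc tau j)) f" by (subst integral_distr) auto
	also have "... = (\<integral>w. f (X0 w) \<partial>M)" unfolding distr_Xc[OF tau] by (subst integral_distr) auto
	finally show "(\<integral>w. f (Xc tau j w) \<partial>M) = (\<integral>w. f (X0 w) \<partial>M)" .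
	have "integrable M (%w. f (Xc tau j w)) \<longleftrightarrow> integrable (distr M borel (Xc tau j)) f" by (subst integrable_distr_eq) auto
	also have "... \<longleftrightarrow> integrable M (%w. f (X0 w))" unfolding distr_Xc[OF tau] by (subst integrable_distr_eq) auto
	finally show "integrable M (%w. f (Xc tau j w)) \<longleftrightarrow> integrable M (%w. f (X0 w))" .
qed

lemma AE_Xc_nonneg: "AE w in M. \<forall>j. 0 <= Xc tau j w"
	using AE_good X0_nonneg
proof eventually_elim
	case (elim w)
	have "0 <= eta tau i w" for i using eta_nonneg[OF elim(1)] elim(2) by (cases "i = 0") (auto simp: eta_def)
	then show ?case unfolding Xc_def by (auto intro!: sum_nonneg)
qed

definition m2 :: real where "m2 = expectation (%w. (X0 w)\<^sup>2)"

lemma m2_nonneg: "0 <= m2" unfolding m2_def by simp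

lemma E_abs_X0: "expectation (%w. \<bar>X0 w\<bar>) <= 1 + m2"
proof -
	have "expectation (%w. \<bar>X0 w\<bar>) <= expectation (%w. 1 + (X0 w)\<^sup>2)"
		using X0_integrable X0_square_integrable abs_le_one_plus_square by (intro integral_mono) auto
	then show ?thesis using X0_square_integrable by (simp add: m2_def prob_space)
qed

lemma prod_integrable:
	fixes f g :: "'a => real"
	assumes [measurable]: "f \<in> borel_measurable M" "g \<in> borel_measurable M"
		and "integrable M (%w. (f w)\<^sup>2)" "integrable M (%w. (g w)\<^sup>2)"
	shows "integrable M (%w. f w * g w)"
		"\<bar>expectation (%w. f w * g w)\<bar> <= (expectation (%w. (f w)\<^sup>2) + expectation (%w. (g w)\<^sup>2)) / 2"
proof -
	have i: "integrable M (%w. ((f w)\<^sup>2 + (g w)\<^sup>2) / 2)" using assms by simp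
	have le: "\<bar>f w * g w\<bar> <= ((f w)\<^sup>2 + (g w)\<^sup>2) / 2" for w
		using sum_squares_bound[of "\<bar>f w\<bar>" "\<bar>g w\<bar>"] by (simp add: abs_mult)
	show "integrable M (%w. f w * g w)"
		by (rule Bochner_Integration.integrable_bound[OF i]) (use le in \<open>auto intro!: AE_I2 order_trans[OF _ abs_ge_self]\<close>)
	have "\<bar>expectation (%w. f w * g w)\<bar> <= expectation (%w. ((f w)\<^sup>2 + (g w)\<^sup>2) / 2)"
		by (rule abs_integral_le[OF i le])
	then show "\<bar>expectation (%w. f w * g w)\<bar> <= (expectation (%w. (f w)\<^sup>2) + expectation (%w. (g w)\<^sup>2)) / 2"
		using assms by simp
qed

text \<open>The product of a bound \<open>G + m2\<close> for the mean of
  \<open>|g (Xc tau i)| * |Xc tau i|\<close> and a bound \<open>3 + 2 * m2\<close> for the mean of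
  \<open>1 + |zeta tau i j|\<close>, which are means of independent variables.\<close>

definition K3 :: "real => real" where "K3 G = (G + m2) * (3 + 2 * m2)"

text \<open>Mixing by contraction: \<open>Xc tau j - zeta tau i j\<close> is of size \<open>exp (- tau) ^ (j - i)\<close>, and
	\<open>zeta tau i j\<close> is independent of \<open>Xc tau i\<close>.\<close>

lemma covariance_lag:
	fixes g :: "real => complex"
	assumes tau: "tau > 0" and [measurable]: "g \<in> borel_measurable borel"
		and lip: "!!u v. cmod (g (u + v) - g v) <= \<Lambda> * \<bar>u\<bar> * (1 + \<bar>v\<bar>)"
		and mean: "(CLINT w|M. g (X0 w)) = 0"
		and sq: "integrable M (%w. (cmod (g (X0 w)))\<^sup>2)" "expectation (%w. (cmod (g (X0 w)))\<^sup>2) <= G"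
		and q: "i + q <= j"
	shows "cmod (CLINT w|M. g (Xc tau i w) * cnj (g (Xc tau j w))) <= \<Lambda> * exp (- tau) ^ q * K3 G"
proof -
	have \<Lambda>0: "0 <= \<Lambda>" using order_trans[OF norm_ge_zero lip[of 1 0]] by simp
	have [measurable]: "cnj \<in> borel_measurable borel" by (intro borel_measurable_continuous_onI continuous_intros)
	have ij: "i <= j" using q by simp
	let ?r = "exp (- tau) ^ (j - i)"
	have r: "0 <= ?r" "?r <= exp (- tau) ^ q" "?r <= 1" using q tau by (auto intro!: power_decreasing power_le_one)
	note sp = Xc_split[OF ij, of tau]
	have sqX: "integrable M (%w. (Xc tau l w)\<^sup>2)" for l using E_Xc(2)[OF tau, of "%x. x\<^sup>2"] X0_square_integrable by simp
	have aX: "integrable M (%w. \<bar>Xc tau l w\<bar>)" for l using E_Xc(2)[OF tau, of "%x. \<bar>x\<bar>"] X0_integrable by simp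
	have sqg: "integrable M (%w. (cmod (g (Xc tau l w)))\<^sup>2)" for l using E_Xc(2)[OF tau, of "%x. (cmod (g x))\<^sup>2"] sq by simp
	have eg: "expectation (%w. (cmod (g (Xc tau l w)))\<^sup>2) <= G" for l using E_Xc(1)[OF tau, of "%x. (cmod (g x))\<^sup>2"] sq by simp
	have eX: "expectation (%w. (Xc tau l w)\<^sup>2) = m2" for l using E_Xc(1)[OF tau, of "%x. x\<^sup>2"] by (simp add: m2_def)
	have eaX: "expectation (%w. \<bar>Xc tau l w\<bar>) <= 1 + m2" for l using E_Xc(1)[OF tau, of "%x. \<bar>x\<bar>"] E_abs_X0 by simp
	have az: "\<bar>zeta tau i j w\<bar> <= \<bar>Xc tau j w\<bar> + \<bar>Xc tau i w\<bar>" for w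
	proof -
		have "\<bar>?r * Xc tau i w\<bar> <= 1 * \<bar>Xc tau i w\<bar>" unfolding abs_mult using r by (intro mult_right_mono) auto
		then show ?thesis using sp[of w] by linarith
	qed
	have iz: "integrable M (%w. \<bar>zeta tau i j w\<bar>)"
		by (rule Bochner_Integration.integrable_bound[OF Bochner_Integration.integrable_add[OF aX[of j] aX[of i]]])
			 (use az in \<open>auto intro!: AE_I2 order_trans[OF _ abs_ge_self]\<close>)
	have ez: "expectation (%w. \<bar>zeta tau i j w\<bar>) <= 2 + 2 * m2"
	proof -
		have "expectation (%w. \<bar>zeta tau i j w\<bar>) <= expectation (%w. \<bar>Xc tau j w\<bar> + \<bar>Xc tau i w\<bar>)"
			using iz aX az by (intro integral_mono) auto
		also have "... <= 2 + 2 * m2" using aX eaX[of i] eaX[of j] by simp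
		finally show ?thesis .
	qed
	let ?gi = "%w. g (Xc tau i w)" and ?gz = "%w. cnj (g (zeta tau i j w))"
	have igi: "integrable M ?gi"
	proof (rule Bochner_Integration.integrable_bound[OF Bochner_Integration.integrable_add[OF integrable_const[of 1] sqg[of i]]])
		show "AE w in M. norm (?gi w) <= norm (1 + (cmod (g (Xc tau i w)))\<^sup>2)"
		proof (rule AE_I2)
			fix w
			show "norm (?gi w) <= norm (1 + (cmod (g (Xc tau i w)))\<^sup>2)"
				using abs_le_one_plus_square[of "cmod (g (Xc tau i w))"] abs_ge_self[of "1 + (cmod (g (Xc tau i w)))\<^sup>2"]
				unfolding real_norm_def abs_norm_cancel by linarith
		qed
	qed measurable
	have ind: "indep_var borel (Xc tau i) borel (zeta tau i j)" by (rule indep_Xc_zeta[OF tau ij])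
	let ?B = "%w. \<Lambda> * \<bar>?r * Xc tau i w\<bar> * (1 + \<bar>zeta tau i j w\<bar>)"
	have dif: "cmod (g (Xc tau j w) - g (zeta tau i j w)) <= ?B w" for w
		unfolding sp[of w] by (rule lip)
	have Bsq: "?B w <= \<Lambda> * (\<bar>Xc tau i w\<bar> + (2 * (Xc tau i w)\<^sup>2 + (Xc tau j w)\<^sup>2))" for w
	proof -
		have "\<bar>?r * Xc tau i w\<bar> * (1 + \<bar>zeta tau i j w\<bar>) <= \<bar>Xc tau i w\<bar> * (1 + (\<bar>Xc tau j w\<bar> + \<bar>Xc tau i w\<bar>))"
			using az[of w] r mult_right_mono[OF r(3), of "\<bar>Xc tau i w\<bar>"] by (intro mult_mono) (auto simp: abs_mult)
		also have "... <= \<bar>Xc tau i w\<bar> + (2 * (Xc tau i w)\<^sup>2 + (Xc tau j w)\<^sup>2)"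
		proof -
			have "2 * \<bar>Xc tau i w\<bar> * \<bar>Xc tau j w\<bar> <= (Xc tau i w)\<^sup>2 + (Xc tau j w)\<^sup>2"
				using sum_squares_bound[of "\<bar>Xc tau i w\<bar>" "\<bar>Xc tau j w\<bar>"] by simp
			moreover have "0 <= \<bar>Xc tau i w\<bar> * \<bar>Xc tau j w\<bar>" by simp
			moreover have "\<bar>Xc tau i w\<bar> * \<bar>Xc tau i w\<bar> = (Xc tau i w)\<^sup>2" by (simp add: power2_eq_square)
			ultimately show ?thesis unfolding distrib_left by linarith
		qed
		finally show ?thesis using \<Lambda>0 by (simp add: mult.assoc mult_left_mono)
	qed
	have iB: "integrable M ?B"
	proof (rule Bochner_Integration.integrable_bound)
		show "integrable M (%w. \<Lambda> * (\<bar>Xc tau i w\<bar> + (2 * (Xc tau i w)\<^sup>2 + (Xc tau j w)\<^sup>2)))" using aX sqX by simp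
		show "AE w in M. norm (?B w) <= norm (\<Lambda> * (\<bar>Xc tau i w\<bar> + (2 * (Xc tau i w)\<^sup>2 + (Xc tau j w)\<^sup>2)))"
		proof (rule AE_I2)
			fix w
			have "0 <= ?B w" using \<Lambda>0 by simp
			then show "norm (?B w) <= norm (\<Lambda> * (\<bar>Xc tau i w\<bar> + (2 * (Xc tau i w)\<^sup>2 + (Xc tau j w)\<^sup>2)))"
				unfolding real_norm_def by (rule_tac order_trans[OF _ abs_ge_self]) (use Bsq[of w] in \<open>simp only: real_norm_def abs_of_nonneg\<close>)
		qed
	qed measurable
	have igj: "integrable M (%w. cmod (g (Xc tau j w)))"
	proof (rule Bochner_Integration.integrable_bound[OF Bochner_Integration.integrable_add[OF integrable_const[of 1] sqg[of j]]])
		show "AE w in M. norm (cmod (g (Xc tau j w))) <= norm (1 + (cmod (g (Xc tau j w)))\<^sup>2)"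
		proof (rule AE_I2)
			fix w
			show "norm (cmod (g (Xc tau j w))) <= norm (1 + (cmod (g (Xc tau j w)))\<^sup>2)"
				using abs_le_one_plus_square[of "cmod (g (Xc tau j w))"] abs_ge_self[of "1 + (cmod (g (Xc tau j w)))\<^sup>2"]
				unfolding real_norm_def abs_norm_cancel by linarith
		qed
	qed measurable
	have igz: "integrable M ?gz"
	proof (rule Bochner_Integration.integrable_bound[OF Bochner_Integration.integrable_add[OF igj iB]])
		show "AE w in M. norm (?gz w) <= norm (cmod (g (Xc tau j w)) + ?B w)"
		proof (rule AE_I2)
			fix w
			have "cmod (g (zeta tau i j w)) <= cmod (g (Xc tau j w)) + cmod (g (Xc tau j w) - g (zeta tau i j w))"
				using norm_triangle_ineq2[of "g (zeta tau i j w)" "g (Xc tau j w)"] by (simp add: norm_minus_commute)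
			then show "norm (?gz w) <= norm (cmod (g (Xc tau j w)) + ?B w)"
				using dif[of w] abs_ge_self[of "cmod (g (Xc tau j w)) + ?B w"] unfolding real_norm_def complex_mod_cnj by linarith
		qed
	qed measurable
	have indg: "indep_var borel ?gi borel ?gz"
		using indep_var_compose[OF ind, of g borel "%x. cnj (g x)" borel] by (simp add: comp_def)
	\<comment> \<open>Independence and the centring of \<open>g\<close> annihilate the term with
	  \<open>zeta\<close>, so only the difference of \<open>g\<close> at \<open>Xc tau j\<close> and at
	  \<open>zeta tau i j\<close> contributes to the covariance.\<close>
	have zero: "(CLINT w|M. ?gi w * ?gz w) = 0"
		using indep_var_lebesgue_integral[OF indg igi igz] E_Xc(1)[OF tau, of g i] mean by simp
	have ip: "integrable M (%w. ?gi w * ?gz w)" by (rule indep_var_integrable[OF indg igi igz])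
	have sqcc: "integrable M (%w. ?gi w * cnj (g (Xc tau j w)))"
	proof (rule Bochner_Integration.integrable_bound[OF prod_integrable(1)[of "%w. cmod (g (Xc tau i w))" "%w. cmod (g (Xc tau j w))"]])
		show "AE w in M. norm (?gi w * cnj (g (Xc tau j w))) <= norm (cmod (g (Xc tau i w)) * cmod (g (Xc tau j w)))" by (simp add: norm_mult)
	qed (use sqg in auto)
	have e: "(CLINT w|M. ?gi w * cnj (g (Xc tau j w))) = (CLINT w|M. ?gi w * cnj (g (Xc tau j w) - g (zeta tau i j w)))"
		using zero ip sqcc by (simp add: right_diff_distrib)
	let ?u = "%w. cmod (g (Xc tau i w)) * \<bar>Xc tau i w\<bar>" and ?wv = "%w. 1 + \<bar>zeta tau i j w\<bar>"
	have iu: "integrable M ?u" and eu: "expectation ?u <= G + m2"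
	proof -
		note p = prod_integrable[of "%w. cmod (g (Xc tau i w))" "%w. \<bar>Xc tau i w\<bar>"]
		show "integrable M ?u" using p(1) sqg sqX by simp
		have "0 <= G" by (rule order_trans[OF Bochner_Integration.integral_nonneg sq(2)]) simp
		then show "expectation ?u <= G + m2" using p(2) sqg sqX eg[of i] eX[of i] m2_nonneg by (simp add: abs_le_iff)
	qed
	have iw: "integrable M ?wv" using iz by simp
	have indu: "indep_var borel ?u borel ?wv"
		using indep_var_compose[OF ind, of "%x. cmod (g x) * \<bar>x\<bar>" borel "%x. 1 + \<bar>x\<bar>" borel] by (simp add: comp_def)
	have euw: "expectation (%w. ?u w * ?wv w) <= K3 G"
	proof -
		have "expectation (%w. ?u w * ?wv w) = expectation ?u * expectation ?wv"
			by (rule indep_var_lebesgue_integral[OF indu iu iw])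
		also have "... <= (G + m2) * (3 + 2 * m2)"
		proof (rule mult_mono[OF eu])
			show "expectation ?wv <= 3 + 2 * m2" using iz ez by (simp add: prob_space)
			show "0 <= G + m2" using order_trans[OF Bochner_Integration.integral_nonneg eu] by simp
		qed simp
		finally show ?thesis by (simp add: K3_def)
	qed
	have iuw: "integrable M (%w. ?u w * ?wv w)" by (rule indep_var_integrable[OF indu iu iw])
	have "cmod (CLINT w|M. ?gi w * cnj (g (Xc tau j w))) <= (LINT w|M. (\<Lambda> * exp (- tau) ^ q) * (?u w * ?wv w))"
		unfolding e
	proof (rule norm_integral_le)
		show "integrable M (%w. (\<Lambda> * exp (- tau) ^ q) * (?u w * ?wv w))" using iuw by (rule integrable_mult_right)
		fix w
		have "cmod (g (Xc tau j w) - g (zeta tau i j w)) <= \<Lambda> * (exp (- tau) ^ q * \<bar>Xc tau i w\<bar>) * ?wv w"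
		proof (rule order_trans[OF dif])
			have "\<bar>?r * Xc tau i w\<bar> <= exp (- tau) ^ q * \<bar>Xc tau i w\<bar>"
				unfolding abs_mult using r by (intro mult_right_mono) auto
			then show "?B w <= \<Lambda> * (exp (- tau) ^ q * \<bar>Xc tau i w\<bar>) * ?wv w"
				using \<Lambda>0 by (intro mult_right_mono mult_left_mono) auto
		qed
		then have "cmod (?gi w) * cmod (g (Xc tau j w) - g (zeta tau i j w)) <= cmod (?gi w) * (\<Lambda> * (exp (- tau) ^ q * \<bar>Xc tau i w\<bar>) * ?wv w)"
			by (intro mult_left_mono) auto
		then show "cmod (?gi w * cnj (g (Xc tau j w) - g (zeta tau i j w))) <= (\<Lambda> * exp (- tau) ^ q) * (?u w * ?wv w)"
			unfolding norm_mult complex_mod_cnj by (simp only: mult_ac)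
	qed
	also have "... <= (\<Lambda> * exp (- tau) ^ q) * K3 G"
		unfolding integral_mult_right_zero using euw \<Lambda>0 by (intro mult_left_mono) auto
	finally show ?thesis .
qed

text \<open>Each index has at most \<open>2 * q\<close> neighbours at a lag below \<open>q\<close>,
  each costing at most \<open>G\<close>. The contraction term is charged to every pair, which covers
  the pairs at larger lags.\<close>

lemma variance_bound:
	fixes g :: "real => complex"
	assumes tau: "tau > 0" and [measurable]: "g \<in> borel_measurable borel"
		and lip: "!!u v. cmod (g (u + v) - g v) <= \<Lambda> * \<bar>u\<bar> * (1 + \<bar>v\<bar>)"
		and mean: "(CLINT w|M. g (X0 w)) = 0"
		and sq: "integrable M (%w. (cmod (g (X0 w)))\<^sup>2)" "expectation (%w. (cmod (g (X0 w)))\<^sup>2) <= G"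
	shows "integrable M (%w. (cmod (\<Sum>j=1..n. g (Xc tau j w)))\<^sup>2)"
		"expectation (%w. (cmod (\<Sum>j=1..n. g (Xc tau j w)))\<^sup>2) <= 2 * real q * real n * G + (real n)\<^sup>2 * (\<Lambda> * exp (- tau) ^ q * K3 G)"
proof -
	have [measurable]: "cnj \<in> borel_measurable borel" by (intro borel_measurable_continuous_onI continuous_intros)
	have \<Lambda>0: "0 <= \<Lambda>" using order_trans[OF norm_ge_zero lip[of 1 0]] by simp
	have G0: "0 <= G" by (rule order_trans[OF Bochner_Integration.integral_nonneg sq(2)]) simp
	have K0: "0 <= K3 G" unfolding K3_def using G0 m2_nonneg by simp
	let ?R = "\<Lambda> * exp (- tau) ^ q * K3 G"
	have R0: "0 <= ?R" using \<Lambda>0 K0 by simp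
	let ?h = "%i j w. g (Xc tau i w) * cnj (g (Xc tau j w))"
	have sqg: "integrable M (%w. (cmod (g (Xc tau l w)))\<^sup>2)" for l using E_Xc(2)[OF tau, of "%x. (cmod (g x))\<^sup>2"] sq by simp
	have eg: "expectation (%w. (cmod (g (Xc tau l w)))\<^sup>2) <= G" for l using E_Xc(1)[OF tau, of "%x. (cmod (g x))\<^sup>2"] sq by simp
	have pi: "integrable M (%w. cmod (g (Xc tau i w)) * cmod (g (Xc tau j w)))" for i j
		by (rule prod_integrable(1)) (use sqg in auto)
	have ih: "integrable M (?h i j)" for i j
		by (rule Bochner_Integration.integrable_bound[OF pi[of i j]]) (auto simp: norm_mult)
	have eq: "cplx ((cmod (\<Sum>j=1..n. g (Xc tau j w)))\<^sup>2) = (\<Sum>i=1..n. \<Sum>j=1..n. ?h i j w)" for w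
		unfolding complex_norm_square cnj_sum sum_product by simp
	have iS: "integrable M (%w. (\<Sum>i=1..n. \<Sum>j=1..n. ?h i j w))"
		using ih by (intro Bochner_Integration.integrable_sum)
	then show int: "integrable M (%w. (cmod (\<Sum>j=1..n. g (Xc tau j w)))\<^sup>2)"
		unfolding eq[symmetric] by (simp only: complex_of_real_integrable_eq)
	have cov: "cmod (CLINT w|M. ?h i j w) <= (if i < j + q \<and> j < i + q then G else 0) + ?R" for i j
	proof -
		have 1: "cmod (CLINT w|M. ?h i j w) <= G"
		proof -
			have "cmod (CLINT w|M. ?h i j w) <= expectation (%w. cmod (g (Xc tau i w)) * cmod (g (Xc tau j w)))"
				by (rule norm_integral_le[OF pi]) (simp add: norm_mult)
			also have "... <= G"
				using prod_integrable(2)[of "%w. cmod (g (Xc tau i w))" "%w. cmod (g (Xc tau j w))"] sqg eg[of i] eg[of j] by (simp add: abs_le_iff)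
			finally show ?thesis .
		qed
		have 2: "cmod (CLINT w|M. ?h i j w) <= ?R" if "i + q <= j" for i j
			by (rule covariance_lag[OF tau _ lip mean sq that]) auto
		have 3: "cmod (CLINT w|M. ?h i j w) <= ?R" if "j + q <= i" for i j
		proof -
			have "(CLINT w|M. ?h i j w) = (CLINT w|M. cnj (?h j i w))" by (intro Bochner_Integration.integral_cong refl) simp
			also have "... = cnj (CLINT w|M. ?h j i w)" by (rule Bochner_Integration.integral_cnj)
			finally show ?thesis using 2[OF that] by simp
		qed
		show ?thesis
		proof (cases "i < j + q \<and> j < i + q")
			case True then show ?thesis using 1 R0 by simp
		next
			case False
			then have "i + q <= j \<or> j + q <= i" by linarith
			then have "cmod (CLINT w|M. ?h i j w) <= ?R" using 2 3 by (elim disjE)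
			then show ?thesis unfolding if_not_P[OF False] by simp
		qed
	qed
	have eqc: "cplx (expectation (%w. (cmod (\<Sum>j=1..n. g (Xc tau j w)))\<^sup>2)) = (\<Sum>i=1..n. \<Sum>j=1..n. (CLINT w|M. ?h i j w))"
		unfolding integral_complex_of_real[symmetric] eq using ih by (simp add: Bochner_Integration.integral_sum Bochner_Integration.integrable_sum)
	have "\<bar>expectation (%w. (cmod (\<Sum>j=1..n. g (Xc tau j w)))\<^sup>2)\<bar> = cmod (\<Sum>i=1..n. \<Sum>j=1..n. (CLINT w|M. ?h i j w))"
		unfolding eqc[symmetric] by (simp only: norm_of_real)
	also have "... <= (\<Sum>i=1..n. \<Sum>j=1..n. (if i < j + q \<and> j < i + q then G else 0) + ?R)"
		by (intro order_trans[OF norm_sum] sum_mono cov)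
	also have "... <= (\<Sum>i=1..n. 2 * real q * G + real n * ?R)"
	proof (rule sum_mono)
		fix i
		have "(\<Sum>j=1..n. (if i < j + q \<and> j < i + q then G else 0)) = real (card {j\<in>{1..n}. i < j + q \<and> j < i + q}) * G"
			by (simp only: sum.inter_filter[OF finite_atLeastAtMost, symmetric] sum_constant)
		also have "... <= real (2 * q) * G"
		proof (intro mult_right_mono G0)
			have "{j\<in>{1..n}. i < j + q \<and> j < i + q} \<subseteq> {i + 1 - q..<i + q}" by auto
			from card_mono[OF _ this] show "real (card {j\<in>{1..n}. i < j + q \<and> j < i + q}) <= real (2 * q)" by simp
		qed
		finally show "(\<Sum>j=1..n. (if i < j + q \<and> j < i + q then G else 0) + ?R) <= 2 * real q * G + real n * ?R"
			unfolding sum.distrib by simp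
	qed
	also have "... = 2 * real q * real n * G + (real n)\<^sup>2 * ?R" by (simp add: algebra_simps power2_eq_square)
	finally show "expectation (%w. (cmod (\<Sum>j=1..n. g (Xc tau j w)))\<^sup>2) <= 2 * real q * real n * G + (real n)\<^sup>2 * ?R" by linarith
qed

end

lemma (in prob_space) window_expectation:
	fixes F :: "real => 'a => real"
	assumes [measurable]: "(%(t, w). F t w) \<in> borel_measurable (lborel \<Otimes>\<^sub>M M)" and nn: "!!t w. 0 <= F t w"
		and i: "!!t. \<bar>t\<bar> <= T ==> integrable M (F t)" and c: "!!t. \<bar>t\<bar> <= T ==> expectation (F t) <= c" and T: "0 <= T"
	shows "integrable M (%w. LINT t|lborel. indicator {-T..T} t * F t w)"
		"expectation (%w. LINT t|lborel. indicator {-T..T} t * F t w) <= 2 * T * c"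
proof -
	interpret P: pair_sigma_finite lborel M by (simp add: pair_sigma_finite_def lborel.sigma_finite_measure_axioms sigma_finite_measure_axioms)
	let ?G = "%(t, w). indicator {-T..T} t * F t w"
	have [measurable]: "(%w. F t w) \<in> borel_measurable M" for t
		using measurable_compose[OF measurable_Pair1'[of t lborel M] assms(1)] by simp
	have eb: "(LINT w|M. norm (?G (t, w))) <= c * indicator {-T..T} t" for t
		using c[of t] nn by (auto simp: indicator_def abs_le_iff)
	have ib: "integrable lborel (%t. c * indicator {-T..T} t :: real)"
		using T by (intro integrable_mult_right integrable_real_indicator) auto
	have int: "integrable (lborel \<Otimes>\<^sub>M M) ?G"
	proof (rule P.Fubini_integrable)
		show "integrable lborel (%t. LINT w|M. norm (?G (t, w)))"
		proof (rule Bochner_Integration.integrable_bound[OF ib])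
			show "AE t in lborel. norm (LINT w|M. norm (?G (t, w))) <= norm (c * indicator {-T..T} t)"
				using eb by (intro AE_I2) (auto intro!: order_trans[OF _ abs_ge_self])
		qed measurable
		show "AE t in lborel. integrable M (%w. ?G (t, w))"
			using i by (intro AE_I2) (auto simp: indicator_def)
	qed measurable
	show "integrable M (%w. LINT t|lborel. indicator {-T..T} t * F t w)"
		using P.integrable_snd[OF int] by simp
	have "expectation (%w. LINT t|lborel. indicator {-T..T} t * F t w) = (LINT t|lborel. LINT w|M. indicator {-T..T} t * F t w)"
		using P.Fubini_integral[OF int] by simp
	also have "... <= \<bar>...\<bar>" by (rule abs_ge_self)
	also have "... <= (LINT t|lborel. c * indicator {-T..T} t)"
	proof (rule abs_integral_le[OF ib])
		fix t
		have "\<bar>LINT w|M. indicator {-T..T} t * F t w\<bar> <= (LINT w|M. norm (?G (t, w)))"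
			using integral_norm_bound[of M "%w. indicator {-T..T} t * F t w"] by simp
		then show "\<bar>LINT w|M. indicator {-T..T} t * F t w\<bar> <= c * indicator {-T..T} t" using eb[of t] by linarith
	qed
	also have "... = 2 * T * c" using T by simp
	finally show "expectation (%w. LINT t|lborel. indicator {-T..T} t * F t w) <= 2 * T * c" .
qed

section \<open>Empirical characteristic functions and linearisation of the estimator\<close>

context ou_stat
begin

text \<open>\<open>Dh\<close> is the error of the empirical characteristic function and
  \<open>D1\<close> its derivative. \<open>Nh\<close> is the derivative of the untruncated empirical
  characteristic function minus \<open>\<i> * phik\<close> times the function itself: the numerator
  in the error of the logarithmic derivative. All three are averages of functions that are centred
  under the stationary law.\<close>

definition Dh :: "(nat => real) => nat => real => complex" where
	"Dh obs n t = (1 / of_nat n) * (\<Sum>j=1..n. iexp (t * obs j) - phi t)"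

definition D1 :: "(nat => real) => nat => real => complex" where
	"D1 obs n t = (1 / of_nat n) * (\<Sum>j=1..n. \<i> * (cplx (obs j) * iexp (t * obs j) - phik t * phi t))"

definition Nh :: "(nat => real) => nat => real => complex" where
	"Nh obs n t = (1 / of_nat n) * (\<Sum>j=1..n. \<i> * (cplx (obs j) - phik t) * iexp (t * obs j))"

text \<open>\<open>K2\<close> bounds the second moment of a summand in any of the three averages,
  and \<open>KM q / n\<close> bounds that of the average itself.\<close>

definition K2 :: real where "K2 = 2 * m2 + 2 * Ck\<^sup>2 + 4"
definition KM :: "nat => real" where "KM q = 2 * real q * K2 + K3 K2"

lemma phi_le_1: "cmod (phi t) <= 1" using md_le_1[of t] by (simp add: md_def)

lemma lip_iexp: "cmod (iexp (t * (u + v)) - iexp (t * v)) <= \<bar>t\<bar> * \<bar>u\<bar>"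
	using cmod_iexp_diff_le[of "t * (u + v)" "t * v"] by (simp add: abs_mult flip: right_diff_distrib)

text \<open>An unbounded factor multiplies a Lipschitz exponential; this is the origin of the weight
  \<open>1 + |v|\<close> in the Lipschitz conditions throughout.\<close>

lemma lip_x_iexp:
	assumes "cmod c <= Ck"
	shows "cmod ((cplx (u + v) - c) * iexp (t * (u + v)) - (cplx v - c) * iexp (t * v))
		 <= (1 + Ck) * (1 + \<bar>t\<bar>) * \<bar>u\<bar> * (1 + \<bar>v\<bar>)"
proof -
	have "(cplx (u + v) - c) * iexp (t * (u + v)) - (cplx v - c) * iexp (t * v)
		 = cplx u * iexp (t * (u + v)) + (cplx v - c) * (iexp (t * (u + v)) - iexp (t * v))"
		by (simp add: algebra_simps)
	then have "cmod ((cplx (u + v) - c) * iexp (t * (u + v)) - (cplx v - c) * iexp (t * v))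
		 <= \<bar>u\<bar> + cmod (cplx v - c) * cmod (iexp (t * (u + v)) - iexp (t * v))"
		using norm_triangle_ineq[of "cplx u * iexp (t * (u + v))" "(cplx v - c) * (iexp (t * (u + v)) - iexp (t * v))"]
		by (simp add: norm_mult)
	also have "... <= \<bar>u\<bar> + (\<bar>v\<bar> + Ck) * (\<bar>t\<bar> * \<bar>u\<bar>)"
		using norm_triangle_ineq4[of "cplx v" c] assms Ck_nonneg lip_iexp[of t u v]
		by (intro add_left_mono mult_mono) auto
	also have "... <= (1 + Ck) * (1 + \<bar>t\<bar>) * \<bar>u\<bar> * (1 + \<bar>v\<bar>)"
	proof -
		have "0 <= \<bar>u\<bar> * \<bar>v\<bar>" "0 <= Ck * \<bar>u\<bar>" "0 <= Ck * (\<bar>u\<bar> * \<bar>v\<bar>)" "0 <= \<bar>t\<bar> * \<bar>u\<bar>" "0 <= Ck * (\<bar>t\<bar> * (\<bar>u\<bar> * \<bar>v\<bar>))"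
			using Ck_nonneg by simp_all
		then show ?thesis by (simp add: algebra_simps)
	qed
	finally show ?thesis .
qed

text \<open>The alternative in \<open>bd\<close> lets one statement serve all three averages. The
  hypothesis \<open>small\<close> says that \<open>q\<close> contractions beat the Lipschitz
  constant on [-T, T] by a factor \<open>n\<close>, so that the contraction term adds only order
  \<open>n\<close> to the second moment of the sum.\<close>

lemma hat_moment:
	fixes g :: "real => complex"
	assumes tau: "tau > 0" and n: "n >= 1" and g[measurable]: "g \<in> borel_measurable borel"
		and lip: "!!u v. cmod (g (u + v) - g v) <= (1 + Ck) * (1 + \<bar>t\<bar>) * \<bar>u\<bar> * (1 + \<bar>v\<bar>)"
		and mean: "(CLINT w|M. g (X0 w)) = 0"
		and bd: "!!x. cmod (g x) <= \<bar>x\<bar> + Ck \<or> cmod (g x) <= 2"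
		and small: "real n * ((1 + Ck) * (1 + T) * exp (- tau) ^ q) <= 1" and t: "\<bar>t\<bar> <= T"
	shows "integrable M (%w. (cmod ((1 / of_nat n) * (\<Sum>j=1..n. g (Xc tau j w))))\<^sup>2)"
		"expectation (%w. (cmod ((1 / of_nat n) * (\<Sum>j=1..n. g (Xc tau j w))))\<^sup>2) <= KM q / real n"
proof -
	have K2: "0 <= K2" "0 <= K3 K2" using m2_nonneg by (auto simp: K2_def K3_def)
	have sqb: "(cmod (g x))\<^sup>2 <= 2 * x\<^sup>2 + 2 * Ck\<^sup>2 + 4" for x
		using bd[of x]
	proof
		assume "cmod (g x) <= \<bar>x\<bar> + Ck"
		then have "(cmod (g x))\<^sup>2 <= (\<bar>x\<bar> + Ck)\<^sup>2" by (intro power_mono) auto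
		also have "... <= 2 * x\<^sup>2 + 2 * Ck\<^sup>2"
			using zero_le_power2[of "\<bar>x\<bar> - Ck"] unfolding power2_sum power2_diff power2_abs by linarith
		finally show ?thesis by simp
	next
		assume "cmod (g x) <= 2"
		then have "(cmod (g x))\<^sup>2 <= 2\<^sup>2" by (intro power_mono) auto
		moreover have "0 <= 2 * x\<^sup>2 + 2 * Ck\<^sup>2" by simp
		moreover have "(2::real)\<^sup>2 = 4" by simp
		ultimately show ?thesis by linarith
	qed
	have isq: "integrable M (%w. 2 * (X0 w)\<^sup>2 + 2 * Ck\<^sup>2 + 4)" using X0_square_integrable by simp
	have sq1: "integrable M (%w. (cmod (g (X0 w)))\<^sup>2)"
		by (rule Bochner_Integration.integrable_bound[OF isq]) (use sqb in \<open>auto intro!: AE_I2 order_trans[OF _ abs_ge_self]\<close>)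
	have sq2: "expectation (%w. (cmod (g (X0 w)))\<^sup>2) <= K2"
	proof -
		have "expectation (%w. (cmod (g (X0 w)))\<^sup>2) <= expectation (%w. 2 * (X0 w)\<^sup>2 + 2 * Ck\<^sup>2 + 4)"
			by (rule integral_mono[OF sq1 isq sqb])
		also have "... = K2" using X0_square_integrable by (simp add: K2_def m2_def prob_space)
		finally show ?thesis .
	qed
	note vb = variance_bound[OF tau g lip mean sq1 sq2, where n=n]
	have e: "(cmod ((1 / of_nat n) * (\<Sum>j=1..n. g (Xc tau j w))))\<^sup>2 = (1 / (real n)\<^sup>2) * (cmod (\<Sum>j=1..n. g (Xc tau j w)))\<^sup>2" for w
		by (simp add: norm_mult norm_divide power_mult_distrib power_divide)
	show "integrable M (%w. (cmod ((1 / of_nat n) * (\<Sum>j=1..n. g (Xc tau j w))))\<^sup>2)"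
		unfolding e using vb(1) by (rule integrable_mult_right)
	have "real n * ((1 + Ck) * (1 + \<bar>t\<bar>) * exp (- tau) ^ q) <= 1"
	proof -
		have "(1 + Ck) * (1 + \<bar>t\<bar>) * exp (- tau) ^ q <= (1 + Ck) * (1 + T) * exp (- tau) ^ q"
			using t Ck_nonneg by (intro mult_right_mono mult_left_mono) auto
		then show ?thesis using small by (meson mult_left_mono of_nat_0_le_iff order_trans)
	qed
	then have 1: "(real n)\<^sup>2 * ((1 + Ck) * (1 + \<bar>t\<bar>) * exp (- tau) ^ q * K3 K2) <= real n * K3 K2"
		using K2(2) n mult_right_mono[of "real n * ((1 + Ck) * (1 + \<bar>t\<bar>) * exp (- tau) ^ q)" 1 "real n * K3 K2"]
		by (simp add: power2_eq_square mult_ac)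
	have "expectation (%w. (cmod ((1 / of_nat n) * (\<Sum>j=1..n. g (Xc tau j w))))\<^sup>2)
			= (1 / (real n)\<^sup>2) * expectation (%w. (cmod (\<Sum>j=1..n. g (Xc tau j w)))\<^sup>2)"
		unfolding e by (rule integral_mult_right_zero)
	also have "... <= (1 / (real n)\<^sup>2) * (2 * real q * real n * K2 + real n * K3 K2)"
		using vb(2)[of q] 1 by (intro mult_left_mono) auto
	also have "... = KM q / real n" using n by (simp add: KM_def power2_eq_square field_simps)
	finally show "expectation (%w. (cmod ((1 / of_nat n) * (\<Sum>j=1..n. g (Xc tau j w))))\<^sup>2) <= KM q / real n" .
qed

abbreviation path :: "real => 'a => nat => real" where "path tau w \<equiv> (%j. Xc tau j w)"

lemma hat_meas [measurable]:
	"(%(t, w). Dh (path tau w) n t) \<in> borel_measurable (lborel \<Otimes>\<^sub>M M)"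
	"(%(t, w). D1 (path tau w) n t) \<in> borel_measurable (lborel \<Otimes>\<^sub>M M)"
	"(%(t, w). Nh (path tau w) n t) \<in> borel_measurable (lborel \<Otimes>\<^sub>M M)"
	unfolding Dh_def D1_def Nh_def by measurable

lemma moments:
	assumes tau: "tau > 0" and n: "n >= 1"
		and small: "real n * ((1 + Ck) * (1 + T) * exp (- tau) ^ q) <= 1" and t: "\<bar>t\<bar> <= T"
	shows "integrable M (%w. (cmod (Dh (path tau w) n t))\<^sup>2)" "expectation (%w. (cmod (Dh (path tau w) n t))\<^sup>2) <= KM q / real n"
		"integrable M (%w. (cmod (D1 (path tau w) n t))\<^sup>2)" "expectation (%w. (cmod (D1 (path tau w) n t))\<^sup>2) <= KM q / real n"
		"integrable M (%w. (cmod (Nh (path tau w) n t))\<^sup>2)" "expectation (%w. (cmod (Nh (path tau w) n t))\<^sup>2) <= KM q / real n"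
proof -
	have iX: "integrable M (%w. cplx (X0 w) * iexp (t * X0 w))"
		by (rule Bochner_Integration.integrable_bound[OF X0_integrable]) (auto simp: norm_mult)
	have ie: "integrable M (%w. iexp (t * X0 w))" by (rule integrable_iexp_rv) simp
	have l1: "cmod ((iexp (t * (u + v)) - phi t) - (iexp (t * v) - phi t)) <= (1 + Ck) * (1 + \<bar>t\<bar>) * \<bar>u\<bar> * (1 + \<bar>v\<bar>)" for u v
	proof -
		have "\<bar>t\<bar> * \<bar>u\<bar> <= (1 + Ck) * (1 + \<bar>t\<bar>) * \<bar>u\<bar> * (1 + \<bar>v\<bar>)"
		proof -
			have "\<bar>t\<bar> * \<bar>u\<bar> <= (1 + \<bar>t\<bar>) * \<bar>u\<bar>" by (intro mult_right_mono) auto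
			also have "... <= (1 + Ck) * ((1 + \<bar>t\<bar>) * \<bar>u\<bar>)" using mult_right_mono[of 1 "1 + Ck" "(1 + \<bar>t\<bar>) * \<bar>u\<bar>"] Ck_nonneg by simp
			also have "... <= (1 + Ck) * ((1 + \<bar>t\<bar>) * \<bar>u\<bar>) * (1 + \<bar>v\<bar>)" using mult_left_mono[of 1 "1 + \<bar>v\<bar>" "(1 + Ck) * ((1 + \<bar>t\<bar>) * \<bar>u\<bar>)"] Ck_nonneg by simp
			finally show ?thesis by (simp add: mult.assoc)
		qed
		then show ?thesis using lip_iexp[of t u v] by simp
	qed
	have b1: "cmod (iexp (t * x) - phi t) <= 2" for x
		using norm_triangle_ineq4[of "iexp (t * x)" "phi t"] phi_le_1[of t] by simp
	have mean1: "(CLINT w|M. iexp (t * X0 w) - phi t) = 0" using ie char_X0[of t] by (simp add: prob_space)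
	show "integrable M (%w. (cmod (Dh (path tau w) n t))\<^sup>2)" "expectation (%w. (cmod (Dh (path tau w) n t))\<^sup>2) <= KM q / real n"
		unfolding Dh_def
		by (rule hat_moment[OF tau n _ _ _ _ small t, where g="%x. iexp (t * x) - phi t"]; use l1 b1 mean1 in auto)+
	have l2: "cmod (\<i> * (cplx (u + v) * iexp (t * (u + v)) - phik t * phi t) - \<i> * (cplx v * iexp (t * v) - phik t * phi t))
		 <= (1 + Ck) * (1 + \<bar>t\<bar>) * \<bar>u\<bar> * (1 + \<bar>v\<bar>)" for u v
	proof -
		have "\<i> * (cplx (u + v) * iexp (t * (u + v)) - phik t * phi t) - \<i> * (cplx v * iexp (t * v) - phik t * phi t)
			= \<i> * ((cplx (u + v) - 0) * iexp (t * (u + v)) - (cplx v - 0) * iexp (t * v))"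
			by (simp only: right_diff_distrib diff_0_right) simp
		then show ?thesis using lip_x_iexp[of 0 u v t] Ck_nonneg by (simp only: norm_mult norm_ii mult_1 norm_zero)
	qed
	have pp: "cmod (phik t * phi t) <= Ck"
		unfolding norm_mult using mult_mono[OF phik_le phi_le_1, of t t] Ck_nonneg by simp
	have b2: "cmod (\<i> * (cplx x * iexp (t * x) - phik t * phi t)) <= \<bar>x\<bar> + Ck" for x
		using norm_triangle_ineq4[of "cplx x * iexp (t * x)" "phik t * phi t"] pp by (simp add: norm_mult)
	have mean2: "(CLINT w|M. \<i> * (cplx (X0 w) * iexp (t * X0 w) - phik t * phi t)) = 0"
		using iX phi_k_phi[of t] by (simp add: prob_space)
	show "integrable M (%w. (cmod (D1 (path tau w) n t))\<^sup>2)" "expectation (%w. (cmod (D1 (path tau w) n t))\<^sup>2) <= KM q / real n"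
		unfolding D1_def
		by (rule hat_moment[OF tau n _ l2 mean2 disjI1[OF b2] small t]; measurable)+
	have l3: "cmod (\<i> * (cplx (u + v) - phik t) * iexp (t * (u + v)) - \<i> * (cplx v - phik t) * iexp (t * v))
		 <= (1 + Ck) * (1 + \<bar>t\<bar>) * \<bar>u\<bar> * (1 + \<bar>v\<bar>)" for u v
	proof -
		have "\<i> * (cplx (u + v) - phik t) * iexp (t * (u + v)) - \<i> * (cplx v - phik t) * iexp (t * v)
			= \<i> * ((cplx (u + v) - phik t) * iexp (t * (u + v)) - (cplx v - phik t) * iexp (t * v))"
			by (simp add: algebra_simps)
		then show ?thesis using lip_x_iexp[of "phik t" u v t] phik_le by (simp only: norm_mult norm_ii mult_1)
	qed
	have b3: "cmod (\<i> * (cplx x - phik t) * iexp (t * x)) <= \<bar>x\<bar> + Ck" for x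
		using norm_triangle_ineq4[of "cplx x" "phik t"] phik_le[of t] by (simp add: norm_mult)
	have mean3: "(CLINT w|M. \<i> * (cplx (X0 w) - phik t) * iexp (t * X0 w)) = 0"
	proof -
		have "(CLINT w|M. \<i> * (cplx (X0 w) - phik t) * iexp (t * X0 w))
			 = (CLINT w|M. \<i> * (cplx (X0 w) * iexp (t * X0 w)) - \<i> * phik t * iexp (t * X0 w))"
			by (intro Bochner_Integration.integral_cong refl) (simp add: algebra_simps)
		also have "... = \<i> * (phik t * phi t) - \<i> * phik t * phi t"
			using iX ie phi_k_phi[of t] char_X0[of t] by simp
		finally show ?thesis by simp
	qed
	show "integrable M (%w. (cmod (Nh (path tau w) n t))\<^sup>2)" "expectation (%w. (cmod (Nh (path tau w) n t))\<^sup>2) <= KM q / real n"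
		unfolding Nh_def
		by (rule hat_moment[OF tau n _ l3 mean3 disjI1[OF b3] small t]; measurable)+
qed

text \<open>\<open>JD\<close> controls the supremum of \<open>Dh\<close> on the window and
  \<open>JN\<close> the quadratic remainder. Both have a mean of order \<open>T / n\<close>.\<close>

definition JD :: "(nat => real) => nat => real => real" where
	"JD obs n T = (LINT t|lborel. indicator {-T..T} t * ((cmod (Dh obs n t))\<^sup>2 + (cmod (D1 obs n t))\<^sup>2))"
definition JN :: "(nat => real) => nat => real => real" where
	"JN obs n T = (LINT t|lborel. indicator {-T..T} t * ((cmod (Nh obs n t))\<^sup>2 + (cmod (Dh obs n t))\<^sup>2))"

lemma J_expectation:
	assumes tau: "tau > 0" and n: "n >= 1" and T: "0 <= T"
		and small: "real n * ((1 + Ck) * (1 + T) * exp (- tau) ^ q) <= 1"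
	shows "integrable M (%w. JD (path tau w) n T)" "expectation (%w. JD (path tau w) n T) <= 2 * T * (2 * KM q / real n)"
		"integrable M (%w. JN (path tau w) n T)" "expectation (%w. JN (path tau w) n T) <= 2 * T * (2 * KM q / real n)"
proof -
	note mo = moments[OF tau n small]
	have 1: "integrable M (%w. (cmod (Dh (path tau w) n t))\<^sup>2 + (cmod (D1 (path tau w) n t))\<^sup>2)"
		"expectation (%w. (cmod (Dh (path tau w) n t))\<^sup>2 + (cmod (D1 (path tau w) n t))\<^sup>2) <= 2 * KM q / real n"
		"integrable M (%w. (cmod (Nh (path tau w) n t))\<^sup>2 + (cmod (Dh (path tau w) n t))\<^sup>2)"
		"expectation (%w. (cmod (Nh (path tau w) n t))\<^sup>2 + (cmod (Dh (path tau w) n t))\<^sup>2) <= 2 * KM q / real n"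
		if "\<bar>t\<bar> <= T" for t
		using mo[OF that] by (simp_all add: Bochner_Integration.integral_add)
	have m: "(%(t, w). (cmod (Dh (path tau w) n t))\<^sup>2 + (cmod (D1 (path tau w) n t))\<^sup>2) \<in> borel_measurable (lborel \<Otimes>\<^sub>M M)"
		"(%(t, w). (cmod (Nh (path tau w) n t))\<^sup>2 + (cmod (Dh (path tau w) n t))\<^sup>2) \<in> borel_measurable (lborel \<Otimes>\<^sub>M M)"
		by measurable
	show "integrable M (%w. JD (path tau w) n T)" "expectation (%w. JD (path tau w) n T) <= 2 * T * (2 * KM q / real n)"
		unfolding JD_def using window_expectation[OF m(1) _ 1(1,2) T] by simp_all
	show "integrable M (%w. JN (path tau w) n T)" "expectation (%w. JN (path tau w) n T) <= 2 * T * (2 * KM q / real n)"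
		unfolding JN_def using window_expectation[OF m(2) _ 1(3,4) T] by simp_all
qed

lemma Dh_deriv: "n >= 1 ==> (Dh obs n has_vector_derivative D1 obs n t) (at t)"
proof -
	assume n: "n >= 1"
	have e: "((%t. iexp (t * x)) has_vector_derivative \<i> * (cplx x * iexp (t * x))) (at t)" for x
	proof -
		have "((iexp \<circ> (%t. t * x)) has_vector_derivative x *\<^sub>R (\<i> * iexp (t * x))) (at t)"
			by (rule vector_diff_chain_at; auto intro!: derivative_eq_intros has_vector_derivative_iexp[THEN has_vector_derivative_at_within]
								simp flip: has_real_derivative_iff_has_vector_derivative)
		then show ?thesis by (simp add: comp_def scaleR_conv_of_real mult_ac)
	qed
	have "((%t. (1 / of_nat n) * (\<Sum>j=1..n. iexp (t * obs j) - phi t)) has_vector_derivative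
		 (1 / of_nat n) * (\<Sum>j=1..n. \<i> * (cplx (obs j) * iexp (t * obs j)) - \<i> * phik t * phi t)) (at t)"
		by (intro has_vector_derivative_mult_right has_vector_derivative_sum has_vector_derivative_diff e phi_deriv)
	then show ?thesis unfolding Dh_def[abs_def] D1_def by (simp add: right_diff_distrib mult.assoc)
qed

lemma Dh_0: "Dh obs n 0 = 0" by (simp add: Dh_def)

lemma phik_minus: "phik (- t) = cnj (phik t)"
proof -
	have "cnj (CLINT x|lborel. iexp (t * x) * cplx (k x)) = (CLINT x|lborel. cnj (iexp (t * x) * cplx (k x)))"
		by (rule Bochner_Integration.integral_cnj[symmetric])
	also have "... = (CLINT x|lborel. iexp ((- t) * x) * cplx (k x))"
		by (intro Bochner_Integration.integral_cong refl) (simp add: exp_cnj)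
	finally show ?thesis unfolding phi_k_eq by simp
qed

lemma hat_minus: "Dh obs n (- t) = cnj (Dh obs n t)" "cmod (Nh obs n (- t)) = cmod (Nh obs n t)"
proof -
	show "Dh obs n (- t) = cnj (Dh obs n t)" unfolding Dh_def phi_minus by (simp add: exp_cnj)
	have "Nh obs n (- t) = - cnj (Nh obs n t)"
		unfolding Nh_def phik_minus by (simp add: exp_cnj sum_negf)
	then show "cmod (Nh obs n (- t)) = cmod (Nh obs n t)" by simp
qed

lemma hat_cont: "continuous_on A (Dh obs n)" "continuous_on A (D1 obs n)" "continuous_on A (Nh obs n)"
	unfolding Dh_def[abs_def] D1_def[abs_def] Nh_def[abs_def] by (rule continuous_on_mult_left, intro continuous_intros phi_cont phik_cont)+

lemma integrable_window:
	assumes "continuous_on UNIV (f :: real => real)"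
	shows "integrable lborel (%t. indicator {-T..T} t * f t)"
	using borel_integrable_atLeastAtMost'[of "-T" T f] continuous_on_subset[OF assms]
	by (simp add: set_integrable_def)

text \<open>\<open>Dh\<close> vanishes at 0, so \<open>|Dh|^2\<close> is the integral of its
  derivative, which is at most \<open>|Dh|^2 + |D1|^2\<close>. A supremum is thus bounded by an
  integral, whose mean Fubini computes.\<close>

lemma sup_bound:
	assumes n: "n >= 1" and t: "\<bar>t\<bar> <= T"
	shows "(cmod (Dh obs n t))\<^sup>2 <= JD obs n T"
proof -
	define u where "u = \<bar>t\<bar>"
	have u: "0 <= u" "u <= T" using t by (auto simp: u_def)
	have eq: "cmod (Dh obs n t) = cmod (Dh obs n u)" unfolding u_def by (cases "t >= 0") (auto simp: hat_minus)
	let ?f' = "%s. 2 * Re (cnj (Dh obs n s) * D1 obs n s)"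
	have d: "((%s. (cmod (Dh obs n s))\<^sup>2) has_real_derivative ?f' s) (at s)" for s
	proof -
		have R: "((%s. Re (Dh obs n s)) has_real_derivative Re (D1 obs n s)) (at s)" by (rule Re_deriv[OF Dh_deriv[OF n]])
		have I: "((%s. Im (Dh obs n s)) has_real_derivative Im (D1 obs n s)) (at s)"
			unfolding has_real_derivative_iff_has_vector_derivative
			by (rule bounded_linear.has_vector_derivative[OF bounded_linear_Im Dh_deriv[OF n]])
		show ?thesis unfolding cmod_power2 by (rule derivative_eq_intros R I refl | simp)+
	qed
	have cf: "continuous_on UNIV ?f'" using hat_cont by (intro continuous_intros)
	have "has_bochner_integral lborel (%s. ?f' s * indicator {0..u} s) ((cmod (Dh obs n u))\<^sup>2 - (cmod (Dh obs n 0))\<^sup>2)"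
		using u d cf by (intro has_bochner_integral_FTC_Icc_real) (auto simp: continuous_on_eq_continuous_at)
	then have "(cmod (Dh obs n u))\<^sup>2 = (LINT s|lborel. ?f' s * indicator {0..u} s)"
		by (simp add: Dh_0 has_bochner_integral_integral_eq)
	also have "... <= \<bar>...\<bar>" by (rule abs_ge_self)
	also have "... <= JD obs n T"
		unfolding JD_def
	proof (rule abs_integral_le)
		show "integrable lborel (%s. indicator {-T..T} s * ((cmod (Dh obs n s))\<^sup>2 + (cmod (D1 obs n s))\<^sup>2))"
			using hat_cont by (intro integrable_window continuous_intros)
		fix s
		have "\<bar>?f' s\<bar> <= 2 * (cmod (Dh obs n s) * cmod (D1 obs n s))"
			using abs_Re_le_cmod[of "cnj (Dh obs n s) * D1 obs n s"] by (simp add: norm_mult)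
		also have "... <= (cmod (Dh obs n s))\<^sup>2 + (cmod (D1 obs n s))\<^sup>2"
			using sum_squares_bound[of "cmod (Dh obs n s)" "cmod (D1 obs n s)"] by simp
		finally show "\<bar>?f' s * indicator {0..u} s\<bar> <= indicator {-T..T} s * ((cmod (Dh obs n s))\<^sup>2 + (cmod (D1 obs n s))\<^sup>2)"
			using u by (auto simp: indicator_def)
	qed
	finally show ?thesis unfolding eq .
qed

text \<open>The influence function of the estimator at an observation \<open>y\<close>: the
  first-order errors of the logarithmic derivatives at \<open>t\<close> and \<open>- t\<close>,
  smoothed by the kernel. Its companion \<open>bt\<close> below is the smoothed target.\<close>

definition fl :: "(real => real) => real => real => real => real" where
	"fl W h x y = Re (1 / (2 * cplx pi) * (CLINT t|lborel. iexp (- (t * x)) *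
		 ((cplx y - phik t) * iexp (t * y) / phi t + (cplx y - phik (- t)) * iexp ((- t) * y) / phi (- t)) * ft W (t * h)))"

definition bt :: "(real => real) => real => real => real" where
	"bt W h x = Re (1 / (2 * cplx pi) * (CLINT t|lborel. iexp (- (t * x)) * ((phik t + phik (- t)) * ft W (t * h))))"

lemma hat_relations:
	assumes n: "n >= 1" and tr: "!!j. j \<in> {1..n} ==> \<bar>obs j\<bar> <= \<theta>"
	shows "phi_hat obs n t = phi t + Dh obs n t" "dphi_hat obs n \<theta> t = \<i> * phik t * phi_hat obs n t + Nh obs n t"
proof -
	show "phi_hat obs n t = phi t + Dh obs n t"
		using n unfolding phi_hat_def Dh_def by (simp add: sum_subtractf field_simps)
	have e1: "(\<Sum>j=1..n. cplx (obs j) * iexp (t * obs j) * (if \<bar>obs j\<bar> <= \<theta> then 1 else 0)) = (\<Sum>j=1..n. cplx (obs j) * iexp (t * obs j))"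
		using tr by (intro sum.cong refl) auto
	have e2: "(\<Sum>j=1..n. \<i> * (cplx (obs j) - phik t) * iexp (t * obs j))
		 = \<i> * (\<Sum>j=1..n. cplx (obs j) * iexp (t * obs j)) - \<i> * phik t * (\<Sum>j=1..n. iexp (t * obs j))"
		by (simp add: sum_distrib_left sum_subtractf algebra_simps)
	have gen: "(\<i> / c) * A = \<i> * p * ((1 / c) * B) + (1 / c) * (\<i> * A - \<i> * p * B)" for A B c p :: complex
		by (simp add: algebra_simps diff_divide_distrib)
	show "dphi_hat obs n \<theta> t = \<i> * phik t * phi_hat obs n t + Nh obs n t"
		unfolding phi_hat_def Nh_def dphi_hat_def e1 e2 by (rule gen)
qed

lemma fl_integrand_bound:
	assumes t: "\<bar>t\<bar> <= T" and CW: "!!u. cmod (ft W u) <= CW"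
	shows "cmod (iexp (- (t * x)) *
		 ((cplx y - phik t) * iexp (t * y) / phi t + (cplx y - phik (- t)) * iexp ((- t) * y) / phi (- t)) * ft W (t * h)) <= (2 * ((\<bar>y\<bar> + Ck) / md T)) * CW"
proof -
	have b: "cmod ((cplx y - phik s) * iexp (s * y) / phi s) <= (\<bar>y\<bar> + Ck) / md T" if "\<bar>s\<bar> <= T" for s
	proof -
		have "cmod (cplx y - phik s) <= \<bar>y\<bar> + Ck"
			using norm_triangle_ineq4[of "cplx y" "phik s"] phik_le[of s] by simp
		moreover have "md T <= md s" using that by (intro md_dec_abs) auto
		ultimately show ?thesis unfolding norm_divide norm_mult norm_exp_i_times mult_1_right md_def[symmetric]
			using md_pos Ck_nonneg by (intro frac_le) auto
	qed
	have "cmod ((cplx y - phik t) * iexp (t * y) / phi t + (cplx y - phik (- t)) * iexp ((- t) * y) / phi (- t))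
			<= 2 * ((\<bar>y\<bar> + Ck) / md T)"
		using norm_triangle_ineq[of "(cplx y - phik t) * iexp (t * y) / phi t" "(cplx y - phik (- t)) * iexp ((- t) * y) / phi (- t)"]
			b[of t] b[of "- t"] t by linarith
	then show ?thesis
		unfolding norm_mult[of _ "ft W (t * h)"] norm_mult[of "iexp (- (t * x))"] norm_exp_i_times mult_1
		using CW[of "t * h"] md_pos[of T] Ck_nonneg by (intro mult_mono) (auto intro!: divide_nonneg_pos)
qed

lemma fl_integrable:
	assumes h: "h > 0" and T: "T = 1 / h" and [measurable]: "ft W \<in> borel_measurable borel"
		and CW: "!!u. cmod (ft W u) <= CW" and supp: "!!u. \<bar>u\<bar> > 1 ==> ft W u = 0"
	shows "integrable lborel (%t. iexp (- (t * x)) *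
		 ((cplx y - phik t) * iexp (t * y) / phi t + (cplx y - phik (- t)) * iexp ((- t) * y) / phi (- t)) * ft W (t * h))"
proof (rule integrable_bounded_support(1)[where R=T and C="(2 * ((\<bar>y\<bar> + Ck) / md T)) * CW", OF _ fl_integrand_bound[OF _ CW]])
	fix t assume "\<bar>t\<bar> > T"
	then have "\<bar>t * h\<bar> > 1" using h T by (simp add: abs_mult field_simps)
	then show "iexp (- (t * x)) *
		 ((cplx y - phik t) * iexp (t * y) / phi t + (cplx y - phik (- t)) * iexp ((- t) * y) / phi (- t)) * ft W (t * h) = 0"
		using supp by simp
qed measurable

text \<open>On [-T, T] the empirical function has at least half the modulus of \<open>phi\<close>,
  so dividing by it instead of \<open>phi\<close> changes \<open>Nh / phi\<close> by at most
  \<open>2 * |Nh| * |Dh| / (md T)^2\<close>. By \<open>tr\<close> no observation exceeds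
  \<open>\<theta>\<close>, so the truncation is inactive.\<close>

lemma khat_decomp:
	assumes n: "n >= 1" and h: "h > 0" and T: "T = 1 / h"
		and tr: "!!j. j \<in> {1..n} ==> \<bar>obs j\<bar> <= \<theta>"
		and near: "!!t. \<bar>t\<bar> <= T ==> cmod (Dh obs n t) <= md t / 2"
		and ftm[measurable]: "ft W \<in> borel_measurable borel"
		and CW: "!!u. cmod (ft W u) <= CW" and supp: "!!u. \<bar>u\<bar> > 1 ==> ft W u = 0"
	shows "\<bar>khat W h \<theta> obs n x - bt W h x - (1 / real n) * (\<Sum>j=1..n. fl W h x (obs j))\<bar> <= CW * JN obs n T / (md T)\<^sup>2"
proof -
	have rel: "phi_hat obs n t = phi t + Dh obs n t" "dphi_hat obs n \<theta> t = \<i> * phik t * phi_hat obs n t + Nh obs n t" for t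
		by (rule hat_relations[OF n]; rule tr; assumption)+
	have [measurable]: "Dh obs n \<in> borel_measurable borel" "Nh obs n \<in> borel_measurable borel"
		using hat_cont by (auto intro: borel_measurable_continuous_onI)
	have CW0: "0 <= CW" using order_trans[OF norm_ge_zero CW] .
	have T0: "T > 0" using h T by simp
	have supp': "ft W (t * h) = 0" if "\<bar>t\<bar> > T" for t
	proof -
		have "\<bar>t * h\<bar> > 1" using that h T by (simp add: abs_mult field_simps)
		then show ?thesis by (rule supp)
	qed
	let ?b = "phi_hat obs n" and ?a = "dphi_hat obs n \<theta>"
	have bn: "cmod (?b t) >= md t / 2" if "\<bar>t\<bar> <= T" for t
		using near[OF that] norm_triangle_ineq2[of "phi t" "- Dh obs n t"] unfolding rel(1) md_def by simp
	have b0: "?b t ~= 0" if "\<bar>t\<bar> <= T" for t using bn[OF that] md_pos[of t] by auto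
	let ?L = "%t. Nh obs n t / phi t"
	define R where "R t = Nh obs n t / (phi t + Dh obs n t) - Nh obs n t / phi t" for t
	have q: "?a t / ?b t = \<i> * phik t + ?L t + R t" if "\<bar>t\<bar> <= T" for t
		unfolding R_def rel(2)[of t] using b0[OF that] by (simp add: rel(1) add_divide_distrib)
	define B where "B t = ((cmod (Nh obs n t))\<^sup>2 + (cmod (Dh obs n t))\<^sup>2) / (md T)\<^sup>2" for t
	have Rb: "cmod (R t) <= B t" if "\<bar>t\<bar> <= T" for t
	proof -
		have "R t = - Nh obs n t * Dh obs n t / (phi t * ?b t)"
			unfolding R_def using b0[OF that] by (simp add: rel(1) field_simps)
		then have e: "cmod (R t) = cmod (Nh obs n t) * cmod (Dh obs n t) / (md t * cmod (?b t))"
			by (simp add: norm_mult norm_divide md_def)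
		have mT: "md T <= md t" using that by (intro md_dec_abs) auto
		have "(md T)\<^sup>2 / 2 <= md t * cmod (?b t)"
		proof -
			have "md T * (md T / 2) <= md t * cmod (?b t)"
				using mT bn[OF that] md_pos[of T] md_pos[of t] by (intro mult_mono) auto
			then show ?thesis by (simp add: power2_eq_square)
		qed
		then have "cmod (R t) <= cmod (Nh obs n t) * cmod (Dh obs n t) / ((md T)\<^sup>2 / 2)"
			unfolding e by (intro divide_left_mono)
				(use md_pos[of T] md_pos[of t] b0[OF that] in \<open>auto intro!: mult_pos_pos divide_pos_pos zero_less_power\<close>)
		also have "... = (2 * cmod (Nh obs n t) * cmod (Dh obs n t)) / (md T)\<^sup>2" by simp
		also have "... <= B t" unfolding B_def
			using sum_squares_bound[of "cmod (Nh obs n t)" "cmod (Dh obs n t)"] by (intro divide_right_mono) auto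
		finally show ?thesis .
	qed
	let ?e = "%t. iexp (- (t * x))" and ?wv = "%t. ft W (t * h)"
	define I1 where "I1 t = ?e t * ((phik t + phik (- t)) * ?wv t)" for t
	define I2 where "I2 t = (1 / of_nat n) * (\<Sum>j=1..n. ?e t *
		 ((cplx (obs j) - phik t) * iexp (t * obs j) / phi t + (cplx (obs j) - phik (- t)) * iexp ((- t) * obs j) / phi (- t)) * ?wv t)" for t
	define I3 where "I3 t = ?e t * (- \<i> * (R t + R (- t))) * ?wv t" for t
	have I2': "I2 t = ?e t * (- \<i> * (?L t + ?L (- t))) * ?wv t" for t
	proof -
		have "- \<i> * ?L s = (1 / of_nat n) * (\<Sum>j=1..n. (cplx (obs j) - phik s) * iexp (s * obs j) / phi s)" for s
			unfolding Nh_def by (simp add: sum_divide_distrib sum_distrib_left mult_ac)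
		then have "- \<i> * (?L t + ?L (- t)) = (1 / of_nat n) * (\<Sum>j=1..n. (cplx (obs j) - phik t) * iexp (t * obs j) / phi t + (cplx (obs j) - phik (- t)) * iexp ((- t) * obs j) / phi (- t))"
			by (simp only: distrib_left sum.distrib)
		then show ?thesis unfolding I2_def by (simp only: sum_distrib_left sum_distrib_right mult_ac)
	qed
	have i1: "integrable lborel I1"
		unfolding I1_def
	proof (rule integrable_bounded_support(1)[where R=T and C="(2 * Ck) * CW"])
		fix t
		have "cmod (phik t + phik (- t)) <= 2 * Ck" using norm_triangle_ineq[of "phik t" "phik (- t)"] phik_le[of t] phik_le[of "- t"] by linarith
		then show "cmod (?e t * ((phik t + phik (- t)) * ?wv t)) <= (2 * Ck) * CW"
			unfolding norm_mult[of "?e t"] norm_mult[of "phik t + phik (- t)"] norm_exp_i_times mult_1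
			using CW Ck_nonneg by (intro mult_mono) auto
	qed (use supp' in auto)
	have i2: "integrable lborel I2"
		unfolding I2_def by (intro integrable_mult_right Bochner_Integration.integrable_sum fl_integrable[OF h T ftm CW supp])
	have JNi: "integrable lborel (%t. indicator {-T..T} t * B t)"
		unfolding B_def using hat_cont md_pos[of T] by (intro integrable_window continuous_intros) auto
	have Bm: "B (- t) = B t" for t by (simp add: B_def hat_minus)
	have I3b: "cmod (I3 t) <= (2 * CW) * (indicator {-T..T} t * B t)" for t
	proof (cases "\<bar>t\<bar> <= T")
		case True
		have "cmod (R t + R (- t)) <= 2 * B t"
			using norm_triangle_ineq[of "R t" "R (- t)"] Rb[of t] Rb[of "- t"] True Bm[of t] by simp
		then have "cmod (R t + R (- t)) * cmod (?wv t) <= (2 * B t) * CW" using CW by (intro mult_mono) (auto simp: B_def)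
		then show ?thesis unfolding I3_def using True by (simp add: norm_mult indicator_def abs_le_iff mult_ac)
	next
		case False
		then have "T < \<bar>t\<bar>" by simp
		then have "I3 t = 0" using supp'[of t] by (simp add: I3_def)
		moreover have "0 <= (2 * CW) * (indicator {-T..T} t * B t)" using CW0 by (simp add: B_def)
		ultimately show ?thesis by simp
	qed
	have [measurable]: "R \<in> borel_measurable borel" unfolding R_def by measurable
	have [measurable]: "I3 \<in> borel_measurable borel" unfolding I3_def by measurable
	have i3: "integrable lborel I3"
		by (rule Bochner_Integration.integrable_bound[OF integrable_mult_right[OF JNi, of "2 * CW"]])
			 (use I3b in \<open>auto intro!: AE_I2 order_trans[OF _ abs_ge_self]\<close>)
	have tot: "- \<i> * (iexp (- t * x) * (dphi_sharp_hat obs n \<theta> t / phi_sharp_hat obs n t) * ?wv t) = I1 t + I2 t + I3 t" for t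
	proof (cases "\<bar>t\<bar> <= T")
		case True
		\<comment> \<open>In form the quotient is the logarithmic derivative of
		  \<open>phi_hat t / phi_hat (- t)\<close>, so it splits into the logarithmic derivatives at
		  \<open>t\<close> and at \<open>- t\<close>.\<close>
		have "dphi_sharp_hat obs n \<theta> t / phi_sharp_hat obs n t = ?a t / ?b t + ?a (- t) / ?b (- t)"
			unfolding dphi_sharp_hat_def phi_sharp_hat_def using b0[of t] b0[of "- t"] True
			by (simp add: field_simps power2_eq_square)
		also have "... = \<i> * (phik t + phik (- t)) + (?L t + ?L (- t)) + (R t + R (- t))"
			using q[of t] q[of "- t"] True by (simp add: algebra_simps)
		finally have r: "dphi_sharp_hat obs n \<theta> t / phi_sharp_hat obs n t = \<i> * (phik t + phik (- t)) + (?L t + ?L (- t)) + (R t + R (- t))" .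
		have gen: "- \<i> * (e * (\<i> * p + l + r) * wv) = e * (p * wv) + e * (- \<i> * l) * wv + e * (- \<i> * r) * wv" for e p l r wv :: complex
			by (simp add: algebra_simps)
		show ?thesis unfolding r I1_def I2' I3_def using gen by simp
	next
		case False
		then have "T < \<bar>t\<bar>" by simp
		then show ?thesis using supp'[of t] by (simp add: I1_def I2' I3_def)
	qed
	let ?c = "1 / (2 * cplx pi)"
	have "(- \<i> / (2 * cplx pi)) * (CLINT t|lborel. iexp (- t * x) * (dphi_sharp_hat obs n \<theta> t / phi_sharp_hat obs n t) * ?wv t)
		 = ?c * (CLINT t|lborel. - \<i> * (iexp (- t * x) * (dphi_sharp_hat obs n \<theta> t / phi_sharp_hat obs n t) * ?wv t))"
		unfolding integral_mult_right_zero by simp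
	also have "... = ?c * (integral\<^sup>L lborel I1 + integral\<^sup>L lborel I2 + integral\<^sup>L lborel I3)"
		unfolding tot using i1 i2 i3 by (simp add: Bochner_Integration.integral_add Bochner_Integration.integrable_add)
	finally have "khat W h \<theta> obs n x = Re (?c * integral\<^sup>L lborel I1) + Re (?c * integral\<^sup>L lborel I2) + Re (?c * integral\<^sup>L lborel I3)"
		unfolding khat_def by (simp add: distrib_left)
	moreover have "Re (?c * integral\<^sup>L lborel I1) = bt W h x" unfolding bt_def I1_def by simp
	moreover have "Re (?c * integral\<^sup>L lborel I2) = (1 / real n) * (\<Sum>j=1..n. fl W h x (obs j))"
	proof -
		have "integral\<^sup>L lborel I2 = (1 / of_nat n) * (\<Sum>j=1..n. CLINT t|lborel. ?e t *
		 ((cplx (obs j) - phik t) * iexp (t * obs j) / phi t + (cplx (obs j) - phik (- t)) * iexp ((- t) * obs j) / phi (- t)) * ?wv t)"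
			unfolding I2_def integral_mult_right_zero
			by (simp only: Bochner_Integration.integral_sum[OF fl_integrable[OF h T ftm CW supp]])
		then have "?c * integral\<^sup>L lborel I2 = (1 / of_nat n) * (\<Sum>j=1..n. ?c * (CLINT t|lborel. ?e t *
		 ((cplx (obs j) - phik t) * iexp (t * obs j) / phi t + (cplx (obs j) - phik (- t)) * iexp ((- t) * obs j) / phi (- t)) * ?wv t))"
			by (simp only: sum_distrib_left mult.left_commute)
		then have "Re (?c * integral\<^sup>L lborel I2) = Re (cplx (1 / real n) * (\<Sum>j=1..n. ?c * (CLINT t|lborel. ?e t *
		 ((cplx (obs j) - phik t) * iexp (t * obs j) / phi t + (cplx (obs j) - phik (- t)) * iexp ((- t) * obs j) / phi (- t)) * ?wv t)))"
			by simp
		moreover have "Re (cplx r * z) = r * Re z" for r z by simp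
		ultimately show ?thesis unfolding fl_def by (simp only: Re_sum)
	qed
	moreover have "\<bar>Re (?c * integral\<^sup>L lborel I3)\<bar> <= CW * JN obs n T / (md T)\<^sup>2"
	proof -
		have jn: "(LINT t|lborel. indicator {-T..T} t * B t) = JN obs n T / (md T)\<^sup>2"
			unfolding JN_def B_def by (simp flip: Bochner_Integration.integral_divide_zero)
		have j0: "0 <= (LINT t|lborel. indicator {-T..T} t * B t)" by (rule Bochner_Integration.integral_nonneg) (simp add: B_def)
		have "cmod (integral\<^sup>L lborel I3) <= (LINT t|lborel. (2 * CW) * (indicator {-T..T} t * B t))"
			by (rule norm_integral_le[OF integrable_mult_right[OF JNi]]) (rule I3b)
		also have "... = (2 * CW) * (LINT t|lborel. indicator {-T..T} t * B t)" by (rule integral_mult_right_zero)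
		also have "... <= (2 * pi * CW) * (LINT t|lborel. indicator {-T..T} t * B t)"
			using pi_gt3 CW0 j0 mult_right_mono[of 2 "2 * pi" CW] by (intro mult_right_mono) auto
		finally have "cmod (?c * integral\<^sup>L lborel I3) <= CW * (LINT t|lborel. indicator {-T..T} t * B t)"
			by (simp add: norm_mult norm_divide field_simps)
		then show ?thesis using abs_Re_le_cmod[of "?c * integral\<^sup>L lborel I3"] unfolding jn by simp
	qed
	ultimately show ?thesis by simp
qed

end

section \<open>Central limit theorem for triangular arrays along the chain\<close>

context ou_stat
begin

text \<open>The last \<open>q\<close> indices up to \<open>j\<close>, written with an addition
  because \<open>j - q\<close> is cut off at 0. For \<open>j < q\<close> the window is all of
  \<open>{..j}\<close>, and \<open>Xt\<close> coincides with \<open>Xc\<close>.\<close>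

definition Wd :: "nat => nat => nat set" where "Wd q j = {l. l <= j \<and> j < l + q}"

definition Xt :: "real => nat => nat => 'a => real" where
	"Xt tau q j w = (\<Sum>l\<in>Wd q j. exp (- tau) ^ (j - l) * eta tau l w)"

lemma Xt_meas [measurable]: "Xt tau q j \<in> borel_measurable M" unfolding Xt_def by measurable

lemma Xt_close: assumes "tau > 0" shows "\<bar>Xc tau j w - Xt tau q j w\<bar> <= exp (- tau) ^ q * \<bar>Xc tau (j - q) w\<bar>"
proof (cases "q <= j")
	case True
	have "Wd q j = {j - q<..j}" using True by (auto simp: Wd_def)
	then have "Xt tau q j w = zeta tau (j - q) j w" by (simp add: Xt_def zeta_def)
	moreover have "Xc tau j w = exp (- tau) ^ (j - (j - q)) * Xc tau (j - q) w + zeta tau (j - q) j w" by (rule Xc_split) simp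
	ultimately show ?thesis using True by (simp add: abs_mult)
next
	case False
	then have "Wd q j = {..j}" by (auto simp: Wd_def)
	then show ?thesis by (simp add: Xt_def Xc_def)
qed

lemma E_abs_Xc: assumes "tau > 0" shows "integrable M (%w. \<bar>Xc tau j w\<bar>)" "expectation (%w. \<bar>Xc tau j w\<bar>) <= 1 + m2"
	using E_Xc[OF assms, of "%x. \<bar>x\<bar>" j] X0_integrable E_abs_X0 by auto

text \<open>Each observation is replaced by a function of its last \<open>q\<close> innovations, at
  the price \<open>\<delta>\<close> in each expectation, and \<open>stein_char\<close> is applied
  with neighbourhoods of radius \<open>q\<close> and \<open>2 * q\<close>. The bound is
  non-asymptotic because \<open>H\<close> will change with \<open>n\<close>. The variance proxy
  \<open>V\<close> of the truncated array stays implicit and is only compared with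
  \<open>s2\<close>.\<close>

lemma array_clt_fixed:
	fixes H :: "real => real"
	assumes tau: "tau > 0" and n: "n >= 1" and q: "q >= 1" and [measurable]: "H \<in> borel_measurable borel"
		and b: "!!y. \<bar>H y\<bar> <= b" and lip: "!!y z. \<bar>H y - H z\<bar> <= \<Lambda> * \<bar>y - z\<bar> * (1 + \<bar>z\<bar>)"
		and mean: "expectation (%w. H (X0 w)) = 0"
		and lag: "!!i j. i < j ==> \<bar>expectation (%w. H (Xc tau i w) * H (Xc tau j w))\<bar> <= lg"
	defines "s2 \<equiv> expectation (%w. (H (X0 w))\<^sup>2)" and "\<delta> \<equiv> \<Lambda> * exp (- tau) ^ q * (1 + 2 * m2)"
	shows "\<exists>V. \<bar>V - s2\<bar> <= 2 * real q * (lg + 2 * b * \<delta>) \<and>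
		 cmod ((CLINT w|M. iexp ((1 / sqrt (real n)) * (\<Sum>j=1..n. H (Xc tau j w)))) - cplx (exp (- V / 2)))
			 <= exp \<bar>V\<bar> * (sqrt (real n) * \<delta> + 3 * (4 * real q)\<^sup>2 * (b / sqrt (real n)) * (s2 + 2 * b * \<delta>)) + sqrt (real n) * \<delta>"
proof -
	define c where "c = 1 / sqrt (real n)"
	have c: "0 < c" "c * c = 1 / real n" "real n * c = sqrt (real n)" using n
		by (auto simp: c_def real_div_sqrt)
	have b0: "0 <= b" using b[of 0] abs_ge_zero order_trans by blast
	have L0: "0 <= \<Lambda>" using order_trans[OF abs_ge_zero lip[of 1 0]] by simp
	have d0: "0 <= \<delta>" unfolding \<delta>_def using L0 m2_nonneg by simp
	have lg0: "0 <= lg" using order_trans[OF abs_ge_zero lag[of 0 1]] by simp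
	define \<xi> where "\<xi> j w = c * H (Xt tau q j w)" for j w
	have xm[measurable]: "\<xi> j \<in> borel_measurable M" for j unfolding \<xi>_def by measurable
	let ?I = "{1..n}"
	define nb where "nb j = {i\<in>?I. i < j + q \<and> j < i + q}" for j
	define nb2 where "nb2 j = {i\<in>?I. i < j + 2 * q \<and> j < i + 2 * q}" for j
	have ib: "integrable M f" if "f \<in> borel_measurable M" "!!w. norm (f w) <= B" for f :: "'a => 'c::{banach, second_countable_topology}" and B
		using that by (rule integrable_bounded_rv)
	have iF: "integrable M (%w. H (Xt tau q j w))" "integrable M (%w. H (Xc tau j w))" for j
		by (rule ib[of _ b]; use b in auto)+
	have bb: "\<bar>H y * H z\<bar> <= b * b" for y z unfolding abs_mult by (intro mult_mono b b0) auto
	have iFF: "integrable M (%w. H (Xt tau q j w) * H (Xt tau q i w))" "integrable M (%w. H (Xc tau j w) * H (Xc tau i w))" for i j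
		by (rule ib[of _ "b * b"]; use bb in auto)+
	\<comment> \<open>The random factor in the Lipschitz bound for the replacement. Its mean is at most
	  \<open>1 + 2 * m2\<close>, the last factor in \<open>\<delta>\<close>.\<close>
	define Z where "Z j w = \<bar>Xc tau (j - q) w\<bar> * (1 + \<bar>Xc tau j w\<bar>)" for j w
	have sqi: "integrable M (%w. \<bar>Xc tau j w\<bar>\<^sup>2)" "expectation (%w. \<bar>Xc tau j w\<bar>\<^sup>2) = m2" for j
		using E_Xc[OF tau, of "%x. \<bar>x\<bar>\<^sup>2" j] X0_square_integrable by (auto simp: m2_def)
	note pr = prod_integrable[OF _ _ sqi(1) sqi(1)]
	have iZ: "integrable M (Z j)" and eZ: "expectation (Z j) <= 1 + 2 * m2" for j
	proof -
		have e: "Z j = (%w. \<bar>Xc tau (j - q) w\<bar> + \<bar>Xc tau (j - q) w\<bar> * \<bar>Xc tau j w\<bar>)" by (auto simp: Z_def algebra_simps)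
		show "integrable M (Z j)" unfolding e using E_abs_Xc(1)[OF tau, of "j - q"] pr(1)[of "j - q" j] by auto
		have "expectation (Z j) = expectation (%w. \<bar>Xc tau (j - q) w\<bar>) + expectation (%w. \<bar>Xc tau (j - q) w\<bar> * \<bar>Xc tau j w\<bar>)"
			unfolding e using E_abs_Xc(1)[OF tau, of "j - q"] pr(1)[of "j - q" j] by simp
		moreover have "expectation (%w. \<bar>Xc tau (j - q) w\<bar> * \<bar>Xc tau j w\<bar>) <= m2" using pr(2)[of "j - q" j] unfolding sqi(2) by simp
		ultimately show "expectation (Z j) <= 1 + 2 * m2" using E_abs_Xc(2)[OF tau, of "j - q"] by linarith
	qed
	have cl: "\<bar>H (Xc tau j w) - H (Xt tau q j w)\<bar> <= \<Lambda> * exp (- tau) ^ q * Z j w" for j w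
	proof -
		have "\<bar>H (Xc tau j w) - H (Xt tau q j w)\<bar> <= \<Lambda> * \<bar>Xc tau j w - Xt tau q j w\<bar> * (1 + \<bar>Xc tau j w\<bar>)"
			using lip[of "Xt tau q j w" "Xc tau j w"] by (simp add: abs_minus_commute)
		also have "... <= \<Lambda> * (exp (- tau) ^ q * \<bar>Xc tau (j - q) w\<bar>) * (1 + \<bar>Xc tau j w\<bar>)"
			using Xt_close[OF tau, of j w q] L0 by (intro mult_right_mono mult_left_mono) auto
		finally show ?thesis by (simp add: Z_def mult.assoc)
	qed
	have ecl: "expectation (%w. \<Lambda> * exp (- tau) ^ q * Z j w) <= \<delta>" for j
		unfolding \<delta>_def integral_mult_right_zero using eZ L0 by (intro mult_left_mono) auto
	have icl: "integrable M (%w. \<Lambda> * exp (- tau) ^ q * Z j w)" for j using iZ by (rule integrable_mult_right)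
	have E1: "\<bar>expectation (%w. H (Xt tau q j w))\<bar> <= \<delta>" for j
	proof -
		have e: "expectation (%w. H (Xt tau q j w)) = expectation (%w. H (Xt tau q j w) - H (Xc tau j w))"
			using iF[of j] E_Xc(1)[OF tau, of H j] mean by simp
		show ?thesis unfolding e
			by (rule order_trans[OF abs_integral_le[OF icl[of j]] ecl]) (use cl[of j] in \<open>simp add: abs_minus_commute\<close>)
	qed
	have E2: "\<bar>expectation (%w. H (Xt tau q j w) * H (Xt tau q i w)) - expectation (%w. H (Xc tau j w) * H (Xc tau i w))\<bar> <= 2 * b * \<delta>" for i j
	proof -
		let ?B = "%w. b * (\<Lambda> * exp (- tau) ^ q * Z i w) + b * (\<Lambda> * exp (- tau) ^ q * Z j w)"
		have e: "expectation (%w. H (Xt tau q j w) * H (Xt tau q i w)) - expectation (%w. H (Xc tau j w) * H (Xc tau i w))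
			 = expectation (%w. H (Xt tau q j w) * H (Xt tau q i w) - H (Xc tau j w) * H (Xc tau i w))" using iFF by simp
		have "\<bar>expectation (%w. H (Xt tau q j w) * H (Xt tau q i w) - H (Xc tau j w) * H (Xc tau i w))\<bar> <= expectation ?B"
		proof (rule abs_integral_le)
			show "integrable M ?B" using icl by simp
			fix w
			have "H (Xt tau q j w) * H (Xt tau q i w) - H (Xc tau j w) * H (Xc tau i w)
				 = H (Xt tau q j w) * (H (Xt tau q i w) - H (Xc tau i w)) + (H (Xt tau q j w) - H (Xc tau j w)) * H (Xc tau i w)"
				by (simp add: algebra_simps)
			then have "\<bar>H (Xt tau q j w) * H (Xt tau q i w) - H (Xc tau j w) * H (Xc tau i w)\<bar>
				 <= \<bar>H (Xt tau q j w)\<bar> * \<bar>H (Xt tau q i w) - H (Xc tau i w)\<bar> + \<bar>H (Xc tau i w)\<bar> * \<bar>H (Xt tau q j w) - H (Xc tau j w)\<bar>"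
				using abs_triangle_ineq[of "H (Xt tau q j w) * (H (Xt tau q i w) - H (Xc tau i w))" "(H (Xt tau q j w) - H (Xc tau j w)) * H (Xc tau i w)"]
				by (simp add: abs_mult mult.commute)
			also have "... <= ?B w"
				using cl[of i w] cl[of j w] b b0 by (intro add_mono mult_mono) (auto simp: abs_minus_commute)
			finally show "\<bar>H (Xt tau q j w) * H (Xt tau q i w) - H (Xc tau j w) * H (Xc tau i w)\<bar> <= ?B w" .
		qed
		also have "... = b * expectation (%w. \<Lambda> * exp (- tau) ^ q * Z i w) + b * expectation (%w. \<Lambda> * exp (- tau) ^ q * Z j w)"
			using icl[of i] icl[of j] by (simp only: Bochner_Integration.integral_add integrable_mult_right integral_mult_right_zero)
		also have "... <= b * \<delta> + b * \<delta>" using ecl b0 by (intro add_mono mult_left_mono)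
		finally show ?thesis unfolding e by linarith
	qed
	have sqe: "expectation (%w. (H (Xc tau j w))\<^sup>2) = s2" for j
		using E_Xc(1)[OF tau, of "%x. (H x)\<^sup>2" j] by (simp add: s2_def)
	have v: "expectation (%w. (\<xi> j w)\<^sup>2) <= (s2 + 2 * b * \<delta>) / real n" for j
	proof -
		have "expectation (%w. (\<xi> j w)\<^sup>2) = (1 / real n) * expectation (%w. H (Xt tau q j w) * H (Xt tau q j w))"
			unfolding \<xi>_def integral_mult_right_zero[symmetric] c(2)[symmetric] by (simp add: power2_eq_square mult_ac)
		moreover have "expectation (%w. H (Xt tau q j w) * H (Xt tau q j w)) <= s2 + 2 * b * \<delta>"
			using E2[of j j] sqe[of j] by (simp add: power2_eq_square abs_le_iff)
		ultimately show ?thesis using n by (simp add: divide_right_mono)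
	qed
	\<comment> \<open>The sum over \<open>A\<close> as a function of a family \<open>p\<close> of
	  innovations, so that sums over index sets with disjoint windows are functions of disjoint blocks
	  of independent variables.\<close>
	define Gs where "Gs A p = (\<Sum>i\<in>A. c * H (\<Sum>l\<in>Wd q i. exp (- tau) ^ (i - l) * p l))" for A :: "nat set" and p :: "nat => real"
	have Gm: "Gs A \<in> borel_measurable (PiM B (%_. borel))" if "!!i. i \<in> A ==> Wd q i \<subseteq> B" for A B
	proof -
		have "(%p. p l) \<in> borel_measurable (PiM B (%_. borel :: real measure))" if "l \<in> B" for l
			using that by (rule measurable_component_singleton)
		then have "(%p. \<Sum>l\<in>Wd q i. exp (- tau) ^ (i - l) * p l) \<in> borel_measurable (PiM B (%_. borel :: real measure))" if "i \<in> A" for i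
			using \<open>!!i. i \<in> A ==> Wd q i \<subseteq> B\<close>[OF that] by (intro borel_measurable_sum borel_measurable_times borel_measurable_const) auto
		then show ?thesis unfolding Gs_def by (intro borel_measurable_sum borel_measurable_times borel_measurable_const) (auto intro: measurable_compose)
	qed
	have GR: "Gs A (restrict (%i. eta tau i w) B) = (\<Sum>i\<in>A. \<xi> i w)" if "!!i. i \<in> A ==> Wd q i \<subseteq> B" for A B w
		unfolding Gs_def \<xi>_def Xt_def
	proof (intro sum.cong refl arg_cong[where f="%x. c * H x"])
		fix i l assume "i \<in> A" "l \<in> Wd q i"
		then show "exp (- tau) ^ (i - l) * restrict (%i. eta tau i w) B l = exp (- tau) ^ (i - l) * eta tau l w" using that by auto
	qed
	\<comment> \<open>\<open>f\<close> acts on the map from index sets to sums and selects either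
	  \<open>\<xi> j\<close> or \<open>\<xi> j * \<xi> i\<close>. In this form one argument yields both
	  factorisations demanded by \<open>stein_char\<close>.\<close>
	have fac: "(CLINT w|M. cplx (f (%A. \<Sum>i\<in>A. \<xi> i w)) * iexp (s * (\<Sum>i\<in>K. \<xi> i w)))
			= cplx (expectation (%w. f (%A. \<Sum>i\<in>A. \<xi> i w))) * (CLINT w|M. iexp (s * (\<Sum>i\<in>K. \<xi> i w)))"
		if f: "f = (%S. S {j} * S {i}) \<or> f = (%S. S {j})" and ji: "j \<in> ?I" "i \<in> ?I" and K: "K \<subseteq> ?I"
			and dis: "!!i'. i' \<in> K ==> Wd q i' \<inter> (Wd q j \<union> Wd q i) = {}" for f :: "(nat set => real) => real" and i j s K
	proof -
		let ?A = "Wd q j \<union> Wd q i" and ?B = "\<Union>i'\<in>K. Wd q i'"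
		have Gj: "Gs {j} \<in> borel_measurable (PiM ?A (%_. borel))" "Gs {i} \<in> borel_measurable (PiM ?A (%_. borel))"
			by (rule Gm; auto)+
		have GK: "Gs K \<in> borel_measurable (PiM ?B (%_. borel))" by (rule Gm) auto
		have fm: "(%p. cplx (f (%A. Gs A p))) \<in> borel_measurable (PiM ?A (%_. borel))"
			using f Gj by auto
		have gm: "(%p. iexp (s * Gs K p)) \<in> borel_measurable (PiM ?B (%_. borel))" using GK by measurable
		have ind: "indep_var borel (%w. cplx (f (%A. Gs A (restrict (%i. eta tau i w) ?A))))
			 borel (%w. iexp (s * Gs K (restrict (%i. eta tau i w) ?B)))"
		proof (rule indep_eta_functions[OF tau _ _ _ fm gm, where n=n])
			show "?A \<inter> ?B = {}" using dis by blast
			show "?A \<subseteq> {..n}" "?B \<subseteq> {..n}" using ji K by (auto simp: Wd_def)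
		qed
		have fR: "f (%A. Gs A (restrict (%i. eta tau i w) ?A)) = f (%A. \<Sum>i\<in>A. \<xi> i w)" for w
			using f GR[of "{j}" ?A w] GR[of "{i}" ?A w] by auto
		have KR: "Gs K (restrict (%i. eta tau i w) ?B) = (\<Sum>i\<in>K. \<xi> i w)" for w by (rule GR) auto
		have xb: "\<bar>\<xi> j w\<bar> <= c * b" for j w unfolding \<xi>_def using b c by (simp add: abs_mult)
		have xxb: "\<bar>\<xi> j w * \<xi> i w\<bar> <= (c * b) * (c * b)" for j i w unfolding abs_mult using b0 c by (intro mult_mono xb) auto
		have fi: "integrable M (%w. f (%A. \<Sum>i\<in>A. \<xi> i w))"
			using f
		proof
			assume "f = (%S. S {j} * S {i})" then show ?thesis using ib[of "%w. \<xi> j w * \<xi> i w" "(c * b) * (c * b)"] xxb by simp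
		next
			assume "f = (%S. S {j})" then show ?thesis using ib[of "\<xi> j" "c * b"] xb by simp
		qed
		have gi: "integrable M (%w. iexp (s * (\<Sum>i\<in>K. \<xi> i w)))" by (rule integrable_iexp_rv) measurable
		show ?thesis
			using indep_var_lebesgue_integral[OF ind[unfolded fR KR] _ gi] fi by (simp only: integral_complex_of_real complex_of_real_integrable_eq)
	qed
	have xb: "\<bar>\<xi> j w\<bar> <= c * b" for j w unfolding \<xi>_def using b c by (simp add: abs_mult)
	define V where "V = (\<Sum>j\<in>?I. \<Sum>i\<in>nb j. expectation (%w. \<xi> j w * \<xi> i w))"
	have st: "cmod ((CLINT w|M. iexp (\<Sum>i\<in>?I. \<xi> i w)) - cplx (exp (- V / 2)))
		 <= exp \<bar>V\<bar> * ((\<Sum>j\<in>?I. \<bar>expectation (\<xi> j)\<bar>) + 3 * real (card ?I) * (4 * real q)\<^sup>2 * (c * b) * ((s2 + 2 * b * \<delta>) / real n))"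
		unfolding V_def
	proof (rule stein_char[where nb=nb and ?nb2.0=nb2])
		show "nb j \<subseteq> nb2 j" "nb2 j \<subseteq> ?I" for j by (auto simp: nb_def nb2_def)
		show "real (card (nb2 j)) <= 4 * real q" for j
		proof -
			have "nb2 j \<subseteq> {j + 1 - 2 * q..<j + 2 * q}" by (auto simp: nb2_def)
			from card_mono[OF _ this] show ?thesis by simp
		qed
		show "(CLINT w|M. cplx (\<xi> j w) * iexp (s * (\<Sum>i\<in>?I - nb j. \<xi> i w)))
				= cplx (expectation (\<xi> j)) * (CLINT w|M. iexp (s * (\<Sum>i\<in>?I - nb j. \<xi> i w)))" if "j \<in> ?I" for j s
		proof -
			\<comment> \<open>An index outside \<open>nb j\<close> is at distance at least \<open>q\<close>
			  from \<open>j\<close>, so the two windows do not meet.\<close>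
			have d: "Wd q i' \<inter> (Wd q j \<union> Wd q j) = {}" if "i' \<in> ?I - nb j" for i' using that by (auto simp: nb_def Wd_def)
			show ?thesis using fac[of "%S. S {j}" j j "?I - nb j" s, OF disjI2[OF refl] that that Diff_subset d] by simp
		qed
		show "(CLINT w|M. cplx (\<xi> j w * \<xi> i w) * iexp (s * (\<Sum>i\<in>?I - nb2 j. \<xi> i w)))
				= cplx (expectation (%w. \<xi> j w * \<xi> i w)) * (CLINT w|M. iexp (s * (\<Sum>i\<in>?I - nb2 j. \<xi> i w)))" if "j \<in> ?I" "i \<in> nb j" for j i s
		proof -
			have i: "i \<in> ?I" using that by (simp add: nb_def)
			have d: "Wd q i' \<inter> (Wd q j \<union> Wd q i) = {}" if "i' \<in> ?I - nb2 j" for i'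
				using that \<open>i \<in> nb j\<close> by (auto simp: nb_def nb2_def Wd_def)
			show ?thesis using fac[of "%S. S {j} * S {i}" j i "?I - nb2 j" s, OF disjI1[OF refl] that(1) i Diff_subset d] by simp
		qed
	qed (use xb v in auto)
	have sumE: "(\<Sum>j\<in>?I. \<bar>expectation (\<xi> j)\<bar>) <= sqrt (real n) * \<delta>"
	proof -
		have "(\<Sum>j\<in>?I. \<bar>expectation (\<xi> j)\<bar>) <= (\<Sum>j\<in>?I. c * \<delta>)"
			using E1 c by (intro sum_mono) (simp add: \<xi>_def[abs_def] abs_mult)
		also have "... = (real n * c) * \<delta>" by simp
		finally show ?thesis using c by simp
	qed
	\<comment> \<open>In each row of at most \<open>2 * q\<close> neighbours the diagonal term is
	  \<open>s2\<close> and the others are at most \<open>lg\<close>, all up to the replacement cost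
	  \<open>2 * b * \<delta>\<close>.\<close>
	have Vs: "\<bar>V - s2\<bar> <= 2 * real q * (lg + 2 * b * \<delta>)"
	proof -
		let ?e = "%j i. expectation (%w. H (Xt tau q j w) * H (Xt tau q i w))"
		have xe: "expectation (%w. \<xi> j w * \<xi> i w) = (1 / real n) * ?e j i" for i j
			unfolding \<xi>_def integral_mult_right_zero[symmetric] c(2)[symmetric] by (simp add: mult_ac)
		have card: "real (card (nb j)) <= 2 * real q" for j
		proof -
			have "nb j \<subseteq> {j + 1 - q..<j + q}" by (auto simp: nb_def)
			from card_mono[OF _ this] show ?thesis by simp
		qed
		have per: "\<bar>?e j i - (if i = j then s2 else 0)\<bar> <= lg + 2 * b * \<delta>" for i j
		proof (cases "i = j")
			case True then show ?thesis using E2[of j j] sqe[of j] lg0 by (simp add: power2_eq_square)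
		next
			case False
			have "\<bar>expectation (%w. H (Xc tau j w) * H (Xc tau i w))\<bar> <= lg"
				using lag[of i j] lag[of j i] False by (cases "i < j") (auto simp: mult.commute)
			then show ?thesis using E2[of j i] False by (simp del: integral_mult_right_zero)
		qed
		have row: "\<bar>(\<Sum>i\<in>nb j. ?e j i) - s2\<bar> <= 2 * real q * (lg + 2 * b * \<delta>)" if "j \<in> ?I" for j
		proof -
			have fn: "finite (nb j)" and jn: "j \<in> nb j" using that q by (auto simp: nb_def)
			have "(\<Sum>i\<in>nb j. ?e j i) - s2 = (\<Sum>i\<in>nb j. ?e j i - (if i = j then s2 else 0))"
				using fn jn by (simp add: sum_subtractf)
			then have "\<bar>(\<Sum>i\<in>nb j. ?e j i) - s2\<bar> <= (\<Sum>i\<in>nb j. \<bar>?e j i - (if i = j then s2 else 0)\<bar>)" by (simp only: sum_abs)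
			also have "... <= real (card (nb j)) * (lg + 2 * b * \<delta>)" using per by (intro sum_bounded_above)
			also have "... <= 2 * real q * (lg + 2 * b * \<delta>)" using card lg0 b0 d0 by (intro mult_right_mono) auto
			finally show ?thesis .
		qed
		have "V - s2 = (1 / real n) * (\<Sum>j\<in>?I. (\<Sum>i\<in>nb j. ?e j i) - s2)"
			unfolding V_def xe using n by (simp add: sum_subtractf sum_divide_distrib right_diff_distrib diff_divide_distrib)
		then have "\<bar>V - s2\<bar> <= (1 / real n) * (\<Sum>j\<in>?I. \<bar>(\<Sum>i\<in>nb j. ?e j i) - s2\<bar>)"
			using n by (simp add: abs_mult divide_right_mono)
		also have "... <= (1 / real n) * (\<Sum>j\<in>?I. 2 * real q * (lg + 2 * b * \<delta>))"
			using row by (intro mult_left_mono sum_mono) auto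
		also have "... = 2 * real q * (lg + 2 * b * \<delta>)" using n by simp
		finally show ?thesis .
	qed
	have rep: "cmod ((CLINT w|M. iexp (c * (\<Sum>j=1..n. H (Xc tau j w)))) - (CLINT w|M. iexp (\<Sum>i\<in>?I. \<xi> i w))) <= sqrt (real n) * \<delta>"
	proof -
		let ?B = "%w. \<Sum>j\<in>?I. c * (\<Lambda> * exp (- tau) ^ q * Z j w)"
		have i1: "integrable M (%w. iexp (c * (\<Sum>j=1..n. H (Xc tau j w))))" by (rule integrable_iexp_rv) measurable
		have i2: "integrable M (%w. iexp (\<Sum>i\<in>?I. \<xi> i w))" using integrable_iexp_rv[of "%w. \<Sum>i\<in>?I. \<xi> i w" 1] by simp
		have e: "(CLINT w|M. iexp (c * (\<Sum>j=1..n. H (Xc tau j w)))) - (CLINT w|M. iexp (\<Sum>i\<in>?I. \<xi> i w))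
			 = (CLINT w|M. iexp (c * (\<Sum>j=1..n. H (Xc tau j w))) - iexp (\<Sum>i\<in>?I. \<xi> i w))"
			by (rule Bochner_Integration.integral_diff[OF i1 i2, symmetric])
		have "cmod (CLINT w|M. iexp (c * (\<Sum>j=1..n. H (Xc tau j w))) - iexp (\<Sum>i\<in>?I. \<xi> i w)) <= expectation ?B"
		proof (rule norm_integral_le)
			show "integrable M ?B" using iZ by (intro Bochner_Integration.integrable_sum integrable_mult_right)
			fix w
			have "cmod (iexp (c * (\<Sum>j=1..n. H (Xc tau j w))) - iexp (\<Sum>i\<in>?I. \<xi> i w)) <= \<bar>c * (\<Sum>j=1..n. H (Xc tau j w)) - (\<Sum>i\<in>?I. \<xi> i w)\<bar>"
				by (rule cmod_iexp_diff_le)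
			also have "c * (\<Sum>j=1..n. H (Xc tau j w)) - (\<Sum>i\<in>?I. \<xi> i w) = (\<Sum>j\<in>?I. c * (H (Xc tau j w) - H (Xt tau q j w)))"
				unfolding \<xi>_def by (simp add: sum_distrib_left sum_subtractf right_diff_distrib)
			also have "\<bar>(\<Sum>j\<in>?I. c * (H (Xc tau j w) - H (Xt tau q j w)))\<bar> <= ?B w"
				by (rule order_trans[OF sum_abs], rule sum_mono) (use cl c in \<open>simp add: abs_mult mult.assoc\<close>)
			finally show "cmod (iexp (c * (\<Sum>j=1..n. H (Xc tau j w))) - iexp (\<Sum>i\<in>?I. \<xi> i w)) <= ?B w" .
		qed
		also have "expectation ?B = (\<Sum>j\<in>?I. c * expectation (%w. \<Lambda> * exp (- tau) ^ q * Z j w))"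
			by (simp only: Bochner_Integration.integral_sum[OF integrable_mult_right[OF icl]] integral_mult_right_zero)
		also have "... <= (\<Sum>j\<in>?I. c * \<delta>)" using ecl c by (intro sum_mono mult_left_mono) auto
		also have "... = (real n * c) * \<delta>" by simp
		finally show ?thesis unfolding e using c by simp
	qed
	have fin: "exp \<bar>V\<bar> * ((\<Sum>j\<in>?I. \<bar>expectation (\<xi> j)\<bar>) + 3 * real (card ?I) * (4 * real q)\<^sup>2 * (c * b) * ((s2 + 2 * b * \<delta>) / real n))
		 <= exp \<bar>V\<bar> * (sqrt (real n) * \<delta> + 3 * (4 * real q)\<^sup>2 * (b / sqrt (real n)) * (s2 + 2 * b * \<delta>))"
	proof (intro mult_left_mono add_mono sumE)
		show "3 * real (card ?I) * (4 * real q)\<^sup>2 * (c * b) * ((s2 + 2 * b * \<delta>) / real n) <= 3 * (4 * real q)\<^sup>2 * (b / sqrt (real n)) * (s2 + 2 * b * \<delta>)"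
			using n by (simp add: c_def field_simps)
	qed simp
	have tri: "cmod (x - z) <= cmod (x - y) + cmod (y - z)" for x y z :: complex
		using norm_triangle_ineq[of "x - y" "y - z"] by simp
	show ?thesis
		by (rule exI[of _ V], rule conjI[OF Vs], rule order_trans[OF tri[of _ _ "CLINT w|M. iexp (\<Sum>i\<in>?I. \<xi> i w)"]])
			 (use rep st fin in \<open>simp only: c_def[symmetric]; linarith\<close>)
qed

lemma array_clt:
	fixes H :: "nat => real => real" and tau b \<Lambda> lg :: "nat => real"
	assumes tau: "!!n. tau n > 0" and q: "q >= 1" and [measurable]: "!!n. H n \<in> borel_measurable borel"
		and ev: "eventually (%n. (\<forall>y. \<bar>H n y\<bar> <= b n) \<and> (\<forall>y z. \<bar>H n y - H n z\<bar> <= \<Lambda> n * \<bar>y - z\<bar> * (1 + \<bar>z\<bar>)) \<and>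
				(\<forall>i j. i < j \<longrightarrow> \<bar>expectation (%w. H n (Xc (tau n) i w) * H n (Xc (tau n) j w))\<bar> <= lg n)) sequentially"
		and mean: "!!n. expectation (%w. H n (X0 w)) = 0"
		and s2: "(%n. expectation (%w. (H n (X0 w))\<^sup>2)) \<longlonglongrightarrow> \<sigma>2"
		and lg: "lg \<longlonglongrightarrow> 0" and bn: "(%n. b n / sqrt (real n)) \<longlonglongrightarrow> 0"
		and sm: "(%n. sqrt (real n) * (\<Lambda> n * exp (- tau n) ^ q)) \<longlonglongrightarrow> 0"
	shows "(%n. CLINT w|M. iexp ((1 / sqrt (real n)) * (\<Sum>j=1..n. H n (Xc (tau n) j w)))) \<longlonglongrightarrow> cplx (exp (- \<sigma>2 / 2))"
proof -
	define \<delta> where "\<delta> n = \<Lambda> n * exp (- tau n) ^ q * (1 + 2 * m2)" for n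
	define S where "S n = expectation (%w. (H n (X0 w))\<^sup>2)" for n
	let ?C = "%n. CLINT w|M. iexp ((1 / sqrt (real n)) * (\<Sum>j=1..n. H n (Xc (tau n) j w)))"
	let ?P = "%n V. \<bar>V - S n\<bar> <= 2 * real q * (lg n + 2 * b n * \<delta> n) \<and>
		 cmod (?C n - cplx (exp (- V / 2)))
			 <= exp \<bar>V\<bar> * (sqrt (real n) * \<delta> n + 3 * (4 * real q)\<^sup>2 * (b n / sqrt (real n)) * (S n + 2 * b n * \<delta> n)) + sqrt (real n) * \<delta> n"
	have "eventually (%n. \<exists>V. ?P n V) sequentially"
		using ev eventually_ge_at_top[of 1]
	proof eventually_elim
		case (elim n)
		show ?case unfolding S_def \<delta>_def
			by (rule array_clt_fixed[OF tau elim(2) q]) (use elim mean in auto)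
	qed
	then obtain V where V: "eventually (%n. ?P n (V n)) sequentially"
		unfolding eventually_sequentially by metis
	have sd: "(%n. sqrt (real n) * \<delta> n) \<longlonglongrightarrow> 0"
	proof -
		have "(%n. sqrt (real n) * (\<Lambda> n * exp (- tau n) ^ q) * (1 + 2 * m2)) \<longlonglongrightarrow> 0 * (1 + 2 * m2)" by (intro tendsto_intros sm)
		then show ?thesis by (simp add: \<delta>_def mult.assoc)
	qed
	\<comment> \<open>\<open>b n\<close> itself may grow; the product is split over a factor
	  \<open>sqrt n\<close>, which makes both parts tend to 0.\<close>
	have bd: "(%n. b n * \<delta> n) \<longlonglongrightarrow> 0"
	proof -
		have "(%n. (b n / sqrt (real n)) * (sqrt (real n) * \<delta> n)) \<longlonglongrightarrow> 0 * 0" by (intro tendsto_intros bn sd)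
		moreover have "eventually (%n. (b n / sqrt (real n)) * (sqrt (real n) * \<delta> n) = b n * \<delta> n) sequentially"
			using eventually_gt_at_top[of 0] by eventually_elim simp
		ultimately show ?thesis using Lim_transform_eventually by fastforce
	qed
	have VS: "(%n. V n - S n) \<longlonglongrightarrow> 0"
	proof (rule Lim_null_comparison)
		show "eventually (%n. norm (V n - S n) <= 2 * real q * (lg n + 2 * (b n * \<delta> n))) sequentially"
			using V by eventually_elim (simp add: mult.assoc)
		have "(%n. 2 * real q * (lg n + 2 * (b n * \<delta> n))) \<longlonglongrightarrow> 2 * real q * (0 + 2 * 0)" by (intro tendsto_intros lg bd)
		then show "(%n. 2 * real q * (lg n + 2 * (b n * \<delta> n))) \<longlonglongrightarrow> 0" by simp
	qed
	have Vl: "V \<longlonglongrightarrow> \<sigma>2" using tendsto_add[OF VS s2[folded S_def]] by simp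
	have "(%n. ?C n - cplx (exp (- V n / 2))) \<longlonglongrightarrow> 0"
	proof (rule Lim_null_comparison)
		show "eventually (%n. norm (?C n - cplx (exp (- V n / 2))) \<le>
			 exp \<bar>V n\<bar> * (sqrt (real n) * \<delta> n + 3 * (4 * real q)\<^sup>2 * (b n / sqrt (real n)) * (S n + 2 * (b n * \<delta> n))) + sqrt (real n) * \<delta> n) sequentially"
			using V by eventually_elim (simp add: mult.assoc)
		have "(%n. exp \<bar>V n\<bar> * (sqrt (real n) * \<delta> n + 3 * (4 * real q)\<^sup>2 * (b n / sqrt (real n)) * (S n + 2 * (b n * \<delta> n))) + sqrt (real n) * \<delta> n)
			 \<longlonglongrightarrow> exp \<bar>\<sigma>2\<bar> * (0 + 3 * (4 * real q)\<^sup>2 * 0 * (\<sigma>2 + 2 * 0)) + 0"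
			by (intro tendsto_intros Vl sd bn bd s2[folded S_def])
		then show "(%n. exp \<bar>V n\<bar> * (sqrt (real n) * \<delta> n + 3 * (4 * real q)\<^sup>2 * (b n / sqrt (real n)) * (S n + 2 * (b n * \<delta> n))) + sqrt (real n) * \<delta> n) \<longlonglongrightarrow> 0"
			by simp
	qed
	moreover have "(%n. cplx (exp (- V n / 2))) \<longlonglongrightarrow> cplx (exp (- \<sigma>2 / 2))" by (intro tendsto_intros Vl) auto
	ultimately show ?thesis using tendsto_add by fastforce
qed

end

section \<open>Fourier tools for second moments\<close>

lemma ft_minus: "ft W (- s) = cnj (ft W s)"
proof -
	have "cnj (ft W s) = (CLINT x|lborel. cnj (iexp (s * x) * cplx (W x)))"
		unfolding ft_def by (rule Bochner_Integration.integral_cnj[symmetric])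
	also have "... = ft W (- s)" unfolding ft_def by (simp add: exp_cnj)
	finally show ?thesis ..
qed

lemma integral_scale_real:
	fixes f :: "real => 'b::{banach, second_countable_topology}"
	assumes "h > 0"
	shows "(\<integral>s. f s \<partial>lborel) = h *\<^sub>R (\<integral>u. f (c + h * u) \<partial>lborel)"
	using lborel_integral_real_affine[of h f c] assms by simp

lemma (in sigma_finite_measure) integral_window_swap:
	fixes f :: "real => 'a => complex"
	assumes [measurable]: "(%(s, w). f s w) \<in> borel_measurable (lborel \<Otimes>\<^sub>M M)"
		and le: "!!s w. w \<in> space M ==> cmod (f s w) <= B w" and B: "integrable M B"
		and supp: "!!s w. \<bar>s\<bar> > R ==> f s w = 0"
	shows "(CLINT w|M. CLINT s|lborel. f s w) = (CLINT s|lborel. CLINT w|M. f s w)"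
proof -
	interpret P: pair_sigma_finite lborel M by (simp add: pair_sigma_finite_def lborel.sigma_finite_measure_axioms sigma_finite_measure_axioms)
	have [measurable]: "f s \<in> borel_measurable M" for s
		using measurable_compose[OF measurable_Pair1'[of s lborel M] assms(1)] by simp
	have if': "integrable M (f s)" for s
		by (rule Bochner_Integration.integrable_bound[OF B]) (use le in \<open>auto intro!: AE_I2 order_trans[OF le abs_ge_self]\<close>)
	have "integrable (lborel \<Otimes>\<^sub>M M) (%(s, w). f s w)"
	proof (rule P.Fubini_integrable)
		show "integrable lborel (%s. LINT w|M. norm (case (s, w) of (s, w) => f s w))"
		proof (rule integrable_bounded_support(1)[where R=R and C="LINT w|M. B w"])
			fix s assume "\<bar>s\<bar> <= R"
			show "norm (LINT w|M. norm (case (s, w) of (s, w) => f s w)) <= (LINT w|M. B w)"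
				by (rule norm_integral_le[OF B]) (use le in auto)
		qed (auto simp: supp)
		show "AE s in lborel. integrable M (%w. case (s, w) of (s, w) => f s w)" using if' by auto
	qed measurable
	from P.Fubini_integral[OF this] show ?thesis by simp
qed

text \<open>Two exchanges of integrals reduce a mixed second moment of inverse transforms to the
  joint characteristic function of \<open>Y\<close> and \<open>Y'\<close>.\<close>

lemma (in prob_space) kap_pair_expectation:
	fixes g :: "real => complex"
	assumes gm[measurable]: "g \<in> borel_measurable borel" and C: "!!s. cmod (g s) <= C" and supp: "!!s. \<bar>s\<bar> > 1 ==> g s = 0"
		and [measurable]: "random_variable borel Y" "random_variable borel Y'"
	shows "(CLINT w|M. kap g (Y w) * cnj (kap g (Y' w))) = 1 / (4 * cplx pi ^ 2) *
		(CLINT t|lborel. cnj (g t) * (CLINT s|lborel. g s * (CLINT w|M. iexp (t * Y' w - s * Y w))))"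
proof -
	have [measurable]: "cnj \<in> borel_measurable borel" by (intro borel_measurable_continuous_onI continuous_intros)
	have C0: "0 <= C" using order_trans[OF norm_ge_zero C] .
	let ?K = "%z. CLINT s|lborel. iexp (- (s * z)) * g s"
	have Kb: "cmod (?K z) <= 2 * C" for z
		using integrable_bounded_support(2)[of "%s. iexp (- (s * z)) * g s" 1 C] C supp by (simp add: norm_mult)
	have Km[measurable]: "(%w. ?K (Y w)) \<in> borel_measurable M" by measurable
	have cK: "cnj (?K z) = (CLINT t|lborel. iexp (t * z) * cnj (g t))" for z
		unfolding Bochner_Integration.integral_cnj[symmetric] by (simp add: exp_cnj)
	have e1: "kap g (Y w) * cnj (kap g (Y' w)) = 1 / (4 * cplx pi ^ 2) * (CLINT t|lborel. iexp (t * Y' w) * cnj (g t) * ?K (Y w))" for w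
	proof -
		have "kap g (Y w) * cnj (kap g (Y' w)) = 1 / (4 * cplx pi ^ 2) * (cnj (?K (Y' w)) * ?K (Y w))"
			unfolding kap_def by (simp add: power2_eq_square mult_ac)
		then show ?thesis unfolding cK integral_mult_left_zero[symmetric] .
	qed
	have "(CLINT w|M. CLINT t|lborel. iexp (t * Y' w) * cnj (g t) * ?K (Y w)) = (CLINT t|lborel. CLINT w|M. iexp (t * Y' w) * cnj (g t) * ?K (Y w))"
	proof (rule integral_window_swap[where R=1 and B="%_. C * (2 * C)"])
		show "cmod (iexp (t * Y' w) * cnj (g t) * ?K (Y w)) <= C * (2 * C)" for t w
			unfolding norm_mult norm_exp_i_times complex_mod_cnj mult_1 using C Kb C0 by (intro mult_mono) auto
	qed (auto simp: supp)
	also have "... = (CLINT t|lborel. cnj (g t) * (CLINT s|lborel. g s * (CLINT w|M. iexp (t * Y' w - s * Y w))))"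
	proof (rule Bochner_Integration.integral_cong[OF refl])
		fix t
		have "(CLINT w|M. iexp (t * Y' w) * cnj (g t) * ?K (Y w)) = (CLINT w|M. cnj (g t) * (CLINT s|lborel. g s * iexp (t * Y' w - s * Y w)))"
		proof (rule Bochner_Integration.integral_cong[OF refl])
			fix w
			have "iexp (t * Y' w - s * Y w) = iexp (t * Y' w) * iexp (- (s * Y w))" for s by (simp add: algebra_simps flip: exp_add)
			then have "(CLINT s|lborel. g s * iexp (t * Y' w - s * Y w)) = (CLINT s|lborel. iexp (t * Y' w) * (iexp (- (s * Y w)) * g s))"
				by (simp only: mult_ac)
			also have "... = iexp (t * Y' w) * ?K (Y w)" by (rule integral_mult_right_zero)
			finally show "iexp (t * Y' w) * cnj (g t) * ?K (Y w) = cnj (g t) * (CLINT s|lborel. g s * iexp (t * Y' w - s * Y w))"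
				by (simp only: mult_ac)
		qed
		also have "... = cnj (g t) * (CLINT w|M. CLINT s|lborel. g s * iexp (t * Y' w - s * Y w))" by (rule integral_mult_right_zero)
		also have "(CLINT w|M. CLINT s|lborel. g s * iexp (t * Y' w - s * Y w)) = (CLINT s|lborel. CLINT w|M. g s * iexp (t * Y' w - s * Y w))"
		proof (rule integral_window_swap[where R=1 and B="%_. C"])
			show "cmod (g s * iexp (t * Y' w - s * Y w)) <= C" for s w unfolding norm_mult norm_exp_i_times using C by simp
		qed (auto simp: supp)
		finally show "(CLINT w|M. iexp (t * Y' w) * cnj (g t) * ?K (Y w)) = cnj (g t) * (CLINT s|lborel. g s * (CLINT w|M. iexp (t * Y' w - s * Y w)))"
			by (simp only: integral_mult_right_zero)
	qed
	finally show ?thesis unfolding e1 integral_mult_right_zero by (rule arg_cong)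
qed

section \<open>The rescaled quotient of kernel and characteristic function\<close>

locale ou_kernel = ou_stat +
	fixes W :: "real => real" and w1 :: "real => complex" and CW :: real and \<pi>d :: "real => real"
	assumes W_d: "!!u. (ft W has_vector_derivative w1 u) (at u)" and w1_cont: "continuous_on UNIV w1"
		and W_b: "!!u. cmod (ft W u) <= CW" and w1_b: "!!u. cmod (w1 u) <= CW" and W_supp: "!!u. \<bar>u\<bar> > 1 ==> ft W u = 0"
		and w1_supp: "!!u. \<bar>u\<bar> > 1 ==> w1 u = 0"
		and dens: "distributed M lborel X0 (%y. ennreal (\<pi>d y))" "!!y. \<pi>d y >= 0" "continuous_on UNIV \<pi>d"
begin

lemma CW_nonneg: "0 <= CW" using order_trans[OF norm_ge_zero W_b] .

lemma ft_cont: "continuous_on A (ft W)"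
	by (intro continuous_at_imp_continuous_on ballI) (use W_d has_vector_derivative_continuous in blast)

lemma ft_meas [measurable]: "ft W \<in> borel_measurable borel" by (rule borel_measurable_continuous_onI[OF ft_cont])

text \<open>The quotient of \<open>ft W\<close> and \<open>phi\<close> on the frequency scale
  \<open>1 / h\<close>. The normalisation by \<open>md (1 / h)\<close> makes it bounded uniformly in
  \<open>h\<close>, with a modulus tending to \<open>|s| powr \<alpha> * |ft W s|\<close> by regular
  variation. The sign \<open>\<sigma>\<close> selects the direct part (1) or the reflected one
  (-1).\<close>

definition gk :: "real => real => real => complex" where
	"gk \<sigma> h s = ft W s * (cplx (md (1 / h)) / phi (\<sigma> * s / h))"
definition Cg :: real where "Cg = CW * (1 + CP * Ck)"

lemma Cg_nonneg: "0 <= Cg" unfolding Cg_def using CW_nonneg CP(1) Ck_nonneg by simp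

text \<open>Differentiating \<open>1 / phi (s / h)\<close> produces a factor
  \<open>phik (s / h) / h\<close> of size \<open>1 / (h + |s|)\<close>, which is large near 0. There
  the Potter bound makes the ratio itself of order \<open>h + |s|\<close>, so the product stays
  bounded; up to the factor \<open>1 / h\<close> this is the last inequality.\<close>

lemma kernel_ratio:
	assumes h: "0 < h" "h <= 1" and s: "\<bar>s\<bar> <= 1" and \<sigma>: "\<bar>\<sigma>\<bar> = 1"
	defines "r \<equiv> cplx (md (1 / h)) / phi (\<sigma> * s / h)"
	shows "cmod r <= 1" "cmod r <= CP * (h + \<bar>s\<bar>)" "cmod (phik (\<sigma> * s / h)) <= Ck * h / (h + \<bar>s\<bar>)"
		"cmod (phik (\<sigma> * s / h)) * cmod r <= CP * Ck * h"
proof -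
	have a: "\<bar>\<sigma> * s / h\<bar> = \<bar>s\<bar> / h" using h \<sigma> by (simp add: abs_mult)
	have le: "\<bar>\<sigma> * s / h\<bar> <= \<bar>1 / h\<bar>" unfolding a using h s by (simp add: divide_right_mono)
	have cr: "cmod r = md (1 / h) / md (\<sigma> * s / h)" unfolding r_def norm_divide md_def[symmetric] using md_pos[of "1/h"] by simp
	show "cmod r <= 1" unfolding cr using md_dec_abs[OF le] md_pos[of "\<sigma> * s / h"] by simp
	have "cmod r <= CP * ((1 + \<bar>\<sigma> * s / h\<bar>) / (1 + \<bar>1 / h\<bar>))\<^sup>2"
		unfolding cr using CP(2)[OF le] md_pos[of "\<sigma> * s / h"] by (simp add: pos_divide_le_eq)
	also have "(1 + \<bar>\<sigma> * s / h\<bar>) / (1 + \<bar>1 / h\<bar>) = (h + \<bar>s\<bar>) / (h + 1)"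
	proof -
		have e: "1 + \<bar>s\<bar> / h = (h + \<bar>s\<bar>) / h" "1 + \<bar>1 / h\<bar> = (h + 1) / h" using h by (auto simp: field_simps)
		show ?thesis unfolding a e using h by simp
	qed
	also have "CP * ((h + \<bar>s\<bar>) / (h + 1))\<^sup>2 <= CP * (h + \<bar>s\<bar>)"
	proof -
		have "(h + \<bar>s\<bar>) / (h + 1) <= 1" "(h + \<bar>s\<bar>) / (h + 1) <= h + \<bar>s\<bar>" "0 <= (h + \<bar>s\<bar>) / (h + 1)" using h s by (auto simp: divide_le_eq mult_nonneg_nonneg algebra_simps)
		then have "((h + \<bar>s\<bar>) / (h + 1)) * ((h + \<bar>s\<bar>) / (h + 1)) <= 1 * (h + \<bar>s\<bar>)" by (intro mult_mono) auto
		then show ?thesis using CP(1) by (intro mult_left_mono) (auto simp: power2_eq_square)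
	qed
	finally show r2: "cmod r <= CP * (h + \<bar>s\<bar>)" .
	show p: "cmod (phik (\<sigma> * s / h)) <= Ck * h / (h + \<bar>s\<bar>)"
	proof -
		have "1 + \<bar>s\<bar> / h = (h + \<bar>s\<bar>) / h" using h by (simp add: field_simps)
		then show ?thesis using phik_b[of "\<sigma> * s / h"] unfolding a by simp
	qed
	have "cmod (phik (\<sigma> * s / h)) * cmod r <= (Ck * h / (h + \<bar>s\<bar>)) * (CP * (h + \<bar>s\<bar>))"
		using h Ck_nonneg by (intro mult_mono p r2) auto
	also have "... = CP * Ck * h" using h by (simp add: field_simps)
	finally show "cmod (phik (\<sigma> * s / h)) * cmod r <= CP * Ck * h" .
qed

text \<open>The point is that \<open>Cg\<close> does not involve \<open>h\<close>: the derivative of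
  the ratio is bounded by the last part of \<open>kernel_ratio\<close>, whose factor
  \<open>h\<close> cancels the inner derivative \<open>1 / h\<close>.\<close>

lemma gk_C1:
	assumes h: "0 < h" "h <= 1" and \<sigma>: "\<bar>\<sigma>\<bar> = 1"
	shows "\<exists>g'. C1_unit_support (gk \<sigma> h) g' Cg"
proof -
	let ?r = "%s. cplx (md (1 / h)) / phi (\<sigma> * s / h)"
	let ?r' = "%s. - (?r s * (cplx (\<sigma> / h) * (\<i> * phik (\<sigma> * s / h))))"
	let ?g' = "%s. ft W s * ?r' s + w1 s * ?r s"
	have rd: "(?r has_vector_derivative ?r' s) (at s)" for s
	proof -
		have a: "((%s. \<sigma> * s / h) has_vector_derivative \<sigma> / h) (at s)"
			unfolding has_real_derivative_iff_has_vector_derivative[symmetric] using h by (auto intro!: derivative_eq_intros)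
		have "((%s. phi (\<sigma> * s / h)) has_vector_derivative (\<sigma> / h) *\<^sub>R (\<i> * phik (\<sigma> * s / h) * phi (\<sigma> * s / h))) (at s)"
			using vector_diff_chain_at[OF a phi_deriv] by (simp add: comp_def)
		moreover have "((%z. cplx (md (1/h)) / z) has_field_derivative - cplx (md (1/h)) / (phi (\<sigma> * s / h) * phi (\<sigma> * s / h))) (at (phi (\<sigma> * s / h)))"
			by (auto intro!: derivative_eq_intros)
		ultimately have "(?r has_vector_derivative ((\<sigma> / h) *\<^sub>R (\<i> * phik (\<sigma> * s / h) * phi (\<sigma> * s / h))) * (- cplx (md (1/h)) / (phi (\<sigma> * s / h) * phi (\<sigma> * s / h)))) (at s)"
			using field_vector_diff_chain_at by (fastforce simp: comp_def)
		moreover have "((\<sigma> / h) *\<^sub>R (\<i> * phik (\<sigma> * s / h) * phi (\<sigma> * s / h))) * (- cplx (md (1/h)) / (phi (\<sigma> * s / h) * phi (\<sigma> * s / h))) = ?r' s"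
			by (simp add: scaleR_conv_of_real mult_ac)
		ultimately show ?thesis by simp
	qed
	have b: "cmod (ft W s * ?r' s) <= CW * (CP * Ck)" "cmod (w1 s * ?r s) <= CW * 1" "cmod (ft W s * ?r s) <= CW * 1" if "\<bar>s\<bar> <= 1" for s
	proof -
		note kr = kernel_ratio[OF h that \<sigma>]
		have "cmod (?r' s) = cmod (phik (\<sigma> * s / h)) * cmod (?r s) / h" using h \<sigma> by (simp add: norm_mult norm_divide)
		also have "... <= CP * Ck" using kr(4) h by (simp add: pos_divide_le_eq)
		finally show "cmod (ft W s * ?r' s) <= CW * (CP * Ck)" unfolding norm_mult[of "ft W s"] using W_b CW_nonneg by (intro mult_mono) auto
		show "cmod (w1 s * ?r s) <= CW * 1" "cmod (ft W s * ?r s) <= CW * 1"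
			unfolding norm_mult[of "ft W s"] norm_mult[of "w1 s"] using W_b w1_b CW_nonneg kr(1) by (intro mult_mono; auto)+
	qed
	have p0: "0 <= CW * (CP * Ck)" using CW_nonneg CP(1) Ck_nonneg by simp
	have Ceq: "Cg = CW * (CP * Ck) + CW * 1" by (simp add: Cg_def algebra_simps)
	have "C1_unit_support (gk \<sigma> h) ?g' Cg"
	proof
		show "(gk \<sigma> h has_vector_derivative ?g' s) (at s)" for s
			unfolding gk_def[abs_def] by (rule has_vector_derivative_mult[OF W_d rd])
		show "continuous_on UNIV ?g'"
		proof -
			have pc: "continuous_on UNIV (%s. phi (\<sigma> * s / h))" "continuous_on UNIV (%s. phik (\<sigma> * s / h))"
				using h by (auto intro!: continuous_on_compose2[OF phi_cont[of UNIV]] continuous_on_compose2[OF phik_cont[of UNIV]] continuous_intros)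
			show ?thesis by (intro continuous_intros ft_cont w1_cont pc) auto
		qed
		show "cmod (gk \<sigma> h s) <= Cg" for s
			using b(3)[of s] p0 W_supp[of s] CW_nonneg unfolding Ceq gk_def by (cases "\<bar>s\<bar> <= 1") auto
		show "cmod (?g' s) <= Cg" for s
		proof (cases "\<bar>s\<bar> <= 1")
			case True
			show ?thesis unfolding Ceq by (rule order_trans[OF norm_triangle_ineq add_mono[OF b(1,2)[OF True]]])
		next
			case False then show ?thesis using W_supp[of s] w1_supp[of s] Cg_nonneg by simp
		qed
		show "gk \<sigma> h s = 0" if "\<bar>s\<bar> > 1" for s using W_supp[OF that] by (simp add: gk_def)
	qed
	then show ?thesis by blast
qed

lemma gk_kap_real: assumes "0 < h" "h <= 1" "\<bar>\<sigma>\<bar> = 1" shows "cplx (Re (kap (gk \<sigma> h) z)) = kap (gk \<sigma> h) z"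
proof -
	obtain g' where "C1_unit_support (gk \<sigma> h) g' Cg" using gk_C1[OF assms] by blast
	then interpret C1_unit_support "gk \<sigma> h" g' Cg .
	show ?thesis by (rule kap_real) (use phi_minus[of "\<sigma> * s / h" for s] in \<open>simp add: gk_def ft_minus\<close>)
qed

end

section \<open>Leading term of the influence function\<close>

context ou_kernel
begin

text \<open>\<open>fn\<close> is the influence function in the normalisation that gives it a
  limiting variance. \<open>f0\<close> is its leading part divided by \<open>x\<close>, and
  \<open>pk\<close> carries the terms with \<open>phik\<close>, which are of lower order.\<close>

definition fn :: "real => real => real => real" where "fn h x y = sqrt h * md (1 / h) * fl W h x y"
definition f0 :: "real => real => real => real" where "f0 h x y = Re (kap (gk 1 h) ((x - y) / h)) / sqrt h"
definition pk :: "real => real => real => complex" where "pk \<sigma> h s = phik (\<sigma> * s / h) * gk \<sigma> h s"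
definition Ce :: real where "Ce = 2 * Cg + 2 * (CW * (CP * Ck))"
definition CL :: real where "CL = 4 * CW * (1 + Ck)"

lemma Ce_nonneg: "0 <= Ce" unfolding Ce_def using Cg_nonneg CW_nonneg CP(1) Ck_nonneg by simp

lemma gk_facts:
	assumes h: "0 < h" "h <= 1" and \<sigma>: "\<bar>\<sigma>\<bar> = 1"
	shows "gk \<sigma> h \<in> borel_measurable borel" "cmod (gk \<sigma> h s) <= Cg" "\<bar>s\<bar> > 1 ==> gk \<sigma> h s = 0"
		"cmod (gk \<sigma> h s - gk \<sigma> h t) <= Cg * \<bar>s - t\<bar>" "cmod (kap (gk \<sigma> h) z) <= Cg" "\<bar>z\<bar> * cmod (kap (gk \<sigma> h) z) <= Cg"
		"kap (gk \<sigma> h) \<in> borel_measurable borel" "integrable lborel (%s. iexp (- (s * z)) * gk \<sigma> h s)"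
proof -
	obtain g' where "C1_unit_support (gk \<sigma> h) g' Cg" using gk_C1[OF assms] by blast
	then interpret C1_unit_support "gk \<sigma> h" g' Cg .
	show "gk \<sigma> h \<in> borel_measurable borel" "cmod (gk \<sigma> h s) <= Cg" "\<bar>s\<bar> > 1 ==> gk \<sigma> h s = 0"
		"cmod (gk \<sigma> h s - gk \<sigma> h t) <= Cg * \<bar>s - t\<bar>" "cmod (kap (gk \<sigma> h) z) <= Cg" "\<bar>z\<bar> * cmod (kap (gk \<sigma> h) z) <= Cg"
		"kap (gk \<sigma> h) \<in> borel_measurable borel" "integrable lborel (%s. iexp (- (s * z)) * gk \<sigma> h s)"
		using meas(1) bound supp lipschitz norm_kap norm_mult_kap kap_measurable integrable_kap by auto
qed

lemma pk_kap:
	assumes h: "0 < h" "h <= 1" and \<sigma>: "\<bar>\<sigma>\<bar> = 1"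
	shows "integrable lborel (%s. iexp (- (s * z)) * pk \<sigma> h s)" "cmod (kap (pk \<sigma> h) z) <= CW * (CP * Ck) * h"
proof -
	note [measurable] = gk_facts(1)[OF assms]
	have b: "cmod (pk \<sigma> h s) <= CW * (CP * Ck * h)" if "\<bar>s\<bar> <= 1" for s
	proof -
		have "cmod (pk \<sigma> h s) = cmod (ft W s) * (cmod (phik (\<sigma> * s / h)) * cmod (cplx (md (1 / h)) / phi (\<sigma> * s / h)))"
			unfolding pk_def gk_def norm_mult by (simp only: mult_ac)
		also have "... <= CW * (CP * Ck * h)" using kernel_ratio(4)[OF h that \<sigma>] CW_nonneg by (intro mult_mono[OF W_b]) auto
		finally show ?thesis .
	qed
	have s0: "pk \<sigma> h s = 0" if "\<bar>s\<bar> > 1" for s using gk_facts(3)[OF assms that] by (simp add: pk_def)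
	have [measurable]: "pk \<sigma> h \<in> borel_measurable borel" unfolding pk_def by measurable
	show "integrable lborel (%s. iexp (- (s * z)) * pk \<sigma> h s)"
		by (rule integrable_bounded_support(1)[where R=1 and C="CW * (CP * Ck * h)"]) (use b s0 in \<open>auto simp: norm_mult\<close>)
	have "cmod (CLINT s|lborel. iexp (- (s * z)) * pk \<sigma> h s) <= 2 * 1 * (CW * (CP * Ck * h))"
		by (rule integrable_bounded_support(2)) (use b s0 in \<open>auto simp: norm_mult\<close>)
	moreover have "0 <= CW * (CP * Ck * h)" using CW_nonneg CP(1) Ck_nonneg h by simp
	ultimately show "cmod (kap (pk \<sigma> h) z) <= CW * (CP * Ck) * h"
		unfolding kap_def norm_mult norm_divide using pi_gt3 mult_mono[of 1 pi "CW * (CP * Ck * h)" "CW * (CP * Ck * h)"] by (simp add: divide_le_eq mult_ac)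
qed

text \<open>Substituting \<open>t = s / h\<close> exhibits \<open>fn\<close> as inverse transforms
  at \<open>(x - y) / h\<close> and, from the reflected frequency, at
  \<open>(x + y) / h\<close>.\<close>

lemma fn_eq:
	assumes h: "0 < h" "h <= 1"
	shows "fn h x y = Re (cplx y * kap (gk 1 h) ((x - y) / h) - kap (pk 1 h) ((x - y) / h)
		 + (cplx y * kap (gk (-1) h) ((x + y) / h) - kap (pk (-1) h) ((x + y) / h))) / sqrt h"
proof -
	let ?F = "%t. iexp (- (t * x)) *
		 ((cplx y - phik t) * iexp (t * y) / phi t + (cplx y - phik (- t)) * iexp ((- t) * y) / phi (- t)) * ft W (t * h)"
	let ?z = "(x - y) / h" and ?z' = "(x + y) / h" and ?m = "cplx (md (1 / h))"
	have ee: "iexp (- (s / h * x)) * iexp (s / h * y) = iexp (- (s * ?z))" "iexp (- (s / h * x)) * iexp (- (s / h) * y) = iexp (- (s * ?z'))" for s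
	proof -
		have e: "iexp a * iexp b = iexp (a + b)" for a b :: real by (simp add: algebra_simps flip: exp_add)
		have "- (s / h * x) + s / h * y = - (s * ?z)" "- (s / h * x) + - (s / h) * y = - (s * ?z')" using h by (auto simp: field_simps)
		then show "iexp (- (s / h * x)) * iexp (s / h * y) = iexp (- (s * ?z))" "iexp (- (s / h * x)) * iexp (- (s / h) * y) = iexp (- (s * ?z'))"
			unfolding e by metis+
	qed
	have gen: "m * (e * ((y' - p) * a / f + (y' - p') * a' / f') * wv)
		 = (y' * ((e * a) * (wv * (m / f))) - (e * a) * (p * (wv * (m / f)))) + (y' * ((e * a') * (wv * (m / f'))) - (e * a') * (p' * (wv * (m / f'))))"
		for m e y' p p' a a' f f' wv :: complex by (simp add: algebra_simps add_divide_distrib diff_divide_distrib)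
	have pt: "?m * ?F (s / h) = (cplx y * (iexp (- (s * ?z)) * gk 1 h s) - iexp (- (s * ?z)) * pk 1 h s)
		 + (cplx y * (iexp (- (s * ?z')) * gk (-1) h s) - iexp (- (s * ?z')) * pk (-1) h s)" for s
		unfolding gen ee gk_def pk_def using h by simp
	have g2: "m * (p * I) = u *\<^sub>R (y' * (p * a) - p * b + (y' * (p * c) - p * d))" if "m * I = u *\<^sub>R (y' * a - b + (y' * c - d))"
		for m p I y' a b c d :: complex and u :: real
	proof -
		have "m * (p * I) = p * (m * I)" by (simp add: mult_ac)
		then show ?thesis unfolding that by (simp add: scaleR_conv_of_real algebra_simps)
	qed
	note i = gk_facts(8)[OF h] pk_kap(1)[OF h]
	have "?m * (CLINT t|lborel. ?F t) = ?m * ((1 / h) *\<^sub>R (CLINT s|lborel. ?F (0 + 1 / h * s)))"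
		using integral_scale_real[of "1 / h" ?F 0] h by simp
	also have "... = (1 / h) *\<^sub>R (CLINT s|lborel. ?m * ?F (s / h))" by simp
	also have "(CLINT s|lborel. ?m * ?F (s / h)) =
		 (cplx y * (CLINT s|lborel. iexp (- (s * ?z)) * gk 1 h s) - (CLINT s|lborel. iexp (- (s * ?z)) * pk 1 h s))
		 + (cplx y * (CLINT s|lborel. iexp (- (s * ?z')) * gk (-1) h s) - (CLINT s|lborel. iexp (- (s * ?z')) * pk (-1) h s))"
		unfolding pt using i[of 1 ?z] i[of "-1" ?z'] by (simp del: of_real_divide of_real_add of_real_diff of_real_mult of_real_minus)
	finally have *: "?m * (1 / (2 * cplx pi) * (CLINT t|lborel. ?F t)) = (1 / h) *\<^sub>R (cplx y * kap (gk 1 h) ?z - kap (pk 1 h) ?z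
		 + (cplx y * kap (gk (-1) h) ?z' - kap (pk (-1) h) ?z'))"
		unfolding kap_def by (rule g2)
	have "fn h x y = sqrt h * Re (?m * (1 / (2 * cplx pi) * (CLINT t|lborel. ?F t)))"
	proof -
		have rm: "md (1 / h) * Re z = Re (?m * z)" for z by simp
		show ?thesis unfolding fn_def fl_def by (simp only: rm mult.assoc[of "sqrt h"])
	qed
	moreover have "sqrt h * Re ((1 / h) *\<^sub>R z) = Re z / sqrt h" for z
	proof -
		have "q * (1 / (q * q) * a) = a / q" if "q > 0" for q a :: real using that by (simp add: field_simps)
		from this[of "sqrt h" "Re z"] show ?thesis using h by simp
	qed
	ultimately show ?thesis unfolding * by (simp only:)
qed

lemma f0_bound: assumes h: "0 < h" "h <= 1" shows "\<bar>f0 h x y\<bar> <= Cg / sqrt h"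
	unfolding f0_def abs_divide using order_trans[OF abs_Re_le_cmod gk_facts(5)[OF h, of 1]] h by (simp add: divide_right_mono)

lemma f0_meas: assumes h: "0 < h" "h <= 1" shows "f0 h x \<in> borel_measurable borel"
proof -
	note [measurable] = gk_facts(7)[OF h, of 1, simplified]
	show ?thesis unfolding f0_def[abs_def] by measurable
qed

text \<open>Writing \<open>y = x + (y - x)\<close>, the decay \<open>|z| * |kap z| <= Cg\<close>
  absorbs the factor \<open>y - x\<close> at the price of \<open>h\<close>. In the reflected term
  \<open>y <= x + y\<close> is absorbed alike, which is where the signs of \<open>x\<close> and
  \<open>y\<close> enter; the \<open>pk\<close> terms are of order \<open>h\<close> by themselves.
  So only \<open>x * f0\<close> survives, whence the \<open>x^2\<close> in the limiting
  variance.\<close>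

lemma fn_close:
	assumes h: "0 < h" "h <= 1" and x: "0 < x" and y: "0 <= y"
	shows "\<bar>fn h x y - x * f0 h x y\<bar> <= sqrt h * Ce"
proof -
	let ?z = "(x - y) / h" and ?z' = "(x + y) / h"
	let ?A = "cplx (y - x) * kap (gk 1 h) ?z" and ?B = "kap (pk 1 h) ?z" and ?C = "cplx y * kap (gk (-1) h) ?z'" and ?D = "kap (pk (-1) h) ?z'"
	have e: "fn h x y - x * f0 h x y = Re (?A - ?B + (?C - ?D)) / sqrt h"
		unfolding fn_eq[OF h] f0_def by (simp add: algebra_simps add_divide_distrib diff_divide_distrib)
	have A: "cmod ?A <= h * Cg"
	proof -
		have "cmod ?A = h * (\<bar>?z\<bar> * cmod (kap (gk 1 h) ?z))" using h by (simp add: norm_mult abs_minus_commute del: of_real_diff)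
		also have "... <= h * Cg" using gk_facts(6)[OF h, of 1 ?z] h by (intro mult_left_mono) auto
		finally show ?thesis .
	qed
	have C: "cmod ?C <= h * Cg"
	proof -
		have "cmod ?C <= (x + y) * cmod (kap (gk (-1) h) ?z')" using x y by (auto simp: norm_mult intro!: mult_right_mono)
		also have "... = h * (\<bar>?z'\<bar> * cmod (kap (gk (-1) h) ?z'))" using h x y by simp
		also have "... <= h * Cg" using gk_facts(6)[OF h, of "-1" ?z'] h by (intro mult_left_mono) auto
		finally show ?thesis .
	qed
	note p = pk_kap(2)[OF h, of 1 ?z] pk_kap(2)[OF h, of "-1" ?z']
	have "cmod (?A - ?B + (?C - ?D)) <= h * Ce"
		using norm_triangle_ineq[of "?A - ?B" "?C - ?D"] norm_triangle_ineq4[of ?A ?B] norm_triangle_ineq4[of ?C ?D] A C p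
		unfolding Ce_def by (simp add: algebra_simps)
	then have "\<bar>Re (?A - ?B + (?C - ?D))\<bar> <= h * Ce" using abs_Re_le_cmod order_trans by blast
	then have "\<bar>Re (?A - ?B + (?C - ?D))\<bar> / sqrt h <= h * Ce / sqrt h" using h by (intro divide_right_mono) auto
	also have "h * Ce / sqrt h = sqrt h * Ce"
	proof -
		have "h * Ce / sqrt h = (h / sqrt h) * Ce" by simp
		then show ?thesis using h by (simp only: real_div_sqrt)
	qed
	finally show ?thesis unfolding e abs_divide using h by simp
qed

text \<open>A crude estimate: \<open>md (1 / h)\<close> cancels the smallest modulus of
  \<open>phi\<close>, while the length of the frequency window and the Lipschitz constant of the
  integrand contribute one factor \<open>1 / h\<close> each. A power of \<open>1 / h\<close> is
  harmless, being met by \<open>exp (- tau) ^ q\<close>.\<close>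

lemma fn_growth:
	assumes h: "0 < h" "h <= 1"
	shows "\<bar>fn h x (u + v) - fn h x v\<bar> <= CL / h\<^sup>2 * \<bar>u\<bar> * (1 + \<bar>v\<bar>)"
proof -
	define T where "T = 1 / h"
	have T: "1 <= T" "0 < T" using h by (auto simp: T_def)
	let ?F = "%y t. iexp (- (t * x)) *
		 ((cplx y - phik t) * iexp (t * y) / phi t + (cplx y - phik (- t)) * iexp ((- t) * y) / phi (- t)) * ft W (t * h)"
	note i = fl_integrable[OF h(1) T_def ft_meas W_b W_supp, of x]
	have s0: "?F y t = 0" if "\<bar>t\<bar> > T" for t y
	proof -
		have "\<bar>t * h\<bar> > 1" using that h by (simp add: T_def abs_mult field_simps)
		then show ?thesis using W_supp by simp
	qed
	let ?Q = "(1 + Ck) * (1 + T) * \<bar>u\<bar> * (1 + \<bar>v\<bar>)"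
	have Q0: "0 <= ?Q" using T Ck_nonneg by simp
	let ?G = "%y t. (cplx y - phik t) * iexp (t * y)"
	have G: "cmod ((?G (u + v) t - ?G v t) / phi t) <= ?Q / md T" if "\<bar>t\<bar> <= T" for t
	proof -
		have "cmod (?G (u + v) t - ?G v t) <= (1 + Ck) * (1 + \<bar>t\<bar>) * \<bar>u\<bar> * (1 + \<bar>v\<bar>)" by (rule lip_x_iexp[OF phik_le])
		also have "... <= ?Q" using that Ck_nonneg by (intro mult_right_mono mult_left_mono) auto
		finally show ?thesis unfolding norm_divide md_def[of t, symmetric]
			using md_pos Q0 md_dec_abs[of t T] that T by (intro frac_le) auto
	qed
	have b: "cmod (?F (u + v) t - ?F v t) <= 2 * (?Q / md T) * CW" if "\<bar>t\<bar> <= T" for t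
	proof -
		have gen: "e * (a / f + b / f') * wv - e * (a' / f + b' / f') * wv = e * ((a - a') / f + (b - b') / f') * wv" for e a b a' b' f f' wv :: complex
			by (simp add: algebra_simps diff_divide_distrib)
		have "cmod ((?G (u + v) t - ?G v t) / phi t + (?G (u + v) (- t) - ?G v (- t)) / phi (- t)) <= 2 * (?Q / md T)"
			using norm_triangle_ineq[of "(?G (u + v) t - ?G v t) / phi t" "(?G (u + v) (- t) - ?G v (- t)) / phi (- t)"] G[of t] G[of "- t"] that by linarith
		then show ?thesis unfolding gen norm_mult[of _ "ft W (t * h)"] norm_mult[of "iexp (- (t * x))"] norm_exp_i_times mult_1
			using W_b[of "t * h"] md_pos[of T] Q0 by (intro mult_mono) (auto intro!: divide_nonneg_pos)
	qed
	have "cmod (CLINT t|lborel. ?F (u + v) t - ?F v t) <= 2 * T * (2 * (?Q / md T) * CW)"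
	proof (rule integrable_bounded_support(2))
		show "cmod (?F (u + v) t - ?F v t) <= 2 * (?Q / md T) * CW" if "\<bar>t\<bar> <= T" for t by (rule b[OF that])
		show "?F (u + v) t - ?F v t = 0" if "\<bar>t\<bar> > T" for t by (simp only: s0[OF that] diff_self)
		show "(%t. ?F (u + v) t - ?F v t) \<in> borel_measurable borel" by measurable
		show "0 <= T" using T by simp
	qed
	moreover have "(CLINT t|lborel. ?F (u + v) t) - (CLINT t|lborel. ?F v t) = (CLINT t|lborel. ?F (u + v) t - ?F v t)"
		by (rule Bochner_Integration.integral_diff[OF i i, symmetric])
	ultimately have I: "cmod ((CLINT t|lborel. ?F (u + v) t) - (CLINT t|lborel. ?F v t)) <= 2 * T * (2 * (?Q / md T) * CW)" by (simp only:)
	have "fn h x (u + v) - fn h x v = sqrt h * md T * Re (1 / (2 * cplx pi) * ((CLINT t|lborel. ?F (u + v) t) - (CLINT t|lborel. ?F v t)))"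
		unfolding fn_def fl_def T_def[symmetric] right_diff_distrib minus_complex.simps ..
	then have "\<bar>fn h x (u + v) - fn h x v\<bar> <= sqrt h * md T * cmod (1 / (2 * cplx pi) * ((CLINT t|lborel. ?F (u + v) t) - (CLINT t|lborel. ?F v t)))"
		using h md_pos[of T] by (simp only: abs_mult) (intro mult_mono abs_Re_le_cmod; simp)
	also have "... <= sqrt h * md T * (1 / (2 * pi) * (2 * T * (2 * (?Q / md T) * CW)))"
		unfolding norm_mult[of "1 / (2 * cplx pi)"] using I h md_pos[of T] by (intro mult_left_mono mult_mono) (auto simp: norm_divide norm_mult)
	also have "... = sqrt h * (1 / pi) * (T * 2 * CW * ?Q)" using md_pos[of T] by (simp add: field_simps)
	also have "... <= 1 * 1 * (T * 2 * CW * ((1 + Ck) * (2 * T) * \<bar>u\<bar> * (1 + \<bar>v\<bar>)))"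
		using h pi_gt3 T CW_nonneg Ck_nonneg Q0 by (intro mult_mono mult_nonneg_nonneg) (auto intro!: mult_nonneg_nonneg)
	also have "... = CL / h\<^sup>2 * \<bar>u\<bar> * (1 + \<bar>v\<bar>)" unfolding CL_def T_def by (simp add: power2_eq_square)
	finally show ?thesis .
qed

lemma fn_meas: assumes h: "0 < h" shows "fn h x \<in> borel_measurable borel"
	unfolding fn_def[abs_def] fl_def by measurable

text \<open>For each \<open>t\<close> the mean of \<open>(X0 - phik t) * iexp (t * X0)\<close>
  vanishes by \<open>phi_k_phi\<close>; the rest is an exchange of integrals.\<close>

lemma fn_mean: assumes h: "0 < h" shows "expectation (%w. fn h x (X0 w)) = 0"
proof -
	define T where "T = 1 / h"
	let ?F = "%t y. iexp (- (t * x)) *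
		 ((cplx y - phik t) * iexp (t * y) / phi t + (cplx y - phik (- t)) * iexp ((- t) * y) / phi (- t)) * ft W (t * h)"
	have s0: "?F t y = 0" if "\<bar>t\<bar> > T" for t y
	proof -
		have "\<bar>t * h\<bar> > 1" using that h by (simp add: T_def abs_mult field_simps)
		then show ?thesis using W_supp by simp
	qed
	have B: "integrable M (%w. (2 * ((\<bar>X0 w\<bar> + Ck) / md T)) * CW)" using X0_integrable by auto
	have le: "cmod (?F t y) <= (2 * ((\<bar>y\<bar> + Ck) / md T)) * CW" for t y
	proof (cases "\<bar>t\<bar> <= T")
		case True show ?thesis by (rule fl_integrand_bound[OF True W_b])
	next
		case False then show ?thesis using s0[of t y] md_pos[of T] CW_nonneg Ck_nonneg by (auto intro!: mult_nonneg_nonneg divide_nonneg_pos)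
	qed
	have "(CLINT w|M. CLINT t|lborel. ?F t (X0 w)) = (CLINT t|lborel. CLINT w|M. ?F t (X0 w))"
		by (rule integral_window_swap[OF _ le B s0]) measurable
	also have "... = (CLINT t|(lborel :: real measure). 0)"
	proof (rule Bochner_Integration.integral_cong[OF refl])
		fix t
		have ix: "integrable M (%w. cplx (X0 w) * iexp (t * X0 w))" for t
			by (rule Bochner_Integration.integrable_bound[OF X0_integrable]) (auto simp: norm_mult)
		have ie: "integrable M (%w. iexp (t * X0 w))" for t by (rule integrable_iexp_rv) simp
		have z: "(CLINT w|M. (cplx (X0 w) - phik t) * iexp (t * X0 w) / phi t) = 0"
			"integrable M (%w. (cplx (X0 w) - phik t) * iexp (t * X0 w) / phi t)" for t
			unfolding left_diff_distrib using ix[of t] ie[of t] phi_k_phi[of t] char_X0[of t] by (auto simp: diff_divide_distrib simp del: of_real_mult)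
		show "(CLINT w|M. ?F t (X0 w)) = 0"
			unfolding integral_mult_left_zero integral_mult_right_zero Bochner_Integration.integral_add[OF z(2)[of t] z(2)[of "- t"]] z by simp
	qed
	finally have 0: "(CLINT w|M. CLINT t|lborel. ?F t (X0 w)) = 0" by simp
	have i: "integrable M (%w. CLINT t|lborel. ?F t (X0 w))"
	proof (rule Bochner_Integration.integrable_bound)
		show "integrable M (%w. 2 * T * ((2 * ((\<bar>X0 w\<bar> + Ck) / md T)) * CW))" using B by (rule integrable_mult_right)
		have c: "cmod (CLINT t|lborel. ?F t y) <= 2 * T * ((2 * ((\<bar>y\<bar> + Ck) / md T)) * CW)" for y
		proof (rule integrable_bounded_support(2)[OF _ le s0])
			show "0 <= T" using h by (simp add: T_def)
		qed measurable
		show "AE w in M. norm (CLINT t|lborel. ?F t (X0 w)) <= norm (2 * T * ((2 * ((\<bar>X0 w\<bar> + Ck) / md T)) * CW))"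
			by (rule AE_I2, unfold real_norm_def, rule order_trans[OF c abs_ge_self])
	qed measurable
	have "(CLINT w|M. 1 / (2 * cplx pi) * (CLINT t|lborel. ?F t (X0 w))) = 0" unfolding integral_mult_right_zero 0 by simp
	then have "expectation (%w. fl W h x (X0 w)) = 0"
		unfolding fl_def using integral_Re[OF integrable_mult_right[OF i, of "1 / (2 * cplx pi)"]] by (simp only: zero_complex.simps)
	then show ?thesis unfolding fn_def integral_mult_right_zero by simp
qed

end

section \<open>Limiting covariances\<close>

context ou_kernel
begin

definition Imd :: real where "Imd = (LINT t|lborel. md t)"
definition I2 :: real where "I2 = (LINT t|lborel. 1 / (1 + \<bar>t\<bar>)\<^sup>2)"

lemma I_nonneg: "0 <= Imd" "0 <= I2"
	unfolding Imd_def I2_def by (intro Bochner_Integration.integral_nonneg; simp add: md_pos less_imp_le)+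

lemma f0_pair:
	assumes h: "0 < h" "h <= 1" and [measurable]: "random_variable borel Y" "random_variable borel Y'"
	shows "cplx (expectation (%w. f0 h x (Y w) * f0 h x' (Y' w))) = 1 / (4 * cplx pi ^ 2 * cplx h) *
		(CLINT t|lborel. cnj (gk 1 h t) * (CLINT s|lborel. gk 1 h s * (CLINT w|M. iexp (t * ((x' - Y' w) / h) - s * ((x - Y w) / h)))))"
proof -
	have "cplx (f0 h x (Y w) * f0 h x' (Y' w)) = 1 / cplx h * (kap (gk 1 h) ((x - Y w) / h) * cnj (kap (gk 1 h) ((x' - Y' w) / h)))" for w
	proof -
		have r: "cplx (Re (kap (gk 1 h) z)) = kap (gk 1 h) z" for z using gk_kap_real[OF h, of 1] by simp
		have "cplx (f0 h x (Y w) * f0 h x' (Y' w)) = 1 / cplx h * (cplx (Re (kap (gk 1 h) ((x - Y w) / h))) * cnj (cplx (Re (kap (gk 1 h) ((x' - Y' w) / h)))))"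
			unfolding f0_def using h by (simp flip: of_real_mult)
		then show ?thesis by (simp only: r)
	qed
	then have "cplx (expectation (%w. f0 h x (Y w) * f0 h x' (Y' w))) = 1 / cplx h * (CLINT w|M. kap (gk 1 h) ((x - Y w) / h) * cnj (kap (gk 1 h) ((x' - Y' w) / h)))"
		unfolding integral_complex_of_real[symmetric] by (simp only: integral_mult_right_zero)
	also have "(CLINT w|M. kap (gk 1 h) ((x - Y w) / h) * cnj (kap (gk 1 h) ((x' - Y' w) / h))) = 1 / (4 * cplx pi ^ 2) *
		(CLINT t|lborel. cnj (gk 1 h t) * (CLINT s|lborel. gk 1 h s * (CLINT w|M. iexp (t * ((x' - Y' w) / h) - s * ((x - Y w) / h)))))"
		using gk_facts(1,2,3)[OF h, of 1] by (intro kap_pair_expectation[where C=Cg]) auto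
	finally show ?thesis by (simp only: mult.assoc[symmetric]) (simp add: mult_ac)
qed

text \<open>Since \<open>Xc tau j\<close> is \<open>\<rho> * Xc tau i\<close> plus an independent
  \<open>zeta tau i j\<close>, the joint characteristic function is
  \<open>phi (a + b * \<rho>)\<close> times \<open>phi b / phi (b * \<rho>)\<close>. The second
  factor is bounded by the Potter inequality; the first is kept because it is integrable in
  \<open>a\<close>.\<close>

lemma char_pair:
	assumes tau: "tau > 0" and ij: "i < j"
	defines "\<rho> \<equiv> exp (- tau) ^ (j - i)"
	shows "cmod (CLINT w|M. iexp (a * Xc tau i w + b * Xc tau j w)) <= md (a + b * \<rho>) * (CP * (2 * (exp (- tau))\<^sup>2 + 2 / (1 + \<bar>b\<bar>)\<^sup>2))"
proof -
	have ii: "integrable M (%w. iexp (c * Y w))" if "random_variable borel Y" for c Y using that by (rule integrable_iexp_rv)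
	have e: "iexp (c + d) = iexp c * iexp d" for c d :: real by (simp add: algebra_simps exp_add)
	have fac: "(CLINT w|M. iexp (a * Xc tau i w + b * Xc tau j w)) = phi (a + b * \<rho>) * (CLINT w|M. iexp (b * zeta tau i j w))" for a
	proof -
		have "a * Xc tau i w + b * Xc tau j w = (a + b * \<rho>) * Xc tau i w + b * zeta tau i j w" for w
			unfolding \<rho>_def Xc_split[OF less_imp_le[OF ij]] by (simp add: algebra_simps)
		then have "(CLINT w|M. iexp (a * Xc tau i w + b * Xc tau j w)) = (CLINT w|M. iexp ((a + b * \<rho>) * Xc tau i w) * iexp (b * zeta tau i j w))"
			by (simp only: e)
		also have "... = (CLINT w|M. iexp ((a + b * \<rho>) * Xc tau i w)) * (CLINT w|M. iexp (b * zeta tau i j w))"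
		proof (rule indep_var_lebesgue_integral)
			show "indep_var borel (%w. iexp ((a + b * \<rho>) * Xc tau i w)) borel (%w. iexp (b * zeta tau i j w))"
				using indep_var_compose[OF indep_Xc_zeta[OF tau less_imp_le[OF ij]], of "%y. iexp ((a + b * \<rho>) * y)" borel "%y. iexp (b * y)" borel]
				by (simp add: comp_def)
		qed (intro ii; simp)+
		finally show ?thesis by (simp only: char_Xc[OF tau])
	qed
	have z: "phi b = phi (b * \<rho>) * (CLINT w|M. iexp (b * zeta tau i j w))"
		using fac[of 0] char_Xc[OF tau, of b j] by (simp only: mult_zero_left add_0)
	have r: "0 <= \<rho>" "\<rho> <= exp (- tau)" "\<rho> <= 1"
	proof -
		show "0 <= \<rho>" by (simp add: \<rho>_def)
		have "exp (- tau) ^ (j - i) <= exp (- tau) ^ 1" using tau ij by (intro power_decreasing) auto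
		then show "\<rho> <= exp (- tau)" by (simp add: \<rho>_def)
		then show "\<rho> <= 1" using tau by (smt (verit) exp_le_one_iff)
	qed
	have cz: "cmod (CLINT w|M. iexp (b * zeta tau i j w)) = md b / md (b * \<rho>)"
		using z md_pos[of "b * \<rho>"] unfolding md_def by (simp add: norm_mult)
	have le: "\<bar>b * \<rho>\<bar> <= \<bar>b\<bar>" using r by (simp add: abs_mult mult_left_le)
	have "md b / md (b * \<rho>) <= CP * ((1 + \<bar>b * \<rho>\<bar>) / (1 + \<bar>b\<bar>))\<^sup>2"
		using CP(2)[OF le] md_pos[of "b * \<rho>"] by (simp add: pos_divide_le_eq)
	also have "... <= CP * (2 * (exp (- tau))\<^sup>2 + 2 / (1 + \<bar>b\<bar>)\<^sup>2)"
	proof (intro mult_left_mono)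
		have "(1 + \<bar>b * \<rho>\<bar>) / (1 + \<bar>b\<bar>) <= exp (- tau) + 1 / (1 + \<bar>b\<bar>)"
		proof -
			have "\<bar>b * \<rho>\<bar> <= exp (- tau) * \<bar>b\<bar>" using mult_left_mono[OF r(2), of "\<bar>b\<bar>"] r(1) by (simp add: abs_mult mult.commute)
			then have "1 + \<bar>b * \<rho>\<bar> <= (exp (- tau) + 1 / (1 + \<bar>b\<bar>)) * (1 + \<bar>b\<bar>)"
			proof -
				assume a: "\<bar>b * \<rho>\<bar> <= exp (- tau) * \<bar>b\<bar>"
				have "1 + \<bar>b\<bar> ~= 0" by linarith
				then have c: "1 / (1 + \<bar>b\<bar>) * (1 + \<bar>b\<bar>) = 1" by simp
				have "(exp (- tau) + 1 / (1 + \<bar>b\<bar>)) * (1 + \<bar>b\<bar>) = exp (- tau) + exp (- tau) * \<bar>b\<bar> + 1" unfolding distrib_right[of _ _ "1 + \<bar>b\<bar>"] c by (simp add: distrib_left)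
				then show ?thesis using a exp_ge_zero[of "- tau"] by linarith
			qed
			then show ?thesis by (subst pos_divide_le_eq) auto
		qed
		then have "((1 + \<bar>b * \<rho>\<bar>) / (1 + \<bar>b\<bar>))\<^sup>2 <= (exp (- tau) + 1 / (1 + \<bar>b\<bar>))\<^sup>2" by (intro power_mono) auto
		also have "... <= 2 * (exp (- tau))\<^sup>2 + 2 * (1 / (1 + \<bar>b\<bar>))\<^sup>2"
			using sum_squares_bound[of "exp (- tau)" "1 / (1 + \<bar>b\<bar>)"] unfolding power2_sum by linarith
		finally show "((1 + \<bar>b * \<rho>\<bar>) / (1 + \<bar>b\<bar>))\<^sup>2 <= 2 * (exp (- tau))\<^sup>2 + 2 / (1 + \<bar>b\<bar>)\<^sup>2" by (simp add: power_divide)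
	qed (use CP(1) in auto)
	finally show ?thesis unfolding fac norm_mult md_def[of "a + b * \<rho>", symmetric] cz by (intro mult_left_mono) (auto simp: md_pos less_imp_le)
qed

text \<open>The frequencies are of order \<open>1 / h\<close>. Integrating the first factor of
  \<open>char_pair\<close> over \<open>s\<close> gives \<open>h * Imd\<close>, which cancels the
  \<open>1 / h\<close> from the normalisation of \<open>f0\<close>. Integrating the second factor
  over \<open>t\<close> leaves \<open>exp (- tau)^2\<close> and another \<open>h\<close>.\<close>

lemma f0_lag:
	assumes h: "0 < h" "h <= 1" and tau: "tau > 0" and ij: "i < j"
	shows "\<bar>expectation (%w. f0 h x (Xc tau i w) * f0 h x' (Xc tau j w))\<bar> <= Cg\<^sup>2 * Imd * (CP * (4 * (exp (- tau))\<^sup>2 + 2 * h * I2))"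
proof -
	let ?\<rho> = "exp (- tau) ^ (j - i)"
	let ?E = "%t s. CLINT w|M. iexp (t * ((x' - Xc tau j w) / h) - s * ((x - Xc tau i w) / h))"
	define \<kappa> where "\<kappa> t = CP * (2 * (exp (- tau))\<^sup>2 + 2 / (1 + \<bar>t / h\<bar>)\<^sup>2)" for t
	have \<kappa>0: "0 <= \<kappa> t" for t unfolding \<kappa>_def using CP(1) by simp
	have E: "cmod (?E t s) <= md (- (t / h) * ?\<rho> + 1 / h * s) * \<kappa> t" for t s
	proof -
		have "iexp (t * ((x' - Xc tau j w) / h) - s * ((x - Xc tau i w) / h)) = iexp (t * x' / h - s * x / h) * iexp (s / h * Xc tau i w + (- (t / h)) * Xc tau j w)" for w
		proof -
			have "t * ((x' - Xc tau j w) / h) - s * ((x - Xc tau i w) / h) = (t * x' / h - s * x / h) + (s / h * Xc tau i w + (- (t / h)) * Xc tau j w)"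
				using h by (simp add: field_simps)
			moreover have "iexp (c + d) = iexp c * iexp d" for c d :: real by (simp add: algebra_simps exp_add)
			ultimately show ?thesis by metis
		qed
		then have "cmod (?E t s) = cmod (CLINT w|M. iexp (s / h * Xc tau i w + (- (t / h)) * Xc tau j w))"
			by (simp only: integral_mult_right_zero norm_mult norm_exp_i_times mult_1)
		also have "... <= md (s / h + (- (t / h)) * ?\<rho>) * \<kappa> t" unfolding \<kappa>_def using char_pair[OF tau ij, of "s / h" "- (t / h)"] by simp
		finally show ?thesis by (simp add: add.commute)
	qed
	have mi: "integrable lborel (%s. md (c + 1 / h * s))" "(LINT s|lborel. md (c + 1 / h * s)) = h * Imd" for c
		using lborel_integrable_real_affine[OF md_integrable, of "1 / h" c] integral_scale_real[of "1 / h" md c] h by (auto simp: Imd_def)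
	have in1: "cmod (CLINT s|lborel. gk 1 h s * ?E t s) <= Cg * \<kappa> t * (h * Imd)" for t
	proof -
		have "cmod (CLINT s|lborel. gk 1 h s * ?E t s) <= (LINT s|lborel. Cg * \<kappa> t * md (- (t / h) * ?\<rho> + 1 / h * s))"
		proof (rule norm_integral_le)
			show "integrable lborel (%s. Cg * \<kappa> t * md (- (t / h) * ?\<rho> + 1 / h * s))" by (rule integrable_mult_right[OF mi(1)])
			fix s
			have "cmod (gk 1 h s * ?E t s) <= Cg * (md (- (t / h) * ?\<rho> + 1 / h * s) * \<kappa> t)"
				unfolding norm_mult[of "gk 1 h s"] using gk_facts(2)[OF h, of 1 s] E[of t s] Cg_nonneg by (intro mult_mono) auto
			then show "cmod (gk 1 h s * ?E t s) <= Cg * \<kappa> t * md (- (t / h) * ?\<rho> + 1 / h * s)" by (simp only: mult_ac)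
		qed
		then show ?thesis unfolding integral_mult_right_zero mi(2) .
	qed
	let ?G = "%t. Cg * Cg * (h * Imd) * CP * (2 * (exp (- tau))\<^sup>2 * indicator {-1..1::real} t + 2 * (1 / (1 + \<bar>0 + 1 / h * t\<bar>)\<^sup>2))"
	have s2: "integrable lborel (%t. 1 / (1 + \<bar>0 + 1 / h * t\<bar>)\<^sup>2)" "(LINT t|lborel. 1 / (1 + \<bar>0 + 1 / h * t\<bar>)\<^sup>2) = h * I2"
		using lborel_integrable_real_affine[OF integrable_inverse_square, of "1 / h" 0] integral_scale_real[of "1 / h" "%t. 1 / (1 + \<bar>t\<bar>)\<^sup>2" 0] h by (auto simp: I2_def)
	have ind: "integrable lborel (%t. 2 * (exp (- tau))\<^sup>2 * indicator {-1..1::real} t :: real)" "(LINT t|lborel. 2 * (exp (- tau))\<^sup>2 * indicator {-1..1::real} t) = 4 * (exp (- tau))\<^sup>2"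
	proof -
		show "integrable lborel (%t. 2 * (exp (- tau))\<^sup>2 * indicator {-1..1::real} t :: real)" by (intro integrable_mult_right integrable_real_indicator) auto
	qed simp
	have iG: "integrable lborel ?G" by (intro integrable_mult_right Bochner_Integration.integrable_add ind s2)
	have "cmod (CLINT t|lborel. cnj (gk 1 h t) * (CLINT s|lborel. gk 1 h s * ?E t s)) <= (LINT t|lborel. ?G t)"
	proof (rule norm_integral_le[OF iG])
		fix t
		show "cmod (cnj (gk 1 h t) * (CLINT s|lborel. gk 1 h s * ?E t s)) <= ?G t"
		proof (cases "\<bar>t\<bar> <= 1")
			case True
			have "cmod (cnj (gk 1 h t) * (CLINT s|lborel. gk 1 h s * ?E t s)) <= Cg * (Cg * \<kappa> t * (h * Imd))"
				unfolding norm_mult[of "cnj (gk 1 h t)"] complex_mod_cnj using gk_facts(2)[OF h, of 1 t] in1[of t] Cg_nonneg by (intro mult_mono) auto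
			also have "... = ?G t" using True by (simp add: \<kappa>_def indicator_def abs_le_iff algebra_simps)
			finally show ?thesis .
		next
			case False
			then have "gk 1 h t = 0" using gk_facts(3)[OF h, of 1 t] by simp
			then show ?thesis using Cg_nonneg I_nonneg CP(1) h by (auto intro!: mult_nonneg_nonneg add_nonneg_nonneg)
		qed
	qed
	also have "(LINT t|lborel. ?G t) = Cg * Cg * (h * Imd) * CP * (4 * (exp (- tau))\<^sup>2 + 2 * (h * I2))"
		unfolding integral_mult_right_zero Bochner_Integration.integral_add[OF ind(1) integrable_mult_right[OF s2(1)]] ind(2) s2(2) by simp
	finally have b: "cmod (CLINT t|lborel. cnj (gk 1 h t) * (CLINT s|lborel. gk 1 h s * ?E t s)) <= h * (Cg\<^sup>2 * Imd * (CP * (4 * (exp (- tau))\<^sup>2 + 2 * h * I2)))" (is "_ <= h * ?R")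
		by (simp add: power2_eq_square mult_ac)
	have R0: "0 <= ?R" using I_nonneg CP(1) h by (intro mult_nonneg_nonneg add_nonneg_nonneg) auto
	have "\<bar>expectation (%w. f0 h x (Xc tau i w) * f0 h x' (Xc tau j w))\<bar> = cmod (cplx (expectation (%w. f0 h x (Xc tau i w) * f0 h x' (Xc tau j w))))" by simp
	also have "... = 1 / (4 * pi\<^sup>2 * h) * cmod (CLINT t|lborel. cnj (gk 1 h t) * (CLINT s|lborel. gk 1 h s * ?E t s))"
		unfolding f0_pair[OF h Xc_meas Xc_meas] norm_mult[of "1 / _"] using h by (simp add: norm_divide norm_mult norm_power)
	also have "... <= 1 / h * (h * ?R)"
	proof (intro mult_mono b)
		have "1 <= pi\<^sup>2" using pi_gt3 by (intro one_le_power) auto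
		then show "1 / (4 * pi\<^sup>2 * h) <= 1 / h" using h by (intro divide_left_mono) (auto intro!: mult_pos_pos)
	qed (use h in auto)
	also have "... = ?R" using h by simp
	finally show ?thesis .
qed

text \<open>The point \<open>y\<close> has distance at least half of \<open>|x - x'|\<close> from
  one of the two centres, and there the decay of the inverse transform makes \<open>f0\<close> of
  order \<open>sqrt h\<close>.\<close>

lemma f0_cross:
	assumes h: "0 < h" "h <= 1" and x: "x ~= x'"
	shows "\<bar>f0 h x y * f0 h x' y\<bar> <= 2 * Cg / \<bar>x - x'\<bar> * sqrt h * (\<bar>f0 h x y\<bar> + \<bar>f0 h x' y\<bar>)"
proof -
	let ?\<eta> = "\<bar>x - x'\<bar>"
	have b: "\<bar>f0 h x y\<bar> <= 2 * Cg / ?\<eta> * sqrt h" if "?\<eta> / 2 <= \<bar>x - y\<bar>" for x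
	proof -
		let ?z = "(x - y) / h"
		have z: "0 < \<bar>x - y\<bar>" by (rule less_le_trans[OF _ that]) (use assms(3) in simp)
		have "\<bar>x - y\<bar> * cmod (kap (gk 1 h) ?z) <= h * Cg" using gk_facts(6)[OF h, of 1 ?z] h by (simp add: pos_divide_le_eq mult_ac)
		then have "cmod (kap (gk 1 h) ?z) <= h * Cg / \<bar>x - y\<bar>" using z by (simp add: pos_le_divide_eq mult.commute)
		also have "... <= h * Cg / (?\<eta> / 2)" using that h Cg_nonneg assms(3) z by (intro divide_left_mono) (auto intro!: mult_pos_pos)
		finally have kk: "\<bar>Re (kap (gk 1 h) ?z)\<bar> <= h * Cg / (?\<eta> / 2)" using abs_Re_le_cmod order_trans by blast
		then have "\<bar>f0 h x y\<bar> <= h * Cg / (?\<eta> / 2) / sqrt h" using divide_right_mono[OF kk, of "sqrt h"] h unfolding f0_def abs_divide by simp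
		also have "... = 2 * Cg / ?\<eta> * (h / sqrt h)" by simp
		finally show ?thesis using h by (simp only: real_div_sqrt)
	qed
	have nn: "0 <= 2 * Cg / ?\<eta> * sqrt h" using Cg_nonneg h by simp
	have "?\<eta> <= \<bar>x - y\<bar> + \<bar>x' - y\<bar>" using abs_triangle_ineq4[of "x - y" "x' - y"] by simp
	then have "?\<eta> / 2 <= \<bar>x - y\<bar> \<or> ?\<eta> / 2 <= \<bar>x' - y\<bar>" by (auto simp: field_simps)
	then show ?thesis
	proof
		assume "?\<eta> / 2 <= \<bar>x - y\<bar>"
		then have "\<bar>f0 h x y\<bar> * \<bar>f0 h x' y\<bar> <= (2 * Cg / ?\<eta> * sqrt h) * (\<bar>f0 h x y\<bar> + \<bar>f0 h x' y\<bar>)" using nn by (intro mult_mono b) auto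
		then show ?thesis by (simp only: abs_mult)
	next
		assume "?\<eta> / 2 <= \<bar>x' - y\<bar>"
		then have "\<bar>f0 h x' y\<bar> * \<bar>f0 h x y\<bar> <= (2 * Cg / ?\<eta> * sqrt h) * (\<bar>f0 h x y\<bar> + \<bar>f0 h x' y\<bar>)" using nn by (intro mult_mono b) auto
		then show ?thesis by (simp only: abs_mult mult.commute[of "\<bar>f0 h x y\<bar>"])
	qed
qed

text \<open>The substitution \<open>s = t + h * u\<close> decouples the double frequency integral:
  by the Lipschitz bound \<open>gk\<close> at \<open>t + h * u\<close> may be replaced by its value
  at \<open>t\<close>. This leaves the integral of \<open>|gk|^2\<close>, which converges by regular
  variation, times the inversion integral of \<open>phi\<close>, which is
  \<open>2 * pi * \<pi>d x\<close>.\<close>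

lemma f0_variance:
	assumes h: "!!n. 0 < h n" "!!n. h n <= 1" and h0: "h \<longlonglongrightarrow> 0"
	shows "(%n. expectation (%w. (f0 (h n) x (X0 w))\<^sup>2)) \<longlonglongrightarrow> \<pi>d x / (2 * pi) * (LINT t|lborel. \<bar>t\<bar> powr (2 * \<alpha>) * (cmod (ft W t))\<^sup>2)"
proof -
	define A where "A n = (LINT t|lborel. (cmod (gk 1 (h n) t))\<^sup>2)" for n
	\<comment> \<open>The error of replacing \<open>gk\<close> at \<open>t + h * u\<close> by its value
	  at \<open>t\<close>. The minimum of the trivial and the Lipschitz bound has the integrable
	  majorant \<open>2 * Cg * md u\<close> and tends to 0 pointwise.\<close>
	define ep where "ep n = (LINT u|lborel. min (2 * Cg) (Cg * h n * \<bar>u\<bar>) * md u)" for n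
	note gm[measurable] = gk_facts(1)[OF h, of 1, simplified]
	have iA: "integrable lborel (%t. (cmod (gk 1 (h n) t))\<^sup>2)" for n
		by (rule integrable_bounded_support(1)[where R=1 and C="Cg\<^sup>2"])
			 (use gk_facts(2)[OF h, of 1 n] gk_facts(3)[OF h, of 1 _ n] in \<open>auto intro!: power_mono\<close>)
	have Alim: "A \<longlonglongrightarrow> (LINT t|lborel. \<bar>t\<bar> powr (2 * \<alpha>) * (cmod (ft W t))\<^sup>2)"
		unfolding A_def
	proof (rule integral_dominated_convergence[where w="%t. Cg\<^sup>2 * indicator {-1..1::real} t"])
		show "integrable lborel (%t. Cg\<^sup>2 * indicator {-1..1::real} t :: real)" by (intro integrable_mult_right integrable_real_indicator) auto
		show "AE t in lborel. norm ((cmod (gk 1 (h n) t))\<^sup>2) <= Cg\<^sup>2 * indicator {-1..1::real} t" for n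
		proof (rule AE_I2)
			fix t show "norm ((cmod (gk 1 (h n) t))\<^sup>2) <= Cg\<^sup>2 * indicator {-1..1::real} t"
				using gk_facts(2)[OF h, of 1 n t] gk_facts(3)[OF h, of 1 t n] by (cases "\<bar>t\<bar> <= 1") (auto simp: indicator_def abs_le_iff intro!: power_mono)
		qed
		have Ti: "filterlim (%n. 1 / h n) at_top sequentially"
			using filterlim_inverse_at_top[OF h0] h(1) by (simp add: divide_inverse)
		show "AE t in lborel. (%n. (cmod (gk 1 (h n) t))\<^sup>2) \<longlonglongrightarrow> \<bar>t\<bar> powr (2 * \<alpha>) * (cmod (ft W t))\<^sup>2"
			using AE_lborel_singleton[of "0::real"]
		proof eventually_elim
			case (elim t)
			have "(%n. md (\<bar>t\<bar> * (1 / h n)) / md (1 / h n)) \<longlonglongrightarrow> \<bar>t\<bar> powr (- \<alpha>)"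
				using filterlim_compose[OF ratio[of "\<bar>t\<bar>"] Ti] elim by (simp add: md_def)
			then have "(%n. (cmod (ft W t) * inverse (md (\<bar>t\<bar> * (1 / h n)) / md (1 / h n)))\<^sup>2) \<longlonglongrightarrow> (cmod (ft W t) * inverse (\<bar>t\<bar> powr (- \<alpha>)))\<^sup>2"
				using elim by (intro tendsto_intros) auto
			moreover have "cmod (ft W t) * inverse (md (\<bar>t\<bar> * (1 / h n)) / md (1 / h n)) = cmod (gk 1 (h n) t)" for n
			proof -
				have "md (\<bar>t\<bar> * (1 / h n)) = md (t / h n)" using md_abs[of "t / h n"] h(1)[of n] by (simp add: abs_divide)
				then show ?thesis unfolding gk_def norm_mult norm_divide mult_1 md_def[of "t / h n", symmetric] using md_pos[of "1 / h n"] by simp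
			qed
			moreover have "(cmod (ft W t) * inverse (\<bar>t\<bar> powr (- \<alpha>)))\<^sup>2 = \<bar>t\<bar> powr (2 * \<alpha>) * (cmod (ft W t))\<^sup>2"
				using elim by (simp add: powr_minus power_mult_distrib powr_powr mult.commute flip: powr_numeral)
			ultimately show ?case by simp
		qed
	qed measurable
	have eplim: "ep \<longlonglongrightarrow> 0"
	proof -
		have "ep \<longlonglongrightarrow> (LINT u|(lborel :: real measure). 0)" unfolding ep_def
		proof (rule integral_dominated_convergence[where w="%u. 2 * Cg * md u"])
			show "integrable lborel (%u. 2 * Cg * md u)" using md_integrable by (rule integrable_mult_right)
			show "AE u in lborel. norm (min (2 * Cg) (Cg * h n * \<bar>u\<bar>) * md u) <= 2 * Cg * md u" for n
				using Cg_nonneg h(1)[of n] md_pos by (intro AE_I2) (auto simp: abs_mult less_imp_le intro!: mult_right_mono)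
			show "AE u in lborel. (%n. min (2 * Cg) (Cg * h n * \<bar>u\<bar>) * md u) \<longlonglongrightarrow> 0"
			proof (rule AE_I2)
				fix u
				have "(%n. min (2 * Cg) (Cg * h n * \<bar>u\<bar>) * md u) \<longlonglongrightarrow> min (2 * Cg) (Cg * 0 * \<bar>u\<bar>) * md u" by (intro tendsto_intros h0)
				then show "(%n. min (2 * Cg) (Cg * h n * \<bar>u\<bar>) * md u) \<longlonglongrightarrow> 0" using Cg_nonneg by simp
			qed
		qed measurable
		then show ?thesis by simp
	qed
	let ?P = "CLINT u|lborel. iexp (- (u * x)) * phi u"
	have P: "?P = cplx (2 * pi * \<pi>d x)" using density_inversion[OF dens, of x] by (simp add: field_simps)
	have diff: "\<bar>expectation (%w. (f0 (h n) x (X0 w))\<^sup>2) - \<pi>d x / (2 * pi) * A n\<bar> <= Cg * ep n" for n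
	proof -
		let ?g = "gk 1 (h n)" and ?h = "h n"
		have ch: "(CLINT w|M. iexp (t * ((x - X0 w) / ?h) - s * ((x - X0 w) / ?h))) = iexp (- ((s - t) / ?h * x)) * phi ((s - t) / ?h)" for s t
		proof -
			have "iexp (t * ((x - X0 w) / ?h) - s * ((x - X0 w) / ?h)) = iexp (- ((s - t) / ?h * x)) * iexp ((s - t) / ?h * X0 w)" for w
			proof -
				have "t * ((x - X0 w) / ?h) - s * ((x - X0 w) / ?h) = - ((s - t) / ?h * x) + (s - t) / ?h * X0 w"
					using h(1)[of n] by (simp add: field_simps)
				moreover have "iexp (c + d) = iexp c * iexp d" for c d :: real by (simp add: algebra_simps exp_add)
				ultimately show ?thesis by metis
			qed
			then show ?thesis by (simp only: integral_mult_right_zero char_X0)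
		qed
		have inn: "(CLINT s|lborel. ?g s * (iexp (- ((s - t) / ?h * x)) * phi ((s - t) / ?h))) = ?h *\<^sub>R (CLINT u|lborel. ?g (t + ?h * u) * (iexp (- (u * x)) * phi u))" for t
			using integral_scale_real[OF h(1)[of n], of "%s. ?g s * (iexp (- ((s - t) / ?h * x)) * phi ((s - t) / ?h))" t] h(1)[of n] by simp
		have ib: "integrable lborel (%u. f u * (iexp (- (u * x)) * phi u))" if [measurable]: "f \<in> borel_measurable borel" and "!!u. cmod (f u) <= Cg" for f
			by (rule Bochner_Integration.integrable_bound[OF integrable_mult_right[OF md_integrable, of Cg]])
				 (use that(2) Cg_nonneg in \<open>auto simp: norm_mult md_def intro!: AE_I2 mult_right_mono\<close>)
		define Q where "Q t = (CLINT u|lborel. ?g (t + ?h * u) * (iexp (- (u * x)) * phi u))" for t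
		have Qm[measurable]: "Q \<in> borel_measurable borel" unfolding Q_def by measurable
		have Q: "cmod (Q t - ?g t * ?P) <= ep n" for t
		proof -
			note i1 = ib[of "%u. ?g (t + ?h * u)"] and i2 = ib[of "%u. ?g t"]
			have e: "Q t - ?g t * ?P = (CLINT u|lborel. (?g (t + ?h * u) - ?g t) * (iexp (- (u * x)) * phi u))"
				unfolding Q_def left_diff_distrib integral_mult_right_zero[symmetric]
				by (rule Bochner_Integration.integral_diff[symmetric]) (intro i1 i2; use gk_facts(2)[OF h, of 1] in simp)+
			show ?thesis unfolding e ep_def
			proof (rule norm_integral_le)
				show "integrable lborel (%u. min (2 * Cg) (Cg * ?h * \<bar>u\<bar>) * md u)"
					by (rule Bochner_Integration.integrable_bound[OF integrable_mult_right[OF md_integrable, of "2 * Cg"]])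
						 (use Cg_nonneg h(1)[of n] md_pos in \<open>auto simp: abs_mult less_imp_le intro!: AE_I2 mult_right_mono\<close>)
				fix u
				have "cmod (?g (t + ?h * u) - ?g t) <= min (2 * Cg) (Cg * ?h * \<bar>u\<bar>)"
					using gk_facts(4)[OF h, of 1 n "t + ?h * u" t] norm_triangle_ineq4[of "?g (t + ?h * u)" "?g t"] gk_facts(2)[OF h, of 1 n t] gk_facts(2)[OF h, of 1 n "t + ?h * u"] h(1)[of n]
					by (auto simp: abs_mult mult.assoc)
				then show "cmod ((?g (t + ?h * u) - ?g t) * (iexp (- (u * x)) * phi u)) <= min (2 * Cg) (Cg * ?h * \<bar>u\<bar>) * md u"
					unfolding norm_mult norm_exp_i_times mult_1 md_def[symmetric] using md_pos by (intro mult_right_mono) (auto simp: less_imp_le)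
			qed
		qed
		have cnjm[measurable]: "cnj \<in> borel_measurable borel" by (intro borel_measurable_continuous_onI continuous_intros)
		have "cplx (expectation (%w. (f0 ?h x (X0 w))\<^sup>2)) = 1 / (4 * cplx pi ^ 2 * cplx ?h) * (CLINT t|lborel. cnj (?g t) * (?h *\<^sub>R Q t))"
			unfolding power2_eq_square[of "f0 _ _ _"] f0_pair[OF h rv(1) rv(1)] ch inn Q_def ..
		also have "(CLINT t|lborel. cnj (?g t) * (?h *\<^sub>R Q t)) = cplx ?h * (CLINT t|lborel. cnj (?g t) * Q t)"
			by (simp add: scaleR_conv_of_real mult.left_commute)
		finally have e1: "cplx (expectation (%w. (f0 ?h x (X0 w))\<^sup>2)) = 1 / (4 * cplx pi ^ 2) * (CLINT t|lborel. cnj (?g t) * Q t)"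
			using h(1)[of n] by simp
		have e2: "cplx (\<pi>d x / (2 * pi) * A n) = 1 / (4 * cplx pi ^ 2) * (CLINT t|lborel. cnj (?g t) * (?g t * ?P))"
		proof -
			have "cnj (?g t) * (?g t * ?P) = cplx ((cmod (?g t))\<^sup>2) * ?P" for t
				using complex_norm_square[of "?g t"] by (simp add: mult.commute mult.left_commute)
			then have "(CLINT t|lborel. cnj (?g t) * (?g t * ?P)) = (CLINT t|lborel. cplx ((cmod (?g t))\<^sup>2)) * ?P" by (simp only: integral_mult_left_zero)
			also have "... = cplx (A n * (2 * pi * \<pi>d x))" unfolding P A_def integral_complex_of_real by simp
			finally show ?thesis by (simp add: power2_eq_square)
		qed
		have Qb: "cmod (Q t) <= ep n + Cg * cmod ?P" for t
		proof -
			have "cmod (Q t) <= cmod (Q t - ?g t * ?P) + cmod (?g t) * cmod ?P" using norm_triangle_ineq[of "Q t - ?g t * ?P" "?g t * ?P"] by (simp add: norm_mult)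
			also have "... <= ep n + Cg * cmod ?P" using Q[of t] gk_facts(2)[OF h, of 1 n t] by (intro add_mono mult_right_mono) auto
			finally show ?thesis .
		qed
		have gz: "?g t = 0" if "\<bar>t\<bar> > 1" for t using gk_facts(3)[OF h, of 1 t n] that by simp
		have gb: "cmod (?g t) <= Cg" for t using gk_facts(2)[OF h, of 1 n t] by simp
		have i1: "integrable lborel (%t. cnj (?g t) * Q t)"
			by (rule integrable_bounded_support(1)[where R=1 and C="Cg * (ep n + Cg * cmod ?P)"])
				 (use gb Qb gz Cg_nonneg in \<open>auto simp: norm_mult intro!: mult_mono\<close>)
		have i2: "integrable lborel (%t. cnj (?g t) * (?g t * ?P))"
			by (rule integrable_bounded_support(1)[where R=1 and C="Cg * (Cg * cmod ?P)"])
				 (use gb gz Cg_nonneg in \<open>auto simp: norm_mult intro!: mult_mono\<close>)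
		have e3: "(CLINT t|lborel. cnj (?g t) * Q t) - (CLINT t|lborel. cnj (?g t) * (?g t * ?P)) = (CLINT t|lborel. cnj (?g t) * (Q t - ?g t * ?P))"
			unfolding right_diff_distrib by (rule Bochner_Integration.integral_diff[OF i1 i2, symmetric])
		have b3: "cmod (CLINT t|lborel. cnj (?g t) * (Q t - ?g t * ?P)) <= 2 * 1 * (Cg * ep n)"
		proof (rule integrable_bounded_support(2))
			show "cmod (cnj (?g t) * (Q t - ?g t * ?P)) <= Cg * ep n" for t
				unfolding norm_mult[of "cnj (?g t)"] complex_mod_cnj using gb[of t] Q[of t] Cg_nonneg by (intro mult_mono) auto
			show "cnj (?g t) * (Q t - ?g t * ?P) = 0" if "\<bar>t\<bar> > 1" for t using gz[OF that] by simp
			show "(%t. cnj (?g t) * (Q t - ?g t * ?P)) \<in> borel_measurable borel" by measurable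
		qed simp
		have "\<bar>expectation (%w. (f0 ?h x (X0 w))\<^sup>2) - \<pi>d x / (2 * pi) * A n\<bar> = cmod (cplx (expectation (%w. (f0 ?h x (X0 w))\<^sup>2)) - cplx (\<pi>d x / (2 * pi) * A n))"
			by (simp only: of_real_diff[symmetric] norm_of_real)
		also have "... = 1 / (4 * pi\<^sup>2) * cmod (CLINT t|lborel. cnj (?g t) * (Q t - ?g t * ?P))"
			unfolding e1 e2 right_diff_distrib[of "1 / (4 * cplx pi ^ 2)", symmetric] e3 norm_mult[of "1 / (4 * cplx pi ^ 2)"] by (simp add: norm_divide norm_mult norm_power)
		also have "... <= 1 / 2 * (2 * 1 * (Cg * ep n))"
		proof (intro mult_mono b3)
			have "1 <= pi\<^sup>2" using pi_gt3 by (intro one_le_power) auto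
			then show "1 / (4 * pi\<^sup>2) <= 1 / 2" by (intro divide_left_mono) auto
		qed auto
		finally show ?thesis by simp
	qed
	have "(%n. expectation (%w. (f0 (h n) x (X0 w))\<^sup>2) - \<pi>d x / (2 * pi) * A n) \<longlonglongrightarrow> 0"
	proof (rule Lim_null_comparison)
		show "eventually (%n. norm (expectation (%w. (f0 (h n) x (X0 w))\<^sup>2) - \<pi>d x / (2 * pi) * A n) <= Cg * ep n) sequentially" using diff by simp
		show "(%n. Cg * ep n) \<longlonglongrightarrow> 0" using tendsto_mult_right_zero[OF eplim] by simp
	qed
	from tendsto_add[OF this tendsto_mult_left[OF Alim, of "\<pi>d x / (2 * pi)"]] show ?thesis by simp
qed

end

section \<open>Central limit theorem for the linear part\<close>

context ou_kernel
begin

lemma integrable_mult_bounded: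
	fixes f g :: "'a => real"
	assumes [measurable]: "random_variable borel f" "random_variable borel g" and b: "!!w. \<bar>f w\<bar> <= A" "!!w. \<bar>g w\<bar> <= B"
	shows "integrable M (%w. f w * g w)"
proof (rule integrable_bounded_rv[of _ "A * B"])
	show "norm (f w * g w) <= A * B" for w unfolding real_norm_def abs_mult using b order_trans[OF abs_ge_zero b(1)] by (intro mult_mono) auto
qed measurable

lemma fn_bound:
	assumes h: "0 < h" "h <= 1" and x: "0 < x" and y: "0 <= y"
	shows "\<bar>fn h x y\<bar> <= (x * Cg + Ce) / sqrt h"
proof -
	have "x * \<bar>f0 h x y\<bar> <= x * (Cg / sqrt h)" using f0_bound[OF h] x by (intro mult_left_mono) auto
	then have A: "\<bar>x * f0 h x y\<bar> <= x * Cg / sqrt h" using x by (simp add: abs_mult)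
	have "sqrt h <= 1" "1 <= 1 / sqrt h" using h by auto
	then have B: "sqrt h * Ce <= (1 / sqrt h) * Ce" using Ce_nonneg by (intro mult_right_mono) linarith+
	show ?thesis unfolding add_divide_distrib using A B fn_close[OF h x y] by simp
qed

text \<open>The product of the two differences and the mixed terms are bounded through
  \<open>fn_close\<close>. Clipping the arguments of \<open>fn\<close> at 0 changes nothing almost
  surely, but makes \<open>fn_bound\<close> available at every sample point.\<close>

lemma fn_f0_moment:
	assumes h: "0 < h" "h <= 1" and x: "0 < x" "0 < x'" and [measurable]: "random_variable borel Y" "random_variable borel Y'"
		and nn: "AE w in M. 0 <= Y w" "AE w in M. 0 <= Y' w"
	shows "\<bar>expectation (%w. fn h x (max (Y w) 0) * fn h x' (max (Y' w) 0)) - x * x' * expectation (%w. f0 h x (Y w) * f0 h x' (Y' w))\<bar>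
		 <= sqrt h * Ce * (x * (1 + expectation (%w. (f0 h x (Y w))\<^sup>2)) / 2 + x' * (1 + expectation (%w. (f0 h x' (Y' w))\<^sup>2)) / 2 + Ce)"
proof -
	note [measurable] = f0_meas[OF h] fn_meas[OF h(1)]
	let ?f = "%w. fn h x (max (Y w) 0) * fn h x' (max (Y' w) 0)" and ?g = "%w. f0 h x (Y w) * f0 h x' (Y' w)"
	let ?B = "%w. sqrt h * Ce * (x * (1 + (f0 h x (Y w))\<^sup>2) / 2 + x' * (1 + (f0 h x' (Y' w))\<^sup>2) / 2 + Ce)"
	have ig: "integrable M (%w. f0 h a (Z w) * f0 h b (Z' w))" if [measurable]: "random_variable borel Z" "random_variable borel Z'" for a b Z Z'
		by (rule integrable_mult_bounded[OF _ _ f0_bound[OF h] f0_bound[OF h]]) measurable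
	have sq: "integrable M (%w. (f0 h a (Z w))\<^sup>2)" if "random_variable borel Z" for a Z using ig[OF that that] by (simp add: power2_eq_square)
	have if': "integrable M ?f"
		by (rule integrable_mult_bounded[OF _ _ fn_bound[OF h x(1)] fn_bound[OF h x(2)]]) auto
	have iB: "integrable M ?B" using sq[of Y x] sq[of Y' x'] by auto
	have e: "expectation ?f - x * x' * expectation ?g = expectation (%w. ?f w - x * x' * ?g w)"
		using if' ig[of Y Y' x x'] by simp
	have s1: "0 <= sqrt h" "sqrt h <= 1" using h by auto
	have pt: "AE w in M. \<bar>?f w - x * x' * ?g w\<bar> <= ?B w"
		using nn
	proof eventually_elim
		case (elim w)
		define a b A B where "a = fn h x (max (Y w) 0)" "b = fn h x' (max (Y' w) 0)" "A = f0 h x (Y w)" "B = f0 h x' (Y' w)"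
		have ab: "\<bar>a - x * A\<bar> <= sqrt h * Ce" "\<bar>b - x' * B\<bar> <= sqrt h * Ce" using fn_close[OF h x(1) elim(1)] fn_close[OF h x(2) elim(2)] elim by (simp_all add: a_b_A_B_def max_def)
		have AA: "\<bar>A\<bar> <= (1 + A\<^sup>2) / 2" "\<bar>B\<bar> <= (1 + B\<^sup>2) / 2" using sum_squares_bound[of "\<bar>A\<bar>" 1] sum_squares_bound[of "\<bar>B\<bar>" 1] by simp_all
		have eq: "a * b - x * x' * (A * B) = (a - x * A) * (b - x' * B) + (x * A) * (b - x' * B) + (a - x * A) * (x' * B)" by (simp add: algebra_simps)
		have "\<bar>a * b - x * x' * (A * B)\<bar> <= \<bar>a - x * A\<bar> * \<bar>b - x' * B\<bar> + \<bar>x * A\<bar> * \<bar>b - x' * B\<bar> + \<bar>a - x * A\<bar> * \<bar>x' * B\<bar>"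
			unfolding eq abs_mult[symmetric] by (intro order_trans[OF abs_triangle_ineq] add_mono order_refl)
		also have "... <= (sqrt h * Ce) * Ce + (x * ((1 + A\<^sup>2) / 2)) * (sqrt h * Ce) + (sqrt h * Ce) * (x' * ((1 + B\<^sup>2) / 2))"
		proof (intro add_mono mult_mono)
			show "\<bar>b - x' * B\<bar> <= Ce" using ab(2) mult_right_mono[OF s1(2) Ce_nonneg] by linarith
			show "\<bar>x * A\<bar> <= x * ((1 + A\<^sup>2) / 2)" "\<bar>x' * B\<bar> <= x' * ((1 + B\<^sup>2) / 2)" using AA x by (auto simp: abs_mult intro!: mult_left_mono)
		qed (use ab s1 Ce_nonneg x in auto)
		also have "... = sqrt h * Ce * (x * (1 + A\<^sup>2) / 2 + x' * (1 + B\<^sup>2) / 2 + Ce)" by (simp add: algebra_simps)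
		finally show ?case unfolding a_b_A_B_def .
	qed
	have "\<bar>expectation (%w. ?f w - x * x' * ?g w)\<bar> <= expectation (%w. \<bar>?f w - x * x' * ?g w\<bar>)" by (rule integral_abs_bound)
	also have "... <= expectation ?B"
		by (rule integral_mono_AE[OF _ iB pt]) (use if' ig[of Y Y' x x'] in auto)
	also have "... = sqrt h * Ce * (x * (1 + expectation (%w. (f0 h x (Y w))\<^sup>2)) / 2 + x' * (1 + expectation (%w. (f0 h x' (Y' w))\<^sup>2)) / 2 + Ce)"
		using sq[of Y x] sq[of Y' x'] by (simp add: prob_space)
	finally show ?thesis unfolding e .
qed

definition Vf :: "real => real" where
	"Vf x = \<pi>d x / (2 * pi) * (LINT t|lborel. \<bar>t\<bar> powr (2 * \<alpha>) * (cmod (ft W t))\<^sup>2)"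

lemma f0_cross_tendsto:
	assumes h: "!!n. 0 < h n" "!!n. h n <= 1" and h0: "h \<longlonglongrightarrow> 0" and x: "x ~= x'"
	shows "(%n. expectation (%w. f0 (h n) x (X0 w) * f0 (h n) x' (X0 w))) \<longlonglongrightarrow> 0"
proof (rule Lim_null_comparison)
	let ?V = "%n x. expectation (%w. (f0 (h n) x (X0 w))\<^sup>2)"
	let ?b = "%n. 2 * Cg / \<bar>x - x'\<bar> * sqrt (h n) * (1 + ?V n x + ?V n x')"
	have "(%n. 2 * Cg / \<bar>x - x'\<bar> * sqrt (h n) * (1 + ?V n x + ?V n x')) \<longlonglongrightarrow> 2 * Cg / \<bar>x - x'\<bar> * sqrt 0 * (1 + Vf x + Vf x')"
		unfolding Vf_def using x by (intro tendsto_intros f0_variance h h0) auto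
	then show "?b \<longlonglongrightarrow> 0" by simp
	have "\<bar>expectation (%w. f0 (h n) x (X0 w) * f0 (h n) x' (X0 w))\<bar> <= ?b n" for n
	proof -
		note [measurable] = f0_meas[OF h]
		have sq: "integrable M (%w. (f0 (h n) x (X0 w))\<^sup>2)" for x
			unfolding power2_eq_square by (rule integrable_mult_bounded[OF _ _ f0_bound[OF h] f0_bound[OF h]]) measurable
		have K0: "0 <= 2 * Cg / \<bar>x - x'\<bar> * sqrt (h n)" using Cg_nonneg h(1)[of n] by simp
		have "\<bar>expectation (%w. f0 (h n) x (X0 w) * f0 (h n) x' (X0 w))\<bar> <= expectation (%w. 2 * Cg / \<bar>x - x'\<bar> * sqrt (h n) * (1 + (f0 (h n) x (X0 w))\<^sup>2 + (f0 (h n) x' (X0 w))\<^sup>2))"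
		proof (rule abs_integral_le)
			show "integrable M (%w. 2 * Cg / \<bar>x - x'\<bar> * sqrt (h n) * (1 + (f0 (h n) x (X0 w))\<^sup>2 + (f0 (h n) x' (X0 w))\<^sup>2))" using sq by auto
			fix w
			have "\<bar>f0 (h n) x (X0 w) * f0 (h n) x' (X0 w)\<bar> <= 2 * Cg / \<bar>x - x'\<bar> * sqrt (h n) * (\<bar>f0 (h n) x (X0 w)\<bar> + \<bar>f0 (h n) x' (X0 w)\<bar>)" by (rule f0_cross[OF h x])
			also have "... <= 2 * Cg / \<bar>x - x'\<bar> * sqrt (h n) * (1 + (f0 (h n) x (X0 w))\<^sup>2 + (f0 (h n) x' (X0 w))\<^sup>2)"
			proof (rule mult_left_mono[OF _ K0])
				have "\<bar>a\<bar> + \<bar>b\<bar> <= 1 + a\<^sup>2 + b\<^sup>2" for a b :: real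
					using sum_squares_bound[of "\<bar>a\<bar>" 1] sum_squares_bound[of "\<bar>b\<bar>" 1] zero_le_power2[of a] zero_le_power2[of b] by (simp; linarith)
				then show "\<bar>f0 (h n) x (X0 w)\<bar> + \<bar>f0 (h n) x' (X0 w)\<bar> <= 1 + (f0 (h n) x (X0 w))\<^sup>2 + (f0 (h n) x' (X0 w))\<^sup>2" .
			qed
			finally show "\<bar>f0 (h n) x (X0 w) * f0 (h n) x' (X0 w)\<bar> <= 2 * Cg / \<bar>x - x'\<bar> * sqrt (h n) * (1 + (f0 (h n) x (X0 w))\<^sup>2 + (f0 (h n) x' (X0 w))\<^sup>2)" .
		qed
		also have "... = ?b n" using sq[of x] sq[of x'] by (simp add: prob_space)
		finally show ?thesis .
	qed
	then show "eventually (%n. norm (expectation (%w. f0 (h n) x (X0 w) * f0 (h n) x' (X0 w))) <= ?b n) sequentially" by simp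
qed

text \<open>A linear combination of the influence functions at all points is a single function of
  the observation, so the one-dimensional array theorem applies. The factor \<open>c n\<close> is
  carried along to absorb the slowly varying part of the normalisation. The bound of the function is
  of order \<open>1 / sqrt h\<close> and its Lipschitz constant of order \<open>1 / h^2\<close>,
  which is where \<open>nh\<close> and \<open>sm\<close> are used.\<close>

lemma linear_part_clt:
	fixes x s :: "'l::finite => real" and h tau c :: "nat => real"
	assumes h: "!!n. 0 < h n" "!!n. h n <= 1" and h0: "h \<longlonglongrightarrow> 0" and x: "inj x" "!!l. 0 < x l"
		and tau: "!!n. tau n > 0" "(%n. exp (- tau n)) \<longlonglongrightarrow> 0" and q: "q >= 1" and c: "c \<longlonglongrightarrow> c0"
		and nh: "(%n. 1 / sqrt (real n * h n)) \<longlonglongrightarrow> 0" and sm: "(%n. sqrt (real n) * (1 / (h n)\<^sup>2 * exp (- tau n) ^ q)) \<longlonglongrightarrow> 0"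
	shows "(%n. CLINT w|M. iexp ((1 / sqrt (real n)) * (\<Sum>j=1..n. c n * (\<Sum>l\<in>UNIV. s l * fn (h n) (x l) (max (Xc (tau n) j w) 0)))))
		 \<longlonglongrightarrow> cplx (exp (- (c0\<^sup>2 * (\<Sum>l\<in>UNIV. (s l)\<^sup>2 * ((x l)\<^sup>2 * Vf (x l)))) / 2))"
proof -
	\<comment> \<open>Clipping at 0 makes \<open>H n\<close> bounded and Lipschitz on the whole line;
	  the chain is almost surely nonnegative and does not notice it.\<close>
	define H where "H n y = c n * (\<Sum>l\<in>UNIV. s l * fn (h n) (x l) (max y 0))" for n y
	note fm[measurable] = fn_meas[OF h(1)]
	have Hm[measurable]: "H n \<in> borel_measurable borel" for n unfolding H_def by measurable
	define V where "V n l = expectation (%w. (f0 (h n) (x l) (X0 w))\<^sup>2)" for n l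
	have Vl: "(%n. V n l) \<longlonglongrightarrow> Vf (x l)" for l unfolding V_def Vf_def by (rule f0_variance[OF h h0])
	define R where "R n l l' = sqrt (h n) * Ce * (x l * (1 + V n l) / 2 + x l' * (1 + V n l') / 2 + Ce)" for n l l'
	have Rl: "(%n. R n l l') \<longlonglongrightarrow> 0" for l l'
	proof -
		have "(%n. R n l l') \<longlonglongrightarrow> sqrt 0 * Ce * (x l * (1 + Vf (x l)) / 2 + x l' * (1 + Vf (x l')) / 2 + Ce)"
			unfolding R_def by (intro tendsto_intros Vl h0) auto
		then show ?thesis by simp
	qed
	define LG where "LG n = Cg\<^sup>2 * Imd * (CP * (4 * (exp (- tau n))\<^sup>2 + 2 * h n * I2))" for n
	have LGl: "LG \<longlonglongrightarrow> 0"
	proof -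
		have "LG \<longlonglongrightarrow> Cg\<^sup>2 * Imd * (CP * (4 * 0\<^sup>2 + 2 * 0 * I2))" unfolding LG_def by (intro tendsto_intros h0 tau(2))
		then show ?thesis by simp
	qed
	have Vc: "expectation (%w. (f0 (h n) (x l) (Xc (tau n) j w))\<^sup>2) = V n l" for n l j
		unfolding V_def using E_Xc(1)[OF tau(1)[of n], of "%y. (f0 (h n) (x l) y)\<^sup>2" j] f0_meas[OF h] by simp
	have nnc: "AE w in M. 0 <= Xc (tau n) j w" for n j using AE_Xc_nonneg[of "tau n"] by eventually_elim simp
	let ?a = "%n l y. fn (h n) (x l) (max y 0)"
	have ab: "\<bar>?a n l y\<bar> <= (x l * Cg + Ce) / sqrt (h n)" for n l y using fn_bound[OF h x(2)] by simp
	have iaa: "integrable M (%w. ?a n l (Y w) * ?a n l' (Y' w))" if [measurable]: "random_variable borel Y" "random_variable borel Y'" for n l l' Y Y'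
		by (rule integrable_mult_bounded[OF _ _ ab ab]) measurable
	have ia: "integrable M (%w. ?a n l (X0 w))" for n l
		by (rule integrable_bounded_rv[of _ "(x l * Cg + Ce) / sqrt (h n)"]) (use ab in auto)
	have EHH: "expectation (%w. H n (Y w) * H n (Y' w)) = (c n)\<^sup>2 * (\<Sum>l\<in>UNIV. \<Sum>l'\<in>UNIV. s l * s l' * expectation (%w. ?a n l (Y w) * ?a n l' (Y' w)))"
		if [measurable]: "random_variable borel Y" "random_variable borel Y'" for n Y Y'
	proof -
		have "H n (Y w) * H n (Y' w) = (c n)\<^sup>2 * (\<Sum>l\<in>UNIV. \<Sum>l'\<in>UNIV. s l * s l' * (?a n l (Y w) * ?a n l' (Y' w)))" for w
		proof -
			have "H n (Y w) * H n (Y' w) = (c n)\<^sup>2 * ((\<Sum>l\<in>UNIV. s l * ?a n l (Y w)) * (\<Sum>l\<in>UNIV. s l * ?a n l (Y' w)))"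
				unfolding H_def by (simp add: power2_eq_square mult_ac)
			also have "(\<Sum>l\<in>UNIV. s l * ?a n l (Y w)) * (\<Sum>l\<in>UNIV. s l * ?a n l (Y' w)) = (\<Sum>l\<in>UNIV. \<Sum>l'\<in>UNIV. s l * s l' * (?a n l (Y w) * ?a n l' (Y' w)))"
				unfolding sum_product by (intro sum.cong refl) (simp add: mult_ac)
			finally show ?thesis .
		qed
		then show ?thesis
			by (simp only: integral_mult_right_zero Bochner_Integration.integral_sum Bochner_Integration.integrable_sum integrable_mult_right[OF iaa[OF that]])
	qed
	have mom: "\<bar>expectation (%w. ?a n l (Xc (tau n) i w) * ?a n l' (Xc (tau n) j w)) - x l * x l' * expectation (%w. f0 (h n) (x l) (Xc (tau n) i w) * f0 (h n) (x l') (Xc (tau n) j w))\<bar> <= R n l l'" for n l l' i j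
		unfolding R_def Vc[of n l i, symmetric] Vc[of n l' j, symmetric] by (rule fn_f0_moment[OF h x(2) x(2) Xc_meas Xc_meas nnc nnc])
	define lg where "lg n = (c n)\<^sup>2 * (\<Sum>l\<in>UNIV. \<Sum>l'\<in>UNIV. \<bar>s l * s l'\<bar> * (x l * x l' * LG n + R n l l'))" for n
	have lag: "\<bar>expectation (%w. H n (Xc (tau n) i w) * H n (Xc (tau n) j w))\<bar> <= lg n" if "i < j" for n i j
	proof -
		have "\<bar>expectation (%w. ?a n l (Xc (tau n) i w) * ?a n l' (Xc (tau n) j w))\<bar> <= x l * x l' * LG n + R n l l'" for l l'
		proof -
			have "\<bar>x l * x l' * expectation (%w. f0 (h n) (x l) (Xc (tau n) i w) * f0 (h n) (x l') (Xc (tau n) j w))\<bar> <= x l * x l' * LG n"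
				unfolding abs_mult[of "x l * x l'"] LG_def using f0_lag[OF h tau(1) that] x(2)[of l] x(2)[of l'] by (intro mult_mono) auto
			then show ?thesis using mom[of n l i l' j] by linarith
		qed
		then have t: "\<bar>s l * s l' * expectation (%w. ?a n l (Xc (tau n) i w) * ?a n l' (Xc (tau n) j w))\<bar> <= \<bar>s l * s l'\<bar> * (x l * x l' * LG n + R n l l')" for l l'
			unfolding abs_mult[of "s l * s l'"] by (intro mult_left_mono) auto
		show ?thesis unfolding EHH[OF Xc_meas Xc_meas] lg_def abs_mult[of "(c n)\<^sup>2"] abs_power2
			by (intro mult_left_mono order_trans[OF sum_abs] sum_mono t) auto
	qed
	have lgl: "lg \<longlonglongrightarrow> 0"
	proof -
		have "lg \<longlonglongrightarrow> c0\<^sup>2 * (\<Sum>l\<in>UNIV. \<Sum>l'\<in>UNIV. \<bar>s l * s l'\<bar> * (x l * x l' * 0 + 0))" unfolding lg_def by (intro tendsto_intros c LGl Rl)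
		then show ?thesis by simp
	qed
	have s2: "(%n. expectation (%w. (H n (X0 w))\<^sup>2)) \<longlonglongrightarrow> c0\<^sup>2 * (\<Sum>l\<in>UNIV. (s l)\<^sup>2 * ((x l)\<^sup>2 * Vf (x l)))"
	proof -
		have one: "(%n. expectation (%w. ?a n l (X0 w) * ?a n l' (X0 w))) \<longlonglongrightarrow> (if l' = l then (x l)\<^sup>2 * Vf (x l) else 0)" for l l'
		proof -
			have d: "(%n. expectation (%w. ?a n l (X0 w) * ?a n l' (X0 w)) - x l * x l' * expectation (%w. f0 (h n) (x l) (X0 w) * f0 (h n) (x l') (X0 w))) \<longlonglongrightarrow> 0"
				by (rule Lim_null_comparison[OF _ Rl[of l l']]) (use fn_f0_moment[OF h x(2) x(2) rv(1) rv(1) X0_nonneg X0_nonneg] in \<open>simp add: R_def V_def\<close>)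
			have f: "(%n. expectation (%w. f0 (h n) (x l) (X0 w) * f0 (h n) (x l') (X0 w))) \<longlonglongrightarrow> (if l' = l then Vf (x l) else 0)"
				using Vl[of l] f0_cross_tendsto[OF h h0, of "x l" "x l'"] x(1) by (auto simp: V_def power2_eq_square inj_eq)
			show ?thesis using tendsto_add[OF d tendsto_mult_left[OF f, of "x l * x l'"]] by (auto simp: power2_eq_square split: if_splits)
		qed
		have "(%n. (c n)\<^sup>2 * (\<Sum>l\<in>UNIV. \<Sum>l'\<in>UNIV. s l * s l' * expectation (%w. ?a n l (X0 w) * ?a n l' (X0 w))))
			 \<longlonglongrightarrow> c0\<^sup>2 * (\<Sum>l\<in>UNIV. \<Sum>l'\<in>UNIV. s l * s l' * (if l' = l then (x l)\<^sup>2 * Vf (x l) else 0))" by (intro tendsto_intros c one)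
		moreover have "(\<Sum>l'\<in>UNIV. s l * s l' * (if l' = l then (x l)\<^sup>2 * Vf (x l) else 0)) = (s l)\<^sup>2 * ((x l)\<^sup>2 * Vf (x l))" for l
			by (simp add: if_distrib power2_eq_square cong: if_cong)
		ultimately show ?thesis unfolding power2_eq_square[of "H _ _"] EHH[OF rv(1) rv(1)] by (simp only:)
	qed
	have mean: "expectation (%w. H n (X0 w)) = 0" for n
	proof -
		have "expectation (%w. ?a n l (X0 w)) = expectation (%w. fn (h n) (x l) (X0 w))" for l
			using X0_nonneg by (intro integral_cong_AE) (auto elim!: eventually_mono simp: max_def)
		then have "expectation (%w. ?a n l (X0 w)) = 0" for l using fn_mean[OF h(1)] by simp
		then show ?thesis unfolding H_def using ia by simp
	qed
	define S where "S = (\<Sum>l\<in>UNIV. \<bar>s l\<bar>)"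
	define b where "b n = \<bar>c n\<bar> * (\<Sum>l\<in>UNIV. \<bar>s l\<bar> * ((x l * Cg + Ce) / sqrt (h n)))" for n
	define \<Lambda> where "\<Lambda> n = \<bar>c n\<bar> * (S * (CL / (h n)\<^sup>2))" for n
	have Hb: "\<bar>H n y\<bar> <= b n" for n y
	proof -
		have t: "\<bar>s l * ?a n l y\<bar> <= \<bar>s l\<bar> * ((x l * Cg + Ce) / sqrt (h n))" for l unfolding abs_mult by (intro mult_left_mono ab) simp
		show ?thesis unfolding H_def b_def abs_mult[of "c n"] by (intro mult_left_mono order_trans[OF sum_abs] sum_mono t) simp
	qed
	have Hl: "\<bar>H n y - H n z\<bar> <= \<Lambda> n * \<bar>y - z\<bar> * (1 + \<bar>z\<bar>)" for n y z
	proof -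
		have "\<bar>?a n l y - ?a n l z\<bar> <= CL / (h n)\<^sup>2 * (\<bar>y - z\<bar> * (1 + \<bar>z\<bar>))" for l
		proof -
			have "\<bar>?a n l y - ?a n l z\<bar> <= CL / (h n)\<^sup>2 * \<bar>max y 0 - max z 0\<bar> * (1 + \<bar>max z 0\<bar>)"
				using fn_growth[OF h, of n "x l" "max y 0 - max z 0" "max z 0"] by simp
			also have "... <= CL / (h n)\<^sup>2 * \<bar>y - z\<bar> * (1 + \<bar>z\<bar>)"
				using CW_nonneg Ck_nonneg by (intro mult_mono) (auto simp: CL_def max_def abs_if intro!: mult_nonneg_nonneg divide_nonneg_nonneg)
			finally show ?thesis by (simp only: mult.assoc)
		qed
		then have t: "\<bar>s l * (?a n l y - ?a n l z)\<bar> <= \<bar>s l\<bar> * (CL / (h n)\<^sup>2 * (\<bar>y - z\<bar> * (1 + \<bar>z\<bar>)))" for l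
			unfolding abs_mult[of "s l"] by (intro mult_left_mono) auto
		have "H n y - H n z = c n * (\<Sum>l\<in>UNIV. s l * (?a n l y - ?a n l z))"
			unfolding H_def by (simp add: right_diff_distrib sum_subtractf)
		then have "\<bar>H n y - H n z\<bar> <= \<bar>c n\<bar> * (\<Sum>l\<in>UNIV. \<bar>s l\<bar> * (CL / (h n)\<^sup>2 * (\<bar>y - z\<bar> * (1 + \<bar>z\<bar>))))"
			by (simp only: abs_mult[of "c n"]) (intro mult_left_mono order_trans[OF sum_abs] sum_mono t; simp)
		also have "... = \<Lambda> n * \<bar>y - z\<bar> * (1 + \<bar>z\<bar>)" unfolding \<Lambda>_def S_def sum_distrib_right[symmetric] by (simp only: mult.assoc)
		finally show ?thesis .
	qed
	have bl: "(%n. b n / sqrt (real n)) \<longlonglongrightarrow> 0"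
	proof -
		have "(%n. \<bar>c n\<bar> * (\<Sum>l\<in>UNIV. \<bar>s l\<bar> * (x l * Cg + Ce)) * (1 / sqrt (real n * h n))) \<longlonglongrightarrow> \<bar>c0\<bar> * (\<Sum>l\<in>UNIV. \<bar>s l\<bar> * (x l * Cg + Ce)) * 0" by (intro tendsto_intros c nh)
		moreover have "\<bar>c n\<bar> * (\<Sum>l\<in>UNIV. \<bar>s l\<bar> * (x l * Cg + Ce)) * (1 / sqrt (real n * h n)) = b n / sqrt (real n)" for n
		proof -
			have "(\<Sum>l\<in>UNIV. \<bar>s l\<bar> * ((x l * Cg + Ce) / sqrt (h n))) = (\<Sum>l\<in>UNIV. \<bar>s l\<bar> * (x l * Cg + Ce)) / sqrt (h n)" by (simp add: sum_divide_distrib)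
			then show ?thesis unfolding b_def by (simp add: real_sqrt_mult mult.commute)
		qed
		ultimately show ?thesis by simp
	qed
	have \<Lambda>l: "(%n. sqrt (real n) * (\<Lambda> n * exp (- tau n) ^ q)) \<longlonglongrightarrow> 0"
	proof -
		have "(%n. \<bar>c n\<bar> * (S * CL) * (sqrt (real n) * (1 / (h n)\<^sup>2 * exp (- tau n) ^ q))) \<longlonglongrightarrow> \<bar>c0\<bar> * (S * CL) * 0" by (intro tendsto_intros c sm)
		then show ?thesis by (simp add: \<Lambda>_def mult_ac)
	qed
	have "(%n. CLINT w|M. iexp ((1 / sqrt (real n)) * (\<Sum>j=1..n. H n (Xc (tau n) j w)))) \<longlonglongrightarrow> cplx (exp (- (c0\<^sup>2 * (\<Sum>l\<in>UNIV. (s l)\<^sup>2 * ((x l)\<^sup>2 * Vf (x l)))) / 2))"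
		by (rule array_clt[OF tau(1) q Hm _ mean s2 lgl bl \<Lambda>l]) (use Hb Hl lag in auto)
	then show ?thesis unfolding H_def .
qed

end

section \<open>Rates of the bandwidth and the normalisation\<close>

lemma bandwidth_facts:
	fixes h :: "nat => real"
	assumes pos: "!!n. h n > 0" and \<alpha>: "2 < \<alpha>" and r: "r > 1/2" and \<delta>: "0 < \<delta>" "\<delta> < 1/12"
		and lo: "(%n. ((ln (real n)) ^ 5 / real n) powr (1 / (2 + 2 * \<alpha> - \<delta>)) / h n) \<longlonglongrightarrow> 0"
		and up: "(%n. h n / (1 / (real n * ln (real n))) powr (1 / (1 + 2 * r + 2 * \<alpha> - \<delta>))) \<longlonglongrightarrow> 0"
	shows "h \<longlonglongrightarrow> 0"
		and "eventually (%n. (ln (real n)) ^ 5 <= real n * h n powr (2 + 2 * \<alpha> - \<delta>)) sequentially"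
		and "eventually (%n. real n * h n powr (1 + 2 * r + 2 * \<alpha> - \<delta>) <= 1 / ln (real n)) sequentially"
		and "eventually (%n. 1 / h n <= real n) sequentially"
proof -
	\<comment> \<open>Raising the two rate conditions to these powers turns them into inequalities for
	  \<open>n * h powr e\<close> and \<open>n * h powr e'\<close>.\<close>
	define e e' where "e = 2 + 2 * \<alpha> - \<delta>" "e' = 1 + 2 * r + 2 * \<alpha> - \<delta>"
	have e: "1 < e" "0 < e'" using \<alpha> r \<delta> by (auto simp: e_e'_def)
	define b where "b n = (1 / (real n * ln (real n))) powr (1 / e')" for n
	have n3: "eventually (%n. n >= (3::nat)) sequentially" by (rule eventually_ge_at_top)
	have ln1: "1 < ln (real n)" if "n >= 3" for n
	proof -
		have "exp 1 < real n" using that e_less_272 by simp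
		then show ?thesis using ln_less_cancel_iff[of "exp 1" "real n"] that by simp
	qed
	have hb: "eventually (%n. h n <= b n \<and> n >= 3) sequentially"
		using order_tendstoD(2)[OF up zero_less_one] n3
	proof eventually_elim
		case (elim n)
		have "0 < b n" using elim ln1[OF elim(2)] by (simp add: b_def)
		then show ?case using elim by (simp add: b_def e_e'_def pos_divide_less_eq)
	qed
	have b0: "b \<longlonglongrightarrow> 0" unfolding b_def
	proof (rule tendsto_zero_powrI[OF _ tendsto_const])
		show "(%n. 1 / (real n * ln (real n))) \<longlonglongrightarrow> 0" by real_asymp
		show "eventually (%n. 0 <= 1 / (real n * ln (real n))) sequentially" using n3
		proof eventually_elim
			case (elim n) show ?case using ln1[OF elim] by simp
		qed
	qed (use e in auto)
	show h0: "h \<longlonglongrightarrow> 0"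
		by (rule tendsto_sandwich[OF _ _ tendsto_const b0]) (use pos hb in \<open>auto intro: less_imp_le elim!: eventually_mono\<close>)
	have L: "eventually (%n. (ln (real n)) ^ 5 <= real n * h n powr e) sequentially"
		using order_tendstoD(2)[OF lo zero_less_one] n3
	proof eventually_elim
		case (elim n)
		have l: "1 < ln (real n)" by (rule ln1[OF elim(2)])
		have p: "0 < (ln (real n)) ^ 5 / real n" using l elim by simp
		have "((ln (real n)) ^ 5 / real n) powr (1 / e) <= h n" using elim pos[of n] by (simp add: e_e'_def pos_divide_less_eq)
		then have "(((ln (real n)) ^ 5 / real n) powr (1 / e)) powr e <= h n powr e" using e by (intro powr_mono2) auto
		moreover have "(y powr (1 / e)) powr e = y" if "y > 0" for y :: real using that e by (simp add: powr_powr)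
		ultimately have "(ln (real n)) ^ 5 / real n <= h n powr e" using p by (simp only:)
		then show ?case using elim by (simp add: pos_divide_le_eq mult.commute)
	qed
	then show "eventually (%n. (ln (real n)) ^ 5 <= real n * h n powr (2 + 2 * \<alpha> - \<delta>)) sequentially" by (simp add: e_e'_def)
	have "eventually (%n. real n * h n powr e' <= 1 / ln (real n)) sequentially" using hb
	proof eventually_elim
		case (elim n)
		have l: "1 < ln (real n)" using ln1 elim by simp
		have "h n powr e' <= b n powr e'" using elim e pos[of n] by (intro powr_mono2) auto
		also have "... = 1 / (real n * ln (real n))" unfolding b_def using e l elim by (simp add: powr_powr)
		finally have "real n * h n powr e' <= real n * (1 / (real n * ln (real n)))" by (intro mult_left_mono) auto
		then show ?case using elim by simp
	qed
	then show "eventually (%n. real n * h n powr (1 + 2 * r + 2 * \<alpha> - \<delta>) <= 1 / ln (real n)) sequentially" by (simp add: e_e'_def)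
	show "eventually (%n. 1 / h n <= real n) sequentially" using L n3 order_tendstoD(2)[OF h0 zero_less_one]
	proof eventually_elim
		case (elim n)
		have "1 <= (ln (real n)) ^ 5" using ln1[OF elim(2)] by (intro one_le_power) auto
		also have "... <= real n * h n powr e" by (rule elim(1))
		\<comment> \<open>Here \<open>h < 1\<close> and \<open>e > 1\<close>, so lowering the exponent to
		  1 increases the power.\<close>
		also have "... <= real n * h n powr 1" using elim(3) pos[of n] e by (intro mult_left_mono powr_mono') auto
		finally show ?case using pos[of n] by (simp add: pos_divide_le_eq)
	qed
qed

context ou_stat
begin

lemma md_lower_power: "b > \<alpha> ==> \<exists>c>0. eventually (%t. c * t powr (- b) <= md t) at_top"
	using alpha2 by (intro potter_lower[OF md_pos md_dec md_ratio2]) auto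

lemma md_upper_power: assumes "0 <= a" "a < \<alpha>" shows "\<exists>C\<ge>0. \<forall>h>0. md (1 / h) <= C * h powr a"
proof -
	from potter_upper[OF md_pos md_dec md_ratio2 assms] obtain C where C: "C >= 1" "!!s t. 0 <= s ==> s <= t ==> md t <= C * ((1 + s) / (1 + t)) powr a * md s" by blast
	have "md (1 / h) <= C * h powr a" if h: "h > 0" for h
	proof -
		have "md (1 / h) <= C * (1 / (1 + 1 / h)) powr a" using C(2)[of 0 "1 / h"] h by (simp add: md_def)
		also have "... <= C * h powr a"
		proof (intro mult_left_mono powr_mono2)
			have "1 <= h * (1 + 1 / h)" using h by (simp add: distrib_left)
			then show "1 / (1 + 1 / h) <= h" using h by (subst pos_divide_le_eq) (auto intro: add_pos_pos)
		qed (use h C assms in auto)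
		finally show ?thesis .
	qed
	then show ?thesis using C(1) by (intro exI[of _ C]) auto
qed

text \<open>\<open>ksharp k x\<close> equals \<open>k x + k (- x)\<close> except at 0, where the sum
  counts the value twice; a null set.\<close>

lemma ft_ksharp: "integrable lborel (ksharp k)" "ft (ksharp k) t = phik t + phik (- t)"
proof -
	have i1: "integrable lborel k" by (rule k_integrable)
	have i2: "integrable lborel (%x. k (- x))" using lborel_integrable_real_affine[OF i1, of "-1" 0] by simp
	have [measurable]: "ksharp k \<in> borel_measurable borel" unfolding ksharp_def[abs_def] by measurable
	have ae: "AE x in lborel. ksharp k x = k x + k (- x)" using AE_lborel_singleton[of "0::real"]
		by eventually_elim (auto simp: ksharp_def k_eq abs_if)
	show "integrable lborel (ksharp k)" using integrable_cong_AE[OF _ _ ae] Bochner_Integration.integrable_add[OF i1 i2] by simp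
	have j1: "integrable lborel (%x. iexp (t * x) * cplx (k x))" for t
		by (rule Bochner_Integration.integrable_bound[OF i1]) (auto simp: norm_mult)
	have j2: "integrable lborel (%x. iexp (t * x) * cplx (k (- x)))"
		by (rule Bochner_Integration.integrable_bound[OF i2]) (auto simp: norm_mult)
	have "ft (ksharp k) t = (CLINT x|lborel. iexp (t * x) * cplx (k x) + iexp (t * x) * cplx (k (- x)))"
		unfolding ft_def using ae by (intro integral_cong_AE) (auto elim!: eventually_mono simp: distrib_left)
	also have "... = phik t + (CLINT x|lborel. iexp (t * x) * cplx (k (- x)))"
		unfolding phi_k_eq by (rule Bochner_Integration.integral_add[OF j1 j2])
	also have "(CLINT x|lborel. iexp (t * x) * cplx (k (- x))) = phik (- t)"
		unfolding phi_k_eq using lborel_integral_real_affine[of "-1" "%x. iexp (- t * x) * cplx (k x)" 0] by simp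
	finally show "ft (ksharp k) t = phik t + phik (- t)" .
qed

end

lemma khat_measurable:
	assumes [measurable]: "!!j. Y j \<in> borel_measurable M" "ft W \<in> borel_measurable borel"
	shows "(%w. khat W h \<theta> (%j. Y j w) n x) \<in> borel_measurable M"
	unfolding khat_def dphi_sharp_hat_def phi_sharp_hat_def dphi_hat_def phi_hat_def by measurable

lemma ou_X_measurable:
	assumes [measurable]: "X0 \<in> borel_measurable M" "!!i. E i \<in> borel_measurable M" "!!i. U i \<in> borel_measurable M"
	shows "ou_X lam X0 E U t \<in> borel_measurable M"
	unfolding ou_X_def[abs_def] jump_time_def by measurable

section \<open>Bias and comparison of characteristic functions\<close>

context ou_kernel
begin

text \<open>The term defined in the frequency domain is a convolution with the rescaled kernel, the
  form to which \<open>kernel_bias\<close> applies.\<close>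

lemma bt_eq:
	assumes W: "integrable lborel W" and c: "continuous_on UNIV (ksharp k)" and h: "h > 0"
	shows "bt W h x = (\<integral>z. ksharp k (x - h * z) * W z \<partial>lborel)"
proof -
	have "integrable lborel (%t. ft (ksharp k) t * ft W (t * h))" unfolding ft_ksharp(2)
	proof (rule integrable_bounded_support(1)[where R="1 / h" and C="(Ck + Ck) * CW"])
		show "norm ((phik t + phik (- t)) * ft W (t * h)) <= (Ck + Ck) * CW" for t
			unfolding norm_mult using W_b phik_le[of t] phik_le[of "- t"] Ck_nonneg
			by (intro mult_mono order_trans[OF norm_triangle_ineq]) auto
		show "(phik t + phik (- t)) * ft W (t * h) = 0" if "\<bar>t\<bar> > 1 / h" for t
		proof -
			have "\<bar>t * h\<bar> > 1" using that h by (simp add: abs_mult field_simps)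
			then show ?thesis using W_supp by simp
		qed
	qed measurable
	moreover have "\<bar>ksharp k y\<bar> <= \<alpha>" for y using k_nonneg k_bound by (simp add: ksharp_def)
	ultimately have "cplx (\<integral>z. ksharp k (x - h * z) * W z \<partial>lborel) = 1 / (2 * cplx pi) * (CLINT t|lborel. iexp (- (t * x)) * (ft (ksharp k) t * ft W (t * h)))"
		using ft_convolution[OF ft_ksharp(1) _ c W] by blast
	then show ?thesis unfolding bt_def ft_ksharp(2) by (metis Re_complex_of_real)
qed

text \<open>The two exponentials differ by at most 2 anyway. This is used when some observation
  exceeds \<open>\<theta>\<close>, and when \<open>JD\<close> exceeds
  \<open>(md (1 / h))^2 / 4\<close>, so that the empirical function may come too close to 0; the
  latter is charged as in Markov's inequality, hence the factor 8 = 2 * 4. Otherwise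
  \<open>khat_decomp\<close> and the Lipschitz bound for \<open>iexp\<close> apply. One random
  variable \<open>?B\<close> dominates in all cases.\<close>

lemma char_approx:
	fixes x s kx :: "'l::finite => real" and c \<theta> \<beta> :: real
	assumes h: "0 < h" "h <= 1" and n: "n >= 1" and tau: "tau > 0"
		and small: "real n * ((1 + Ck) * (1 + 1 / h) * exp (- tau) ^ q) <= 1"
		and bias: "!!l. \<bar>bt W h (x l) - kx l\<bar> <= \<beta>"
	defines "K \<equiv> sqrt (real n * h) * md (1 / h) * c" and "S \<equiv> (\<Sum>l\<in>UNIV. \<bar>s l\<bar>)"
	shows "cmod ((CLINT w|M. iexp (K * (\<Sum>l\<in>UNIV. s l * (khat W h \<theta> (path tau w) n (x l) - kx l))))
			- (CLINT w|M. iexp ((1 / sqrt (real n)) * (\<Sum>j=1..n. c * (\<Sum>l\<in>UNIV. s l * fn h (x l) (max (Xc tau j w) 0))))))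
		<= 2 * real n * prob {w\<in>space M. \<theta> < \<bar>X0 w\<bar>} + 8 * (4 * KM q / (real n * h * (md (1 / h))\<^sup>2))
			+ \<bar>K\<bar> * S * (CW * (4 * KM q / (real n * h * (md (1 / h))\<^sup>2)) + \<beta>)"
proof -
	define T where "T = 1 / h"
	have T0: "0 <= T" using h by (simp add: T_def)
	note Jx = J_expectation[OF tau n T0 small[folded T_def]]
	let ?U = "%w. K * (\<Sum>l\<in>UNIV. s l * (khat W h \<theta> (path tau w) n (x l) - kx l))"
	let ?V = "%w. (1 / sqrt (real n)) * (\<Sum>j=1..n. c * (\<Sum>l\<in>UNIV. s l * fn h (x l) (max (Xc tau j w) 0)))"
	have [measurable]: "(%w. khat W h \<theta> (path tau w) n (x l)) \<in> borel_measurable M" for l by (rule khat_measurable) auto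
	note [measurable] = fn_meas[OF h(1)]
	have Um: "random_variable borel ?U" "random_variable borel ?V" by measurable
	define md2 where "md2 = (md T)\<^sup>2"
	have m0: "0 < md2" using md_pos[of T] by (simp add: md2_def)
	have J0: "0 <= JD obs n T" "0 <= JN obs n T" for obs unfolding JD_def JN_def by (intro Bochner_Integration.integral_nonneg; simp)+
	have S0: "0 <= S" unfolding S_def by (simp add: sum_nonneg)
	have \<beta>0: "0 <= \<beta>" using order_trans[OF abs_ge_zero bias] .
	let ?A = "%y. indicator {y. \<theta> < \<bar>y\<bar>} y :: real"
	let ?B = "%w. 2 * (\<Sum>j=1..n. ?A (Xc tau j w)) + 8 * (JD (path tau w) n T / md2) + \<bar>K\<bar> * S * (CW * (JN (path tau w) n T / md2) + \<beta>)"
	have iA: "integrable M (%w. ?A (Y w))" if [measurable]: "random_variable borel Y" for Y by (rule integrable_bounded_rv[of _ 1]) (auto simp: indicator_def)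
	have iB: "integrable M ?B" using Jx(1,3) iA by auto
	have EA: "expectation (%w. ?A (Xc tau j w)) = prob {w\<in>space M. \<theta> < \<bar>X0 w\<bar>}" for j
	proof -
		have "expectation (%w. ?A (Xc tau j w)) = expectation (%w. ?A (X0 w))" by (rule E_Xc(1)[OF tau]) measurable
		also have "... = expectation (indicator {w\<in>space M. \<theta> < \<bar>X0 w\<bar>})" by (intro Bochner_Integration.integral_cong refl) (auto simp: indicator_def)
		also have "... = prob {w\<in>space M. \<theta> < \<bar>X0 w\<bar>}" by simp
		finally show ?thesis .
	qed
	have pt: "AE w in M. cmod (iexp (?U w) - iexp (?V w)) <= ?B w"
		using AE_Xc_nonneg[of tau]
	proof eventually_elim
		case (elim w)
		let ?o = "path tau w"
		have two: "cmod (iexp (?U w) - iexp (?V w)) <= 2" using norm_triangle_ineq4[of "iexp (?U w)" "iexp (?V w)"] unfolding norm_exp_i_times by simp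
		have p1: "0 <= (\<Sum>j=1..n. ?A (?o j))" by (rule sum_nonneg) simp
		have p2: "0 <= JD ?o n T / md2" "0 <= JN ?o n T / md2" using J0 m0 by (auto intro!: divide_nonneg_pos)
		have p3: "0 <= \<bar>K\<bar> * S * (CW * (JN ?o n T / md2) + \<beta>)" using p2 S0 CW_nonneg \<beta>0 by (intro mult_nonneg_nonneg add_nonneg_nonneg) auto
		show ?case
		proof (cases "\<exists>j\<in>{1..n}. \<theta> < \<bar>?o j\<bar>")
			case True
			then obtain j where j: "j \<in> {1..n}" "\<theta> < \<bar>?o j\<bar>" by blast
			have "?A (?o j) <= (\<Sum>j=1..n. ?A (?o j))" using j by (intro member_le_sum) auto
			then have "1 <= (\<Sum>j=1..n. ?A (?o j))" using j by simp
			then show ?thesis using two p2 p3 by linarith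
		next
			case F1: False
			show ?thesis
			proof (cases "JD ?o n T / md2 <= 1 / 4")
				case False
				then show ?thesis using two p1 p3 by linarith
			next
				case True
				have near: "cmod (Dh ?o n t) <= md t / 2" if "\<bar>t\<bar> <= T" for t
				proof (rule power2_le_imp_le)
					have "(cmod (Dh ?o n t))\<^sup>2 <= JD ?o n T" by (rule sup_bound[OF n that])
					also have "... <= md2 / 4" using True m0 by (simp add: pos_divide_le_eq)
					also have "... <= (md t / 2)\<^sup>2" unfolding md2_def power_divide using md_dec_abs[of t T] that T0 md_pos[of T] by (auto intro!: divide_right_mono power_mono simp: less_imp_le)
					finally show "(cmod (Dh ?o n t))\<^sup>2 <= (md t / 2)\<^sup>2" .
					show "0 <= md t / 2" using md_pos[of t] by simp
				qed
				have dec: "\<bar>khat W h \<theta> ?o n (x l) - bt W h (x l) - (1 / real n) * (\<Sum>j=1..n. fl W h (x l) (?o j))\<bar> <= CW * JN ?o n T / md2" for l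
					unfolding md2_def by (rule khat_decomp[OF n h(1) T_def _ near ft_meas W_b W_supp]) (use F1 in \<open>auto simp: not_less\<close>)
				have Veq: "?V w = K * (\<Sum>l\<in>UNIV. s l * ((1 / real n) * (\<Sum>j=1..n. fl W h (x l) (?o j))))"
				proof -
					have f: "fn h (x l) (max (?o j) 0) = sqrt h * md (1 / h) * fl W h (x l) (?o j)" for j l using elim by (simp add: fn_def max_absorb1)
					have "?V w = (1 / sqrt (real n)) * (c * (\<Sum>l\<in>UNIV. s l * (\<Sum>j=1..n. sqrt h * md (1 / h) * fl W h (x l) (?o j))))"
						unfolding f sum_distrib_left[symmetric] by (subst sum.swap) (simp add: sum_distrib_left mult_ac)
					also have "... = (1 / sqrt (real n)) * (c * (sqrt h * md (1 / h))) * (\<Sum>l\<in>UNIV. s l * (\<Sum>j=1..n. fl W h (x l) (?o j)))"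
						unfolding sum_distrib_left[symmetric] by (simp add: sum_distrib_left mult_ac)
					also have "(1 / sqrt (real n)) * (c * (sqrt h * md (1 / h))) = K * (1 / real n)"
					proof -
						have "1 / sqrt (real n) = sqrt (real n) * (1 / real n)" using n by (simp add: real_div_sqrt field_simps)
						then show ?thesis unfolding K_def real_sqrt_mult by (simp add: mult_ac)
					qed
					finally show ?thesis by (simp add: sum_distrib_left mult_ac)
				qed
				have "?U w - ?V w = K * (\<Sum>l\<in>UNIV. s l * ((khat W h \<theta> ?o n (x l) - bt W h (x l) - (1 / real n) * (\<Sum>j=1..n. fl W h (x l) (?o j))) + (bt W h (x l) - kx l)))"
					unfolding Veq right_diff_distrib[symmetric] sum_subtractf[symmetric] by (simp add: algebra_simps)
				then have "\<bar>?U w - ?V w\<bar> <= \<bar>K\<bar> * (\<Sum>l\<in>UNIV. \<bar>s l\<bar> * (CW * JN ?o n T / md2 + \<beta>))"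
				proof (simp only: abs_mult[of K], intro mult_left_mono order_trans[OF sum_abs] sum_mono)
					fix l
					show "\<bar>s l * ((khat W h \<theta> ?o n (x l) - bt W h (x l) - (1 / real n) * (\<Sum>j=1..n. fl W h (x l) (?o j))) + (bt W h (x l) - kx l))\<bar> <= \<bar>s l\<bar> * (CW * JN ?o n T / md2 + \<beta>)"
						unfolding abs_mult[of "s l"] by (intro mult_left_mono order_trans[OF abs_triangle_ineq] add_mono dec bias) simp
				qed simp
				also have "... = \<bar>K\<bar> * S * (CW * (JN ?o n T / md2) + \<beta>)" unfolding S_def sum_distrib_right[symmetric] by simp
				finally have "\<bar>?U w - ?V w\<bar> <= \<bar>K\<bar> * S * (CW * (JN ?o n T / md2) + \<beta>)" .
				then show ?thesis using cmod_iexp_diff_le[of "?U w" "?V w"] p1 p2 by linarith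
			qed
		qed
	qed
	have iU: "integrable M (%w. iexp (?U w))" "integrable M (%w. iexp (?V w))"
		using integrable_iexp_rv[OF Um(1), of 1] integrable_iexp_rv[OF Um(2), of 1] by (simp_all only: mult_1)
	have e: "(CLINT w|M. iexp (?U w)) - (CLINT w|M. iexp (?V w)) = (CLINT w|M. iexp (?U w) - iexp (?V w))"
		by (rule Bochner_Integration.integral_diff[OF iU, symmetric])
	have "cmod (CLINT w|M. iexp (?U w) - iexp (?V w)) <= expectation (%w. cmod (iexp (?U w) - iexp (?V w)))" by (rule integral_norm_bound)
	also have "... <= expectation ?B"
		by (rule integral_mono_AE[OF integrable_norm[OF Bochner_Integration.integrable_diff[OF iU]] iB pt])
	also have "... = 2 * (real n * prob {w\<in>space M. \<theta> < \<bar>X0 w\<bar>}) + 8 * (expectation (%w. JD (path tau w) n T) / md2) + \<bar>K\<bar> * S * (CW * (expectation (%w. JN (path tau w) n T) / md2) + \<beta>)"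
	proof -
		have a: "expectation (%w. \<Sum>j=1..n. ?A (Xc tau j w)) = real n * prob {w\<in>space M. \<theta> < \<bar>X0 w\<bar>}"
			unfolding Bochner_Integration.integral_sum[OF iA[OF Xc_meas]] EA by simp
		have i: "integrable M (%w. \<Sum>j=1..n. ?A (Xc tau j w))" by (intro Bochner_Integration.integrable_sum iA Xc_meas)
		have l: "expectation (%w. 2 * X w + 8 * (Y w / md2) + \<bar>K\<bar> * S * (CW * (Z w / md2) + \<beta>)) = 2 * expectation X + 8 * (expectation Y / md2) + \<bar>K\<bar> * S * (CW * (expectation Z / md2) + \<beta>)"
			if "integrable M X" "integrable M Y" "integrable M Z" for X Y Z :: "'a => real" using that by (simp add: prob_space)
		show ?thesis unfolding l[OF i Jx(1,3)] a ..
	qed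
	also have "... <= 2 * real n * prob {w\<in>space M. \<theta> < \<bar>X0 w\<bar>} + 8 * (4 * KM q / (real n * h * md2)) + \<bar>K\<bar> * S * (CW * (4 * KM q / (real n * h * md2)) + \<beta>)"
	proof -
		have q: "E / md2 <= 4 * KM q / (real n * h * md2)" if "E <= 2 * T * (2 * KM q / real n)" for E
			using divide_right_mono[OF that, of md2] m0 by (simp add: T_def mult_ac)
		show ?thesis using q[OF Jx(2)] q[OF Jx(4)] S0 CW_nonneg by (intro add_mono mult_left_mono) auto
	qed
	finally show ?thesis unfolding e md2_def T_def .
qed

end

text \<open>The ratio is a quotient of two functions with the same limit \<open>B\<close>, times a
  ratio of values of \<open>L\<close>, times the power of \<open>c\<close>.\<close>

lemma ratio_tendsto_of_slowly_varying:
	fixes m L :: "real => real"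
	assumes lim: "((%t. \<bar>t\<bar> powr \<alpha> * m t / L \<bar>t\<bar>) \<longlongrightarrow> B) at_infinity" and B: "B > 0" and sv: "slowly_varying L" and c: "c > 0"
	shows "((%t. m (c * t) / m t) \<longlongrightarrow> c powr (- \<alpha>)) at_top"
proof -
	define g where "g t = \<bar>t\<bar> powr \<alpha> * m t / L \<bar>t\<bar>" for t
	have g: "(g \<longlongrightarrow> B) at_top" unfolding g_def using tendsto_mono[OF at_top_le_at_infinity lim] .
	have ct: "filterlim (%t. c * t) at_top at_top" using c by (intro filterlim_tendsto_pos_mult_at_top[OF tendsto_const]) (auto intro: filterlim_ident)
	have gc: "((%t. g (c * t)) \<longlongrightarrow> B) at_top" by (rule filterlim_compose[OF g ct])
	have "((%t. g (c * t) / g t * (L (c * t) / L t) * c powr (- \<alpha>)) \<longlongrightarrow> B / B * 1 * c powr (- \<alpha>)) at_top"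
		using sv c B unfolding slowly_varying_def by (intro tendsto_intros g gc) auto
	moreover have "eventually (%t. g (c * t) / g t * (L (c * t) / L t) * c powr (- \<alpha>) = m (c * t) / m t) at_top"
		using order_tendstoD(1)[OF g B] order_tendstoD(1)[OF gc B] eventually_gt_at_top[of 0]
	proof eventually_elim
		case (elim t)
		\<comment> \<open>Division by 0 yields 0, so positivity of the quotient \<open>g\<close> forces
		  its numerator and denominator to be nonzero.\<close>
		have "L t ~= 0" "L (c * t) ~= 0" "m t ~= 0" using elim c by (auto simp: g_def)
		then show ?case using elim c by (simp add: g_def powr_mult powr_minus abs_mult field_simps)
	qed
	ultimately show ?thesis using B by (auto intro: Lim_transform_eventually)
qed

lemma kfun_measurable:
	assumes "finite_measure F" "sets F = sets borel"
	shows "kfun \<alpha> F \<in> borel_measurable borel"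
proof -
	interpret finite_measure F by fact
	have "mono (%x. - measure F {x<..})" by (rule monoI) (auto intro!: finite_measure_mono simp: assms(2))
	then have "(%x. - measure F {x<..}) \<in> borel_measurable borel" by (rule borel_measurable_mono)
	then have [measurable]: "(%x. measure F {x<..}) \<in> borel_measurable borel" by simp
	show ?thesis unfolding kfun_def[abs_def] by measurable
qed

lemma hoelder_continuous:
	fixes D :: "nat => real => real"
	assumes d: "!!j y. j < p ==> (D j has_real_derivative D (Suc j) y) (at y)"
		and hol: "!!y z. y ~= z ==> \<bar>D p y - D p z\<bar> <= C * \<bar>y - z\<bar> powr (r - real p)" and r: "real p < r"
	shows "continuous_on UNIV (D 0)"
proof (cases "p = 0")
	case False
	then show ?thesis using d[of 0] DERIV_isCont by (intro continuous_at_imp_continuous_on) blast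
next
	case True
	have "(D 0 \<longlongrightarrow> D 0 y) (at y)" for y
	proof (rule Lim_null[THEN iffD2], rule Lim_null_comparison)
		show "eventually (%z. norm (D 0 z - D 0 y) <= C * \<bar>z - y\<bar> powr r) (at y)"
			using hol[of _ y] True by (auto simp: eventually_at_filter)
		have "((%z. \<bar>z - y\<bar>) \<longlongrightarrow> \<bar>y - y\<bar>) (at y)" by (intro tendsto_intros)
		then have "((%z. \<bar>z - y\<bar> powr r) \<longlongrightarrow> 0) (at y)" using r True by (intro tendsto_zero_powrI[OF _ tendsto_const]) auto
		then show "((%z. C * \<bar>z - y\<bar> powr r) \<longlongrightarrow> 0) (at y)" by (rule tendsto_mult_right_zero)
	qed
	then show ?thesis by (simp add: continuous_on_def tendsto_at_within_iff_tendsto_nhds tendsto_within_subset)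
qed

lemma C1_bounded:
	assumes d: "!!u::real. (f has_vector_derivative f' u) (at u)" and c: "continuous_on UNIV f'" and supp: "!!u. \<bar>u\<bar> > 1 ==> f u = (0::complex)"
	shows "!!u. \<bar>u\<bar> > 1 ==> f' u = 0" "\<exists>B\<ge>0. \<forall>u. cmod (f' u) <= B"
proof -
	show z: "f' u = 0" if "\<bar>u\<bar> > 1" for u
	proof -
		have op: "open {u::real. 1 < \<bar>u\<bar>}" by (intro open_Collect_less continuous_intros)
		have "(f has_vector_derivative 0) (at u)"
			by (rule has_vector_derivative_transform_within_open[OF _ op, of "%_. 0"]) (use that supp in auto)
		then show ?thesis using d vector_derivative_unique_at by blast
	qed
	have "bounded (f' ` {-1..1})" by (intro compact_imp_bounded compact_continuous_image continuous_on_subset[OF c]) auto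
	then obtain B where B: "!!u. u \<in> {-1..1} ==> cmod (f' u) <= B" unfolding bounded_iff by blast
	have "0 <= B" using order_trans[OF norm_ge_zero B[of 0]] by simp
	moreover have "cmod (f' u) <= B" for u using B[of u] z[of u] \<open>0 <= B\<close> by (cases "\<bar>u\<bar> <= 1") (auto simp: abs_le_iff)
	ultimately show "\<exists>B\<ge>0. \<forall>u. cmod (f' u) <= B" by blast
qed

context ou_kernel
begin

text \<open>\<open>md (1 / h)\<close> is a power of \<open>h\<close> only up to a slowly varying
  factor, so each claim spends a little of the exponent. It is at least of order
  \<open>h powr (\<alpha> + 1/4)\<close>, and
  \<open>1 + 2 * (\<alpha> + 1/4) <= 2 + 2 * \<alpha> - \<delta>\<close> because
  \<open>\<delta> < 1/12\<close>. It is at most of order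
  \<open>h powr (\<alpha> - \<delta> / 2)\<close>, which matches the exponent in the upper rate
  exactly.\<close>

lemma rate_facts:
	assumes hp: "!!n. h n > 0" and r: "r > 1/2" and \<delta>: "0 < \<delta>" "\<delta> < 1/12"
		and lo: "(%n. ((ln (real n)) ^ 5 / real n) powr (1 / (2 + 2 * \<alpha> - \<delta>)) / h n) \<longlonglongrightarrow> 0"
		and up: "(%n. h n / (1 / (real n * ln (real n))) powr (1 / (1 + 2 * r + 2 * \<alpha> - \<delta>))) \<longlonglongrightarrow> 0"
	defines "G \<equiv> %n. sqrt (real n * h n) * md (1 / h n)"
	shows "filterlim G at_top sequentially" "(%n. G n * h n powr r) \<longlonglongrightarrow> 0"
proof -
	note bw = bandwidth_facts[OF hp alpha2 r \<delta> lo up]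
	have Ti: "filterlim (%n. 1 / h n) at_top sequentially" using filterlim_inverse_at_top[OF bw(1)] hp by (simp add: divide_inverse)
	have G0: "0 <= G n" for n unfolding G_def using hp[of n] md_pos[of "1 / h n"] by simp
	have G2: "(G n)\<^sup>2 = real n * h n * (md (1 / h n))\<^sup>2" for n unfolding G_def power_mult_distrib using hp[of n] by simp
	have pw: "h n * (h n powr a)\<^sup>2 = h n powr (1 + 2 * a)" for n a using hp[of n] by (simp add: powr_add power2_eq_square flip: powr_add) (simp add: powr_add)
	obtain c where c: "c > 0" "eventually (%t. c * t powr (- (\<alpha> + 1/4)) <= md t) at_top" using md_lower_power[of "\<alpha> + 1/4"] by auto
	have "eventually (%n. c * sqrt (ln (real n) ^ 5) <= G n) sequentially"
		using eventually_compose_filterlim[OF c(2) Ti] bw(2) order_tendstoD(2)[OF bw(1) zero_less_one] eventually_ge_at_top[of 1]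
	proof eventually_elim
		case (elim n)
		have m: "c * h n powr (\<alpha> + 1/4) <= md (1 / h n)"
		proof -
			have "(1 / h n) powr (- b) = h n powr b" for b using hp[of n] by (simp add: powr_divide powr_minus_divide)
			then show ?thesis using elim(1) by (simp only:)
		qed
		have "c\<^sup>2 * ln (real n) ^ 5 <= c\<^sup>2 * (real n * h n powr (2 + 2 * \<alpha> - \<delta>))" using elim(2) by (intro mult_left_mono) auto
		also have "... <= c\<^sup>2 * (real n * h n powr (1 + 2 * (\<alpha> + 1/4)))" using elim(3) hp[of n] \<delta> by (intro mult_left_mono powr_mono') auto
		also have "... = real n * h n * (c * h n powr (\<alpha> + 1/4))\<^sup>2" unfolding pw[symmetric] by (simp add: power_mult_distrib mult_ac)
		also have "... <= (G n)\<^sup>2" unfolding G2 using m c hp[of n] by (intro mult_left_mono power_mono) auto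
		finally have "sqrt (c\<^sup>2 * ln (real n) ^ 5) <= sqrt ((G n)\<^sup>2)" by (rule real_sqrt_le_mono)
		then show ?case using c G0[of n] by (simp add: real_sqrt_mult)
	qed
	moreover have "filterlim (%n. c * sqrt (ln (real n) ^ 5)) at_top sequentially"
	proof -
		have "filterlim (%n. sqrt (ln (real n) ^ 5)) at_top sequentially" by real_asymp
		then show ?thesis using c by (intro filterlim_tendsto_pos_mult_at_top[OF tendsto_const])
	qed
	ultimately show "filterlim G at_top sequentially" by (rule filterlim_at_top_mono[rotated])
	have a: "0 <= \<alpha> - \<delta> / 2" "\<alpha> - \<delta> / 2 < \<alpha>" using alpha2 \<delta> by auto
	obtain C where C: "C >= 0" "!!h. h > 0 ==> md (1 / h) <= C * h powr (\<alpha> - \<delta> / 2)" using md_upper_power[OF a] by blast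
	have "(%n. (G n * h n powr r)\<^sup>2) \<longlonglongrightarrow> 0"
	proof (rule Lim_null_comparison)
		show "eventually (%n. norm ((G n * h n powr r)\<^sup>2) <= C\<^sup>2 * (1 / ln (real n))) sequentially" using bw(3)
		proof eventually_elim
			case (elim n)
			have "(G n * h n powr r)\<^sup>2 = real n * h n * (md (1 / h n))\<^sup>2 * (h n powr r)\<^sup>2" by (simp add: power_mult_distrib G2)
			also have "... <= real n * h n * (C * h n powr (\<alpha> - \<delta> / 2))\<^sup>2 * (h n powr r)\<^sup>2"
				using C(2)[OF hp[of n]] md_pos[of "1 / h n"] hp[of n] by (intro mult_right_mono mult_left_mono power_mono) auto
			also have "... = C\<^sup>2 * (real n * (h n * (h n powr (\<alpha> - \<delta> / 2 + r))\<^sup>2))" by (simp add: power_mult_distrib powr_add mult_ac)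
			also have "... <= C\<^sup>2 * (1 / ln (real n))" unfolding pw using elim by (intro mult_left_mono) (auto simp: algebra_simps)
			finally show ?case by simp
		qed
		have "(%n. 1 / ln (real n)) \<longlonglongrightarrow> 0" by real_asymp
		then show "(%n. C\<^sup>2 * (1 / ln (real n))) \<longlonglongrightarrow> 0" by (rule tendsto_mult_right_zero)
	qed
	from tendsto_real_sqrt[OF this] show "(%n. G n * h n powr r) \<longlonglongrightarrow> 0" using tendsto_rabs_zero_cancel by (simp only: real_sqrt_abs real_sqrt_zero)
qed

text \<open>At a level of order \<open>sqrt n / (ln n)^3\<close> the cubic tail bound makes the
  product at most of order \<open>(ln n)^9 / sqrt n\<close>.\<close>

lemma tail_tendsto:
	assumes \<theta>: "(%n. \<theta> n / (sqrt (real n) * ln (real n) powr (-3))) \<longlonglongrightarrow> 1"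
	shows "(%n. real n * prob {w\<in>space M. \<theta> n < \<bar>X0 w\<bar>}) \<longlonglongrightarrow> 0"
proof (rule Lim_null_comparison)
	define t where "t n = sqrt (real n) * ln (real n) powr (-3) / 2" for n
	have "1 / 2 < (1::real)" by simp
	from order_tendstoD(1)[OF \<theta> this]
	show "eventually (%n. norm (real n * prob {w\<in>space M. \<theta> n < \<bar>X0 w\<bar>}) <= 2 * C3 * (real n * (9 / (4 * t n)) ^ 3)) sequentially"
		using eventually_ge_at_top[of 3]
	proof eventually_elim
		case (elim n)
		have "ln (real n) ~= 0" using elim by (simp add: ln_eq_zero_iff)
		then have t0: "0 < t n" using elim by (simp add: t_def)
		have "t n <= \<theta> n"
		proof -
			have "0 < sqrt (real n) * ln (real n) powr (-3)" using t0 by (simp add: t_def)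
			then show ?thesis using elim(1) by (simp add: t_def pos_less_divide_eq)
		qed
		then have "prob {w\<in>space M. \<theta> n < \<bar>X0 w\<bar>} <= prob {w\<in>space M. 9 / (4 * (9 / (4 * t n))) <= \<bar>X0 w\<bar>}"
			using t0 by (intro finite_measure_mono) auto
		also have "... <= 2 * C3 * (9 / (4 * t n)) ^ 3" using t0 by (intro X0_tail) auto
		finally have "real n * prob {w\<in>space M. \<theta> n < \<bar>X0 w\<bar>} <= real n * (2 * C3 * (9 / (4 * t n)) ^ 3)" by (intro mult_left_mono) auto
		then show ?case by (simp add: mult_ac)
	qed
	have "(%n. real n * (9 / (4 * t n)) ^ 3) \<longlonglongrightarrow> 0" unfolding t_def by real_asymp
	then show "(%n. 2 * C3 * (real n * (9 / (4 * t n)) ^ 3)) \<longlonglongrightarrow> 0" by (rule tendsto_mult_right_zero)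
qed

end

section \<open>Choice of constants and passage to the limit\<close>

theorem theorem1:
  fixes M :: "'s measure"
    and lam \<alpha> :: real
    and X0 :: "'s \<Rightarrow> real"
    and E U :: "nat \<Rightarrow> 's \<Rightarrow> real"
    and \<pi>d :: "real \<Rightarrow> real"
    and L :: "real \<Rightarrow> real" and B :: real
    and \<epsilon> r \<delta> :: real and p :: nat
    and W :: "real \<Rightarrow> real"
    and \<Delta> h \<theta> :: "nat \<Rightarrow> real"
    and x :: "'n::{finite,linorder} \<Rightarrow> real"
  defines "k \<equiv> kfun \<alpha> (distr M borel (U 0))"
  assumes M: "prob_space M"
    and lam: "lam > 0"
    and alpha_pos: "\<alpha> > 0"
    \<comment> \<open>X0, interarrival times E i ~ Exp(alpha), jumps U i iid positive; all independent\<close>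
    and indep: "prob_space.indep_vars M (\<lambda>_. borel)
                  (\<lambda>i. case i of Inl _ \<Rightarrow> X0 | Inr (Inl j) \<Rightarrow> E j | Inr (Inr j) \<Rightarrow> U j)
                  (UNIV :: (unit + (nat + nat)) set)"
    and E_exp: "\<And>i. distributed M lborel (E i) (\<lambda>y. ennreal (exponential_density \<alpha> y))"
    and U_iid: "\<And>i. distr M borel (U i) = distr M borel (U 0)"
    and U_pos: "\<And>i. AE \<omega> in M. U i \<omega> > 0"
    \<comment> \<open>stationarity: X0 has the stationary law, with continuous Lebesgue density \<pi>d\<close>
    and X0_char: "\<And>t. char (distr M borel X0) t = phi_stat k t"
    and X0_dens: "distributed M lborel X0 (\<lambda>y. ennreal (\<pi>d y))"
    and \<pi>d_nonneg: "\<And>y. \<pi>d y \<ge> 0"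
    and \<pi>d_cont: "continuous_on UNIV \<pi>d"
    \<comment> \<open>Assumption A (i)\<close>
    and eps: "\<epsilon> > 0"
    and A1: "set_integrable lborel {0..} (\<lambda>y. max 1 (\<bar>y\<bar> powr (2 + \<epsilon>)) * k y)"
    \<comment> \<open>(ii)\<close>
    and A2: "2 < \<alpha>"
    \<comment> \<open>(iii)\<close>
    and r: "r > 1/2" and p: "real p < r" "r \<le> real p + 1"
    and A3: "\<exists>D :: nat \<Rightarrow> real \<Rightarrow> real. D 0 = ksharp k \<and>
               (\<forall>j<p. \<forall>y. (D j has_real_derivative D (Suc j) y) (at y)) \<and>
               (\<exists>C. \<forall>y z. y \<noteq> z \<longrightarrow> \<bar>D p y - D p z\<bar> \<le> C * \<bar>y - z\<bar> powr (r - real p))"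
    \<comment> \<open>(iv)\<close>
    and A4: "\<exists>C d1 d2. \<forall>u. ((phi_k k) has_vector_derivative d1 u) (at u) \<and>
               (d1 has_vector_derivative d2 u) (at u) \<and>
               cmod (phi_k k u) \<le> C / (1 + \<bar>u\<bar>) \<and>
               cmod (d1 u) \<le> C / (1 + \<bar>u\<bar>)\<^sup>2 \<and> cmod (d2 u) \<le> C / (1 + \<bar>u\<bar>)\<^sup>2"
    \<comment> \<open>(v)\<close>
    and W_int: "integrable lborel W"
    and W_one: "(LINT y|lborel. W y) = 1"
    and W_mom: "integrable lborel (\<lambda>y. \<bar>y\<bar> ^ (p + 1) * \<bar>W y\<bar>)"
    and W_van: "\<And>l. l \<in> {1..p} \<Longrightarrow> (LINT y|lborel. y ^ l * W y) = 0"
    and W_supp: "\<And>u. \<bar>u\<bar> > 1 \<Longrightarrow> ft W u = 0"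
    and W_C3: "\<exists>w1 w2 w3. (\<forall>u. (ft W has_vector_derivative w1 u) (at u) \<and>
                 (w1 has_vector_derivative w2 u) (at u) \<and>
                 (w2 has_vector_derivative w3 u) (at u)) \<and> continuous_on UNIV w3"
    \<comment> \<open>(vi)\<close>
    and \<Delta>_pos: "\<And>n. \<Delta> n > 0"
    and \<Delta>_log: "\<exists>c>0. \<forall>\<^sub>F n in sequentially. \<Delta> n \<ge> c * ln (real n)"
    and \<Delta>_small: "filterlim (\<lambda>n. real n / \<Delta> n) at_top sequentially"
    and h_pos: "\<And>n. h n > 0"
    and \<delta>: "0 < \<delta>" "\<delta> < 1/12"
    and h_lower: "(\<lambda>n. ((ln (real n)) ^ 5 / real n) powr (1 / (2 + 2 * \<alpha> - \<delta>)) / h n)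
                    \<longlonglongrightarrow> 0"
    and h_upper: "(\<lambda>n. h n / (1 / (real n * ln (real n))) powr (1 / (1 + 2 * r + 2 * \<alpha> - \<delta>)))
                    \<longlonglongrightarrow> 0"
    \<comment> \<open>truncation levels\<close>
    and \<theta>: "(\<lambda>n. \<theta> n / (sqrt (real n) * ln (real n) powr (-3))) \<longlonglongrightarrow> 1"
    \<comment> \<open>slowly varying factor\<close>
    and L_nonneg: "\<And>t. t > 1 \<Longrightarrow> L t \<ge> 0"
    and L_sv: "slowly_varying L"
    and B_pos: "B > 0"
    and LB: "((\<lambda>t. \<bar>t\<bar> powr \<alpha> * cmod (phi_stat k t) / L \<bar>t\<bar>) \<longlongrightarrow> B) at_infinity"
    \<comment> \<open>evaluation points 0 < x_1 < ... < x_N\<close>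
    and x_mono: "strict_mono x"
    and x_pos: "\<And>l. x l > 0"
  shows "conv_distr M
           (\<lambda>n \<omega>. \<chi> l. sqrt (real n * h n) * h n powr \<alpha> * L (1 / h n) *
               (khat W (h n) (\<theta> n) (\<lambda>j. ou_X lam X0 E U (real j * \<Delta> n) \<omega>) n (x l)
                - ksharp k (x l)))
           (gauss_diag (\<lambda>l. (x l)\<^sup>2 * \<pi>d (x l) / (2 * pi * B\<^sup>2) *
               (LINT t|lborel. \<bar>t\<bar> powr (2 * \<alpha>) * (cmod (ft W t))\<^sup>2)))"
proof -
	interpret P: prob_space M by (rule M)
	let ?F = "distr M borel (U 0)"
	obtain Ck d1 d2 where A4': "!!u. ((phi_k k) has_vector_derivative d1 u) (at u)" "!!u. (d1 has_vector_derivative d2 u) (at u)"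
			"!!u. cmod (phi_k k u) <= Ck / (1 + \<bar>u\<bar>)" "!!u. cmod (d1 u) <= Ck / (1 + \<bar>u\<bar>)\<^sup>2" "!!u. cmod (d2 u) <= Ck / (1 + \<bar>u\<bar>)\<^sup>2"
		using A4 by blast
	obtain D CD where D: "D 0 = ksharp k" "!!j y. j < p ==> (D j has_real_derivative D (Suc j) y) (at y)"
			"!!y z. y ~= z ==> \<bar>D p y - D p z\<bar> <= CD * \<bar>y - z\<bar> powr (r - real p)"
		using A3 by blast
	obtain w1 w2 where w: "!!u. (ft W has_vector_derivative w1 u) (at u)" "!!u. (w1 has_vector_derivative w2 u) (at u)"
		using W_C3 by blast
	have w1c: "continuous_on UNIV w1"
		by (intro continuous_at_imp_continuous_on ballI) (use w(2) has_vector_derivative_continuous in blast)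
	obtain Bw where Bw: "Bw >= 0" "!!u. cmod (w1 u) <= Bw" using C1_bounded(2)[OF w(1) w1c W_supp] by blast
	\<comment> \<open>One constant has to bound both \<open>ft W\<close> and its derivative
	  \<open>w1\<close>.\<close>
	define CW where "CW = (LINT y|lborel. \<bar>W y\<bar>) + Bw"
	have W0: "0 <= (LINT y|lborel. \<bar>W y\<bar>)" by (rule Bochner_Integration.integral_nonneg) simp
	have Wb: "cmod (ft W u) <= CW" for u
	proof -
		have "cmod (ft W u) <= (LINT y|lborel. \<bar>W y\<bar>)" unfolding ft_def
			by (rule norm_integral_le) (use W_int in \<open>auto simp: norm_mult\<close>)
		then show ?thesis using Bw by (simp add: CW_def)
	qed
	have Fp: "prob_space ?F"
	proof -
		have "U 0 \<in> borel_measurable M"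
			using bspec[OF conjunct1[OF indep[unfolded P.indep_vars_def2]], of "Inr (Inr 0)"] by simp
		then show ?thesis by (intro P.prob_space_distr)
	qed
	interpret Fi: prob_space ?F by (rule Fp)
	have km[measurable]: "k \<in> borel_measurable borel" unfolding k_def by (rule kfun_measurable[OF Fi.finite_measure_axioms]) simp
	have kn: "0 <= k y" for y unfolding k_def kfun_def using alpha_pos by simp
	have k_int: "set_integrable lborel {0..} k"
		unfolding set_integrable_def
	proof (rule Bochner_Integration.integrable_bound[OF A1[unfolded set_integrable_def]])
		show "AE y in lborel. norm (indicator {0..} y *\<^sub>R k y) <= norm (indicator {0..} y *\<^sub>R (max 1 (\<bar>y\<bar> powr (2 + \<epsilon>)) * k y))"
		proof (rule AE_I2)
			fix y
			have "1 * k y <= max 1 (\<bar>y\<bar> powr (2 + \<epsilon>)) * k y" using kn by (intro mult_right_mono) auto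
			then show "norm (indicator {0..} y *\<^sub>R k y) <= norm (indicator {0..} y *\<^sub>R (max 1 (\<bar>y\<bar> powr (2 + \<epsilon>)) * k y))"
				using kn[of y] by (auto simp: indicator_def abs_mult)
		qed
	qed measurable
	have ratio: "((%t. cmod (phi_stat k (c * t)) / cmod (phi_stat k t)) \<longlongrightarrow> c powr (- \<alpha>)) at_top" if "c > 0" for c
		by (rule ratio_tendsto_of_slowly_varying[OF LB B_pos L_sv that])
	interpret K: ou_kernel M \<alpha> X0 E U ?F k d1 d2 Ck W w1 CW \<pi>d
	proof (intro ou_kernel.intro ou_stat.intro ou_process.intro ou_process_axioms.intro ou_stat_axioms.intro ou_kernel_axioms.intro)
		show "cmod (w1 u) <= CW" for u using Bw(2)[of u] W0 unfolding CW_def by linarith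
		show "w1 u = 0" if "\<bar>u\<bar> > 1" for u by (rule C1_bounded(1)[OF w(1) w1c W_supp that])
		show "k = kfun \<alpha> ?F" by (simp add: k_def)
	qed (fact M alpha_pos indep E_exp U_iid U_pos k_int X0_char A4' A2 ratio w(1) w1c Wb W_supp X0_dens \<pi>d_nonneg \<pi>d_cont)+
	note bw = bandwidth_facts[OF h_pos A2 r \<delta> h_lower h_upper]
	note rate = K.rate_facts[OF h_pos r \<delta> h_lower h_upper]
	define G where "G n = sqrt (real n * h n) * K.md (1 / h n)" for n
	have G: "filterlim G at_top sequentially" "(%n. G n * h n powr r) \<longlonglongrightarrow> 0" using rate unfolding G_def by auto
	have Gi: "(%n. 1 / G n) \<longlonglongrightarrow> 0" using tendsto_inverse_0_at_top[OF G(1)] by (simp add: divide_inverse)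
	have G0: "0 <= G n" for n unfolding G_def using h_pos[of n] K.md_pos[of "1 / h n"] by simp
	define tau where "tau n = lam * \<Delta> n" for n
	have tau: "tau n > 0" for n using lam \<Delta>_pos by (simp add: tau_def)
	\<comment> \<open>The prescribed normalisation relative to the intrinsic one. Its limit
	  \<open>1 / B\<close> is the limit relation defining \<open>B\<close>, read at
	  \<open>t = 1 / h\<close>; it is the source of the \<open>B^2\<close> in the limiting
	  variance.\<close>
	define c where "c n = h n powr \<alpha> * L (1 / h n) / K.md (1 / h n)" for n
	have Ti: "filterlim (%n. 1 / h n) at_top sequentially" using filterlim_inverse_at_top[OF bw(1)] h_pos by (simp add: divide_inverse)
	have c: "c \<longlonglongrightarrow> 1 / B"
	proof -
		have "(%n. \<bar>1 / h n\<bar> powr \<alpha> * cmod (phi_stat k (1 / h n)) / L \<bar>1 / h n\<bar>) \<longlonglongrightarrow> B"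
			by (rule filterlim_compose[OF LB filterlim_mono[OF Ti at_top_le_at_infinity order_refl]])
		from tendsto_inverse[OF this] have "(%n. inverse (\<bar>1 / h n\<bar> powr \<alpha> * cmod (phi_stat k (1 / h n)) / L \<bar>1 / h n\<bar>)) \<longlonglongrightarrow> inverse B" using B_pos by simp
		moreover have "inverse (\<bar>1 / h n\<bar> powr \<alpha> * cmod (phi_stat k (1 / h n)) / L \<bar>1 / h n\<bar>) = c n" for n
		proof -
			have e: "\<bar>1 / h n\<bar> powr \<alpha> = 1 / h n powr \<alpha>" "\<bar>1 / h n\<bar> = 1 / h n" using h_pos[of n] by (simp_all add: powr_divide)
			show ?thesis unfolding c_def K.md_def e(1) unfolding e(2) by simp
		qed
		ultimately show ?thesis by (simp add: divide_inverse)
	qed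
	obtain c1 where c1: "c1 > 0" "eventually (%n. \<Delta> n >= c1 * ln (real n)) sequentially" using \<Delta>_log by blast
	define a where "a = lam * c1"
	have a: "a > 0" using lam c1 by (simp add: a_def)
	have taul: "eventually (%n. a * ln (real n) <= tau n) sequentially" using c1(2)
		by eventually_elim (use lam in \<open>simp add: a_def tau_def mult.assoc\<close>)
	have lnt: "filterlim (%n. ln (real n)) at_top sequentially" by real_asymp
	have "filterlim (%n. a * ln (real n)) at_top sequentially" by (rule filterlim_tendsto_pos_mult_at_top[OF tendsto_const a lnt])
	then have "filterlim tau at_top sequentially" using taul by (rule filterlim_at_top_mono)
	then have tau0: "(%n. exp (- tau n)) \<longlonglongrightarrow> 0"
		by (intro filterlim_compose[OF exp_at_bot]) (simp add: filterlim_uminus_at_top[symmetric])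
	\<comment> \<open>Since \<open>tau n >= a * ln n\<close>, this makes
	  \<open>exp (- tau n) ^ q\<close> at most \<open>n^(-10)\<close>. The 10 is generous: with
	  \<open>1 / h <= n\<close>, the factors to be beaten are of order \<open>n^2\<close> in
	  \<open>small\<close> and \<open>n^(5/2)\<close> in \<open>sm\<close>.\<close>
	obtain q :: nat where q: "q >= 1" "real q * a >= 10"
	proof -
		obtain q0 :: nat where "10 / a < real q0" using reals_Archimedean2 by blast
		then have "10 <= real (Suc q0) * a" using a by (simp add: pos_divide_less_eq distrib_right)
		then show thesis using that[of "Suc q0"] by simp
	qed
	have \<rho>: "eventually (%n. exp (- tau n) ^ q <= 1 / real n ^ 10) sequentially" using taul eventually_ge_at_top[of 1]
	proof eventually_elim
		case (elim n)
		have "10 * ln (real n) <= real q * a * ln (real n)" using q elim by (intro mult_right_mono) auto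
		also have "... <= real q * tau n" using elim by (simp add: mult.assoc mult_left_mono)
		finally have "exp (real q * (- tau n)) <= exp (real 10 * (- ln (real n)))" by simp
		then have "exp (- tau n) ^ q <= exp (- ln (real n)) ^ 10" unfolding exp_of_nat_mult .
		then show ?case using elim by (simp add: exp_minus power_inverse divide_inverse)
	qed
	have h1: "eventually (%n. h n <= 1) sequentially" using order_tendstoD(2)[OF bw(1) zero_less_one] by eventually_elim simp
	\<comment> \<open>The bandwidth is below 1 only eventually, whereas \<open>linear_part_clt\<close>
	  asks for it at every \<open>n\<close>; \<open>hh\<close> agrees with \<open>h\<close> from some
	  point on.\<close>
	define hh where "hh n = min (h n) 1" for n
	have hh: "0 < hh n" "hh n <= 1" for n using h_pos by (auto simp: hh_def)
	have heq: "eventually (%n. hh n = h n) sequentially" using h1 by eventually_elim (simp add: hh_def)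
	have hh0: "hh \<longlonglongrightarrow> 0" using bw(1) heq by (rule Lim_transform_eventually[OF _ eventually_mono]) simp
	have small: "eventually (%n. real n * ((1 + Ck) * (1 + 1 / h n) * exp (- tau n) ^ q) <= 1) sequentially"
	proof -
		have "(%n. real n * ((1 + real n) * (1 / real n ^ 10))) \<longlonglongrightarrow> 0" by real_asymp
		then have "(%n. (1 + Ck) * (real n * ((1 + real n) * (1 / real n ^ 10)))) \<longlonglongrightarrow> 0" by (rule tendsto_mult_right_zero)
		from order_tendstoD(2)[OF this zero_less_one] \<rho> bw(4) show ?thesis
		proof eventually_elim
			case (elim n)
			have "real n * ((1 + Ck) * (1 + 1 / h n) * exp (- tau n) ^ q) <= real n * ((1 + Ck) * (1 + real n) * (1 / real n ^ 10))"
				using elim K.Ck_nonneg h_pos[of n] by (intro mult_left_mono mult_mono) (auto intro!: add_nonneg_nonneg)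
			then show ?case using elim by (simp add: mult_ac)
		qed
	qed
	have sm: "(%n. sqrt (real n) * (1 / (hh n)\<^sup>2 * exp (- tau n) ^ q)) \<longlonglongrightarrow> 0"
	proof (rule Lim_null_comparison)
		show "(%n. sqrt (real n) * ((real n)\<^sup>2 * (1 / real n ^ 10))) \<longlonglongrightarrow> 0" by real_asymp
		show "eventually (%n. norm (sqrt (real n) * (1 / (hh n)\<^sup>2 * exp (- tau n) ^ q)) <= sqrt (real n) * ((real n)\<^sup>2 * (1 / real n ^ 10))) sequentially"
			using heq bw(4) \<rho>
		proof eventually_elim
			case (elim n)
			have "(1 / h n)\<^sup>2 <= (real n)\<^sup>2" using elim h_pos[of n] by (intro power_mono) auto
			then have "sqrt (real n) * (1 / (hh n)\<^sup>2 * exp (- tau n) ^ q) <= sqrt (real n) * ((real n)\<^sup>2 * (1 / real n ^ 10))"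
				unfolding elim(1) using elim by (intro mult_left_mono mult_mono) (auto simp: power_divide)
			then show ?case by simp
		qed
	qed
	\<comment> \<open>Since \<open>md\<close> is at most 1, \<open>sqrt (n * h)\<close> is at least
	  \<open>G n\<close> and tends to infinity with it.\<close>
	have nh: "(%n. 1 / sqrt (real n * hh n)) \<longlonglongrightarrow> 0"
	proof (rule Lim_null_comparison[OF _ Gi])
		show "eventually (%n. norm (1 / sqrt (real n * hh n)) <= 1 / G n) sequentially" using heq eventually_ge_at_top[of 1]
		proof eventually_elim
			case (elim n)
			have s: "0 < sqrt (real n * h n)" using elim h_pos[of n] by simp
			have "G n <= sqrt (real n * h n) * 1" unfolding G_def using K.md_le_1 s by (intro mult_left_mono) auto
			moreover have "0 < G n" unfolding G_def using s K.md_pos by simp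
			ultimately show ?case unfolding elim(1) using s by (simp add: frac_le)
		qed
	qed
	have inj: "inj x" using x_mono by (rule strict_mono_imp_inj_on)
	have kc: "continuous_on UNIV (ksharp k)" using hoelder_continuous[OF D(2,3) p(1)] unfolding D(1) by blast
	have kb: "\<bar>D 0 y\<bar> <= \<alpha>" for y unfolding D(1) ksharp_def using K.k_nonneg K.k_bound by simp
	have kmD: "D 0 \<in> borel_measurable borel" unfolding D(1) using kc by (rule borel_measurable_continuous_onI)
	have "\<exists>Q. \<forall>h>0. \<bar>K.bt W h (x l) - ksharp k (x l)\<bar> <= Q * h powr r" for l
		using kernel_bias[OF D(2,3) p W_int W_one W_mom W_van kb kmD, of "x l"] unfolding D(1)
		using K.bt_eq[OF W_int kc] by simp
	then obtain Q where Q: "!!l h. h > 0 ==> \<bar>K.bt W h (x l) - ksharp k (x l)\<bar> <= Q l * h powr r" by metis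
	\<comment> \<open>A common bias constant for the finitely many evaluation points.\<close>
	define Qs where "Qs = (\<Sum>l\<in>UNIV. \<bar>Q l\<bar>)"
	have Qs: "\<bar>K.bt W h (x l) - ksharp k (x l)\<bar> <= Qs * h powr r" if "h > 0" for l h
	proof -
		have "Q l <= Qs" unfolding Qs_def by (rule order_trans[OF abs_ge_self]) (intro member_le_sum; simp)
		then have "Q l * h powr r <= Qs * h powr r" by (intro mult_right_mono) auto
		then show ?thesis using Q[OF that, of l] by linarith
	qed
	let ?I = "LINT t|lborel. \<bar>t\<bar> powr (2 * \<alpha>) * (cmod (ft W t))\<^sup>2"
	let ?d = "%l. (x l)\<^sup>2 * \<pi>d (x l) / (2 * pi * B\<^sup>2) * ?I"
	have I0: "0 <= ?I" by (rule Bochner_Integration.integral_nonneg) simp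
	have d0: "?d l >= 0" for l using I0 \<pi>d_nonneg by simp
	let ?Y = "%n w. \<chi> l. sqrt (real n * h n) * h n powr \<alpha> * L (1 / h n) *
			(khat W (h n) (\<theta> n) (%j. ou_X lam X0 E U (real j * \<Delta> n) w) n (x l) - ksharp k (x l))"
	have [measurable]: "ou_X lam X0 E U t \<in> borel_measurable M" for t by (rule ou_X_measurable) simp_all
	have khm[measurable]: "(%w. khat W (h n) (\<theta> n) (%j. ou_X lam X0 E U (real j * \<Delta> n) w) n z) \<in> borel_measurable M" for n z
		by (rule khat_measurable) simp_all
	show ?thesis
	proof (rule conv_distr_if_char[OF M])
		show "?Y n \<in> borel_measurable M" for n
		proof (rule borel_measurable_euclidean_space[THEN iffD2], rule ballI)
			fix b :: "(real, 'n) vec" assume "b \<in> Basis"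
			then obtain l where "b = axis l 1" by (auto simp: Basis_vec_def)
			then show "(%w. ?Y n w \<bullet> b) \<in> borel_measurable M" by (simp add: inner_axis)
		qed
		show "prob_space (gauss_diag ?d)" "sets (gauss_diag ?d) = sets borel" using gauss_diag_facts(1,2)[OF d0] .
		fix s :: "(real, 'n) vec"
		define S where "S = (\<Sum>l\<in>UNIV. \<bar>s $ l\<bar>)"
		let ?V = "%n. CLINT w|M. iexp ((1 / sqrt (real n)) * (\<Sum>j=1..n. c n * (\<Sum>l\<in>UNIV. s $ l * K.fn (hh n) (x l) (max (K.Xc (tau n) j w) 0))))"
		have Vl: "?V \<longlonglongrightarrow> cplx (exp (- ((1 / B)\<^sup>2 * (\<Sum>l\<in>UNIV. (s $ l)\<^sup>2 * ((x l)\<^sup>2 * K.Vf (x l)))) / 2))"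
			by (rule K.linear_part_clt[OF hh hh0 inj x_pos tau tau0 q(1) c nh sm])
		have lim_eq: "cplx (exp (- ((1 / B)\<^sup>2 * (\<Sum>l\<in>UNIV. (s $ l)\<^sup>2 * ((x l)\<^sup>2 * K.Vf (x l)))) / 2)) = (CLINT y|gauss_diag ?d. iexp (s \<bullet> y))"
		proof -
			have "(1 / B)\<^sup>2 * (\<Sum>l\<in>UNIV. (s $ l)\<^sup>2 * ((x l)\<^sup>2 * K.Vf (x l))) = (\<Sum>l\<in>UNIV. (s $ l)\<^sup>2 * ?d l)"
				unfolding sum_distrib_left K.Vf_def by (intro sum.cong refl) (simp add: power_divide mult_ac)
			then show ?thesis unfolding gauss_diag_facts(3)[OF d0] by (simp only:)
		qed
		\<comment> \<open>The normalisation is rewritten as \<open>G n * c n\<close>, and the process as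
		  the moving sum \<open>Xc\<close>, with which it agrees on the almost sure set
		  \<open>good\<close>.\<close>
		have Yeq: "(CLINT w|M. iexp (s \<bullet> ?Y n w)) = (CLINT w|M. iexp (sqrt (real n * h n) * K.md (1 / h n) * c n *
				(\<Sum>l\<in>UNIV. s $ l * (khat W (h n) (\<theta> n) (%j. K.Xc (tau n) j w) n (x l) - ksharp k (x l)))))" for n
		proof (rule integral_cong_AE)
			have [measurable]: "(%w. khat W (h n) (\<theta> n) (%j. K.Xc (tau n) j w) n z) \<in> borel_measurable M" for z
				by (rule khat_measurable) simp_all
			have in_eq: "s \<bullet> ?Y n w = sqrt (real n * h n) * K.md (1 / h n) * c n *
					(\<Sum>l\<in>UNIV. s $ l * (khat W (h n) (\<theta> n) (%j. ou_X lam X0 E U (real j * \<Delta> n) w) n (x l) - ksharp k (x l)))" for w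
			proof -
				have "K.md (1 / h n) * c n = h n powr \<alpha> * L (1 / h n)" unfolding c_def using K.md_pos[of "1 / h n"] by simp
				then have e: "sqrt (real n * h n) * K.md (1 / h n) * c n = sqrt (real n * h n) * h n powr \<alpha> * L (1 / h n)" by (simp add: mult.assoc)
				show ?thesis unfolding e inner_vec_def by (simp add: sum_distrib_left mult_ac)
			qed
			show "AE w in M. iexp (s \<bullet> ?Y n w) = iexp (sqrt (real n * h n) * K.md (1 / h n) * c n *
				(\<Sum>l\<in>UNIV. s $ l * (khat W (h n) (\<theta> n) (%j. K.Xc (tau n) j w) n (x l) - ksharp k (x l))))"
				using K.AE_good
			proof eventually_elim
				case (elim w)
				have "ou_X lam X0 E U (real j * \<Delta> n) w = K.Xc (tau n) j w" for j
					by (rule K.ou_X_eq[OF elim less_imp_le[OF tau]]) (simp add: tau_def)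
				then show ?case unfolding in_eq by (simp only:)
			qed
			show "(%w. iexp (s \<bullet> ?Y n w)) \<in> borel_measurable M" unfolding in_eq by measurable
			show "(%w. iexp (sqrt (real n * h n) * K.md (1 / h n) * c n *
				(\<Sum>l\<in>UNIV. s $ l * (khat W (h n) (\<theta> n) (%j. K.Xc (tau n) j w) n (x l) - ksharp k (x l))))) \<in> borel_measurable M" by measurable
		qed
		\<comment> \<open>The bound of \<open>char_approx\<close> in terms of \<open>G\<close>: exceedance
		  of the truncation level, failure of the supremum bound (order \<open>1 / G^2\<close>, with 32 =
		  8 * 4), quadratic remainder (order \<open>1 / G\<close> after normalisation) and bias (order
		  \<open>G * h powr r\<close>).\<close>
		let ?R = "%n. 2 * (real n * P.prob {w\<in>space M. \<theta> n < \<bar>X0 w\<bar>}) + 32 * K.KM q * (1 / G n)\<^sup>2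
				+ \<bar>c n\<bar> * S * (CW * 4 * K.KM q * (1 / G n) + Qs * (G n * h n powr r))"
		have "(%n. (CLINT w|M. iexp (s \<bullet> ?Y n w)) - ?V n) \<longlonglongrightarrow> 0"
		proof (rule Lim_null_comparison)
			have "?R \<longlonglongrightarrow> 2 * 0 + 32 * K.KM q * 0\<^sup>2 + \<bar>1 / B\<bar> * S * (CW * 4 * K.KM q * 0 + Qs * 0)"
				by (intro tendsto_intros K.tail_tendsto[OF \<theta>] Gi G(2) c)
			then show "?R \<longlonglongrightarrow> 0" by simp
			show "eventually (%n. norm ((CLINT w|M. iexp (s \<bullet> ?Y n w)) - ?V n) <= ?R n) sequentially"
				using heq h1 small eventually_ge_at_top[of 1]
			proof eventually_elim
				case (elim n)
				have gp: "0 < G n" unfolding G_def using elim h_pos[of n] K.md_pos by simp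
				have G2: "real n * h n * (K.md (1 / h n))\<^sup>2 = (G n)\<^sup>2" unfolding G_def power_mult_distrib using h_pos[of n] by simp
				have Kn: "\<bar>sqrt (real n * h n) * K.md (1 / h n) * c n\<bar> = G n * \<bar>c n\<bar>" unfolding G_def[symmetric] abs_mult using G0 by simp
				have "cmod ((CLINT w|M. iexp (s \<bullet> ?Y n w)) - ?V n) <= 2 * real n * P.prob {w\<in>space M. \<theta> n < \<bar>X0 w\<bar>} + 8 * (4 * K.KM q / (G n)\<^sup>2)
					 + G n * \<bar>c n\<bar> * S * (CW * (4 * K.KM q / (G n)\<^sup>2) + Qs * h n powr r)"
					unfolding Yeq elim(1) Kn[symmetric] G2[symmetric] S_def
					by (rule K.char_approx[OF h_pos elim(2) elim(4) tau elim(3) Qs[OF h_pos]])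
				also have "... = ?R n" using gp by (simp add: power2_eq_square field_simps)
				finally show ?case .
			qed
		qed
		from tendsto_add[OF this Vl] show "(%n. CLINT w|M. iexp (s \<bullet> ?Y n w)) \<longlonglongrightarrow> (CLINT y|gauss_diag ?d. iexp (s \<bullet> y))"
			unfolding lim_eq by simp
	qed
qed

end
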